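(* Let $\mathsf f$ be an a.s. uniformly bounded additive functional on a uniformly elliptic Markov chain $\mathsf X$. Assume $\mathsf f$ is irreducible with algebraic range $\mathbb Z$, and $S_N\in c_N+\mathbb Z$ almost surely, where $c_N\in\mathbb R$. If $z_N\in c_N+\mathbb Z$ satisfy $\frac{z_N-\mathbb E(S_N)}{V_N}\to0$, then for every $x\in\mathfrak S_1$, as $N\to\infty$, $$\mathbb P_x[S_N=z_N]=\frac{[1+o(1)]}{\sqrt{2\pi V_N}}\exp\left(-V_N\mathcal I_N\left(\frac{z_N}{V_N}\right)\right),$$ $$\mathbb P_x[S_N=z_N]=\frac{[1+o(1)]}{\sqrt{2\pi V_N}}\exp\left[-\frac{1+o(1)}{2}\left(\frac{z_N-\mathbb E(S_N)}{\sqrt{V_N}}\right)^2\right].$$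
   Context: A Markov chain $\mathsf X=\{X_n\}_{n\ge1}$ (possibly inhomogeneous) has complete separable metric state spaces $\mathfrak S_n\ni X_n$ with Borel $\sigma$-algebras, an initial distribution on $\mathfrak S_1$, and transition kernels $\pi_{n,n+1}(x,dy)$, so that $\mathbb P(X_{n+1}\in E\mid X_n,\dots,X_1)=\pi_{n,n+1}(X_n,E)$. $\mathbb P_x$ denotes probability when the initial distribution is replaced by the point mass at $x\in\mathfrak S_1$. The chain is uniformly elliptic if there are $0<\epsilon_0<1$, Borel probability measures $\mu_n$ on $\mathfrak S_n$ and measurable $p_n:\mathfrak S_n\times\mathfrak S_{n+1}\to[0,\infty)$ such that for all $n\ge1$: (a) $\pi_{n,n+1}(x,dy)=p_n(x,y)\mu_{n+1}(dy)$; (b) $0\le p_n\le1/\epsilon_0$; (c) $\int_{\mathfrak S_{n+1}}p_n(x,y)p_{n+1}(y,z)\mu_{n+1}(dy)>\epsilon_0$ for all $x\in\mathfrak S_n$, $z\in\mathfrak S_{n+2}$. An additive functional is a sequence $\mathsf f=\{f_n\}$ of measurable $f_n:\mathfrak S_n\times\mathfrak S_{n+1}\to\mathbb R$; $S_N=\sum_{n=1}^Nf_n(X_n,X_{n+1})$; $V_N=\mathrm{Var}(S_N)$. $\mathsf f$ is a.s. uniformly bounded if $\sup_n\mathrm{ess\,sup}|f_n(X_n,X_{n+1})|<\infty$. $\mathsf f$ is center-tight if there are constants $m_N$ such that for every $\epsilon>0$ there is $M$ with $\mathbb P[|S_N-m_N|>M]<\epsilon$ for all $N$. $G_{alg}(\mathsf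 X,\mathsf f)$ (algebraic range) is the intersection of all closed subgroups $G\le\mathbb R$ for which there are $c_n\in\mathbb R$ with $\mathbb P[f_n(X_n,X_{n+1})-c_n\in G]=1$ for all $n\ge1$. $G_{ess}(\mathsf X,\mathsf f)=\bigcap\{G_{alg}(\mathsf X,\mathsf g):\mathsf g$ an additive functional on $\mathsf X$ with $\mathsf f-\mathsf g$ center-tight$\}$. $\mathsf f$ is irreducible if $G_{ess}(\mathsf X,\mathsf f)=G_{alg}(\mathsf X,\mathsf f)$. Rate functions. When $V_N\ne0$, $\mathcal F_N(\xi)=\frac1{V_N}\log\mathbb E(e^{\xi S_N})$ ($\xi\in\mathbb R$), which is smooth and strictly convex. $\mathcal I_N$ is its Legendre transform: for $\eta\in(\inf\mathcal F_N',\sup\mathcal F_N')$, $\mathcal I_N(\eta)=\xi\eta-\mathcal F_N(\xi)$ for the unique $\xi$ with $\mathcal F_N'(\xi)=\eta$. (Under the hypotheses $z_N/V_N$ lies in this domain for all large $N$.)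
   Formalization: Proved for each x such that f is also a.s. uniformly bounded and S_N ∈ c_N+ℤ a.s. under P_x (true for almost every x); for exceptional x the claim can fail: fair coin flips after X_1=a, f_n(x,y)=1[y=a] but f_1(b,·)=1/2 gives P_b[S_N=z_N]=0. *)

theory Defs
  imports "HOL-Probability.Probability"
begin

text \<open>All sequences are indexed by \<open>n \<ge> 1\<close>; values at index \<open>0\<close> are never used. The state spaces are
  metric spaces with carriers \<open>mspace (S n)\<close> inside one ambient type, which is no restriction since
  any sequence of spaces embeds into its disjoint union.\<close>

definition metric_borel :: "'a metric \<Rightarrow> 'a measure" where
  "metric_borel m = sigma (mspace m) {U. openin (mtopology_of m) U}"

definition state_spaces :: "(nat \<Rightarrow> 'a metric) \<Rightarrow> bool" where
  "state_spaces S \<longleftrightarrow>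
    (\<forall>n\<ge>1. mcomplete_of (S n) \<and> separable_space (mtopology_of (S n)))"

definition transition_kernels ::
    "(nat \<Rightarrow> 'a metric) \<Rightarrow> (nat \<Rightarrow> 'a \<Rightarrow> 'a measure) \<Rightarrow> bool" where
  "transition_kernels S \<kappa> \<longleftrightarrow>
    (\<forall>n\<ge>1. \<kappa> n \<in> metric_borel (S n) \<rightarrow>\<^sub>M prob_algebra (metric_borel (S (Suc n))))"

text \<open>The \<open>\<sigma>\<close>-algebra generated by \<open>X\<^sub>1, \<dots>, X\<^sub>n\<close>.\<close>

definition past ::
    "'w measure \<Rightarrow> (nat \<Rightarrow> 'a metric) \<Rightarrow> (nat \<Rightarrow> 'w \<Rightarrow> 'a) \<Rightarrow> nat \<Rightarrow> 'w measure" where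
  "past P S X n =
    vimage_algebra (space P) (\<lambda>\<omega>. \<lambda>i\<in>{1..n}. X i \<omega>) (\<Pi>\<^sub>M i\<in>{1..n}. metric_borel (S i))"

definition markov_chain ::
    "'w measure \<Rightarrow> (nat \<Rightarrow> 'a metric) \<Rightarrow> 'a measure \<Rightarrow> (nat \<Rightarrow> 'a \<Rightarrow> 'a measure)
      \<Rightarrow> (nat \<Rightarrow> 'w \<Rightarrow> 'a) \<Rightarrow> bool" where
  "markov_chain P S \<nu> \<kappa> X \<longleftrightarrow>
    prob_space P \<and> state_spaces S \<and> transition_kernels S \<kappa> \<and>
    (\<forall>n\<ge>1. X n \<in> P \<rightarrow>\<^sub>M metric_borel (S n)) \<and>
    distr P (metric_borel (S 1)) (X 1) = \<nu> \<and>
    (\<forall>n\<ge>1. \<forall>E\<in>sets (metric_borel (S (Suc n))).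
       AE \<omega> in P. real_cond_exp P (past P S X n) (indicator (X (Suc n) -` E \<inter> space P)) \<omega>
                    = measure (\<kappa> n (X n \<omega>)) E)"

definition uniformly_elliptic ::
    "(nat \<Rightarrow> 'a metric) \<Rightarrow> (nat \<Rightarrow> 'a \<Rightarrow> 'a measure) \<Rightarrow> bool" where
  "uniformly_elliptic S \<kappa> \<longleftrightarrow>
    (\<exists>\<epsilon>\<^sub>0 \<mu> p. 0 < \<epsilon>\<^sub>0 \<and> \<epsilon>\<^sub>0 < (1::real) \<and>
      (\<forall>n\<ge>1. \<mu> n \<in> space (prob_algebra (metric_borel (S n)))) \<and>
      (\<forall>n\<ge>1. p n \<in> borel_measurable (metric_borel (S n) \<Otimes>\<^sub>M metric_borel (S (Suc n)))) \<and>
      (\<forall>n\<ge>1. \<forall>x\<in>mspace (S n).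
         \<kappa> n x = density (\<mu> (Suc n)) (\<lambda>y. ennreal (p n (x, y)))) \<and>
      (\<forall>n\<ge>1. \<forall>x\<in>mspace (S n). \<forall>y\<in>mspace (S (Suc n)).
         0 \<le> p n (x, y) \<and> p n (x, y) \<le> 1 / \<epsilon>\<^sub>0) \<and>
      (\<forall>n\<ge>1. \<forall>x\<in>mspace (S n). \<forall>z\<in>mspace (S (Suc (Suc n))).
         (\<integral>y. p n (x, y) * p (Suc n) (y, z) \<partial>\<mu> (Suc n)) > \<epsilon>\<^sub>0))"

definition additive_functional ::
    "(nat \<Rightarrow> 'a metric) \<Rightarrow> (nat \<Rightarrow> 'a \<times> 'a \<Rightarrow> real) \<Rightarrow> bool" where
  "additive_functional S f \<longleftrightarrow>
    (\<forall>n\<ge>1. f n \<in> borel_measurable (metric_borel (S n) \<Otimes>\<^sub>M metric_borel (S (Suc n))))"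

definition partial_sum ::
    "(nat \<Rightarrow> 'w \<Rightarrow> 'a) \<Rightarrow> (nat \<Rightarrow> 'a \<times> 'a \<Rightarrow> real) \<Rightarrow> nat \<Rightarrow> 'w \<Rightarrow> real" where
  "partial_sum X f N \<omega> = (\<Sum>n=1..N. f n (X n \<omega>, X (Suc n) \<omega>))"

definition mean_sum ::
    "'w measure \<Rightarrow> (nat \<Rightarrow> 'w \<Rightarrow> 'a) \<Rightarrow> (nat \<Rightarrow> 'a \<times> 'a \<Rightarrow> real) \<Rightarrow> nat \<Rightarrow> real" where
  "mean_sum P X f N = prob_space.expectation P (partial_sum X f N)"

definition var_sum ::
    "'w measure \<Rightarrow> (nat \<Rightarrow> 'w \<Rightarrow> 'a) \<Rightarrow> (nat \<Rightarrow> 'a \<times> 'a \<Rightarrow> real) \<Rightarrow> nat \<Rightarrow> real" where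
  "var_sum P X f N = prob_space.variance P (partial_sum X f N)"

definition as_uniformly_bounded ::
    "'w measure \<Rightarrow> (nat \<Rightarrow> 'w \<Rightarrow> 'a) \<Rightarrow> (nat \<Rightarrow> 'a \<times> 'a \<Rightarrow> real) \<Rightarrow> bool" where
  "as_uniformly_bounded P X f \<longleftrightarrow>
    (SUP n\<in>{1..}. esssup P (\<lambda>\<omega>. ereal \<bar>f n (X n \<omega>, X (Suc n) \<omega>)\<bar>)) < \<infinity>"

definition center_tight ::
    "'w measure \<Rightarrow> (nat \<Rightarrow> 'w \<Rightarrow> 'a) \<Rightarrow> (nat \<Rightarrow> 'a \<times> 'a \<Rightarrow> real) \<Rightarrow> bool" where
  "center_tight P X f \<longleftrightarrow>
    (\<exists>m. \<forall>\<epsilon>>0. \<exists>K. \<forall>N\<ge>1. \<P>(\<omega> in P. \<bar>partial_sum X f N \<omega> - m N\<bar> > K) < (\<epsilon>::real))"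

definition closed_subgroup :: "real set \<Rightarrow> bool" where
  "closed_subgroup G \<longleftrightarrow>
    closed G \<and> 0 \<in> G \<and> (\<forall>a\<in>G. \<forall>b\<in>G. a + b \<in> G) \<and> (\<forall>a\<in>G. - a \<in> G)"

definition alg_range ::
    "'w measure \<Rightarrow> (nat \<Rightarrow> 'w \<Rightarrow> 'a) \<Rightarrow> (nat \<Rightarrow> 'a \<times> 'a \<Rightarrow> real) \<Rightarrow> real set" where
  "alg_range P X f =
    \<Inter> {G. closed_subgroup G \<and>
           (\<exists>c. \<forall>n\<ge>1. \<P>(\<omega> in P. f n (X n \<omega>, X (Suc n) \<omega>) - c n \<in> G) = 1)}"

definition ess_range ::
    "'w measure \<Rightarrow> (nat \<Rightarrow> 'a metric) \<Rightarrow> (nat \<Rightarrow> 'w \<Rightarrow> 'a) \<Rightarrow> (nat \<Rightarrow> 'a \<times> 'a \<Rightarrow> real)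
      \<Rightarrow> real set" where
  "ess_range P S X f =
    \<Inter> {alg_range P X g | g.
         additive_functional S g \<and> center_tight P X (\<lambda>n xy. f n xy - g n xy)}"

definition irreducible_functional ::
    "'w measure \<Rightarrow> (nat \<Rightarrow> 'a metric) \<Rightarrow> (nat \<Rightarrow> 'w \<Rightarrow> 'a) \<Rightarrow> (nat \<Rightarrow> 'a \<times> 'a \<Rightarrow> real)
      \<Rightarrow> bool" where
  "irreducible_functional P S X f \<longleftrightarrow> ess_range P S X f = alg_range P X f"

definition log_mgf ::
    "'w measure \<Rightarrow> (nat \<Rightarrow> 'w \<Rightarrow> 'a) \<Rightarrow> (nat \<Rightarrow> 'a \<times> 'a \<Rightarrow> real) \<Rightarrow> nat \<Rightarrow> real \<Rightarrow> real" where
  "log_mgf P X f N \<xi> =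
    1 / var_sum P X f N * ln (prob_space.expectation P (\<lambda>\<omega>. exp (\<xi> * partial_sum X f N \<omega>)))"

text \<open>Legendre transform of a strictly convex differentiable function; meaningful only for \<open>\<eta>\<close> in
  the range of the derivative, i.e. between its infimum and its supremum.\<close>

definition legendre :: "(real \<Rightarrow> real) \<Rightarrow> real \<Rightarrow> real" where
  "legendre F \<eta> = (let \<xi> = (THE \<xi>. (F has_real_derivative \<eta>) (at \<xi>)) in \<xi> * \<eta> - F \<xi>)"

definition rate_function ::
    "'w measure \<Rightarrow> (nat \<Rightarrow> 'w \<Rightarrow> 'a) \<Rightarrow> (nat \<Rightarrow> 'a \<times> 'a \<Rightarrow> real) \<Rightarrow> nat \<Rightarrow> real \<Rightarrow> real" where
  "rate_function P X f N = legendre (log_mgf P X f N)"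

text \<open>The law of the whole trajectory on the product of the state spaces, by the Ionescu-Tulcea
  theorem. Trajectories are indexed from \<open>0\<close> there, so \<open>X\<^sub>n\<close> becomes coordinate \<open>n - 1\<close>.\<close>

definition coord :: "nat \<Rightarrow> (nat \<Rightarrow> 'a) \<Rightarrow> 'a" where
  "coord n \<omega> = \<omega> (n - 1)"

definition step_kernel ::
    "'a measure \<Rightarrow> (nat \<Rightarrow> 'a \<Rightarrow> 'a measure) \<Rightarrow> nat \<Rightarrow> (nat \<Rightarrow> 'a) \<Rightarrow> 'a measure" where
  "step_kernel \<nu> \<kappa> i \<omega> = (case i of 0 \<Rightarrow> \<nu> | Suc j \<Rightarrow> \<kappa> (Suc j) (\<omega> j))"

definition path_measure ::
    "(nat \<Rightarrow> 'a metric) \<Rightarrow> 'a measure \<Rightarrow> (nat \<Rightarrow> 'a \<Rightarrow> 'a measure) \<Rightarrow> (nat \<Rightarrow> 'a) measure" where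
  "path_measure S \<nu> \<kappa> =
    projective_family.lim UNIV
      (Ionescu_Tulcea.CI (step_kernel \<nu> \<kappa>) (\<lambda>i. metric_borel (S (Suc i))))
      (\<lambda>i. metric_borel (S (Suc i)))"

text \<open>\<open>\<P>\<^sub>x\<close>: the chain with the same kernels started from the point mass at \<open>x\<close>.\<close>

definition path_measure_from ::
    "(nat \<Rightarrow> 'a metric) \<Rightarrow> (nat \<Rightarrow> 'a \<Rightarrow> 'a measure) \<Rightarrow> 'a \<Rightarrow> (nat \<Rightarrow> 'a) measure" where
  "path_measure_from S \<kappa> x = path_measure S (return (metric_borel (S 1)) x) \<kappa>"

text \<open>The path measure does realise the Markov chain with the given initial distribution and
  kernels.\<close>

lemma space_metric_borel [simp]: "space (metric_borel m) = mspace m"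
  by (simp add: metric_borel_def space_measure_of_conv)

lemma Ionescu_Tulcea_step_kernel:
  assumes \<kappa>: "transition_kernels S \<kappa>" and \<nu>: "\<nu> \<in> space (prob_algebra (metric_borel (S 1)))"
  shows "Ionescu_Tulcea (step_kernel \<nu> \<kappa>) (\<lambda>i. metric_borel (S (Suc i)))"
proof -
  let ?B = "\<lambda>i. metric_borel (S (Suc i))"
  have *: "step_kernel \<nu> \<kappa> i \<in> PiM {0..<i} ?B \<rightarrow>\<^sub>M prob_algebra (?B i)" for i
  proof (cases i)
    case 0
    then show ?thesis using \<nu> by (simp add: step_kernel_def[abs_def])
  next
    case (Suc j)
    have "\<kappa> (Suc j) \<in> ?B j \<rightarrow>\<^sub>M prob_algebra (?B (Suc j))"
      using \<kappa> by (simp add: transition_kernels_def)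
    then have "(\<lambda>\<omega>. \<kappa> (Suc j) (\<omega> j)) \<in> PiM {0..<Suc j} ?B \<rightarrow>\<^sub>M prob_algebra (?B (Suc j))"
      by (rule measurable_compose[rotated]) (rule measurable_component_singleton, simp)
    then show ?thesis using Suc by (simp add: step_kernel_def[abs_def])
  qed
  show ?thesis
  proof (rule Ionescu_Tulcea.intro)
    show "step_kernel \<nu> \<kappa> i \<in> PiM {0..<i} ?B \<rightarrow>\<^sub>M subprob_algebra (?B i)" for i
      using * by (rule measurable_prob_algebraD)
    show "prob_space (step_kernel \<nu> \<kappa> i \<omega>)" if "\<omega> \<in> space (PiM {0..<i} ?B)" for i \<omega>
      using measurable_space[OF * that] by (simp add: space_prob_algebra)
  qed
qed

lemma (in Ionescu_Tulcea) distr_lim_initial: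
  "distr PF.lim (PiM {0..<n} M) (\<lambda>\<omega>. restrict \<omega> {0..<n}) = C 0 n (\<lambda>_. undefined)"
proof -
  have "distr PF.lim (PiM {0..<n} M) (\<lambda>\<omega>. restrict \<omega> {0..<n}) = CI {0..<n}"
    by (rule distr_lim) simp
  also have "\<dots> = C 0 n (\<lambda>_. undefined)"
  proof -
    have "up_to {0..<n} \<le> n" by (simp add: up_to_iff)
    moreover have "n \<le> up_to {0..<n}"
      using up_to_less[of "{0..<n}" "n - 1"] by (cases n) auto
    ultimately have "up_to {0..<n} = n" by simp
    then show ?thesis
      using distr_C[of n n "\<lambda>_. undefined" 0] by (simp add: CI_def space_PiM)
  qed
  finally show ?thesis .
qed

lemma (in Ionescu_Tulcea) emeasure_lim_step:
  assumes W: "W \<in> sets (PiM {0..<n} M)" and E: "E \<in> sets (M n)"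
  shows "emeasure PF.lim {\<omega> \<in> space (PiM UNIV M). restrict \<omega> {0..<n} \<in> W \<and> \<omega> n \<in> E}
    = (\<integral>\<^sup>+\<omega>. indicator W (restrict \<omega> {0..<n}) * emeasure (P n (restrict \<omega> {0..<n})) E \<partial>PF.lim)"
proof -
  let ?u = "\<lambda>_::nat. undefined :: 'a"
  let ?r = "\<lambda>n \<omega>. restrict \<omega> {0..<n}"
  have u: "?u \<in> space (PiM {0..<0} M)" by (simp add: space_PiM)
  have r[measurable]: "?r n \<in> PF.lim \<rightarrow>\<^sub>M PiM {0..<n} M" for n
    by (auto intro!: measurable_restrict simp: measurable_cong_sets[OF PF.sets_lim refl])
  note [measurable] = W E
  define A where "A = {\<omega> \<in> space (PiM {0..<Suc n} M). ?r n \<omega> \<in> W \<and> \<omega> n \<in> E}"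
  have rr[measurable]: "?r n \<in> PiM {0..<Suc n} M \<rightarrow>\<^sub>M PiM {0..<n} M"
    by (intro measurable_restrict_subset) auto
  have A[measurable]: "A \<in> sets (PiM {0..<Suc n} M)"
    unfolding A_def by measurable
  have "{\<omega> \<in> space (PiM UNIV M). ?r n \<omega> \<in> W \<and> \<omega> n \<in> E} = ?r (Suc n) -` A \<inter> space PF.lim"
  proof -
    have "?r n (?r (Suc n) \<omega>) = ?r n \<omega>" for \<omega> :: "nat \<Rightarrow> 'a"
      by (auto simp: restrict_def)
    then show ?thesis
      using measurable_space[OF r[of "Suc n"]] by (auto simp: A_def)
  qed
  then have "emeasure PF.lim {\<omega> \<in> space (PiM UNIV M). ?r n \<omega> \<in> W \<and> \<omega> n \<in> E}
      = emeasure (distr PF.lim (PiM {0..<Suc n} M) (?r (Suc n))) A"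
    by (simp add: emeasure_distr)
  also have "\<dots> = emeasure (C 0 n ?u \<bind> eP n) A"
    using distr_lim_initial[of "Suc n"] by simp
  also have "\<dots> = (\<integral>\<^sup>+\<omega>. emeasure (eP n \<omega>) A \<partial>C 0 n ?u)"
    using u prob_space.not_empty[OF prob_space_C[OF u, of n]]
    by (intro emeasure_bind[OF _ _ A]) (auto simp: measurable_cong_sets[OF sets_C])
  also have "\<dots> = (\<integral>\<^sup>+\<omega>. indicator W \<omega> * emeasure (P n \<omega>) E \<partial>C 0 n ?u)"
  proof (rule nn_integral_cong)
    fix \<omega> assume "\<omega> \<in> space (C 0 n ?u)"
    then have \<omega>: "\<omega> \<in> space (PiM {0..<n} M)" using space_C[OF u, of n] by simp
    have e: "?r n (fun_upd \<omega> n x) = \<omega>" for x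
      using \<omega> by (auto simp: space_PiM PiE_def extensional_def restrict_def)
    have sp: "fun_upd \<omega> n x \<in> space (PiM {0..<Suc n} M)" if "x \<in> space (M n)" for x
      using \<omega> that by (auto simp: space_PiM PiE_iff extensional_def)
    have "(\<lambda>x. fun_upd \<omega> n x) -` A \<inter> space (M n) = (if \<omega> \<in> W then E else {})"
      using sp sets.sets_into_space[OF E] by (auto simp: A_def e simp del: fun_upd_apply) (auto)
    then show "emeasure (eP n \<omega>) A = indicator W \<omega> * emeasure (P n \<omega>) E"
      using emeasure_eP[OF \<omega> A] by simp
  qed
  also have "\<dots> = (\<integral>\<^sup>+\<omega>. indicator W \<omega> * emeasure (P n \<omega>) E \<partial>distr PF.lim (PiM {0..<n} M) (?r n))"
    by (simp add: distr_lim_initial)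
  also have "\<dots> = (\<integral>\<^sup>+\<omega>. indicator W (?r n \<omega>) * emeasure (P n (?r n \<omega>)) E \<partial>PF.lim)"
    by (rule nn_integral_distr) measurable
  finally show ?thesis .
qed

theorem markov_chain_path_measure:
  assumes S: "state_spaces S" and \<kappa>: "transition_kernels S \<kappa>"
    and \<nu>: "\<nu> \<in> space (prob_algebra (metric_borel (S 1)))"
  shows "markov_chain (path_measure S \<nu> \<kappa>) S \<nu> \<kappa> coord"
proof -
  let ?B = "\<lambda>i. metric_borel (S (Suc i))"
  interpret IT: Ionescu_Tulcea "step_kernel \<nu> \<kappa>" ?B
    using \<kappa> \<nu> by (rule Ionescu_Tulcea_step_kernel)
  define Q where "Q = path_measure S \<nu> \<kappa>"
  have Q: "Q = IT.PF.lim" by (simp add: Q_def path_measure_def)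
  have space_Q: "space Q = space (PiM UNIV ?B)" and sets_Q: "sets Q = sets (PiM UNIV ?B)"
    by (simp_all add: Q)
  interpret Q: prob_space Q
  proof -
    have "prob_space (distr Q (PiM {0..<0} ?B) (\<lambda>\<omega>. restrict \<omega> {0..<0}))"
      unfolding Q IT.distr_lim_initial by (rule IT.prob_space_C) (simp add: space_PiM)
    then show "prob_space Q"
      by (rule prob_space_distrD[rotated])
        (auto intro!: measurable_restrict simp: measurable_cong_sets[OF sets_Q refl])
  qed
  have coord_meas: "coord n \<in> Q \<rightarrow>\<^sub>M metric_borel (S n)" if "n \<ge> 1" for n
    using that measurable_component_singleton[of "n - 1" UNIV ?B]
    by (simp add: coord_def[abs_def] measurable_cong_sets[OF sets_Q refl])
  have r[measurable]: "(\<lambda>\<omega>. restrict \<omega> {0..<n}) \<in> Q \<rightarrow>\<^sub>M PiM {0..<n} ?B" for n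
    by (auto intro!: measurable_restrict simp: measurable_cong_sets[OF sets_Q refl])
  have sets_\<nu>: "sets \<nu> = sets (?B 0)" using \<nu> by (simp add: space_prob_algebra)
  have initial: "distr Q (metric_borel (S 1)) (coord 1) = \<nu>"
  proof (rule measure_eqI)
    show "sets (distr Q (metric_borel (S 1)) (coord 1)) = sets \<nu>" by (simp add: sets_\<nu>)
    fix E assume "E \<in> sets (distr Q (metric_borel (S 1)) (coord 1))"
    then have E: "E \<in> sets (?B 0)" by simp
    let ?W = "space (PiM {0..<0::nat} ?B)"
    have "emeasure (distr Q (metric_borel (S 1)) (coord 1)) E
        = emeasure Q {\<omega> \<in> space (PiM UNIV ?B). restrict \<omega> {0..<0} \<in> ?W \<and> \<omega> 0 \<in> E}"
      using E coord_meas[of 1]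
      by (auto simp: emeasure_distr coord_def space_Q space_PiM intro!: arg_cong[where f="emeasure Q"])
    also have "\<dots> = (\<integral>\<^sup>+\<omega>. emeasure \<nu> E \<partial>Q)"
    proof -
      have "restrict \<omega> {0..<0} \<in> ?W" for \<omega> :: "nat \<Rightarrow> 'a" by (simp add: space_PiM restrict_def)
      then show ?thesis
        unfolding Q using IT.emeasure_lim_step[of ?W 0 E] E
        by (simp add: step_kernel_def)
    qed
    also have "\<dots> = emeasure \<nu> E" by (simp add: Q.emeasure_space_1)
    finally show "emeasure (distr Q (metric_borel (S 1)) (coord 1)) E = emeasure \<nu> E" .
  qed
  have markov: "AE \<omega> in Q. real_cond_exp Q (past Q S coord n) (indicator (coord (Suc n) -` E \<inter> space Q)) \<omega>
      = measure (\<kappa> n (coord n \<omega>)) E"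
    if n: "n \<ge> 1" and E: "E \<in> sets (metric_borel (S (Suc n)))" for n E
  proof -
    let ?F = "past Q S coord n"
    let ?h = "\<lambda>\<omega>. \<lambda>i\<in>{1..n}. coord i \<omega>"
    let ?D = "\<Pi>\<^sub>M i\<in>{1..n}. metric_borel (S i)"
    have h: "?h \<in> Q \<rightarrow>\<^sub>M ?D"
      by (intro measurable_restrict) (auto intro: coord_meas)
    have hsp: "?h \<in> space Q \<rightarrow> space ?D" using measurable_space[OF h] by auto
    have sets_F: "sets ?F = {?h -` A \<inter> space Q | A. A \<in> sets ?D}"
      unfolding past_def by (rule sets_vimage_algebra2[OF hsp])
    have "subalgebra Q ?F"
      unfolding subalgebra_def sets_F using measurable_sets[OF h] by (auto simp: past_def)
    then interpret F: finite_measure_subalgebra Q ?F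
      by unfold_locales
    have \<kappa>n: "\<kappa> n \<in> metric_borel (S n) \<rightarrow>\<^sub>M prob_algebra (metric_borel (S (Suc n)))"
      using \<kappa> n by (simp add: transition_kernels_def)
    have \<kappa>E: "(\<lambda>x. measure (\<kappa> n x) E) \<in> borel_measurable (metric_borel (S n))"
      using measurable_compose[OF \<kappa>n measurable_measure_prob_algebra[OF E]] .
    have hF: "?h \<in> ?F \<rightarrow>\<^sub>M ?D"
      unfolding past_def by (rule measurable_vimage_algebra1[OF hsp])
    have "coord n \<in> ?F \<rightarrow>\<^sub>M metric_borel (S n)"
      using measurable_compose[OF hF measurable_component_singleton[of n "{1..n}"]] n by simp
    from measurable_compose[OF this \<kappa>E]
    have gF: "(\<lambda>\<omega>. measure (\<kappa> n (coord n \<omega>)) E) \<in> borel_measurable ?F" .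
    have gQ: "(\<lambda>\<omega>. measure (\<kappa> n (coord n \<omega>)) E) \<in> borel_measurable Q"
      using measurable_compose[OF coord_meas[OF n] \<kappa>E] .
    have prob_\<kappa>: "prob_space (\<kappa> n (coord n \<omega>))" if "\<omega> \<in> space Q" for \<omega>
      using measurable_space[OF \<kappa>n measurable_space[OF coord_meas[OF n] that]]
      by (simp add: space_prob_algebra)
    have int_g: "integrable Q (\<lambda>\<omega>. measure (\<kappa> n (coord n \<omega>)) E)"
      using gQ by (intro Q.integrable_const_bound[where B=1])
        (auto intro!: AE_I2 prob_space.prob_le_1 prob_\<kappa>)
    have meas_E: "coord (Suc n) -` E \<inter> space Q \<in> sets Q"
      using coord_meas[of "Suc n"] E by (intro measurable_sets) auto
    show ?thesis
    proof (rule F.real_cond_exp_charact)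
      show "integrable Q (indicator (coord (Suc n) -` E \<inter> space Q) :: _ \<Rightarrow> real)"
        using meas_E by (auto simp: Q.emeasure_eq_measure)
      show "integrable Q (\<lambda>\<omega>. measure (\<kappa> n (coord n \<omega>)) E)" by (rule int_g)
      show "(\<lambda>\<omega>. measure (\<kappa> n (coord n \<omega>)) E) \<in> borel_measurable ?F" by (rule gF)
      fix A assume A: "A \<in> sets ?F"
      then obtain A' where A': "A' \<in> sets ?D" "A = ?h -` A' \<inter> space Q"
        unfolding sets_F by auto
      have AQ: "A \<in> sets Q" using A' measurable_sets[OF h] by auto
      let ?s = "\<lambda>\<omega>. \<lambda>i\<in>{1..n}. \<omega> (i - 1)"
      have s: "?s \<in> PiM {0..<n} ?B \<rightarrow>\<^sub>M ?D"
      proof (rule measurable_restrict)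
        fix i assume "i \<in> {1..n}"
        then show "(\<lambda>\<omega>. \<omega> (i - 1)) \<in> PiM {0..<n} ?B \<rightarrow>\<^sub>M metric_borel (S i)"
          using measurable_component_singleton[of "i - 1" "{0..<n}" ?B] by auto
      qed
      define W where "W = ?s -` A' \<inter> space (PiM {0..<n} ?B)"
      have W: "W \<in> sets (PiM {0..<n} ?B)"
        unfolding W_def using s A'(1) by (rule measurable_sets)
      have AW: "\<omega> \<in> A \<longleftrightarrow> restrict \<omega> {0..<n} \<in> W" if "\<omega> \<in> space Q" for \<omega>
      proof -
        have "?s (restrict \<omega> {0..<n}) = ?h \<omega>"
          by (auto simp: coord_def restrict_def fun_eq_iff)
        then show ?thesis
          using that measurable_space[OF r that, of n] by (simp add: W_def A'(2))
      qed
      have k: "step_kernel \<nu> \<kappa> n (restrict \<omega> {0..<n}) = \<kappa> n (coord n \<omega>)" for \<omega>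
        using n by (cases n) (auto simp: step_kernel_def coord_def)
      have "ennreal (measure Q (A \<inter> (coord (Suc n) -` E \<inter> space Q)))
          = emeasure Q {\<omega> \<in> space (PiM UNIV ?B). restrict \<omega> {0..<n} \<in> W \<and> \<omega> n \<in> E}"
        unfolding Q.emeasure_eq_measure[symmetric]
        using AW by (intro arg_cong[where f="emeasure Q"]) (auto simp: coord_def space_Q)
      also have "\<dots> = (\<integral>\<^sup>+\<omega>. indicator W (restrict \<omega> {0..<n}) * emeasure (\<kappa> n (coord n \<omega>)) E \<partial>Q)"
        unfolding Q using IT.emeasure_lim_step[OF W, of E] E by (simp add: k)
      also have "\<dots> = (\<integral>\<^sup>+\<omega>. ennreal (indicator A \<omega> * measure (\<kappa> n (coord n \<omega>)) E) \<partial>Q)"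
      proof (rule nn_integral_cong)
        fix \<omega> assume \<omega>: "\<omega> \<in> space Q"
        interpret K: prob_space "\<kappa> n (coord n \<omega>)" using prob_\<kappa>[OF \<omega>] .
        show "indicator W (restrict \<omega> {0..<n}) * emeasure (\<kappa> n (coord n \<omega>)) E
            = ennreal (indicator A \<omega> * measure (\<kappa> n (coord n \<omega>)) E)"
          using AW[OF \<omega>] by (auto simp: indicator_def K.emeasure_eq_measure)
      qed
      also have "\<dots> = ennreal (\<integral>\<omega>. indicator A \<omega> * measure (\<kappa> n (coord n \<omega>)) E \<partial>Q)"
        using integrable_mult_indicator[OF AQ int_g] by (intro nn_integral_eq_integral) auto
      finally have "measure Q (A \<inter> (coord (Suc n) -` E \<inter> space Q))
          = (\<integral>\<omega>. indicator A \<omega> * measure (\<kappa> n (coord n \<omega>)) E \<partial>Q)"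
        by (subst (asm) ennreal_inj) (auto intro!: integral_nonneg_AE)
      moreover have "(\<integral>\<omega>\<in>A. indicator (coord (Suc n) -` E \<inter> space Q) \<omega> \<partial>Q)
          = measure Q (A \<inter> (coord (Suc n) -` E \<inter> space Q))"
      proof -
        have "(\<integral>\<omega>\<in>A. indicator (coord (Suc n) -` E \<inter> space Q) \<omega> \<partial>Q)
            = (\<integral>\<omega>. indicat_real (A \<inter> (coord (Suc n) -` E \<inter> space Q)) \<omega> \<partial>Q)"
          unfolding set_lebesgue_integral_def
          by (intro Bochner_Integration.integral_cong) (auto simp: indicator_def)
        then show ?thesis using AQ meas_E by simp
      qed
      ultimately show "(\<integral>\<omega>\<in>A. indicator (coord (Suc n) -` E \<inter> space Q) \<omega> \<partial>Q)
          = (\<integral>\<omega>\<in>A. measure (\<kappa> n (coord n \<omega>)) E \<partial>Q)"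
        by (simp add: set_lebesgue_integral_def)
    qed
  qed
  show ?thesis
    unfolding Q_def[symmetric] markov_chain_def
    using Q.prob_space_axioms S \<kappa> coord_meas initial markov by auto
qed

end

theory Submission
 imports Defs "HOL-Complex_Analysis.Complex_Analysis"
begin

text \<open>
Let \<open>T\<^sub>w\<close> be the transfer operators with kernel \<open>exp (w f\<^sub>n) p\<^sub>n\<close>, so that \<open>E\<^sub>x (exp (w S\<^sub>N)) = T\<^sub>w \<dots> T\<^sub>w 1 (x)\<close>.
Ellipticity makes the untilted products contract oscillations, and a coboundary turns \<open>f\<close> into a martingale difference
whose quadratic variation is comparable to \<open>V\<^sub>N\<close>. Cutting the time axis into blocks of bounded variation shows that
\<open>log E\<^sub>x (exp (w S\<^sub>N))\<close> is holomorphic in a fixed disc and \<open>O(V\<^sub>N)\<close> there. Hence a saddle point \<open>\<xi>\<^sub>N\<close> with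
\<open>\<xi>\<^sub>N \<longlonglongrightarrow> 0\<close> exists, and the rate function is quadratic up to a factor \<open>1 + o(1)\<close>. The probability is the Fourier
integral over \<open>\<xi>\<^sub>N + i [-\<pi>, \<pi>]\<close>.

Near the saddle point the integrand is Gaussian. Away from it, compare two frequencies: blockwise, the product of the
norms at \<open>\<theta>\<close> and \<open>\<theta>'\<close> is at most \<open>exp (- c (\<theta> - \<theta>')\<^sup>2 V\<^sub>N)\<close> (for \<open>\<xi>\<^sub>N \<noteq> 0\<close> after Doob's transform), so
each short interval contributes \<open>o(1 / sqrt V\<^sub>N)\<close> once the norm tends to \<open>0\<close> at every \<open>\<theta> \<noteq> 0\<close>. If it did not, a
minimal-norm argument would give functions \<open>u\<^sub>n\<close> with \<open>\<bar>u\<^sub>n\<bar> \<le> 1\<close> and \<open>u\<^sub>n = T\<^bsub>i\<theta>\<^esub> u\<^bsub>n+1\<^esub>\<close>; their phases are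
asymptotically rigid and exhibit \<open>f\<close> as a \<open>2\<pi>/\<theta>\<close>-integral functional plus a center-tight one. By irreducibility
\<open>1\<close> would be a multiple of \<open>2\<pi>/\<theta>\<close>, which is impossible for \<open>0 < \<bar>\<theta>\<bar> \<le> \<pi>\<close>.
\<close>

section \<open>Elliptic chains and weighted transfer operators\<close>

text \<open>Why two frequencies: on long stretches of time \<open>f\<close> may stay close to a
  lattice of step \<open>2 * pi / \<theta>\<close>, so at a single \<theta> no rate in terms of the
  variance is available. Two frequencies cannot both be nearly resonant on one block: one phase
  times the conjugate of the other is the phase at the difference, and that one loses a definite
  amount. Hence around the frequency where the norm is largest it decays like a Gaussian, and mere
  convergence to 0 at each frequency improves to o(1 / sqrt V) after integration. Why an arbitrary
  starting point: mean, variance and rate function refer to the given initial law, the probability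
  to the chain from \<open>x\<close>. By ellipticity the transforms of the two differ by a factor 1
  + O(norm w), so the saddle point of the first also serves the second. Only two-step densities are
  bounded below. Every contraction and every comparison of laws from below therefore spends two
  steps, which explains the offsets \<open>n + 2\<close> and the exponents
  \<open>k div 2\<close>.\<close>

abbreviation (input) "cor == complex_of_real"

text \<open>Bounded at every point, not almost everywhere: the functions are integrated against
  kernels from all starting points, and suprema over the whole space are taken.\<close>

definition bfun :: "'a measure => ('a => 'b::{banach,second_countable_topology}) => bool" where
 "bfun N h \<longleftrightarrow> h \<in> borel_measurable N \<and> (\<exists>B. \<forall>x\<in>space N. norm (h x) <= B)"

lemma bfunI: "h \<in> borel_measurable N ==> (!!x. x \<in> space N ==> norm (h x) <= B) ==> bfun N h"
 by (auto simp: bfun_def)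

lemma bfunE:
 assumes "bfun N h"
 obtains B where "h \<in> borel_measurable N" "B >= 0" "!!x. x \<in> space N ==> norm (h x) <= B"
proof -
 have m: "h \<in> borel_measurable N" using assms by (simp add: bfun_def)
 from assms obtain B where "\<forall>x\<in>space N. norm (h x) <= B" by (auto simp: bfun_def)
 then have "max 0 B >= 0" "!!x. x \<in> space N ==> norm (h x) <= max 0 B" by (auto simp: max.coboundedI2)
 with m show ?thesis using that by blast
qed

lemma bfun_measurable [measurable_dest]: "bfun N h ==> h \<in> borel_measurable N"
 by (simp add: bfun_def)

lemma bfun_const [intro, simp]: "bfun N (\<lambda>_. c)"
 by (rule bfunI[where B = "norm c"]) auto

lemma bfun_comp2:
 assumes h: "bfun N h" and g: "bfun N g" and m: "(\<lambda>x. F (h x) (g x)) \<in> borel_measurable N"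
  and F: "!!B C x. B >= 0 ==> C >= 0 ==> norm (h x) <= B ==> norm (g x) <= C ==> norm (F (h x) (g x)) <= G B C"
 shows "bfun N (\<lambda>x. F (h x) (g x))"
proof -
 obtain B where B: "B >= 0" "!!x. x \<in> space N ==> norm (h x) <= B" using h by (elim bfunE) blast
 obtain C where C: "C >= 0" "!!x. x \<in> space N ==> norm (g x) <= C" using g by (elim bfunE) blast
 show ?thesis using B C F m by (intro bfunI[where B = "G B C"]) auto
qed

lemma bfun_add [intro]: "bfun N h ==> bfun N g ==> bfun N (\<lambda>x. h x + g x)"
 by (rule bfun_comp2[where G = "(+)"]) (auto intro: norm_triangle_mono)

lemma bfun_minus [intro]: "bfun N h ==> bfun N (\<lambda>x. - h x)"
 by (rule bfun_comp2[where F = "\<lambda>a b. - a" and G = "\<lambda>a b. a"]) auto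

lemma bfun_diff [intro]: "bfun N h ==> bfun N g ==> bfun N (\<lambda>x. h x - g x)"
 using bfun_add[of N h "\<lambda>x. - g x"] by (simp add: bfun_minus)

lemma bfun_mult [intro]:
 fixes h g :: "'a => 'b::{real_normed_field,banach,second_countable_topology}"
 shows "bfun N h ==> bfun N g ==> bfun N (\<lambda>x. h x * g x)"
 by (rule bfun_comp2[where G = "(*)"]) (auto simp: norm_mult intro: mult_mono)

lemma bfun_power [intro]:
 fixes h :: "'a => 'b::{real_normed_field,banach,second_countable_topology}"
 shows "bfun N h ==> bfun N (\<lambda>x. h x ^ n)"
 by (induction n) auto

lemma bfun_exp [intro]:
 fixes h :: "'a => 'b::{real_normed_field,banach,second_countable_topology}"
 assumes "bfun N h"
 shows "bfun N (\<lambda>x. exp (h x))"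
proof -
 obtain B where B: "h \<in> borel_measurable N" "!!x. x \<in> space N ==> norm (h x) <= B" using assms by (elim bfunE) blast
 show ?thesis
 proof (rule bfunI)
  show "(\<lambda>x. exp (h x)) \<in> borel_measurable N"
   using B(1) by (rule borel_measurable_continuous_on[rotated]) (auto intro!: continuous_intros)
  show "norm (exp (h x)) <= exp B" if "x \<in> space N" for x
   using B(2)[OF that] by (meson norm_exp order_trans exp_le_cancel_iff)
 qed
qed

lemma bfun_of_real [intro]:
 "bfun N h ==> bfun N (\<lambda>x. of_real (h x) :: 'b::{real_normed_field,banach,second_countable_topology})"
 by (elim bfunE, rule bfunI) (auto intro!: borel_measurable_of_real)

lemma bfun_norm [intro]: "bfun N h ==> bfun N (\<lambda>x. norm (h x))"
 by (elim bfunE, rule bfunI) auto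

lemma bfun_abs [intro]: "bfun N (h :: 'a => real) ==> bfun N (\<lambda>x. \<bar>h x\<bar>)"
 using bfun_norm[of N h] by simp

lemma bfun_Re [intro]: "bfun N h ==> bfun N (\<lambda>x. Re (h x))"
 by (elim bfunE, rule bfunI) (auto intro: order_trans[OF abs_Re_le_cmod])

lemma bfun_cnj [intro]: "bfun N h ==> bfun N (\<lambda>x. cnj (h x))"
 by (elim bfunE, rule bfunI) (auto intro!: borel_measurable_continuous_on[where f = cnj] continuous_intros)

lemma bfun_sum [intro]: "(!!i. i \<in> I ==> bfun N (h i)) ==> bfun N (\<lambda>x. \<Sum>i\<in>I. h i x)"
 by (induction I rule: infinite_finite_induct) auto

lemma bfun_prod [intro]:
 fixes h :: "'i => 'a => 'b::{real_normed_field,banach,second_countable_topology}"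
 shows "(!!i. i \<in> I ==> bfun N (h i)) ==> bfun N (\<lambda>x. \<Prod>i\<in>I. h i x)"
 by (induction I rule: infinite_finite_induct) auto

lemma bfun_compose: "bfun N h ==> g \<in> measurable N' N ==> bfun N' (\<lambda>x. h (g x))"
 by (elim bfunE, rule bfunI) (auto dest: measurable_space)

lemma bfun_divide_const [intro]:
 fixes h :: "'a => 'b::{real_normed_field,banach,second_countable_topology}"
 shows "bfun N h ==> bfun N (\<lambda>x. h x / c)"
 unfolding divide_inverse by auto

lemma (in finite_measure) bfun_integrable: "bfun M h ==> integrable M h"
 by (elim bfunE) (rule integrable_const_bound, auto simp: bfun_def)

lemma (in prob_space) norm_integral_le_const:
 fixes h :: "'a => 'b::{banach,second_countable_topology}"
 assumes "!!x. x \<in> space M ==> norm (h x) <= B" "B >= 0"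
 shows "norm (LINT x|M. h x) <= B"
proof (cases "integrable M h")
 case True
 have "norm (LINT x|M. h x) <= (LINT x|M. norm (h x))" by (rule integral_norm_bound)
 also have "... <= (LINT x|M. B)" using True assms by (intro integral_mono) auto
 finally show ?thesis by (simp add: prob_space)
qed (auto simp: not_integrable_integral_eq assms)

text \<open>Times start at \<open>0\<close>: here \<open>S n\<close> and \<open>p n\<close> are the paper's state space and density with index \<open>n + 1\<close>.\<close>

locale elliptic_chain =
 fixes S :: "nat => 'a metric" and M :: "nat => 'a measure"
  and p :: "nat => 'a \<times> 'a => real" and ep \<beta> :: real
 assumes complete_S: "mcomplete_of (S n)" and separable_S: "separable_space (mtopology_of (S n))"
  and sets_M: "sets (M n) = sets (metric_borel (S n))"
  and prob_M: "prob_space (M n)"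
  and p_meas [measurable]: "p n \<in> borel_measurable (M n \<Otimes>\<^sub>M M (Suc n))"
  and p_nonneg: "x \<in> space (M n) ==> y \<in> space (M (Suc n)) ==> 0 <= p n (x, y)"
  and p_le: "x \<in> space (M n) ==> y \<in> space (M (Suc n)) ==> p n (x, y) <= \<beta>"
  and p_int: "x \<in> space (M n) ==> (LINT y|M (Suc n). p n (x, y)) = 1"
  and p_two: "x \<in> space (M n) ==> z \<in> space (M (Suc (Suc n))) ==>
   ep <= (LINT y|M (Suc n). p n (x, y) * p (Suc n) (y, z))"
  and eps_pos: "0 < ep" and eps_less_1: "ep < 1"
begin

abbreviation (input) St :: "nat => 'a set" where "St n \<equiv> space (M n)"
abbreviation (input) MM :: "nat => ('a \<times> 'a) measure" where "MM n \<equiv> M n \<Otimes>\<^sub>M M (Suc n)"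

lemma space_nonempty: "\<exists>x. x \<in> St n"
 using prob_space.not_empty[OF prob_M[of n]] by blast

lemma beta_nonneg: "0 <= \<beta>"
 using space_nonempty[of 0] space_nonempty[of 1] p_nonneg[of _ 0] p_le[of _ 0] by (force intro: order_trans)

definition kern :: "nat => 'a => 'a measure" where
 "kern n x = density (M (Suc n)) (\<lambda>y. ennreal (p n (x, y)))"

lemma space_kern [simp]: "space (kern n x) = St (Suc n)"
 and sets_kern [simp, measurable_cong]: "sets (kern n x) = sets (M (Suc n))"
 by (simp_all add: kern_def)

lemma p_bound: "x \<in> St n ==> y \<in> St (Suc n) ==> \<bar>p n (x, y)\<bar> <= \<beta>"
 using p_nonneg p_le by auto

lemma p_bfun: "x \<in> St n ==> bfun (M (Suc n)) (\<lambda>y. p n (x, y))"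
 using p_bound by (intro bfunI) auto

lemma prob_kern: assumes x: "x \<in> St n" shows "prob_space (kern n x)"
proof
 interpret prob_space "M (Suc n)" by (rule prob_M)
 have "emeasure (kern n x) (space (kern n x)) = (\<integral>\<^sup>+y. ennreal (p n (x, y)) \<partial>M (Suc n))"
  using x by (auto simp: kern_def emeasure_density intro!: nn_integral_cong)
 also have "... = ennreal (LINT y|M (Suc n). p n (x, y))"
  using x by (intro nn_integral_eq_integral bfun_integrable p_bfun) (auto intro!: AE_I2 p_nonneg)
 finally show "emeasure (kern n x) (space (kern n x)) = 1" using p_int[OF x] by simp
qed

lemma integral_kern:
 fixes h :: "'a => 'b::{banach,second_countable_topology}"
 assumes "x \<in> St n" "h \<in> borel_measurable (M (Suc n))"
 shows "(LINT y|kern n x. h y) = (LINT y|M (Suc n). p n (x, y) *\<^sub>R h y)"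
 unfolding kern_def using assms by (intro integral_density) (auto intro!: AE_I2 p_nonneg)

lemma kern_meas:
 fixes g :: "'a \<times> 'a => 'b::{banach,second_countable_topology}"
 assumes [measurable]: "g \<in> borel_measurable (MM n)"
 shows "(\<lambda>x. \<integral>y. g (x, y) \<partial>kern n x) \<in> borel_measurable (M n)"
proof -
 interpret prob_space "M (Suc n)" by (rule prob_M)
 have "(\<lambda>x. \<integral>y. p n (x, y) *\<^sub>R g (x, y) \<partial>M (Suc n)) \<in> borel_measurable (M n)" by measurable
 then show ?thesis
  by (rule measurable_cong[THEN iffD1, rotated]) (auto intro!: integral_kern[symmetric])
qed

lemma kern_bfun:
 fixes g :: "'a \<times> 'a => 'b::{banach,second_countable_topology}"
 assumes "bfun (MM n) g"
 shows "bfun (M n) (\<lambda>x. \<integral>y. g (x, y) \<partial>kern n x)"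
proof -
 from assms obtain B where B: "B >= 0" "!!z. z \<in> space (MM n) ==> norm (g z) <= B" by (elim bfunE) blast
 show ?thesis
 proof (rule bfunI)
  show "(\<lambda>x. \<integral>y. g (x, y) \<partial>kern n x) \<in> borel_measurable (M n)" using assms by (intro kern_meas bfun_measurable)
  fix x assume x: "x \<in> St n"
  interpret prob_space "kern n x" using x by (rule prob_kern)
  show "norm (LINT y|kern n x. g (x, y)) <= B"
   using B x by (intro norm_integral_le_const) (auto simp: space_pair_measure)
 qed
qed

lemma bfun_pair1: "bfun (M n \<Otimes>\<^sub>M N) g ==> x \<in> St n ==> bfun N (\<lambda>y. g (x, y))"
 by (rule bfun_compose) auto

lemma bfun_kern [simp]: "bfun (kern n x) h \<longleftrightarrow> bfun (M (Suc n)) h"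
 by (simp add: bfun_def measurable_cong_sets[OF sets_kern refl])

lemma integrable_kern: "x \<in> St n ==> bfun (M (Suc n)) h ==> integrable (kern n x) h"
 using finite_measure.bfun_integrable[of "kern n x" h] prob_kern[of x n] by (simp add: prob_space_def)

lemma kern_le:
 fixes g :: "'a => real"
 assumes x: "x \<in> St n" and g: "bfun (M (Suc n)) g" and nn: "!!y. y \<in> St (Suc n) ==> 0 <= g y"
 shows "(LINT y|kern n x. g y) <= \<beta> * (LINT y|M (Suc n). g y)"
proof -
 interpret prob_space "M (Suc n)" by (rule prob_M)
 have "(LINT y|kern n x. g y) = (LINT y|M (Suc n). p n (x, y) * g y)"
  using integral_kern[OF x, of g] g by (simp add: bfun_def)
 also have "... <= (LINT y|M (Suc n). \<beta> * g y)"
  using p_bfun[OF x] g p_le[OF x] nn by (intro integral_mono bfun_integrable mult_right_mono) auto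
 finally show ?thesis by simp
qed

text \<open>Fubini: the two-step law has exactly the density that \<open>p_two\<close> bounds from
  below.\<close>

lemma kern2_eq:
 fixes g :: "'a => real"
 assumes x: "x \<in> St n" and g: "bfun (M (Suc (Suc n))) g"
 shows "(\<integral>y. \<integral>z. g z \<partial>kern (Suc n) y \<partial>kern n x) =
  (LINT z|M (Suc (Suc n)). (LINT y|M (Suc n). p n (x, y) * p (Suc n) (y, z)) * g z)"
proof -
 let ?M1 = "M (Suc n)" and ?M2 = "M (Suc (Suc n))"
 interpret M1: prob_space ?M1 by (rule prob_M)
 interpret M2: prob_space ?M2 by (rule prob_M)
 interpret PP: pair_prob_space ?M1 ?M2 ..
 note [measurable] = bfun_measurable[OF g]
 have gk: "bfun ?M1 (\<lambda>y. \<integral>z. g z \<partial>kern (Suc n) y)"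
  using kern_bfun[OF bfun_compose[OF g measurable_snd]] by simp
 from g obtain B where B: "B >= 0" "!!z. z \<in> space ?M2 ==> norm (g z) <= B" by (elim bfunE) blast
 have [measurable]: "p (Suc n) \<in> borel_measurable (?M1 \<Otimes>\<^sub>M ?M2)" by (rule p_meas)
 have int: "integrable (?M1 \<Otimes>\<^sub>M ?M2) (\<lambda>(y, z). p n (x, y) * (p (Suc n) (y, z) * g z))"
 proof (rule PP.P.integrable_const_bound[where B = "\<beta> * (\<beta> * B)"])
  show "AE yz in ?M1 \<Otimes>\<^sub>M ?M2. norm (case yz of (y, z) => p n (x, y) * (p (Suc n) (y, z) * g z)) <= \<beta> * (\<beta> * B)"
   using B beta_nonneg p_bound[OF x] p_bound[of _ "Suc n"]
   by (intro AE_I2) (auto simp: space_pair_measure abs_mult intro!: mult_mono)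
 qed (use x in measurable)
 have "(\<integral>y. \<integral>z. g z \<partial>kern (Suc n) y \<partial>kern n x) = (LINT y|?M1. p n (x, y) * (LINT z|kern (Suc n) y. g z))"
  using integral_kern[OF x bfun_measurable[OF gk]] by simp
 also have "... = (LINT y|?M1. (LINT z|?M2. p n (x, y) * (p (Suc n) (y, z) * g z)))"
  using g by (intro Bochner_Integration.integral_cong) (auto simp: integral_kern bfun_def)
 also have "... = (LINT z|?M2. (LINT y|?M1. p n (x, y) * (p (Suc n) (y, z) * g z)))"
  using PP.Fubini_integral[OF int] by simp
 also have "... = (LINT z|?M2. (LINT y|?M1. p n (x, y) * p (Suc n) (y, z)) * g z)"
  by (simp add: mult.assoc[symmetric])
 finally show ?thesis .
qed

text \<open>Doeblin minorisation: from every starting point the two-step law dominates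
  \<open>ep\<close> times the reference measure.\<close>

lemma kern2_ge:
 fixes g :: "'a => real"
 assumes x: "x \<in> St n" and g: "bfun (M (Suc (Suc n))) g"
  and nn: "!!z. z \<in> St (Suc (Suc n)) ==> 0 <= g z"
 shows "ep * (LINT z|M (Suc (Suc n)). g z) <= (\<integral>y. \<integral>z. g z \<partial>kern (Suc n) y \<partial>kern n x)"
proof -
 let ?M1 = "M (Suc n)" and ?M2 = "M (Suc (Suc n))"
 interpret M1: prob_space ?M1 by (rule prob_M)
 interpret M2: prob_space ?M2 by (rule prob_M)
 note [measurable] = bfun_measurable[OF g]
 have [measurable]: "p (Suc n) \<in> borel_measurable (?M1 \<Otimes>\<^sub>M ?M2)" by (rule p_meas)
 have q: "bfun ?M2 (\<lambda>z. \<integral>y. p n (x, y) * p (Suc n) (y, z) \<partial>?M1)"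
 proof (rule bfunI[where B = "\<beta> * \<beta>"])
  show "(\<lambda>z. \<integral>y. p n (x, y) * p (Suc n) (y, z) \<partial>?M1) \<in> borel_measurable ?M2" using x by measurable
  fix z assume "z \<in> space ?M2"
  then show "norm (LINT y|?M1. p n (x, y) * p (Suc n) (y, z)) <= \<beta> * \<beta>"
   using beta_nonneg p_bound[OF x] p_bound[of _ "Suc n"]
   by (intro M1.norm_integral_le_const) (auto simp: abs_mult intro!: mult_mono)
 qed
 have "ep * (LINT z|?M2. g z) = (LINT z|?M2. ep * g z)" by simp
 also have "... <= (LINT z|?M2. (LINT y|?M1. p n (x, y) * p (Suc n) (y, z)) * g z)"
  using q g nn p_two[OF x] by (intro integral_mono M2.bfun_integrable mult_right_mono) auto
 finally show ?thesis using kern2_eq[OF x g] by simp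
qed

text \<open>The weights are a parameter, so that the same lemmas serve the plain chain (weight 1,
  \<open>PT\<close>), complex exponentials and real tilts.\<close>

definition T1 :: "(nat => 'a \<times> 'a => 'b::{real_normed_field,banach,second_countable_topology}) => nat => ('a => 'b) => 'a => 'b" where
 "T1 W n h x = (LINT y|kern n x. W n (x, y) * h y)"

fun T :: "(nat => 'a \<times> 'a => 'b::{real_normed_field,banach,second_countable_topology}) => nat => nat => ('a => 'b) => 'a => 'b" where
 "T W n 0 h = h"
| "T W n (Suc k) h = T1 W n (T W (Suc n) k h)"

definition bwt :: "(nat => 'a \<times> 'a => 'b::{real_normed_field,banach,second_countable_topology}) => bool" where
 "bwt W \<longleftrightarrow> (\<forall>n. bfun (MM n) (W n))"

lemma bwtD: "bwt W ==> bfun (MM n) (W n)" by (simp add: bwt_def)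

lemma bwt_1 [simp]: "bwt (\<lambda>n xy. 1)" by (simp add: bwt_def)

lemma T1_bfun_pair: "bwt W ==> bfun (M (Suc n)) h ==> bfun (MM n) (\<lambda>(x, y). W n (x, y) * h y)"
 unfolding case_prod_beta by (auto simp: bwt_def intro!: bfun_mult bfun_compose[OF _ measurable_snd])

lemma T1_bfun: "bwt W ==> bfun (M (Suc n)) h ==> bfun (M n) (T1 W n h)"
 using kern_bfun[OF T1_bfun_pair] by (simp add: T1_def[abs_def])

lemma T_bfun: "bwt W ==> bfun (M (n + k)) h ==> bfun (M n) (T W n k h)"
 by (induction k arbitrary: n) (auto intro!: T1_bfun)

lemma T_bfun_1 [intro]: "bwt W ==> bfun (M n) (T W n k (\<lambda>_. c))"
 by (rule T_bfun) auto

lemma T_add_steps: "T W n (j + k) h = T W n j (T W (n + j) k h)"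
 by (induction j arbitrary: n) auto

lemma T_Suc_right: "T W n (Suc k) h = T W n k (T1 W (n + k) h)"
 using T_add_steps[of W n k 1 h] by simp

lemma bfun_T1_integrand: "bwt W ==> bfun (M (Suc n)) h ==> x \<in> St n ==> bfun (M (Suc n)) (\<lambda>y. W n (x, y) * h y)"
 by (intro bfun_mult bfun_pair1[OF bwtD])

lemma T1_lin:
 assumes "bwt W" "bfun (M (Suc n)) g" "bfun (M (Suc n)) h" "x \<in> St n"
 shows "T1 W n (\<lambda>y. a * g y + b * h y) x = a * T1 W n g x + b * T1 W n h x"
proof -
 note i = integrable_kern[OF assms(4) bfun_T1_integrand[OF assms(1,2,4)]]
  integrable_kern[OF assms(4) bfun_T1_integrand[OF assms(1,3,4)]]
 have "T1 W n (\<lambda>y. a * g y + b * h y) x = (LINT y|kern n x. a * (W n (x, y) * g y) + b * (W n (x, y) * h y))"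
  unfolding T1_def by (rule arg_cong[where f = "integral\<^sup>L _"]) (auto simp: algebra_simps)
 then show ?thesis using i by (simp add: T1_def)
qed

lemma T1_cong:
 assumes "x \<in> St n" "!!y. y \<in> St (Suc n) ==> h y = h' y"
 shows "T1 W n h x = T1 W n h' x"
 unfolding T1_def using assms by (intro Bochner_Integration.integral_cong) auto

lemma T_lin:
 assumes "bwt W" "bfun (M (n + k)) g" "bfun (M (n + k)) h" "x \<in> St n"
 shows "T W n k (\<lambda>y. a * g y + b * h y) x = a * T W n k g x + b * T W n k h x"
 using assms
proof (induction k arbitrary: n x)
 case (Suc k)
 have "T W n (Suc k) (\<lambda>y. a * g y + b * h y) x = T1 W n (\<lambda>y. a * T W (Suc n) k g y + b * T W (Suc n) k h y) x"
  using Suc by (auto intro!: T1_cong)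
 also have "... = a * T W n (Suc k) g x + b * T W n (Suc k) h x"
  using Suc by (simp add: T1_lin T_bfun)
 finally show ?case .
qed simp

lemma T_cmult:
 assumes "bwt W" "bfun (M (n + k)) g" "x \<in> St n"
 shows "T W n k (\<lambda>y. a * g y) x = a * T W n k g x"
 using T_lin[OF assms(1,2,2,3), of a 0] by simp

lemma T_diff:
 assumes "bwt W" "bfun (M (n + k)) g" "bfun (M (n + k)) h" "x \<in> St n"
 shows "T W n k (\<lambda>y. g y - h y) x = T W n k g x - T W n k h x"
 using T_lin[OF assms, of 1 "- 1"] by simp

lemma T1_norm_le:
 assumes "bwt W" "bfun (M (Suc n)) h" "x \<in> St n"
  and "!!y. y \<in> St (Suc n) ==> norm (W n (x, y)) <= U n (x, y)" "bwt U"
  and "!!y. y \<in> St (Suc n) ==> norm (h y) <= g y" "bfun (M (Suc n)) g"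
 shows "norm (T1 W n h x) <= T1 U n g x"
proof -
 have "norm (T1 W n h x) <= (LINT y|kern n x. norm (W n (x, y) * h y))"
  unfolding T1_def by (rule integral_norm_bound)
 also have "... <= (LINT y|kern n x. U n (x, y) * g y)"
  using assms by (intro integral_mono integrable_kern bfun_norm bfun_T1_integrand)
   (auto simp: norm_mult intro!: mult_mono intro: order_trans[OF norm_ge_zero])
 finally show ?thesis by (simp add: T1_def)
qed

lemma T_norm_le:
 assumes "bwt W" "bwt U"
  and "!!n x y. x \<in> St n ==> y \<in> St (Suc n) ==> norm (W n (x, y)) <= U n (x, y)"
  and "bfun (M (n + k)) h" "bfun (M (n + k)) g" "!!y. y \<in> St (n + k) ==> norm (h y) <= g y"
  and "x \<in> St n"
 shows "norm (T W n k h x) <= T U n k g x"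
 using assms(4-)
proof (induction k arbitrary: n x)
 case (Suc k)
 then show ?case using assms(1-3) Suc.IH[of "Suc n"]
  by (auto intro!: T1_norm_le T_bfun)
qed simp

lemma T_one_const:
 assumes "x \<in> St n"
 shows "T (\<lambda>n xy. 1) n k (\<lambda>_. c) x = c"
 using assms
proof (induction k arbitrary: n x)
 case (Suc k)
 interpret prob_space "kern n x" using Suc.prems by (rule prob_kern)
 have "T (\<lambda>n xy. 1) n (Suc k) (\<lambda>_. c) x = T1 (\<lambda>n xy. 1) n (\<lambda>_. c) x"
  using Suc by (auto intro!: T1_cong)
 then show ?case using prob_space by (simp add: T1_def)
qed simp

lemma T_norm_le_1:
 assumes "bwt W" "!!n x y. x \<in> St n ==> y \<in> St (Suc n) ==> norm (W n (x, y)) <= 1"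
  and "bfun (M (n + k)) h" "!!y. y \<in> St (n + k) ==> norm (h y) <= c" "x \<in> St n"
 shows "norm (T W n k h x) <= c"
 using T_norm_le[of W "\<lambda>n xy. 1" n k h "\<lambda>_. c" x] assms by (simp add: T_one_const)

abbreviation PT where "PT \<equiv> T (\<lambda>n xy. 1)"

lemma PT_mono:
 fixes g h :: "'a => real"
 assumes "bfun (M (n + k)) g" "bfun (M (n + k)) h" "!!y. y \<in> St (n + k) ==> g y <= h y" "x \<in> St n"
 shows "PT n k g x <= PT n k h x"
proof -
 have "norm (PT n k (\<lambda>y. 0::real) x) <= PT n k (\<lambda>y. h y - g y) x"
  using assms by (intro T_norm_le) auto
 moreover have "PT n k (\<lambda>y. h y - g y) x = PT n k h x - PT n k g x"
  using assms by (intro T_diff) auto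
 ultimately show ?thesis by (simp add: T_one_const[OF assms(4)])
qed

text \<open>The last two steps minorise; the earlier ones only average a constant.\<close>

lemma PT_ge:
 fixes g :: "'a => real"
 assumes "k >= 2" "bfun (M (n + k)) g" "!!y. y \<in> St (n + k) ==> 0 <= g y" "x \<in> St n"
 shows "ep * (\<integral>z. g z \<partial>M (n + k)) <= PT n k g x"
proof -
 obtain j where k: "k = j + 2" using assms(1) by (metis add.commute le_Suc_ex)
 let ?c = "ep * (\<integral>z. g z \<partial>M (n + k))"
 have "?c = PT n j (\<lambda>_. ?c) x" using assms by (simp add: T_one_const)
 also have "... <= PT n j (PT (n + j) 2 g) x"
 proof (rule PT_mono)
  show "bfun (M (n + j)) (PT (n + j) 2 g)" using assms k by (intro T_bfun) (auto simp: add.assoc)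
  fix y assume "y \<in> St (n + j)"
  then have "ep * (\<integral>z. g z \<partial>M (Suc (Suc (n + j)))) <= (\<integral>u. \<integral>z. g z \<partial>kern (Suc (n + j)) u \<partial>kern (n + j) y)"
   using assms k by (intro kern2_ge) auto
  then show "?c <= PT (n + j) 2 g y" using k by (simp add: numeral_2_eq_2 T1_def[abs_def])
 qed (use assms in auto)
 also have "... = PT n k g x" by (simp only: k T_add_steps)
 finally show ?thesis .
qed

text \<open>The last step has density at most \<beta>; the earlier ones only average a
  constant.\<close>

lemma PT_le:
 fixes g :: "'a => real"
 assumes "k >= 1" "bfun (M (n + k)) g" "!!y. y \<in> St (n + k) ==> 0 <= g y" "x \<in> St n"
 shows "PT n k g x <= \<beta> * (\<integral>z. g z \<partial>M (n + k))"
proof -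
 obtain j where k: "k = j + 1" using assms(1) by (metis add.commute le_Suc_ex)
 let ?c = "\<beta> * (\<integral>z. g z \<partial>M (n + k))"
 have "PT n k g x = PT n j (PT (n + j) 1 g) x" by (simp only: k T_add_steps)
 also have "... <= PT n j (\<lambda>_. ?c) x"
 proof (rule PT_mono)
  show "bfun (M (n + j)) (PT (n + j) 1 g)" using assms k by (intro T_bfun) (auto simp: add.assoc)
  fix y assume "y \<in> St (n + j)"
  then have "(\<integral>z. g z \<partial>kern (n + j) y) <= \<beta> * (\<integral>z. g z \<partial>M (Suc (n + j)))"
   using assms k by (intro kern_le) auto
  then show "PT (n + j) 1 g y <= ?c" using k by (simp add: T1_def[abs_def])
 qed (use assms in auto)
 also have "... = ?c" using assms by (simp add: T_one_const)
 finally show ?thesis .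
qed

text \<open>Both laws dominate \<open>ep\<close> times the same measure, and this common part
  cancels. With \<open>a\<close> the infimum and \<open>b = a + d\<close>, \<open>PT_ge\<close> for
  \<open>h - a\<close> from one point and for \<open>b - h\<close> from the other gain
  \<open>ep * d\<close> together.\<close>

lemma PT2_osc_real:
 fixes h :: "'a => real"
 assumes h: "bfun (M (n + 2)) h" and d: "!!y z. y \<in> St (n + 2) ==> z \<in> St (n + 2) ==> h y - h z <= d"
  and x: "x \<in> St n" "x' \<in> St n"
 shows "PT n 2 h x - PT n 2 h x' <= (1 - ep) * d"
proof -
 let ?N = "M (n + 2)"
 interpret N: prob_space ?N by (rule prob_M)
 define a where "a = (INF y\<in>space ?N. h y)"
 define b where "b = a + d"
 have bdd: "bdd_below (h ` space ?N)"
  using h by (elim bfunE) (auto intro!: bdd_belowI2[where m = "- _"] simp: abs_le_iff minus_le_iff)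
 have a: "a <= h y" if "y \<in> space ?N" for y unfolding a_def using bdd that by (rule cINF_lower)
 have b: "h y <= b" if "y \<in> space ?N" for y
 proof -
  have "h y - d <= a" unfolding a_def
   using d that by (intro cINF_greatest) (auto simp: N.not_empty algebra_simps)
  then show ?thesis by (simp add: b_def)
 qed
 have int: "integrable ?N h" using h by (rule N.bfun_integrable)
 have "ep * (LINT z|?N. h z - a) <= PT n 2 (\<lambda>z. h z - a) x'"
  using h a x by (intro PT_ge) auto
 moreover have "PT n 2 (\<lambda>z. h z - a) x' = PT n 2 h x' - a"
  using h x T_diff[of "\<lambda>_ _. 1" n 2 h "\<lambda>_. a" x'] by (simp add: T_one_const)
 moreover have "ep * (LINT z|?N. b - h z) <= PT n 2 (\<lambda>z. b - h z) x"
  using h b x by (intro PT_ge) auto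
 moreover have "PT n 2 (\<lambda>z. b - h z) x = b - PT n 2 h x"
  using h x T_diff[of "\<lambda>_ _. 1" n 2 "\<lambda>_. b" h x] by (simp add: T_one_const)
 moreover have "(LINT z|?N. h z - a) + (LINT z|?N. b - h z) = d"
  unfolding Bochner_Integration.integral_diff[OF int N.integrable_const] Bochner_Integration.integral_diff[OF N.integrable_const int]
  using N.prob_space by (simp add: b_def)
 moreover have "ep * (LINT z|?N. h z - a) + ep * (LINT z|?N. b - h z) = ep * ((LINT z|?N. h z - a) + (LINT z|?N. b - h z))"
  by (simp add: algebra_simps)
 ultimately show ?thesis by (simp add: algebra_simps b_def)
qed

lemma T1_Re: "bwt W ==> bfun (M (Suc n)) h ==> x \<in> St n ==>
  Re (T1 (\<lambda>n xy. cor (W n xy)) n h x) = T1 W n (\<lambda>y. Re (h y)) x"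
proof -
 assume *: "bwt W" "bfun (M (Suc n)) h" "x \<in> St n"
 have "bwt (\<lambda>n xy. cor (W n xy))" using *(1) by (auto simp: bwt_def)
 from integral_Re[OF integrable_kern[OF *(3) bfun_T1_integrand[OF this *(2,3)]]]
 show ?thesis by (simp add: T1_def)
qed

lemma T_Re:
 assumes "bwt W" "bfun (M (n + k)) h" "x \<in> St n"
 shows "Re (T (\<lambda>n xy. cor (W n xy)) n k h x) = T W n k (\<lambda>y. Re (h y)) x"
 using assms
proof (induction k arbitrary: n x)
 case (Suc k)
 have b: "bwt (\<lambda>n xy. cor (W n xy))" using assms(1) by (auto simp: bwt_def)
 have "Re (T (\<lambda>n xy. cor (W n xy)) n (Suc k) h x)
   = T1 W n (\<lambda>y. Re (T (\<lambda>n xy. cor (W n xy)) (Suc n) k h y)) x"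
  using Suc.prems b by (simp add: T1_Re T_bfun)
 also have "... = T W n (Suc k) (\<lambda>y. Re (h y)) x"
  using Suc by (auto intro!: T1_cong)
 finally show ?case .
qed simp

text \<open>Multiplying by the conjugate phase \<open>u\<close> of the difference makes it real and
  nonnegative, so the real case applies without loss of a constant.\<close>

lemma PT2_osc:
 fixes h :: "'a => complex"
 assumes h: "bfun (M (n + 2)) h" and d: "!!y z. y \<in> St (n + 2) ==> z \<in> St (n + 2) ==> norm (h y - h z) <= d"
  and x: "x \<in> St n" "x' \<in> St n"
 shows "norm (PT n 2 h x - PT n 2 h x') <= (1 - ep) * d"
proof -
 define D where "D = PT n 2 h x - PT n 2 h x'"
 define u where "u = cnj (sgn D)"
 have u: "norm u <= 1" by (simp add: u_def norm_sgn)
 have "norm D = Re (u * D)"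
 proof (cases "D = 0")
  case False
  have "u * D = of_real (norm D)"
   using False complex_norm_square[of D]
   by (simp add: u_def sgn_div_norm scaleR_conv_of_real divide_simps power2_eq_square mult.commute)
  then show ?thesis by simp
 qed (simp add: u_def)
 also have "u * D = PT n 2 (\<lambda>y. u * h y) x - PT n 2 (\<lambda>y. u * h y) x'"
  using h x by (simp add: T_cmult D_def algebra_simps)
 also have "Re ... = PT n 2 (\<lambda>y. Re (u * h y)) x - PT n 2 (\<lambda>y. Re (u * h y)) x'"
  using T_Re[of "\<lambda>_ _. 1" n 2 "\<lambda>y. u * h y"] h x bfun_mult[OF bfun_const h] by simp
 also have "... <= (1 - ep) * d"
 proof (rule PT2_osc_real)
  fix y z assume yz: "y \<in> St (n + 2)" "z \<in> St (n + 2)"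
  have "Re (u * h y) - Re (u * h z) = Re (u * (h y - h z))" by (simp add: algebra_simps)
  also have "... <= norm (u * (h y - h z))" by (rule complex_Re_le_cmod)
  also have "... <= 1 * d" unfolding norm_mult using u d[OF yz] by (intro mult_mono) auto
  finally show "Re (u * h y) - Re (u * h z) <= d" by simp
 qed (use h x in \<open>auto intro!: bfun_Re simp del: times_complex.sel\<close>)
 finally show ?thesis by (simp add: D_def)
qed

lemma PT_osc_le:
 fixes h :: "'a => complex"
 assumes h: "bfun (M (n + k)) h" and d: "!!y z. y \<in> St (n + k) ==> z \<in> St (n + k) ==> norm (h y - h z) <= d"
  and x: "x \<in> St n" "x' \<in> St n"
 shows "norm (PT n k h x - PT n k h x') <= (1 - ep) ^ (k div 2) * d"
proof -
 \<comment> \<open>For odd \<open>k\<close> a single step remains; it does not contract, but does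
   not increase the oscillation either.\<close>
 have one: "norm (PT n 1 g x - PT n 1 g x') <= d"
  if "bfun (M (n + 1)) g" "!!y z. y \<in> St (n + 1) ==> z \<in> St (n + 1) ==> norm (g y - g z) <= d"
   "x \<in> St n" "x' \<in> St n" for n x x' d and g :: "'a => complex"
 proof -
  have d0: "0 <= d" using that(2) space_nonempty[of "n + 1"] by (meson norm_ge_zero order_trans)
  have "norm (PT n 1 g x - g y) <= d" if y: "y \<in> St (n + 1)" for y
  proof -
   have "norm (PT n 1 (\<lambda>z. g z - g y) x) <= d"
    using that \<open>bfun _ g\<close> \<open>x \<in> _\<close> \<open>!!y z. _ ==> _ ==> norm (g y - g z) <= d\<close>
    by (intro T_norm_le_1) auto
   then show ?thesis using T_diff[of "\<lambda>_ _. 1" n 1 g "\<lambda>_. g y" x] that \<open>bfun _ g\<close> \<open>x \<in> _\<close>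
    by (simp add: T1_def prob_space.prob_space[OF prob_kern, simplified])
  qed
  then have "norm (PT n 1 (\<lambda>y. PT n 1 g x - g y) x') <= d"
   using that by (intro T_norm_le_1) auto
  moreover have "PT n 1 (\<lambda>y. PT n 1 g x - g y) x' = PT n 1 g x - PT n 1 g x'"
   using T_diff[of "\<lambda>_ _. 1" n 1 "\<lambda>_. PT n 1 g x" g x'] that T_one_const[of x' n 1 "PT n 1 g x"]
   by simp
  ultimately show ?thesis by simp
 qed
 show ?thesis using assms
 proof (induction k arbitrary: n x x' rule: nat_less_induct)
  case (1 k)
  consider "k = 0" | "k = 1" | j where "k = 2 + j" by (metis One_nat_def add_2_eq_Suc not0_implies_Suc)
  then show ?case
  proof cases
   case 3
   have "norm (PT n 2 (PT (n + 2) j h) x - PT n 2 (PT (n + 2) j h) x') <= (1 - ep) * ((1 - ep) ^ (j div 2) * d)"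
    using 1 3 by (intro PT2_osc T_bfun) (auto simp: add.assoc)
   then show ?thesis by (simp only: 3 T_add_steps) simp
  qed (use 1 one[of n h d] in auto)
 qed
qed

end

section \<open>Conditional laws of the chain\<close>

text \<open>Upgrades a Markov property for events to one for joint functions of the past and the
  next state. Rectangles form an intersection-stable generator, so it suffices to know the joint law
  on them.\<close>

lemma (in prob_space) joint_law_eqI:
 assumes sub: "subalgebra M F" and N: "prob_space N" and X: "X \<in> measurable M N"
  and q: "q \<in> borel_measurable (F \<Otimes>\<^sub>M N)"
  and rect: "!!A E. A \<in> sets F ==> E \<in> sets N ==>
   emeasure M (A \<inter> (X -` E \<inter> space M)) = (\<integral>\<^sup>+om. indicator A om * (\<integral>\<^sup>+y. q (om, y) * indicator E y \<partial>N) \<partial>M)"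
 shows "distr M (F \<Otimes>\<^sub>M N) (\<lambda>om. (om, X om)) = density (restr_to_subalg M F \<Otimes>\<^sub>M N) q"
proof -
 let ?R = "restr_to_subalg M F"
 interpret N: prob_space N by fact
 interpret R: prob_space ?R by (rule prob_space_restr_to_subalg[OF sub prob_space_axioms])
 have spF: "space F = space M" using sub by (simp add: subalgebra_def)
 have setsR [measurable_cong]: "sets ?R = sets F" by (rule sets_restr_to_subalg[OF sub])
 have idF: "(\<lambda>om. om) \<in> measurable M F" using sub by (auto simp: measurable_def subalgebra_def)
 have m: "(\<lambda>om. (om, X om)) \<in> measurable M (F \<Otimes>\<^sub>M N)" using idF X by measurable
 have qR [measurable]: "q \<in> borel_measurable (?R \<Otimes>\<^sub>M N)"
  using q by (simp cong: measurable_cong_sets add: measurable_cong_sets[OF sets_pair_measure_cong[OF setsR refl] refl])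
 show ?thesis
 proof (rule measure_eqI_generator_eq[OF Int_stable_pair_measure_generator[of F N],
    where A = "\<lambda>_. space F \<times> space N" and \<Omega> = "space F \<times> space N"])
  show "{a \<times> b |a b. a \<in> sets F \<and> b \<in> sets N} \<subseteq> Pow (space F \<times> space N)"
   using sets.space_closed[of F] sets.space_closed[of N] by auto
  show "sets (distr M (F \<Otimes>\<^sub>M N) (\<lambda>om. (om, X om))) = sigma_sets (space F \<times> space N) {a \<times> b |a b. a \<in> sets F \<and> b \<in> sets N}"
   by (simp add: sets_pair_measure)
  show "sets (density (?R \<Otimes>\<^sub>M N) q) = sigma_sets (space F \<times> space N) {a \<times> b |a b. a \<in> sets F \<and> b \<in> sets N}"
   using sets_pair_measure_cong[OF setsR refl, of N] by (simp add: sets_pair_measure)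
  show "(\<Union>i::nat. space F \<times> space N) = space F \<times> space N" by simp
  show "range (\<lambda>_. space F \<times> space N) \<subseteq> {a \<times> b |a b. a \<in> sets F \<and> b \<in> sets N}" by auto
  show "emeasure (distr M (F \<Otimes>\<^sub>M N) (\<lambda>om. (om, X om))) (space F \<times> space N) \<noteq> \<infinity>"
   using m by (simp add: emeasure_distr)
 next
  fix C assume "C \<in> {a \<times> b |a b. a \<in> sets F \<and> b \<in> sets N}"
  then obtain A E where C: "C = A \<times> E" and A: "A \<in> sets F" and E: "E \<in> sets N" by auto
  have [measurable]: "A \<in> sets ?R" "E \<in> sets N" using A E setsR by auto
  have "emeasure (distr M (F \<Otimes>\<^sub>M N) (\<lambda>om. (om, X om))) C = emeasure M ((\<lambda>om. (om, X om)) -` C \<inter> space M)"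
   using A E m C by (intro emeasure_distr) auto
  also have "(\<lambda>om. (om, X om)) -` C \<inter> space M = A \<inter> (X -` E \<inter> space M)" by (auto simp: C)
  also have "emeasure M ... = (\<integral>\<^sup>+om. indicator A om * (\<integral>\<^sup>+y. q (om, y) * indicator E y \<partial>N) \<partial>M)" by (rule rect[OF A E])
  also have "... = (\<integral>\<^sup>+om. indicator A om * (\<integral>\<^sup>+y. q (om, y) * indicator E y \<partial>N) \<partial>?R)"
  proof (rule nn_integral_subalgebra2[OF sub, symmetric])
   have [measurable]: "A \<in> sets F" by fact
   note [measurable] = q
   show "(\<lambda>om. indicator A om * (\<integral>\<^sup>+y. q (om, y) * indicator E y \<partial>N)) \<in> borel_measurable F" by measurable
  qed
  also have "... = (\<integral>\<^sup>+om. (\<integral>\<^sup>+y. q (om, y) * indicator (A \<times> E) (om, y) \<partial>N) \<partial>?R)"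
   by (intro nn_integral_cong, subst nn_integral_cmult[symmetric])
    (auto simp: indicator_def space_restr_to_subalg intro!: nn_integral_cong measurable_compose_Pair1[of _ ?R _ N, THEN measurable_compose])
  also have "... = (\<integral>\<^sup>+z. q z * indicator (A \<times> E) z \<partial>(?R \<Otimes>\<^sub>M N))"
   by (rule N.nn_integral_fst) measurable
  also have "... = emeasure (density (?R \<Otimes>\<^sub>M N) q) C"
   unfolding C by (rule emeasure_density[symmetric]) measurable
  finally show "emeasure (distr M (F \<Otimes>\<^sub>M N) (\<lambda>om. (om, X om))) C = emeasure (density (?R \<Otimes>\<^sub>M N) q) C" .
 qed
qed

text \<open>The Markov property is taken for bounded functions of past and next state jointly. The
  starting time \<open>s\<close> is free because the operator products over a block are represented
  by a chain that starts with the block.\<close>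

locale chain_process = elliptic_chain +
 fixes Om :: "'w measure" and F :: "nat => 'w measure" and X :: "nat => 'w => 'a" and s :: nat
 assumes prob_Om: "prob_space Om"
  and sub_F: "n >= s ==> subalgebra Om (F n)"
  and X_F: "s <= i ==> i <= n ==> X i \<in> F n \<rightarrow>\<^sub>M M i"
  and X_meas: "n >= s ==> X n \<in> Om \<rightarrow>\<^sub>M M n"
  and F_mono: "s <= n ==> n <= m ==> (\<lambda>om. om) \<in> F m \<rightarrow>\<^sub>M F n"
  and markov: "n >= s ==> bfun (F n \<Otimes>\<^sub>M M (Suc n)) G ==>
   (LINT om|Om. (G (om, X (Suc n) om) :: complex)) = (LINT om|Om. (LINT y|kern n (X n om). G (om, y)))"

context elliptic_chain
begin

text \<open>Index 1 of the given chain becomes time \<open>s\<close>; index 0 is never looked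
  at.\<close>

lemma chain_procI:
 assumes mc: "markov_chain Om S' \<nu> \<kappa> X'"
  and S': "!!i. i >= 1 ==> S' i = S (s + i - 1)"
  and \<kappa>: "!!i x. i >= 1 ==> x \<in> St (s + i - 1) ==> \<kappa> i x = kern (s + i - 1) x"
 shows "chain_process S M p ep \<beta> Om (\<lambda>n. past Om S' X' (Suc n - s)) (\<lambda>n. X' (Suc n - s)) s"
proof -
 interpret Om: prob_space Om using mc by (simp add: markov_chain_def)
 have setsB: "sets (metric_borel (S' i)) = sets (M (s + i - 1))" if "i >= 1" for i
  using S'[OF that] sets_M by simp
 have X': "X' i \<in> Om \<rightarrow>\<^sub>M M (s + i - 1)" if "i >= 1" for i
  using mc that unfolding measurable_cong_sets[OF refl setsB[OF that], symmetric] by (simp add: markov_chain_def)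
 have sub: "subalgebra Om (past Om S' X' k)"
  and meas: "1 <= i ==> i <= k ==> X' i \<in> past Om S' X' k \<rightarrow>\<^sub>M M (s + i - 1)" for i k
 proof -
  let ?h = "\<lambda>om. \<lambda>i\<in>{1..k}. X' i om"
  let ?D = "\<Pi>\<^sub>M i\<in>{1..k}. metric_borel (S' i)"
  have h: "?h \<in> Om \<rightarrow>\<^sub>M ?D"
   using mc by (intro measurable_restrict) (auto simp: markov_chain_def)
  have hsp: "?h \<in> space Om \<rightarrow> space ?D" using measurable_space[OF h] by auto
  have sets_F: "sets (past Om S' X' k) = {?h -` A \<inter> space Om | A. A \<in> sets ?D}"
   unfolding past_def by (rule sets_vimage_algebra2[OF hsp])
  show "subalgebra Om (past Om S' X' k)"
   unfolding subalgebra_def sets_F using measurable_sets[OF h] by (auto simp: past_def)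
  have hF: "?h \<in> past Om S' X' k \<rightarrow>\<^sub>M ?D"
   unfolding past_def by (rule measurable_vimage_algebra1[OF hsp])
  assume i: "1 <= i" "i <= k"
  have "X' i \<in> past Om S' X' k \<rightarrow>\<^sub>M metric_borel (S' i)"
   using measurable_compose[OF hF measurable_component_singleton[of i "{1..k}"]] i by simp
  then show "X' i \<in> past Om S' X' k \<rightarrow>\<^sub>M M (s + i - 1)"
   unfolding measurable_cong_sets[OF refl setsB[OF i(1)]] .
 qed
 have mono: "(\<lambda>om. om) \<in> past Om S' X' m \<rightarrow>\<^sub>M past Om S' X' n" if "n <= m" for m n
  unfolding past_def[of _ _ _ n]
 proof (rule measurable_vimage_algebra2)
  show "(\<lambda>om. om) \<in> space (past Om S' X' m) \<rightarrow> space Om" by (simp add: past_def)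
  show "(\<lambda>om. \<lambda>i\<in>{1..n}. X' i om) \<in> past Om S' X' m \<rightarrow>\<^sub>M (\<Pi>\<^sub>M i\<in>{1..n}. metric_borel (S' i))"
  proof (rule measurable_restrict)
   fix i assume i: "i \<in> {1..n}"
   then have "X' i \<in> past Om S' X' m \<rightarrow>\<^sub>M M (s + i - 1)" using that by (intro meas) auto
   then show "X' i \<in> past Om S' X' m \<rightarrow>\<^sub>M metric_borel (S' i)"
    using measurable_cong_sets[OF refl setsB[of i], of "past Om S' X' m"] i by auto
  qed
 qed
 have step: "(LINT om|Om. G (om, X' (Suc k) om)) = (LINT om|Om. (LINT y|kern n (X' k om). G (om, y)))"
  if k: "k >= 1" "n = s + k - 1" and G: "bfun (past Om S' X' k \<Otimes>\<^sub>M M (Suc n)) G" for k n and G :: "'b \<times> 'a => complex"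
 proof -
  let ?F = "past Om S' X' k" and ?N = "M (Suc n)"
  let ?R = "restr_to_subalg Om ?F"
  have nk: "s + Suc k - 1 = Suc n" using k by simp
  interpret N: prob_space ?N by (rule prob_M)
  interpret R: prob_space ?R by (rule prob_space_restr_to_subalg[OF sub Om.prob_space_axioms])
  interpret RN: pair_prob_space ?R ?N ..
  interpret F: finite_measure_subalgebra Om ?F by unfold_locales (rule sub)
  have setsR [measurable_cong]: "sets ?R = sets ?F" by (rule sets_restr_to_subalg[OF sub])
  have XkF [measurable]: "X' k \<in> ?F \<rightarrow>\<^sub>M M n" using meas[of k k] k by simp
  have Xk [measurable]: "X' k \<in> Om \<rightarrow>\<^sub>M M n" using X'[of k] k by simp
  have Xk1 [measurable]: "X' (Suc k) \<in> Om \<rightarrow>\<^sub>M ?N" using X'[of "Suc k"] nk by simp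
  have [measurable]: "p n \<in> borel_measurable (M n \<Otimes>\<^sub>M ?N)" by (rule p_meas)
  have pX: "0 <= p n (X' k om, y)" if "om \<in> space Om" "y \<in> space ?N" for om y
   using that measurable_space[OF Xk] by (auto intro: p_nonneg)
  have kernX: "\<kappa> k (X' k om) = kern n (X' k om)" if "om \<in> space Om" for om
   using \<kappa>[of k] measurable_space[OF Xk that] k by simp
  have em: "(\<integral>\<^sup>+y. ennreal (p n (X' k om, y)) * indicator E y \<partial>?N) = ennreal (measure (kern n (X' k om)) E)"
   if "om \<in> space Om" "E \<in> sets ?N" for om E
  proof -
   interpret K: prob_space "kern n (X' k om)" using prob_kern measurable_space[OF Xk that(1)] by blast
   have "emeasure (kern n (X' k om)) E = (\<integral>\<^sup>+y. ennreal (p n (X' k om, y)) * indicator E y \<partial>?N)"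
    using that measurable_space[OF Xk that(1)] by (simp add: kern_def emeasure_density)
   then show ?thesis by (simp add: K.emeasure_eq_measure)
  qed
  \<comment> \<open>The conditional probabilities fix the joint law on rectangles, hence everywhere:
    it has density \<open>p n\<close> relative to the product of the law on the past and
    \<open>M (Suc n)\<close>.\<close>
  have J: "distr Om (?F \<Otimes>\<^sub>M ?N) (\<lambda>om. (om, X' (Suc k) om)) = density (?R \<Otimes>\<^sub>M ?N) (\<lambda>(om, y). ennreal (p n (X' k om, y)))"
  proof (rule Om.joint_law_eqI[OF sub prob_M Xk1])
   show "(\<lambda>(om, y). ennreal (p n (X' k om, y))) \<in> borel_measurable (?F \<Otimes>\<^sub>M ?N)" by measurable
   fix A E assume A: "A \<in> sets ?F" and E: "E \<in> sets ?N"
   have AOm: "A \<in> sets Om" using A sub by (auto simp: subalgebra_def)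
   let ?E = "X' (Suc k) -` E \<inter> space Om"
   have EOm [measurable]: "?E \<in> sets Om" using E by measurable
   have E': "E \<in> sets (metric_borel (S' (Suc k)))" using E setsB[of "Suc k"] nk by simp
   have ae: "AE om in Om. real_cond_exp Om ?F (indicator ?E) om = measure (\<kappa> k (X' k om)) E"
    using mc k E' unfolding markov_chain_def by blast
   have ae2: "AE om in Om. indicator A om * real_cond_exp Om ?F (indicator ?E) om = indicator A om * measure (kern n (X' k om)) E"
    using ae by eventually_elim (use kernX sets.sets_into_space[OF AOm] in \<open>auto simp: indicator_def\<close>)
   have mk: "(\<lambda>om. measure (kern n (X' k om)) E) \<in> borel_measurable Om"
   proof -
    have *: "(\<lambda>x. measure (kern n x) E) \<in> borel_measurable (M n)"
    proof -
     have "(\<lambda>x. \<integral>y. indicat_real E (snd (x, y)) \<partial>kern n x) \<in> borel_measurable (M n)"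
      using E by (intro kern_meas measurable_compose[OF measurable_snd borel_measurable_indicator]) auto
     then show ?thesis using sets.sets_into_space[OF E]
      by (subst measurable_cong[where g = "\<lambda>x. \<integral>y. indicat_real E (snd (x, y)) \<partial>kern n x"])
       (auto simp: Int_absorb2 Int_absorb1 E)
    qed
    show ?thesis by (rule measurable_compose[OF Xk *])
   qed
   have le1: "measure (kern n (X' k om)) E <= 1" if "om \<in> space Om" for om
    using prob_space.prob_le_1[OF prob_kern] measurable_space[OF Xk that] by blast
   have intg: "integrable Om (\<lambda>om. indicator A om * measure (kern n (X' k om)) E)"
    using mk AOm le1 by (intro Om.integrable_const_bound[where B = 1]) (auto simp: indicator_def intro!: AE_I2)
   have "emeasure Om (A \<inter> ?E) = ennreal (measure Om (A \<inter> ?E))" by (rule Om.emeasure_eq_measure)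
   also have "measure Om (A \<inter> ?E) = (LINT om|Om. indicator A om * indicator ?E om)"
    using AOm EOm by (simp add: indicator_inter_arith[symmetric])
   also have "... = (LINT om|Om. indicator A om * real_cond_exp Om ?F (indicator ?E) om)"
    using A AOm EOm by (intro F.real_cond_exp_intg(2)[symmetric])
     (auto simp: indicator_inter_arith[symmetric] Om.emeasure_eq_measure)
   also have "... = (LINT om|Om. indicator A om * measure (kern n (X' k om)) E)"
    using ae2 mk AOm A by (intro integral_cong_AE) (auto intro: measurable_from_subalg[OF sub])
   also have "ennreal ... = (\<integral>\<^sup>+om. ennreal (indicator A om * measure (kern n (X' k om)) E) \<partial>Om)"
    using intg by (intro nn_integral_eq_integral[symmetric]) auto
   also have "... = (\<integral>\<^sup>+om. indicator A om * (\<integral>\<^sup>+y. (case (om, y) of (om, y) => ennreal (p n (X' k om, y))) * indicator E y \<partial>?N) \<partial>Om)"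
    using em E by (intro nn_integral_cong) (auto simp: indicator_def)
   finally show "emeasure Om (A \<inter> ?E) = ..." .
  qed
  have [measurable]: "G \<in> borel_measurable (?F \<Otimes>\<^sub>M ?N)" using G by (rule bfun_measurable)
  obtain B where B: "B >= 0" "!!z. z \<in> space (?F \<Otimes>\<^sub>M ?N) ==> norm (G z) <= B" using G by (elim bfunE) blast
  have spF: "space ?F = space Om" using sub by (simp add: subalgebra_def)
  have spR: "space ?R = space Om" by (simp add: space_restr_to_subalg)
  have GR [measurable]: "G \<in> borel_measurable (?R \<Otimes>\<^sub>M ?N)"
   by (simp add: measurable_cong_sets[OF sets_pair_measure_cong[OF setsR refl] refl])
  have int: "integrable (?R \<Otimes>\<^sub>M ?N) (\<lambda>z. p n (X' k (fst z), snd z) *\<^sub>R G z)"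
  proof (rule RN.P.integrable_const_bound[where B = "\<beta> * B"])
   show "AE z in ?R \<Otimes>\<^sub>M ?N. norm (p n (X' k (fst z), snd z) *\<^sub>R G z) <= \<beta> * B"
    using B beta_nonneg p_bound measurable_space[OF Xk]
    by (intro AE_I2) (auto simp: space_pair_measure spR spF intro!: mult_mono)
  qed measurable
  have idF: "(\<lambda>om. om) \<in> measurable Om ?F" using sub by (auto simp: measurable_def subalgebra_def)
  have "(LINT om|Om. G (om, X' (Suc k) om)) = (\<integral>z. G z \<partial>distr Om (?F \<Otimes>\<^sub>M ?N) (\<lambda>om. (om, X' (Suc k) om)))"
   by (intro integral_distr[symmetric] measurable_Pair idF Xk1) measurable
  also have "... = (\<integral>z. p n (X' k (fst z), snd z) *\<^sub>R G z \<partial>(?R \<Otimes>\<^sub>M ?N))"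
   unfolding J case_prod_beta
   by (rule integral_density) (auto simp: space_pair_measure spR intro!: AE_I2 pX)
  also have "... = (LINT om|?R. (LINT y|?N. p n (X' k om, y) *\<^sub>R G (om, y)))"
   using RN.integral_fst'[OF int] by simp
  also have "... = (LINT om|Om. (LINT y|?N. p n (X' k om, y) *\<^sub>R G (om, y)))"
   by (rule integral_subalgebra2[OF sub]) measurable
  also have "... = (LINT om|Om. (LINT y|kern n (X' k om). G (om, y)))"
  proof (rule Bochner_Integration.integral_cong[OF refl])
   fix om assume om: "om \<in> space Om"
   then have "(\<lambda>y. G (om, y)) \<in> borel_measurable ?N"
    by (intro measurable_Pair2[OF bfun_measurable[OF G]]) (simp add: spF)
   then show "(LINT y|?N. p n (X' k om, y) *\<^sub>R G (om, y)) = (LINT y|kern n (X' k om). G (om, y))"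
    using measurable_space[OF Xk om] by (intro integral_kern[symmetric])
  qed
  finally show ?thesis .
 qed
 have "(LINT om|Om. G (om, X' (Suc (Suc n) - s) om)) = (LINT om|Om. (\<integral>y. G (om, y) \<partial>kern n (X' (Suc n - s) om)))"
  if "n >= s" "bfun (past Om S' X' (Suc n - s) \<Otimes>\<^sub>M M (Suc n)) G" for n and G :: "'b \<times> 'a => complex"
  using that step[of "Suc n - s" n G] by (simp add: Suc_diff_le)
 moreover have "X' (Suc i - s) \<in> past Om S' X' (Suc n - s) \<rightarrow>\<^sub>M M i" if "s <= i" "i <= n" for i n
  using that meas[of "Suc i - s" "Suc n - s"] by (simp add: Suc_diff_le)
 moreover have "X' (Suc i - s) \<in> Om \<rightarrow>\<^sub>M M i" if "s <= i" for i
  using that X'[of "Suc i - s"] by (simp add: Suc_diff_le)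
 ultimately show ?thesis
  using sub Om.prob_space_axioms mono
  by (intro chain_process.intro chain_process_axioms.intro elliptic_chain_axioms) auto
qed

lemma kern_transition: "kern n \<in> metric_borel (S n) \<rightarrow>\<^sub>M prob_algebra (metric_borel (S (Suc n)))"
proof -
 have "kern n \<in> M n \<rightarrow>\<^sub>M prob_algebra (M (Suc n))"
 proof (rule measurable_prob_algebraI)
  show "kern n \<in> M n \<rightarrow>\<^sub>M subprob_algebra (M (Suc n))"
  proof (rule measurable_subprob_algebra)
   fix x assume "x \<in> St n"
   then show "subprob_space (kern n x)" by (intro prob_space_imp_subprob_space prob_kern)
  next
   fix A assume A: "A \<in> sets (M (Suc n))"
   interpret prob_space "M (Suc n)" by (rule prob_M)
   have "(\<lambda>x. \<integral>\<^sup>+y. ennreal (p n (x, y)) * indicator A y \<partial>M (Suc n)) \<in> borel_measurable (M n)"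
    using A by measurable
   then show "(\<lambda>x. emeasure (kern n x) A) \<in> borel_measurable (M n)"
    using A by (subst measurable_cong[where g = "\<lambda>x. \<integral>\<^sup>+y. ennreal (p n (x, y)) * indicator A y \<partial>M (Suc n)"])
     (auto simp: kern_def emeasure_density)
  qed simp
 qed (rule prob_kern)
 moreover have "prob_algebra (M (Suc n)) = prob_algebra (metric_borel (S (Suc n)))"
  unfolding prob_algebra_def by (simp add: subprob_algebra_cong[OF sets_M])
 ultimately show ?thesis by (simp add: measurable_cong_sets[OF sets_M refl])
qed

text \<open>Lets pointwise statements about operator products be proved as statements about a
  process started from a point mass.\<close>

lemma chain_proc_exists:
 assumes y: "y \<in> St s"
 obtains Om :: "(nat => 'a) measure" and F X
 where "chain_process S M p ep \<beta> Om F X s" "distr Om (M s) (X s) = return (M s) y"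
proof -
 define S' where "S' i = S (s + i - 1)" for i
 define \<kappa> where "\<kappa> i = kern (s + i - 1)" for i
 define \<nu> where "\<nu> = return (M s) y"
 have S: "state_spaces S'" by (simp add: state_spaces_def S'_def complete_S separable_S)
 have \<kappa>: "transition_kernels S' \<kappa>"
  unfolding transition_kernels_def
 proof (intro allI impI)
  fix n :: nat assume "n >= 1"
  then have "Suc (s + n - 1) = s + Suc n - 1" by simp
  then show "\<kappa> n \<in> metric_borel (S' n) \<rightarrow>\<^sub>M prob_algebra (metric_borel (S' (Suc n)))"
   using kern_transition[of "s + n - 1"] by (simp add: S'_def \<kappa>_def)
 qed
 have \<nu>: "\<nu> \<in> space (prob_algebra (metric_borel (S' 1)))"
  using y by (auto simp: \<nu>_def S'_def space_prob_algebra sets_M prob_space_return)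
 have mc: "markov_chain (path_measure S' \<nu> \<kappa>) S' \<nu> \<kappa> coord"
  by (rule markov_chain_path_measure[OF S \<kappa> \<nu>])
 let ?Om = "path_measure S' \<nu> \<kappa>"
 have "chain_process S M p ep \<beta> ?Om (\<lambda>n. past ?Om S' coord (Suc n - s)) (\<lambda>n. coord (Suc n - s)) s"
  by (rule chain_procI[OF mc]) (auto simp: S'_def \<kappa>_def)
 moreover have "distr ?Om (metric_borel (S' 1)) (coord 1) = \<nu>"
  using mc by (simp add: markov_chain_def)
 then have "distr ?Om (M s) (coord (Suc s - s)) = return (M s) y"
  unfolding \<nu>_def S'_def by (simp add: sets_M cong: distr_cong)
 ultimately show ?thesis by (rule that)
qed

end

text \<open>The terms come in equal pairs, so the sum is twice a geometric series.\<close>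

lemma suminf_power_div2:
 fixes r :: real
 assumes "0 <= r" "r < 1"
 shows "summable (\<lambda>j. r ^ (j div 2))" "(\<Sum>j. r ^ (j div 2)) <= 2 / (1 - r)"
  "(\<Sum>j<n. r ^ (j div 2)) <= 2 / (1 - r)"
proof -
 have *: "(\<Sum>j<2 * m. r ^ (j div 2)) = 2 * (\<Sum>i<m. r ^ i)" for m
  by (induction m) (auto simp: algebra_simps)
 have bound: "(\<Sum>j<n. r ^ (j div 2)) <= 2 / (1 - r)" for n
 proof -
  have "(\<Sum>j<n. r ^ (j div 2)) <= (\<Sum>j<2 * n. r ^ (j div 2))"
   using assms by (intro sum_mono2) auto
  also have "... = 2 * ((1 - r ^ n) / (1 - r))"
   using assms by (simp add: * sum_gp_strict)
  also have "... <= 2 / (1 - r)"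
   using assms by (simp add: divide_right_mono)
  finally show ?thesis .
 qed
 then show "(\<Sum>j<n. r ^ (j div 2)) <= 2 / (1 - r)" .
 show "summable (\<lambda>j. r ^ (j div 2))"
  using assms bound by (intro summableI_nonneg_bounded) auto
 then show "(\<Sum>j. r ^ (j div 2)) <= 2 / (1 - r)"
  using bound by (intro suminf_le_const)
qed

context elliptic_chain
begin

lemma T_of_real:
 assumes "x \<in> St n"
 shows "T (\<lambda>n xy. cor (W n xy)) n k (\<lambda>y. cor (h y)) x = cor (T W n k h x)"
 using assms
proof (induction k arbitrary: n x)
 case (Suc k)
 then have "T (\<lambda>n xy. cor (W n xy)) n (Suc k) (\<lambda>y. cor (h y)) x
  = T1 (\<lambda>n xy. cor (W n xy)) n (\<lambda>y. cor (T W (Suc n) k h y)) x"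
  by (auto intro!: T1_cong)
 then show ?case by (simp add: T1_def flip: of_real_mult)
qed simp

lemma PT_osc_le_real:
 fixes h :: "'a => real"
 assumes h: "bfun (M (n + k)) h" and d: "!!y z. y \<in> St (n + k) ==> z \<in> St (n + k) ==> \<bar>h y - h z\<bar> <= d"
  and x: "x \<in> St n" "x' \<in> St n"
 shows "\<bar>PT n k h x - PT n k h x'\<bar> <= (1 - ep) ^ (k div 2) * d"
proof -
 have "norm (PT n k (\<lambda>y. cor (h y)) x - PT n k (\<lambda>y. cor (h y)) x') <= (1 - ep) ^ (k div 2) * d"
  using h d x by (intro PT_osc_le) (auto simp flip: of_real_diff)
 then show ?thesis
  using T_of_real[of _ n "\<lambda>_ _. 1" k h] x by (simp flip: of_real_diff)
qed

lemma PT_avg_diff_le: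
 fixes h :: "'a => real"
 assumes h: "bfun (M n) h" and d: "!!y z. y \<in> St n ==> z \<in> St n ==> \<bar>h y - h z\<bar> <= d"
  and x: "x \<in> St n" and m: "m + j = n" "x' \<in> St m"
 shows "\<bar>h x - PT m j h x'\<bar> <= d"
proof -
 have "norm (PT m j (\<lambda>y. h x - h y) x') <= d"
  using h d x m by (intro T_norm_le_1) auto
 moreover have "PT m j (\<lambda>y. h x - h y) x' = h x - PT m j h x'"
  using T_diff[of "\<lambda>_ _. 1" m j "\<lambda>_. h x" h x'] h m by (simp add: T_one_const)
 ultimately show ?thesis by simp
qed

end

section \<open>Martingale approximation of a bounded functional\<close>

locale bounded_functional = elliptic_chain +
 fixes f :: "nat => 'a \<times> 'a => real" and K :: real
 assumes f_meas [measurable]: "f n \<in> borel_measurable (M n \<Otimes>\<^sub>M M (Suc n))"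
  and f_bound: "x \<in> space (M n) ==> y \<in> space (M (Suc n)) ==> \<bar>f n (x, y)\<bar> <= K"
begin

lemma K_nonneg: "0 <= K"
 using space_nonempty[of 0] space_nonempty[of 1] f_bound[of _ 0] by (force intro: order_trans)

lemma f_bfun: "bfun (MM n) (f n)"
 by (rule bfunI[where B = K]) (auto simp: space_pair_measure f_bound)

definition fbar :: "nat => 'a => real" where "fbar n x = (LINT y|kern n x. f n (x, y))"

lemma fbar_bfun: "bfun (M n) (fbar n)"
 unfolding fbar_def[abs_def] by (rule kern_bfun[OF f_bfun])

lemma fbar_bound: "x \<in> St n ==> \<bar>fbar n x\<bar> <= K"
 unfolding fbar_def using prob_space.norm_integral_le_const[OF prob_kern, of x n "\<lambda>y. f n (x, y)" K] f_bound K_nonneg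
 by auto

definition base :: "nat => 'a" where "base n = (SOME x. x \<in> St n)"

lemma base_in: "base n \<in> St n"
 unfolding base_def using space_nonempty by (rule someI_ex)

text \<open>Centering along the chain from one fixed point, not by the mean under the process at
  hand: the corrector is then the same function for every initial law.\<close>

definition cen :: "nat => real" where "cen k = PT 0 k (fbar k) (base 0)"

definition corr_term :: "nat => nat => 'a => real" where
 "corr_term n j x = PT n j (fbar (n + j)) x - cen (n + j)"

text \<open>\<open>corr\<close> solves the Poisson equation, so \<open>mart\<close> is a martingale difference cohomologous to \<open>f - cen\<close>.\<close>

definition corr :: "nat => 'a => real" where "corr n x = (\<Sum>j. corr_term n j x)"

definition mart :: "nat => 'a \<times> 'a => real" where
 "mart n = (\<lambda>(x, y). f n (x, y) - cen n + corr (Suc n) y - corr n x)"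

text \<open>Bound for the corrector: \<open>2 * K\<close> times the bound \<open>2 / ep\<close> of
  the mixing series. \<open>KD\<close> bounds the martingale difference, which consists of
  \<open>f\<close>, its centering and two correctors.\<close>

definition KA :: real where "KA = 4 * K / ep"
definition KD :: real where "KD = 2 * K + 2 * KA"

lemma cen_bound: "\<bar>cen n\<bar> <= K"
 unfolding cen_def using T_norm_le_1[of "\<lambda>_ _. 1" 0 n "fbar n" K "base 0"] fbar_bfun fbar_bound base_in by auto

lemma corr_term_bfun: "bfun (M n) (corr_term n j)"
 unfolding corr_term_def[abs_def] by (intro bfun_diff T_bfun bfun_const fbar_bfun bwt_1)

text \<open>\<open>cen (n + j)\<close> is itself an average of \<open>PT n j (fbar (n + j))\<close>
  over the states at time \<open>n\<close>. The difference is therefore at most the oscillation,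
  which has contracted \<open>j div 2\<close> times.\<close>

lemma corr_term_le:
 assumes x: "x \<in> St n"
 shows "\<bar>corr_term n j x\<bar> <= 2 * K * (1 - ep) ^ (j div 2)"
proof -
 have c: "cen (n + j) = PT 0 n (PT n j (fbar (n + j))) (base 0)"
  by (simp add: cen_def T_add_steps)
 have "\<bar>PT n j (fbar (n + j)) x - PT 0 n (PT n j (fbar (n + j))) (base 0)\<bar> <= (1 - ep) ^ (j div 2) * (2 * K)"
 proof (rule PT_avg_diff_le)
  fix y z assume "y \<in> St n" "z \<in> St n"
  then show "\<bar>PT n j (fbar (n + j)) y - PT n j (fbar (n + j)) z\<bar> <= (1 - ep) ^ (j div 2) * (2 * K)"
  proof (intro PT_osc_le_real fbar_bfun)
   fix u v assume "u \<in> St (n + j)" "v \<in> St (n + j)"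
   then show "\<bar>fbar (n + j) u - fbar (n + j) v\<bar> <= 2 * K"
    using fbar_bound[of u "n + j"] fbar_bound[of v "n + j"] by linarith
  qed
 qed (use x base_in in \<open>auto intro!: T_bfun fbar_bfun\<close>)
 then show ?thesis by (simp add: corr_term_def c mult.commute)
qed

lemma summable_corr_bound: "summable (\<lambda>j. 2 * K * (1 - ep) ^ (j div 2))"
 using eps_pos eps_less_1 by (intro summable_mult suminf_power_div2) auto

lemma summable_corr: "x \<in> St n ==> summable (\<lambda>j. corr_term n j x)"
 by (rule summable_comparison_test'[OF summable_corr_bound, where N = 0]) (simp add: corr_term_le)

lemma corr_bound: assumes x: "x \<in> St n" shows "\<bar>corr n x\<bar> <= KA"
proof -
 have "norm (corr n x) <= (\<Sum>j. 2 * K * (1 - ep) ^ (j div 2))"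
  unfolding corr_def using x by (intro norm_suminf_le summable_corr_bound) (simp add: corr_term_le)
 also have "... = 2 * K * (\<Sum>j. (1 - ep) ^ (j div 2))"
  using eps_pos eps_less_1 by (intro suminf_mult suminf_power_div2) auto
 also have "... <= 2 * K * (2 / (1 - (1 - ep)))"
  using eps_pos eps_less_1 K_nonneg by (intro mult_left_mono suminf_power_div2) auto
 finally show ?thesis by (simp add: KA_def)
qed

lemma corr_bfun: "bfun (M n) (corr n)"
proof (rule bfunI[where B = KA])
 show "corr n \<in> borel_measurable (M n)"
  unfolding corr_def[abs_def] by (intro borel_measurable_suminf bfun_measurable corr_term_bfun)
qed (simp add: corr_bound)

lemma KA_nonneg: "0 <= KA" and KD_nonneg: "0 <= KD"
 using K_nonneg eps_pos by (auto simp: KA_def KD_def)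

text \<open>Integrating against the kernel shifts the series by one, so that exactly the term
  \<open>j = 0\<close> is lost.\<close>

lemma corr_poisson:
 assumes x: "x \<in> St n"
 shows "(LINT y|kern n x. corr (Suc n) y) = corr n x - fbar n x + cen n"
proof -
 interpret k: prob_space "kern n x" using x by (rule prob_kern)
 have int: "integrable (kern n x) (corr_term (Suc n) j)" for j
  using x by (intro integrable_kern corr_term_bfun)
 have "(LINT y|kern n x. corr (Suc n) y) = (\<Sum>j. \<integral>y. corr_term (Suc n) j y \<partial>kern n x)"
  unfolding corr_def
 proof (rule integral_suminf[OF int])
  show "AE y in kern n x. summable (\<lambda>j. norm (corr_term (Suc n) j y))"
   by (intro AE_I2 summable_comparison_test'[OF summable_corr_bound, where N = 0]) (simp add: corr_term_le)
  show "summable (\<lambda>j. \<integral>y. norm (corr_term (Suc n) j y) \<partial>kern n x)"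
  proof (rule summable_comparison_test'[OF summable_corr_bound, where N = 0])
   fix j
   have "norm (LINT y|kern n x. norm (corr_term (Suc n) j y)) <= 2 * K * (1 - ep) ^ (j div 2)"
    using K_nonneg eps_less_1 by (intro k.norm_integral_le_const) (auto simp: corr_term_le)
   then show "norm (LINT y|kern n x. norm (corr_term (Suc n) j y)) <= 2 * K * (1 - ep) ^ (j div 2)" .
  qed
 qed
 also have "... = (\<Sum>j. corr_term n (Suc j) x)"
 proof (rule arg_cong[where f = suminf], rule ext)
  fix j
  have "bfun (M (Suc n)) (PT (Suc n) j (fbar (Suc n + j)))"
   by (intro T_bfun fbar_bfun bwt_1)
  from integrable_kern[OF x this] show "(LINT y|kern n x. corr_term (Suc n) j y) = corr_term n (Suc j) x"
   using k.prob_space by (simp add: corr_term_def T1_def)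
 qed
 also have "... = corr n x - corr_term n 0 x"
  unfolding corr_def using suminf_split_head[OF summable_corr[OF x]] by simp
 finally show ?thesis by (simp add: corr_term_def)
qed

lemma mart_bfun: "bfun (MM n) (mart n)"
 unfolding mart_def case_prod_beta prod.collapse
 by (intro bfun_diff bfun_add f_bfun bfun_const bfun_compose[OF corr_bfun]) auto

lemma mart_bound: "x \<in> St n ==> y \<in> St (Suc n) ==> \<bar>mart n (x, y)\<bar> <= KD"
 using f_bound[of x n y] cen_bound[of n] corr_bound[of x n] corr_bound[of y "Suc n"]
 by (auto simp: mart_def KD_def)

lemma mart_centered:
 assumes x: "x \<in> St n"
 shows "(LINT y|kern n x. mart n (x, y)) = 0"
proof -
 interpret k: prob_space "kern n x" using x by (rule prob_kern)
 note i = integrable_kern[OF x bfun_pair1[OF f_bfun x]] integrable_kern[OF x corr_bfun]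
 show ?thesis using i k.prob_space corr_poisson[OF x] by (simp add: mart_def fbar_def)
qed

lemma f_eq_mart: "f n (x, y) = mart n (x, y) + cen n + corr n x - corr (Suc n) y"
 by (simp add: mart_def)

end

section \<open>The Markov property along a process\<close>

context chain_process
begin

abbreviation (input) XX :: "nat => 'w => 'a \<times> 'a" where "XX n om \<equiv> (X n om, X (Suc n) om)"

sublocale Om: prob_space Om by (rule prob_Om)

lemma X_space: "n >= s ==> om \<in> space Om ==> X n om \<in> St n"
 by (rule measurable_space[OF X_meas])

lemma space_F: assumes "n >= s" shows "space (F n) = space Om"
 using sub_F[OF assms] unfolding subalgebra_def by blast

lemma bfun_F_Omega: assumes "n >= s" "bfun (F n) A" shows "bfun Om A"
 using measurable_from_subalg[OF sub_F[OF assms(1)] bfun_measurable[OF assms(2)]] assms(2)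
 unfolding bfun_def space_F[OF assms(1)] by blast

lemma bfun_mono: assumes "bfun (F n) A" "s <= n" "n <= m" shows "bfun (F m) A"
 using bfun_compose[of "F n" A "\<lambda>om. om" "F m", OF assms(1) F_mono[OF assms(2,3)]] .

lemma bfun_X: assumes "s <= i" "i <= n" "bfun (M i) h" shows "bfun (F n) (\<lambda>om. h (X i om))"
 using bfun_compose[of "M i" h "X i" "F n", OF assms(3) X_F[OF assms(1,2)]] .

lemma bfun_XOm: assumes "s <= i" "bfun (M i) h" shows "bfun Om (\<lambda>om. h (X i om))"
 using bfun_compose[of "M i" h "X i" Om, OF assms(2) X_meas[OF assms(1)]] .

lemma bfun_XX:
 assumes "s <= i" "Suc i <= n" "bfun (MM i) h"
 shows "bfun (F n) (\<lambda>om. h (XX i om))"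
 using bfun_compose[of "MM i" h "\<lambda>om. (XX i om)" "F n",
   OF assms(3) measurable_Pair[OF X_F[of i n] X_F[of "Suc i" n]]] assms by simp

lemma bfun_XXOm:
 assumes "s <= i" "bfun (MM i) h"
 shows "bfun Om (\<lambda>om. h (XX i om))"
 using bfun_compose[of "MM i" h "\<lambda>om. (XX i om)" Om,
   OF assms(2) measurable_Pair[OF X_meas[of i] X_meas[of "Suc i"]]] assms by simp

lemma bfun_Om_integrable: "bfun Om A ==> integrable Om A"
 by (rule Om.bfun_integrable)

lemma markov_mult:
 fixes A :: "'w => complex" and h :: "'a \<times> 'a => complex"
 assumes n: "n >= s" and A: "bfun (F n) A" and h: "bfun (MM n) h"
 shows "(LINT om|Om. A om * h (XX n om)) = (LINT om|Om. A om * (LINT y|kern n (X n om). h (X n om, y)))"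
proof -
 have b: "bfun (F n \<Otimes>\<^sub>M M (Suc n)) (\<lambda>(om, y). A om * h (X n om, y))"
 proof -
  have "(\<lambda>z. (X n (fst z), snd z)) \<in> F n \<Otimes>\<^sub>M M (Suc n) \<rightarrow>\<^sub>M MM n"
   using measurable_compose[OF measurable_fst X_F[OF n, of n]] by (intro measurable_Pair) auto
  from bfun_mult[OF bfun_compose[OF A measurable_fst] bfun_compose[OF h this]]
  show "bfun (F n \<Otimes>\<^sub>M M (Suc n)) (\<lambda>(om, y). A om * h (X n om, y))" by (simp add: case_prod_unfold)
 qed
 show ?thesis using markov[OF n b] by simp
qed

lemma markov_real:
 fixes A :: "'w => real" and h :: "'a \<times> 'a => real"
 assumes n: "n >= s" and A: "bfun (F n) A" and h: "bfun (MM n) h"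
 shows "(LINT om|Om. A om * h (XX n om)) = (LINT om|Om. A om * (LINT y|kern n (X n om). h (X n om, y)))"
 using markov_mult[OF n bfun_of_real[OF A] bfun_of_real[OF h]]
 by (simp flip: of_real_mult)

lemma markov_1:
 fixes h :: "'a \<times> 'a => real"
 assumes n: "n >= s" and h: "bfun (MM n) h"
 shows "(LINT om|Om. h (XX n om)) = (LINT om|Om. (LINT y|kern n (X n om). h (X n om, y)))"
 using markov_real[OF n bfun_const[of _ 1] h] by simp

lemma markov_T:
 fixes A :: "'w => complex"
 assumes n: "n >= s" and A: "bfun (F n) A" and W: "bwt W" and h: "bfun (M (n + k)) h"
 shows "(LINT om|Om. A om * ((\<Prod>j<k. W (n + j) (XX (n + j) om)) * h (X (n + k) om))) = (LINT om|Om. A om * T W n k h (X n om))"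
 using h
proof (induction k arbitrary: h)
 case (Suc k)
 let ?A = "\<lambda>om. A om * (\<Prod>j<k. W (n + j) (XX (n + j) om))"
 have AF: "bfun (F (n + k)) A"
  using n by (intro bfun_mono[OF A]) auto
 have b: "bfun (F (n + k)) ?A"
  using n by (intro bfun_mult AF bfun_prod bfun_XX bwtD[OF W]) auto
 have h': "bfun (M (Suc (n + k))) h" using Suc.prems by simp
 have hw: "bfun (MM (n + k)) (\<lambda>z. W (n + k) z * h (snd z))"
  by (intro bfun_mult bwtD[OF W] bfun_compose[OF h']) auto
 have "(LINT om|Om. A om * ((\<Prod>j<Suc k. W (n + j) (XX (n + j) om)) * h (X (n + Suc k) om)))
  = (LINT om|Om. ?A om * (W (n + k) (XX (n + k) om) * h (snd (XX (n + k) om))))"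
  by (simp add: mult.assoc)
 also have "... = (LINT om|Om. ?A om * T1 W (n + k) h (X (n + k) om))"
  using markov_mult[OF _ b hw] n by (simp add: T1_def)
 also have "... = (LINT om|Om. A om * ((\<Prod>j<k. W (n + j) (XX (n + j) om)) * T1 W (n + k) h (X (n + k) om)))"
  by (simp add: mult.assoc)
 also have "... = (LINT om|Om. A om * T W n k (T1 W (n + k) h) (X n om))"
  by (rule Suc.IH) (rule T1_bfun[OF W h'])
 finally show ?case by (simp only: T_Suc_right)
qed simp

end

section \<open>Martingale differences\<close>

lemma exp_le_quadratic:
 fixes u :: real
 assumes "\<bar>u\<bar> <= 1"
 shows "exp u <= 1 + u + u\<^sup>2"
proof (cases "u >= 0")
 case True
 then show ?thesis using exp_bound[of u] assms by simp
next
 case False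
 define v where "v = - u"
 have v: "0 <= v" "v <= 1" using False assms by (auto simp: v_def)
 have "exp u = 1 / exp v" by (simp add: v_def exp_minus field_simps)
 also have "... <= 1 / (1 + v + v\<^sup>2 / 2)"
  using exp_lower_Taylor_quadratic[OF v(1)] v by (intro divide_left_mono mult_pos_pos) (auto intro: add_pos_nonneg)
 also have "... <= 1 - v + v\<^sup>2"
 proof -
  have "(1 - v + v\<^sup>2) * (1 + v + v\<^sup>2 / 2) = 1 + v\<^sup>2 / 2 + v ^ 3 / 2 + v ^ 4 / 2"
   by (simp add: field_simps power2_eq_square power3_eq_cube power4_eq_xxxx)
  then show ?thesis using v by (simp add: divide_le_eq add_pos_nonneg)
 qed
 finally show ?thesis by (simp add: v_def)
qed

lemma power_le_fact_exp:
 fixes x :: real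
 assumes "0 <= x"
 shows "x ^ k <= fact k * exp x"
proof -
 have "x ^ k / fact k <= (\<Sum>n\<le>k. x ^ n / fact n)"
  using assms by (intro member_le_sum) auto
 also have "... = (\<Sum>n\<le>k. x ^ n /\<^sub>R fact n)" by (simp add: divide_inverse mult.commute)
 also have "... <= exp x"
  unfolding exp_def using assms summable_exp_generic[of x] by (intro sum_le_suminf) auto
 finally show ?thesis by (simp add: divide_le_eq mult.commute)
qed

text \<open>Used for \<open>mart\<close> with \<open>L = KD + 1\<close>; the condition
  \<open>1 <= L\<close> makes powers of \<open>L\<close> monotone in the exponent.\<close>

locale centered_functional = elliptic_chain +
 fixes D :: "nat => 'a \<times> 'a => real" and L :: real
 assumes D_bfun: "bfun (M n \<Otimes>\<^sub>M M (Suc n)) (D n)"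
  and D_bound: "x \<in> space (M n) ==> y \<in> space (M (Suc n)) ==> \<bar>D n (x, y)\<bar> <= L"
  and D_centered: "x \<in> space (M n) ==> (LINT y|kern n x. D n (x, y)) = 0"
  and L_ge_1: "1 <= L"
begin

definition sig :: "nat => 'a => real" where "sig n x = (LINT y|kern n x. (D n (x, y))\<^sup>2)"
text \<open>The conditional variance is averaged over the reference measure instead of the law of
  the process. Up to the factors \<open>ep\<close> and \<beta> this is the true variance for every
  start, so that blocks can be cut without reference to the starting point.\<close>

definition sv :: "nat => real" where "sv n = (LINT x|M n. sig n x)"

lemma sig_bfun: "bfun (M n) (sig n)"
 unfolding sig_def[abs_def] by (rule kern_bfun) (rule bfun_power[OF D_bfun])

lemma sig_nonneg: "0 <= sig n x" unfolding sig_def by simp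

lemma D_sq_le: "x \<in> St n ==> y \<in> St (Suc n) ==> (D n (x, y))\<^sup>2 <= L\<^sup>2"
 using D_bound[of x n y] L_ge_1 by (metis abs_le_square_iff abs_of_nonneg order_trans zero_le_one)

lemma sig_le: "x \<in> St n ==> sig n x <= L\<^sup>2"
 using prob_space.norm_integral_le_const[OF prob_kern, of x n "\<lambda>y. (D n (x, y))\<^sup>2" "L\<^sup>2"] D_sq_le
 by (auto simp: sig_def)

lemma sv_nonneg: "0 <= sv n" unfolding sv_def by (intro Bochner_Integration.integral_nonneg sig_nonneg)

lemma sv_le: "sv n <= L\<^sup>2"
 using prob_space.norm_integral_le_const[OF prob_M, of n "sig n" "L\<^sup>2"] sig_le sig_nonneg
 by (auto simp: sv_def)

end

locale martingale_process = centered_functional S M p ep \<beta> D L + chain_process S M p ep \<beta> Om F X s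
 for S :: "nat => 'a metric" and M p ep \<beta> D L and Om :: "'w measure" and F X s
begin

definition Z :: "nat => 'w => real" where "Z n om = (\<Sum>j=s..<n. D j (XX j om))"

lemma Z_s [simp]: "Z s om = 0" by (simp add: Z_def)

lemma Z_Suc: "n >= s ==> Z (Suc n) om = Z n om + D n (XX n om)"
 by (simp add: Z_def)

lemma Z_bfun: "bfun (F n) (Z n)" if "n >= s"
 unfolding Z_def[abs_def] by (rule bfun_sum, rule bfun_XX[OF _ _ D_bfun]) auto

lemma Z_bfunOm: "bfun Om (Z n)"
 unfolding Z_def[abs_def] by (rule bfun_sum, rule bfun_XXOm[OF _ D_bfun]) auto

lemma markov_D: assumes "n >= s" "bfun (F n) A" shows "(LINT om|Om. A om * D n (XX n om)) = 0"
proof -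
 have "(LINT om|Om. A om * D n (XX n om)) = (LINT om|Om. A om * (LINT y|kern n (X n om). D n (X n om, y)))"
  by (rule markov_real[OF assms D_bfun])
 also have "... = (LINT om|Om. 0)"
  by (intro Bochner_Integration.integral_cong refl) (simp add: D_centered X_space assms(1))
 finally show ?thesis by simp
qed

lemma markov_D_sq: assumes "n >= s" "bfun (F n) A"
 shows "(LINT om|Om. A om * (D n (XX n om))\<^sup>2) = (LINT om|Om. A om * sig n (X n om))"
 unfolding sig_def by (rule markov_real[OF assms bfun_power[OF D_bfun]])

lemma Z_mean: "n >= s ==> (LINT om|Om. Z n om) = 0"
proof (induction n rule: dec_induct)
 case (step n)
 have "(LINT om|Om. Z (Suc n) om) = (LINT om|Om. Z n om) + (LINT om|Om. D n (XX n om))"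
  using step by (simp add: Z_Suc bfun_Om_integrable Z_bfunOm bfun_XXOm D_bfun)
 then show ?case using step markov_D[of n "\<lambda>_. 1"] by simp
qed simp

lemma Z_var: "n >= s ==> (LINT om|Om. (Z n om)\<^sup>2) = (\<Sum>j=s..<n. \<integral>om. sig j (X j om) \<partial>Om)"
proof (induction n rule: dec_induct)
 case (step n)
 have D: "bfun Om (\<lambda>om. D n (XX n om))" using step(1) by (rule bfun_XXOm[OF _ D_bfun])
 have i: "integrable Om (\<lambda>om. (Z n om)\<^sup>2)" "integrable Om (\<lambda>om. Z n om * D n (XX n om))"
  "integrable Om (\<lambda>om. (D n (XX n om))\<^sup>2)"
  by (intro bfun_Om_integrable bfun_power bfun_mult Z_bfunOm D)+
 have "(LINT om|Om. (Z (Suc n) om)\<^sup>2) = (LINT om|Om. (Z n om)\<^sup>2 + 2 * (Z n om * D n (XX n om)) + (D n (XX n om))\<^sup>2)"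
  using step by (simp add: Z_Suc power2_sum algebra_simps)
 also have "... = (LINT om|Om. (Z n om)\<^sup>2) + (LINT om|Om. (D n (XX n om))\<^sup>2)"
  using i step markov_D[OF _ Z_bfun, of n] by simp
 also have "(LINT om|Om. (D n (XX n om))\<^sup>2) = (LINT om|Om. sig n (X n om))"
  using markov_D_sq[of n "\<lambda>_. 1"] step by simp
 finally show ?case using step by simp
qed simp

text \<open>The weight \<open>A\<close> from the past is needed for exponential moments, where it is
  \<open>exp (r * Z n)\<close>.\<close>

lemma law_le:
 fixes h :: "'a => real"
 assumes n: "n >= s" and A: "bfun (F n) A" "!!om. om \<in> space Om ==> 0 <= A om"
  and h: "bfun (M (Suc n)) h" "!!x. x \<in> St (Suc n) ==> 0 <= h x"
 shows "(LINT om|Om. A om * h (X (Suc n) om)) <= \<beta> * (LINT x|M (Suc n). h x) * (LINT om|Om. A om)"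
proof -
 have h2: "bfun (MM n) (\<lambda>z. h (snd z))"
  using bfun_compose[OF h(1) measurable_snd] .
 have AOm: "bfun Om A" by (rule bfun_F_Omega[OF n A(1)])
 have "(LINT om|Om. A om * h (X (Suc n) om)) = (LINT om|Om. A om * (LINT y|kern n (X n om). h y))"
  using markov_real[OF n A(1) h2] by simp
 also have "... <= (LINT om|Om. A om * (\<beta> * (LINT x|M (Suc n). h x)))"
 proof (intro integral_mono bfun_Om_integrable bfun_mult AOm bfun_const)
  show "bfun Om (\<lambda>om. \<integral>y. h y \<partial>kern n (X n om))"
   using bfun_XOm[OF n kern_bfun[OF h2]] by simp
  fix om assume "om \<in> space Om"
  then show "A om * (LINT y|kern n (X n om). h y) <= A om * (\<beta> * (LINT x|M (Suc n). h x))"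
   using A(2) kern_le[OF X_space[OF n] h] by (intro mult_left_mono) auto
 qed
 finally show ?thesis by (simp add: mult.commute)
qed

lemma law_ge:
 fixes h :: "'a => real"
 assumes n: "n >= s + 2" and h: "bfun (M n) h" "!!x. x \<in> St n ==> 0 <= h x"
 shows "ep * (LINT x|M n. h x) <= (LINT om|Om. h (X n om))"
proof -
 define m where "m = n - 2"
 have m: "n = Suc (Suc m)" "m >= s" using n by (auto simp: m_def)
 have h': "bfun (M (Suc (Suc m))) h" using h m by simp
 have h2: "bfun (MM (Suc m)) (\<lambda>z. h (snd z))" using bfun_compose[OF h' measurable_snd] .
 have k1: "bfun (M (Suc m)) (\<lambda>x. \<integral>y. h y \<partial>kern (Suc m) x)" using kern_bfun[OF h2] by simp
 have h3: "bfun (MM m) (\<lambda>z. \<integral>y. h y \<partial>kern (Suc m) (snd z))" using bfun_compose[OF k1 measurable_snd] .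
 have k2: "bfun (M m) (\<lambda>x. \<integral>z. \<integral>y. h y \<partial>kern (Suc m) z \<partial>kern m x)" using kern_bfun[OF h3] by simp
 have "(LINT om|Om. h (X n om)) = (\<integral>om. \<integral>y. h y \<partial>kern (Suc m) (X (Suc m) om) \<partial>Om)"
  using markov_1[OF _ h2] m by simp
 also have "... = (\<integral>om. \<integral>z. \<integral>y. h y \<partial>kern (Suc m) z \<partial>kern m (X m om) \<partial>Om)"
  using markov_1[OF _ h3] m by simp
 also have "... >= (LINT om|Om. ep * (LINT x|M n. h x))"
 proof (intro integral_mono bfun_Om_integrable bfun_const)
  show "bfun Om (\<lambda>om. \<integral>z. \<integral>y. h y \<partial>kern (Suc m) z \<partial>kern m (X m om))" by (rule bfun_XOm[OF m(2) k2])
  fix om assume "om \<in> space Om"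
  then show "ep * (LINT x|M n. h x) <= (\<integral>z. \<integral>y. h y \<partial>kern (Suc m) z \<partial>kern m (X m om))"
   using kern2_ge[OF X_space[OF m(2)] h'] h m by simp
 qed
 finally show ?thesis using Om.prob_space by simp
qed

lemma E_sig_le: "j >= Suc s ==> (LINT om|Om. sig j (X j om)) <= \<beta> * sv j"
 using law_le[of "j - 1" "\<lambda>_. 1" "sig j"] sig_bfun sig_nonneg Om.prob_space by (simp add: sv_def)

lemma E_sig_ge: "j >= s + 2 ==> ep * sv j <= (LINT om|Om. sig j (X j om))"
 unfolding sv_def by (rule law_ge) (auto intro: sig_bfun sig_nonneg)

lemma E_sig_le_L: "j >= s ==> (LINT om|Om. sig j (X j om)) <= L\<^sup>2"
 using Om.norm_integral_le_const[of "\<lambda>om. sig j (X j om)" "L\<^sup>2"] sig_le sig_nonneg X_space by auto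

text \<open>The first term is bounded separately by \<open>L^2\<close>: the law of
  \<open>X s\<close> may be a point mass, which is not comparable with \<open>M s\<close>.\<close>

lemma Z_var_le: assumes "n >= s" shows "(LINT om|Om. (Z n om)\<^sup>2) <= L\<^sup>2 + \<beta> * (\<Sum>j=s..<n. sv j)"
proof (cases "n = s")
 case False
 with assms have "n > s" by simp
 then have e: "{s..<n} = insert s {Suc s..<n}" by auto
 have "(LINT om|Om. (Z n om)\<^sup>2) = (LINT om|Om. sig s (X s om)) + (\<Sum>j=Suc s..<n. \<integral>om. sig j (X j om) \<partial>Om)"
  using assms by (simp add: Z_var e)
 also have "... <= L\<^sup>2 + (\<Sum>j=Suc s..<n. \<beta> * sv j)"
  by (intro add_mono sum_mono E_sig_le_L E_sig_le) auto
 also have "(\<Sum>j=Suc s..<n. \<beta> * sv j) <= (\<Sum>j=s..<n. \<beta> * sv j)"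
  using sv_nonneg beta_nonneg by (intro sum_mono2) auto
 finally show ?thesis by (simp add: sum_distrib_left)
qed simp

text \<open>The first two terms are given up, since a lower comparison with the reference measure
  takes two steps.\<close>

lemma Z_var_ge: assumes "n >= s" shows "ep * (\<Sum>j=s+2..<n. sv j) <= (LINT om|Om. (Z n om)\<^sup>2)"
proof -
 have "ep * (\<Sum>j=s+2..<n. sv j) <= (\<Sum>j=s+2..<n. \<integral>om. sig j (X j om) \<partial>Om)"
  unfolding sum_distrib_left by (intro sum_mono E_sig_ge) auto
 also have "... <= (\<Sum>j=s..<n. \<integral>om. sig j (X j om) \<partial>Om)"
  by (intro sum_mono2) (auto intro!: Bochner_Integration.integral_nonneg sig_nonneg)
 finally show ?thesis using assms by (simp add: Z_var)
qed

lemma exp_Z_step: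
 assumes n: "n >= s" and r: "\<bar>r\<bar> * L <= 1"
 shows "(LINT om|Om. exp (r * Z (Suc n) om)) <= (LINT om|Om. exp (r * Z n om)) + r\<^sup>2 * (LINT om|Om. exp (r * Z n om) * sig n (X n om))"
proof -
 let ?D = "\<lambda>om. D n (XX n om)"
 have Y: "bfun (F n) (\<lambda>om. exp (r * Z n om))" by (intro bfun_exp bfun_mult bfun_const Z_bfun n)
 note YOm = bfun_F_Omega[OF n Y]
 have D: "bfun Om ?D" by (rule bfun_XXOm[OF n D_bfun])
 have i: "integrable Om (\<lambda>om. exp (r * Z n om))" "integrable Om (\<lambda>om. exp (r * Z n om) * ?D om)"
  "integrable Om (\<lambda>om. exp (r * Z n om) * (?D om)\<^sup>2)"
  by (intro bfun_Om_integrable bfun_mult bfun_power YOm D)+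
 have "(LINT om|Om. exp (r * Z (Suc n) om)) <= (LINT om|Om. exp (r * Z n om) + r * (exp (r * Z n om) * ?D om) + r\<^sup>2 * (exp (r * Z n om) * (?D om)\<^sup>2))"
 proof (rule integral_mono)
  show "integrable Om (\<lambda>om. exp (r * Z (Suc n) om))"
   by (intro bfun_Om_integrable bfun_exp bfun_mult bfun_const Z_bfunOm)
  show "integrable Om (\<lambda>om. exp (r * Z n om) + r * (exp (r * Z n om) * ?D om) + r\<^sup>2 * (exp (r * Z n om) * (?D om)\<^sup>2))"
   using i by simp
  fix om assume om: "om \<in> space Om"
  have "\<bar>?D om\<bar> <= L" using n om by (intro D_bound X_space) auto
  then have "\<bar>r * ?D om\<bar> <= 1" using r by (simp add: abs_mult) (meson abs_ge_zero mult_left_mono order_trans)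
  then have "exp (r * ?D om) <= 1 + r * ?D om + (r * ?D om)\<^sup>2" by (rule exp_le_quadratic)
  then have "exp (r * Z n om) * exp (r * ?D om) <= exp (r * Z n om) * (1 + r * ?D om + (r * ?D om)\<^sup>2)"
   by (intro mult_left_mono) auto
  then show "exp (r * Z (Suc n) om) <= exp (r * Z n om) + r * (exp (r * Z n om) * ?D om) + r\<^sup>2 * (exp (r * Z n om) * (?D om)\<^sup>2)"
   using n by (simp add: Z_Suc exp_add distrib_left power_mult_distrib algebra_simps)
 qed
 also have "... = (LINT om|Om. exp (r * Z n om)) + r\<^sup>2 * (LINT om|Om. exp (r * Z n om) * sig n (X n om))"
  using i markov_D[OF n Y] markov_D_sq[OF n Y] by simp
 finally show ?thesis .
qed

text \<open>Given time \<open>Suc n\<close>, the conditional variance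
  \<open>sig (Suc n) (X (Suc n) om)\<close> is already fixed; it becomes comparable with
  \<open>sv (Suc n)\<close> only when conditioning one step earlier. Removing the last increment
  from the exponential costs the factor \<open>exp 1 <= 3\<close>.\<close>

lemma exp_Z_two_step:
 assumes n: "n >= s" and r: "\<bar>r\<bar> * L <= 1"
 shows "(LINT om|Om. exp (r * Z (Suc (Suc n)) om)) <=
  (LINT om|Om. exp (r * Z (Suc n) om)) + 3 * \<beta> * r\<^sup>2 * sv (Suc n) * (LINT om|Om. exp (r * Z n om))"
proof -
 have Y: "bfun (F n) (\<lambda>om. exp (r * Z n om))" by (intro bfun_exp bfun_mult bfun_const Z_bfun n)
 have Y': "bfun Om (\<lambda>om. exp (r * Z m om))" for m by (intro bfun_exp bfun_mult bfun_const Z_bfunOm)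
 have sX: "bfun Om (\<lambda>om. sig (Suc n) (X (Suc n) om))" using n by (intro bfun_XOm sig_bfun) auto
 have "(LINT om|Om. exp (r * Z (Suc n) om) * sig (Suc n) (X (Suc n) om))
   <= (LINT om|Om. 3 * (exp (r * Z n om) * sig (Suc n) (X (Suc n) om)))"
 proof (intro integral_mono bfun_Om_integrable bfun_mult Y' sX bfun_const)
  fix om assume om: "om \<in> space Om"
  have "\<bar>D n (XX n om)\<bar> <= L" using n om by (intro D_bound X_space) auto
  then have "\<bar>r * D n (XX n om)\<bar> <= 1" using r by (simp add: abs_mult) (meson abs_ge_zero mult_left_mono order_trans)
  then have "exp (r * D n (XX n om)) <= exp 1" by simp
  also have "... <= 3" by (rule exp_le)
  finally have "exp (r * Z n om) * exp (r * D n (XX n om)) <= exp (r * Z n om) * 3"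
   by (intro mult_left_mono) auto
  then have "exp (r * Z (Suc n) om) <= 3 * exp (r * Z n om)"
   using n by (simp add: Z_Suc distrib_left exp_add)
  from mult_right_mono[OF this sig_nonneg]
  show "exp (r * Z (Suc n) om) * sig (Suc n) (X (Suc n) om) <= 3 * (exp (r * Z n om) * sig (Suc n) (X (Suc n) om))"
   by (simp add: mult.assoc)
 qed
 also have "... = 3 * (LINT om|Om. exp (r * Z n om) * sig (Suc n) (X (Suc n) om))" by simp
 also have "... <= 3 * (\<beta> * sv (Suc n) * (LINT om|Om. exp (r * Z n om)))"
  unfolding sv_def by (intro mult_left_mono law_le[OF n Y] sig_bfun sig_nonneg) auto
 finally have "r\<^sup>2 * (LINT om|Om. exp (r * Z (Suc n) om) * sig (Suc n) (X (Suc n) om))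
   <= r\<^sup>2 * (3 * (\<beta> * sv (Suc n) * (LINT om|Om. exp (r * Z n om))))"
  by (intro mult_left_mono) auto
 then show ?thesis using exp_Z_step[OF _ r, of "Suc n"] n by (simp add: algebra_simps)
qed

text \<open>The recursion reaches back two steps, so two consecutive bounds are carried through the
  induction. The factor 2 pays for the first increment, whose variance is only known to be at most
  \<open>L^2\<close>.\<close>

lemma exp_Z_le:
 assumes r: "\<bar>r\<bar> * L <= 1" and n: "n >= s"
 shows "(LINT om|Om. exp (r * Z n om)) <= 2 * exp (3 * \<beta> * r\<^sup>2 * (\<Sum>j=s..<n. sv j))"
proof -
 let ?g = "\<lambda>n. 3 * \<beta> * r\<^sup>2 * sv n" and ?y = "\<lambda>n. \<integral>om. exp (r * Z n om) \<partial>Om"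
 let ?b = "\<lambda>n. 2 * exp (3 * \<beta> * r\<^sup>2 * (\<Sum>j=s..<n. sv j))"
 have g: "0 <= ?g n" for n using sv_nonneg beta_nonneg by simp
 have bS: "?b n * (1 + ?g n) <= ?b (Suc n)" if "n >= s" for n
 proof -
  have "?b (Suc n) = ?b n * exp (?g n)" using that by (simp add: distrib_left exp_add)
  then show ?thesis using exp_ge_add_one_self[of "?g n"] by simp
 qed
 have bm: "?b n <= ?b (Suc n)" if "n >= s" for n
  using bS[OF that] g[of n] by (smt (verit) exp_gt_zero mult_left_mono mult_cancel_left1)
 have "?y n <= ?b n \<and> ?y (Suc n) <= ?b (Suc n)" using n
 proof (induction n rule: dec_induct)
  case base
  have "r\<^sup>2 * L\<^sup>2 <= 1" using r power_mono[OF r, of 2] L_ge_1 by (simp add: power_mult_distrib)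
  moreover have "r\<^sup>2 * (LINT om|Om. sig s (X s om)) <= r\<^sup>2 * L\<^sup>2"
   by (intro mult_left_mono E_sig_le_L) auto
  ultimately have "?y (Suc s) <= 2" using exp_Z_step[OF order_refl r] Om.prob_space by simp
  moreover have "?b s <= ?b (Suc s)" by (rule bm) simp
  moreover have "?b s = 2" "?y s = 1" using Om.prob_space by simp_all
  ultimately show ?case by linarith
 next
  case (step n)
  have "?y (Suc (Suc n)) <= ?y (Suc n) + ?g (Suc n) * ?y n"
   using exp_Z_two_step[OF _ r, of n] step by simp
  also have "... <= ?b (Suc n) + ?g (Suc n) * ?b (Suc n)"
  proof (intro add_mono mult_left_mono g)
   have "?y n <= ?b n" "?b n <= ?b (Suc n)" using step bm by blast+
   then show "?y n <= ?b (Suc n)" by (rule order_trans)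
  qed (use step in blast)
  also have "... = ?b (Suc n) * (1 + ?g (Suc n))" by (simp add: algebra_simps)
  also have "... <= ?b (Suc (Suc n))" using bS[of "Suc n"] step by simp
  finally show ?case using step by simp
 qed
 then show ?thesis by simp
qed

lemma exp_abs_Z_le:
 assumes n: "n >= s"
 shows "(LINT om|Om. exp (\<bar>Z n om\<bar> / L)) <= 4 * exp (3 * \<beta> * (\<Sum>j=s..<n. sv j))"
proof -
 have b: "bfun Om (\<lambda>om. exp (r * Z n om))" for r by (intro bfun_exp bfun_mult bfun_const Z_bfunOm)
 have one: "(LINT om|Om. exp (r * Z n om)) <= 2 * exp (3 * \<beta> * (\<Sum>j=s..<n. sv j))" if r: "\<bar>r\<bar> = 1 / L" for r
 proof -
  have "\<bar>r\<bar> * L <= 1" using r L_ge_1 by simp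
  from exp_Z_le[OF this n] have "(LINT om|Om. exp (r * Z n om)) <= 2 * exp (3 * \<beta> * r\<^sup>2 * (\<Sum>j=s..<n. sv j))" .
  also have "r\<^sup>2 <= 1" using r L_ge_1 by (metis abs_le_square_iff abs_one divide_le_eq_1 less_le_trans one_power2 zero_less_one)
  then have "3 * \<beta> * r\<^sup>2 * (\<Sum>j=s..<n. sv j) <= 3 * \<beta> * 1 * (\<Sum>j=s..<n. sv j)"
   using beta_nonneg sv_nonneg by (intro mult_right_mono mult_left_mono sum_nonneg) auto
  finally show ?thesis by simp
 qed
 have "(LINT om|Om. exp (\<bar>Z n om\<bar> / L)) <= (LINT om|Om. exp ((1 / L) * Z n om) + exp ((- 1 / L) * Z n om))"
  by (intro integral_mono bfun_Om_integrable bfun_add b bfun_exp bfun_divide_const bfun_abs Z_bfunOm)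
   (auto simp: abs_if add_increasing add_increasing2)
 also have "... = (LINT om|Om. exp ((1 / L) * Z n om)) + (LINT om|Om. exp ((- 1 / L) * Z n om))"
  by (intro Bochner_Integration.integral_add bfun_Om_integrable b)
 also have "... <= 4 * exp (3 * \<beta> * (\<Sum>j=s..<n. sv j))"
  using one[of "1 / L"] one[of "- 1 / L"] L_ge_1 by simp
 finally show ?thesis .
qed

lemma abs_Z_power_le:
 assumes n: "n >= s"
 shows "(LINT om|Om. \<bar>Z n om\<bar> ^ k) <= 4 * fact k * L ^ k * exp (3 * \<beta> * (\<Sum>j=s..<n. sv j))"
proof -
 have "(LINT om|Om. \<bar>Z n om\<bar> ^ k) <= (LINT om|Om. fact k * L ^ k * exp (\<bar>Z n om\<bar> / L))"
 proof (intro integral_mono bfun_Om_integrable bfun_mult bfun_const bfun_power bfun_exp bfun_divide_const bfun_abs Z_bfunOm)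
  fix om
  have "(\<bar>Z n om\<bar> / L) ^ k <= fact k * exp (\<bar>Z n om\<bar> / L)" using L_ge_1 by (intro power_le_fact_exp) auto
  then have "L ^ k * (\<bar>Z n om\<bar> / L) ^ k <= L ^ k * (fact k * exp (\<bar>Z n om\<bar> / L))" using L_ge_1 by (intro mult_left_mono) auto
  then show "\<bar>Z n om\<bar> ^ k <= fact k * L ^ k * exp (\<bar>Z n om\<bar> / L)" using L_ge_1 by (simp add: power_divide ac_simps)
 qed
 also have "... = fact k * L ^ k * (LINT om|Om. exp (\<bar>Z n om\<bar> / L))" by simp
 also have "... <= fact k * L ^ k * (4 * exp (3 * \<beta> * (\<Sum>j=s..<n. sv j)))"
  using L_ge_1 by (intro mult_left_mono exp_abs_Z_le[OF n]) auto
 finally show ?thesis by (simp add: ac_simps)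
qed

end

lemma (in prob_space) integral_sq_le:
 assumes "integrable M (\<lambda>x. (h x :: real)\<^sup>2)" "integrable M h"
 shows "(LINT x|M. h x)\<^sup>2 <= (LINT x|M. (h x)\<^sup>2)"
 using variance_positive[of h] variance_eq[OF assms(2,1)] by simp

lemma cmod_sq_sub_mean:
 fixes a b :: complex
 shows "(cmod (a - b))\<^sup>2 = (cmod a)\<^sup>2 - 2 * Re (cnj b * a) + (cmod b)\<^sup>2"
 unfolding cmod_power2 by (simp add: power2_eq_square algebra_simps)

lemma norm_iI: "norm (\<i> * of_real t * (x :: complex)) = \<bar>t\<bar> * norm x"
 by (simp add: norm_mult)

section \<open>Loss of the characteristic function over one block\<close>

context centered_functional
begin

text \<open>Constant of \<open>correlation_le\<close>: the mixing series over the increments gives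
  \<open>4 * \<beta> / ep^2\<close>, the last increment before \<open>n\<close> the summand
  1.\<close>

definition C1 :: real where "C1 = L * (1 + 4 * \<beta> / ep\<^sup>2)"

text \<open>Bounds all absolute moments of \<open>Z\<close> up to order 4 over a stretch of
  \<open>sv\<close>-mass at most \<open>A\<close>; \<open>96 = 4 * fact 4\<close>.\<close>

definition Cm :: "real => real" where "Cm A = 96 * L ^ 4 * exp (3 * \<beta> * A)"

end

context martingale_process
begin

text \<open>Seen from time \<open>Suc j\<close>, the centred \<open>q0 (X n)\<close> has shrunk
  geometrically in \<open>n - j\<close>, so its correlations with all increments sum to a bound
  independent of the length of the block. Cauchy-Schwarz would cost the standard deviation of
  \<open>Z\<close>, too much for \<open>block_contraction\<close>.\<close>

lemma correlation_le:
 fixes q0 :: "'a => complex"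
 assumes n: "n >= s + 2" and q0: "bfun (M n) q0" and mean0: "(LINT om|Om. q0 (X n om)) = 0"
 shows "norm (LINT om|Om. of_real (Z n om) * q0 (X n om)) <= C1 * (LINT om|Om. norm (q0 (X n om)))"
proof -
 define a where "a = (LINT om|Om. norm (q0 (X n om)))"
 have a0: "0 <= a" unfolding a_def by simp
 have ns: "n >= s" using n by simp
 have qX: "bfun Om (\<lambda>om. q0 (X n om))" by (rule bfun_XOm[OF ns q0])
 have Mq: "(LINT x|M n. norm (q0 x)) <= a / ep"
  using law_ge[OF n bfun_norm[OF q0]] eps_pos by (simp add: a_def field_simps)
 have summand: "norm (LINT om|Om. of_real (D j (XX j om)) * q0 (X n om))
   <= L * ((1 - ep) ^ ((n - Suc (Suc j)) div 2) * (2 * \<beta> * (a / ep)))" if j: "s <= j" "Suc j < n" for j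
 proof -
  define k where "k = n - Suc (Suc j)"
  have nk: "n = Suc j + Suc k" "n = Suc (Suc j + k)" using j by (auto simp: k_def)
  have q0': "bfun (M (Suc j + Suc k)) q0" using q0 nk by simp
  define g where "g = PT (Suc j) (Suc k) q0"
  have g: "bfun (M (Suc j)) g" unfolding g_def by (rule T_bfun[OF bwt_1 q0'])
  have sj: "s <= Suc j" using j by simp
  have A: "bfun (F (Suc j)) (\<lambda>om. cor (D j (XX j om)))"
   by (rule bfun_of_real[OF bfun_XX[OF j(1) order_refl D_bfun]])
  \<comment> \<open>One step turns the integral bound \<open>Mq\<close> into a bound at every point;
    the other \<open>k\<close> steps contract the oscillation.\<close>
  have osc: "norm (g x - g x') <= (1 - ep) ^ (k div 2) * (2 * \<beta> * (a / ep))"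
   if "x \<in> St (Suc j)" "x' \<in> St (Suc j)" for x x'
  proof -
   have q1: "bfun (M (Suc j + k + 1)) q0" using q0 nk by simp
   have b1: "norm (PT (Suc j + k) 1 q0 y) <= \<beta> * (a / ep)" if y: "y \<in> St (Suc j + k)" for y
   proof -
    have "norm (PT (Suc j + k) 1 q0 y) <= PT (Suc j + k) 1 (\<lambda>z. norm (q0 z)) y"
     by (rule T_norm_le[OF bwt_1 bwt_1 _ q1 bfun_norm[OF q1] _ y]) auto
    also have "... <= \<beta> * (\<integral>z. norm (q0 z) \<partial>M (Suc j + k + 1))"
     by (rule PT_le[OF _ bfun_norm[OF q1] _ y]) auto
    also have "... <= \<beta> * (a / ep)"
     using Mq nk beta_nonneg by (intro mult_left_mono) auto
    finally show ?thesis .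
   qed
   have "g = PT (Suc j) k (PT (Suc j + k) 1 q0)"
    unfolding g_def using T_add_steps[of "\<lambda>_ _. 1" "Suc j" k 1 q0] by simp
   moreover have "norm (PT (Suc j) k (PT (Suc j + k) 1 q0) x - PT (Suc j) k (PT (Suc j + k) 1 q0) x') <= (1 - ep) ^ (k div 2) * (2 * \<beta> * (a / ep))"
   proof (rule PT_osc_le[OF _ _ that])
    show "bfun (M (Suc j + k)) (PT (Suc j + k) 1 q0)" by (rule T_bfun[OF bwt_1 q1])
    fix y z assume "y \<in> St (Suc j + k)" "z \<in> St (Suc j + k)"
    then show "norm (PT (Suc j + k) 1 q0 y - PT (Suc j + k) 1 q0 z) <= 2 * \<beta> * (a / ep)"
     using b1[of y] b1[of z] norm_triangle_ineq4[of "PT (Suc j + k) 1 q0 y" "PT (Suc j + k) 1 q0 z"] by linarith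
   qed
   ultimately show ?thesis by simp
  qed
  have gm: "(LINT om|Om. g (X (Suc j) om)) = 0"
   using markov_T[OF sj bfun_const[of _ 1] bwt_1 q0'] mean0 nk by (simp add: g_def)
  have gX: "bfun Om (\<lambda>om. g (X (Suc j) om))" by (rule bfun_XOm[OF sj g])
  have gle: "norm (g x) <= (1 - ep) ^ (k div 2) * (2 * \<beta> * (a / ep))" if x: "x \<in> St (Suc j)" for x
  proof -
   have "g x = (LINT om|Om. g x - g (X (Suc j) om))"
    using gm bfun_Om_integrable[OF gX] Om.prob_space by simp
   also have "norm ... <= (1 - ep) ^ (k div 2) * (2 * \<beta> * (a / ep))"
    using osc[OF x] X_space[OF sj] eps_less_1 eps_pos beta_nonneg a0
    by (intro Om.norm_integral_le_const) auto
   finally show ?thesis .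
  qed
  have "(LINT om|Om. of_real (D j (XX j om)) * q0 (X n om))
    = (LINT om|Om. of_real (D j (XX j om)) * g (X (Suc j) om))"
   using markov_T[OF sj A bwt_1 q0'] nk by (simp add: g_def)
  also have "norm ... <= L * ((1 - ep) ^ (k div 2) * (2 * \<beta> * (a / ep)))"
  proof (rule Om.norm_integral_le_const)
   fix om assume om: "om \<in> space Om"
   show "norm (of_real (D j (XX j om)) * g (X (Suc j) om)) <= L * ((1 - ep) ^ (k div 2) * (2 * \<beta> * (a / ep)))"
    unfolding norm_mult using D_bound[OF X_space[OF j(1) om] X_space[OF sj om]] gle[OF X_space[OF sj om]] L_ge_1
    by (intro mult_mono) auto
  qed (use L_ge_1 eps_less_1 eps_pos beta_nonneg a0 in auto)
  finally show ?thesis by (simp add: k_def)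
 qed
 have last: "norm (LINT om|Om. of_real (D j (XX j om)) * q0 (X n om)) <= L * a" if j: "n = Suc j" for j
 proof -
  have sj: "s <= j" using j n by simp
  have "norm (LINT om|Om. of_real (D j (XX j om)) * q0 (X n om)) <= (LINT om|Om. norm (of_real (D j (XX j om)) * q0 (X n om)))"
   by (rule integral_norm_bound)
  also have "... <= (LINT om|Om. L * norm (q0 (X n om)))"
  proof (intro integral_mono bfun_Om_integrable)
   show "bfun Om (\<lambda>om. norm (of_real (D j (XX j om)) * q0 (X n om)))"
    by (rule bfun_norm[OF bfun_mult[OF bfun_of_real[OF bfun_XXOm[OF sj D_bfun]] qX]])
   show "bfun Om (\<lambda>om. L * norm (q0 (X n om)))"
    by (rule bfun_mult[OF bfun_const bfun_norm[OF qX]])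
   fix om assume om: "om \<in> space Om"
   show "norm (of_real (D j (XX j om)) * q0 (X n om)) <= L * norm (q0 (X n om))"
    unfolding norm_mult using D_bound[OF X_space[OF sj om] X_space[OF _ om, of "Suc j"]] sj
    by (intro mult_right_mono) auto
  qed
  finally show ?thesis by (simp add: a_def)
 qed
 obtain m where m: "n = Suc m" "s < m" using n by (cases n) auto
 have "norm (LINT om|Om. of_real (Z n om) * q0 (X n om))
   = norm (\<Sum>j=s..<n. \<integral>om. of_real (D j (XX j om)) * q0 (X n om) \<partial>Om)"
 proof -
  have "integrable Om (\<lambda>om. of_real (D j (XX j om)) * q0 (X n om))" if "j \<in> {s..<n}" for j
   using that by (intro bfun_Om_integrable bfun_mult[OF bfun_of_real[OF bfun_XXOm[OF _ D_bfun]] qX]) auto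
  then have "(LINT om|Om. (\<Sum>j=s..<n. of_real (D j (XX j om)) * q0 (X n om)))
    = (\<Sum>j=s..<n. \<integral>om. of_real (D j (XX j om)) * q0 (X n om) \<partial>Om)"
   by (rule Bochner_Integration.integral_sum)
  then show ?thesis by (simp add: Z_def sum_distrib_right)
 qed
 also have "... <= (\<Sum>j=s..<n. norm (LINT om|Om. of_real (D j (XX j om)) * q0 (X n om)))"
  by (rule norm_sum)
 also have "... = (\<Sum>j=s..<m. norm (LINT om|Om. of_real (D j (XX j om)) * q0 (X n om)))
   + norm (LINT om|Om. of_real (D m (XX m om)) * q0 (X n om))"
  using m by simp
 also have "... <= (\<Sum>j=s..<m. L * ((1 - ep) ^ ((n - Suc (Suc j)) div 2) * (2 * \<beta> * (a / ep)))) + L * a"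
  using m by (intro add_mono sum_mono summand last) auto
 also have "(\<Sum>j=s..<m. L * ((1 - ep) ^ ((n - Suc (Suc j)) div 2) * (2 * \<beta> * (a / ep))))
   = L * (2 * \<beta> * (a / ep)) * (\<Sum>j=s..<m. (1 - ep) ^ ((m - Suc j) div 2))"
  by (simp add: m(1) sum_distrib_left ac_simps)
 also have "(\<Sum>j=s..<m. (1 - ep) ^ ((m - Suc j) div 2)) = (\<Sum>i<m - s. (1 - ep) ^ (i div 2))"
  using m by (intro sum.reindex_bij_witness[where i = "\<lambda>i. m - Suc i" and j = "\<lambda>j. m - Suc j"]) auto
 also have "L * (2 * \<beta> * (a / ep)) * ... <= L * (2 * \<beta> * (a / ep)) * (2 / (1 - (1 - ep)))"
  using L_ge_1 beta_nonneg a0 eps_pos eps_less_1 by (intro mult_left_mono suminf_power_div2) auto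
 also have "L * (2 * \<beta> * (a / ep)) * (2 / (1 - (1 - ep))) + L * a = C1 * a"
  using eps_pos by (simp add: C1_def field_simps power2_eq_square)
 finally show ?thesis by (simp add: a_def)
qed

text \<open>The scalar core of \<open>block_contraction\<close>; \<open>B\<close> is the variance of
  \<open>q\<close>. Either \<open>q\<close> varies, and then its mean \<open>qm\<close> is small, or
  the characteristic function \<phi> loses about \<open>t^2 * V / 2\<close>. The cross term with
  \<open>c\<close> is split by the inequality of means: a part \<open>a^2 / 8\<close> is paid by
  \<open>B\<close>, a part \<open>2 * c^2 * t^2\<close> by the lower bound on
  \<open>V\<close>.\<close>

lemma block_contraction_aux:
 fixes t B V a C c :: real
 assumes B: "0 <= B" "B <= 1" and a: "a\<^sup>2 <= B" "0 <= a" and c: "0 <= c"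
  and V: "16 * c\<^sup>2 + 16 <= V" "V <= C" and t: "\<bar>t\<bar> * C <= 1"
  and qm: "0 <= qm" "qm\<^sup>2 <= 1 - B"
  and \<phi>: "\<phi> <= 1 - t\<^sup>2 * V / 2 + \<bar>t\<bar> ^ 3 * C / 6" "0 <= \<phi>"
  and r: "r <= \<bar>t\<bar> * (c * a) + (t ^ 4 * C / 2 + B / 8)"
 shows "qm * \<phi> + r <= 1 - t\<^sup>2"
proof -
 have C: "C >= 16" using V by (smt (verit) zero_le_power2)
 have t1: "\<bar>t\<bar> <= 1" using t C mult_left_mono[of 1 C "\<bar>t\<bar>"] by simp
 have t2: "t\<^sup>2 * C <= 1"
 proof -
  have "t\<^sup>2 * C = \<bar>t\<bar> * (\<bar>t\<bar> * C)" by (simp add: power2_eq_square)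
  also have "... <= \<bar>t\<bar> * 1" using t by (intro mult_left_mono) auto
  finally show ?thesis using t1 by simp
 qed
 have t3: "\<bar>t\<bar> ^ 3 * C <= t\<^sup>2"
 proof -
  have "\<bar>t\<bar> ^ 3 * C = t\<^sup>2 * (\<bar>t\<bar> * C)" by (simp add: power3_eq_cube power2_eq_square)
  also have "... <= t\<^sup>2 * 1" using t by (intro mult_left_mono) auto
  finally show ?thesis by simp
 qed
 have t4: "t ^ 4 * C <= t\<^sup>2"
 proof -
  have "t ^ 4 * C = t\<^sup>2 * (t\<^sup>2 * C)" by (simp add: power4_eq_xxxx power2_eq_square)
  also have "... <= t\<^sup>2 * 1" using t2 by (intro mult_left_mono) auto
  finally show ?thesis by simp
 qed
 define w where "w = t\<^sup>2 * V / 4"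
 have V16: "V >= 16" using V(1) by (smt (verit) zero_le_power2)
 have w: "0 <= w" "w <= 1"
 proof -
  show "0 <= w" using V16 by (simp add: w_def)
  have "t\<^sup>2 * V <= t\<^sup>2 * C" using V by (intro mult_left_mono) auto
  then show "w <= 1" using t2 by (simp add: w_def)
 qed
 have "t\<^sup>2 * 16 <= t\<^sup>2 * V" using V16 by (intro mult_left_mono) auto
 then have \<phi>w: "\<phi> <= 1 - w" using \<phi>(1) t3 zero_le_power2[of t] unfolding w_def by linarith
 have "1 - B <= (1 - B / 2)\<^sup>2" by (simp add: power2_eq_square algebra_simps)
 then have "qm <= 1 - B / 2" using qm B by (intro power2_le_imp_le[of qm "1 - B / 2"]) linarith+
 then have "qm * \<phi> <= (1 - B / 2) * (1 - w)"
  using qm \<phi> \<phi>w B w by (intro mult_mono) auto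
 also have "... <= 1 - B / 4 - w / 2"
 proof -
  define u where "u = B / 2"
  have "u * w <= u" "u * w <= w"
   using B w mult_left_le[of w u] mult_left_le_one_le[of w u] by (simp_all add: u_def)
  moreover have "(1 - u) * (1 - w) = 1 - w - u + u * w" by (simp add: algebra_simps)
  ultimately have "(1 - u) * (1 - w) <= 1 - u / 2 - w / 2" by linarith
  then show ?thesis by (simp add: u_def)
 qed
 finally have q: "qm * \<phi> <= 1 - B / 4 - w / 2" .
 have "\<bar>t\<bar> * (c * a) <= a\<^sup>2 / 8 + 2 * c\<^sup>2 * t\<^sup>2"
 proof -
  have "0 <= (a / 2 - 2 * c * \<bar>t\<bar>)\<^sup>2" by simp
  also have "... = a\<^sup>2 / 4 - 2 * (\<bar>t\<bar> * (c * a)) + 4 * c\<^sup>2 * t\<^sup>2"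
   by (simp add: power2_eq_square algebra_simps abs_mult_self_eq)
  finally show ?thesis by simp
 qed
 moreover have "(16 * c\<^sup>2 + 16) * t\<^sup>2 <= V * t\<^sup>2" using V by (intro mult_right_mono) auto
 then have "2 * c\<^sup>2 * t\<^sup>2 + 2 * t\<^sup>2 <= w / 2" by (simp add: w_def algebra_simps)
 ultimately show ?thesis using q r a t4 B zero_le_power2[of t] by linarith
qed

lemma moment_le:
 assumes n: "n >= s" and k: "k <= 4" and A: "(\<Sum>j=s..<n. sv j) <= A"
 shows "(LINT om|Om. \<bar>Z n om\<bar> ^ k) <= Cm A"
proof -
 have "(LINT om|Om. \<bar>Z n om\<bar> ^ k) <= 4 * fact k * L ^ k * exp (3 * \<beta> * (\<Sum>j=s..<n. sv j))"
  by (rule abs_Z_power_le[OF n])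
 also have "... <= 4 * fact 4 * L ^ 4 * exp (3 * \<beta> * A)"
  using L_ge_1 k A beta_nonneg
  by (intro mult_mono power_increasing fact_mono) (auto intro!: mult_left_mono mult_nonneg_nonneg)
 finally show ?thesis by (simp add: Cm_def fact_numeral)
qed

text \<open>Split \<open>q\<close> into its mean and a centred part \<open>q0\<close>. The mean
  multiplies the characteristic function of \<open>Z\<close>, expanded to second order. Against
  \<open>q0\<close> the constant term vanishes, the linear term is \<open>correlation_le\<close>,
  and the remainder is controlled by fourth moments.\<close>

lemma block_contraction:
 fixes q :: "'a => complex"
 assumes n: "n >= s + 2" and q: "bfun (M n) q" "!!x. x \<in> St n ==> norm (q x) <= 1"
  and big: "16 * C1\<^sup>2 + 16 <= ep * (\<Sum>j=s+2..<n. sv j)" and A: "(\<Sum>j=s..<n. sv j) <= A"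
  and t: "\<bar>t\<bar> * Cm A <= 1"
 shows "norm (LINT om|Om. exp (\<i> * of_real (t * Z n om)) * q (X n om)) <= 1 - t\<^sup>2"
proof -
 have ns: "n >= s" using n by simp
 define qm where "qm = (LINT om|Om. q (X n om))"
 define q0 where "q0 x = q x - qm" for x
 have q0: "bfun (M n) q0" unfolding q0_def[abs_def] by (rule bfun_diff[OF q(1) bfun_const])
 have qX: "bfun Om (\<lambda>om. q (X n om))" by (rule bfun_XOm[OF ns q(1)])
 have q0X: "bfun Om (\<lambda>om. q0 (X n om))" by (rule bfun_XOm[OF ns q0])
 have mean0: "(LINT om|Om. q0 (X n om)) = 0"
  using bfun_Om_integrable[OF qX] Om.prob_space by (simp add: q0_def qm_def)
 define a where "a = (LINT om|Om. norm (q0 (X n om)))"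
 define B where "B = (LINT om|Om. (norm (q0 (X n om)))\<^sup>2)"
 have nB: "bfun Om (\<lambda>om. norm (q0 (X n om)))" "bfun Om (\<lambda>om. (norm (q0 (X n om)))\<^sup>2)"
  by (rule bfun_norm[OF q0X], rule bfun_power[OF bfun_norm[OF q0X]])
 have aB: "a\<^sup>2 <= B" unfolding a_def B_def
  by (rule Om.integral_sq_le[OF bfun_Om_integrable[OF nB(2)] bfun_Om_integrable[OF nB(1)]])
 have a0: "0 <= a" and B0: "0 <= B" unfolding a_def B_def by simp_all
 have Bq: "B <= 1 - (norm qm)\<^sup>2"
 proof -
  have i: "integrable Om (\<lambda>om. (norm (q (X n om)))\<^sup>2)" "integrable Om (\<lambda>om. cnj qm * q (X n om))"
   by (rule bfun_Om_integrable[OF bfun_power[OF bfun_norm[OF qX]]],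
     rule bfun_Om_integrable[OF bfun_mult[OF bfun_const qX]])
  have "B = (LINT om|Om. (norm (q (X n om)))\<^sup>2 - 2 * Re (cnj qm * q (X n om)) + (norm qm)\<^sup>2)"
   unfolding B_def q0_def by (simp only: cmod_sq_sub_mean)
  also have "... = (LINT om|Om. (norm (q (X n om)))\<^sup>2) - 2 * Re (cnj qm * qm) + (norm qm)\<^sup>2"
   using i integrable_Re[OF i(2)] integral_Re[OF i(2)] Om.prob_space by (simp add: qm_def del: times_complex.sel)
  also have "Re (cnj qm * qm) = (norm qm)\<^sup>2"
   unfolding cmod_power2 by (simp add: power2_eq_square)
  finally have "B = (LINT om|Om. (norm (q (X n om)))\<^sup>2) - (norm qm)\<^sup>2" by simp
  moreover have "norm (LINT om|Om. (norm (q (X n om)))\<^sup>2) <= 1"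
   using q(2) X_space[OF ns] by (intro Om.norm_integral_le_const) (auto simp: power_le_one)
  ultimately show ?thesis by simp
 qed
 have qm1: "(norm qm)\<^sup>2 <= 1 - B" using Bq by simp
 have B1: "B <= 1" using Bq zero_le_power2[of "norm qm"] by linarith
 let ?e = "\<lambda>om. exp (\<i> * of_real (t * Z n om))"
 have eb: "bfun Om ?e" by (intro bfun_exp bfun_mult[OF bfun_const] bfun_of_real Z_bfunOm)
 have V: "(LINT om|Om. (Z n om)\<^sup>2) >= 16 * C1\<^sup>2 + 16" using Z_var_ge[OF ns] big by linarith
 have VC: "(LINT om|Om. (Z n om)\<^sup>2) <= Cm A" using moment_le[OF ns _ A, of 2] by simp
 have \<phi>: "norm (LINT om|Om. ?e om) <= 1 - t\<^sup>2 * (LINT om|Om. (Z n om)\<^sup>2) / 2 + \<bar>t\<bar> ^ 3 * Cm A / 6"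
 proof -
  define V where "V = (LINT om|Om. (Z n om)\<^sup>2)"
  have i: "integrable Om (\<lambda>om. cor (Z n om))" "integrable Om (\<lambda>om. cor ((Z n om)\<^sup>2))"
   "integrable Om (\<lambda>om. \<bar>Z n om\<bar> ^ 3)"
   by (rule bfun_Om_integrable[OF bfun_of_real[OF Z_bfunOm]], rule bfun_Om_integrable[OF bfun_of_real[OF bfun_power[OF Z_bfunOm]]],
    rule bfun_Om_integrable[OF bfun_power[OF bfun_abs[OF Z_bfunOm]]])
  have "(LINT om|Om. ?e om - (1 + \<i> * t * of_real (Z n om) - of_real (t\<^sup>2 / 2) * of_real ((Z n om)\<^sup>2)))
   = (LINT om|Om. ?e om) - (1 + \<i> * t * of_real (LINT om|Om. Z n om) - of_real (t\<^sup>2 / 2) * of_real V)"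
   using i bfun_Om_integrable[OF eb] Om.prob_space
   by (simp add: V_def del: of_real_power flip: integral_complex_of_real)
  also have "... = (LINT om|Om. ?e om) - of_real (1 - t\<^sup>2 * V / 2)"
   by (simp add: Z_mean[OF ns])
  finally have e1: "(LINT om|Om. ?e om) - of_real (1 - t\<^sup>2 * V / 2)
   = (LINT om|Om. ?e om - (1 + \<i> * t * of_real (Z n om) - of_real (t\<^sup>2 / 2) * of_real ((Z n om)\<^sup>2)))" by simp
  have "norm ... <= (LINT om|Om. norm (?e om - (1 + \<i> * t * of_real (Z n om) - of_real (t\<^sup>2 / 2) * of_real ((Z n om)\<^sup>2))))"
   by (rule integral_norm_bound)
  also have "... <= (LINT om|Om. \<bar>t\<bar> ^ 3 / 6 * \<bar>Z n om\<bar> ^ 3)"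
  proof (rule integral_mono)
   show "integrable Om (\<lambda>om. norm (?e om - (1 + \<i> * t * of_real (Z n om) - of_real (t\<^sup>2 / 2) * of_real ((Z n om)\<^sup>2))))"
    using i(1,2) bfun_Om_integrable[OF eb] by (intro integrable_norm Bochner_Integration.integrable_diff Bochner_Integration.integrable_add integrable_mult_right Om.integrable_const)
   show "integrable Om (\<lambda>om. \<bar>t\<bar> ^ 3 / 6 * \<bar>Z n om\<bar> ^ 3)" using i(3) by simp
   fix om
   have "cmod (iexp (t * Z n om) - (\<Sum>k\<le>2. (\<i> * of_real (t * Z n om)) ^ k / fact k)) <= \<bar>t * Z n om\<bar> ^ Suc 2 / fact (Suc 2)"
    by (rule iexp_approx1)
   also have "(\<Sum>k\<le>2. (\<i> * of_real (t * Z n om)) ^ k / fact k) = 1 + \<i> * t * of_real (Z n om) - of_real (t\<^sup>2 / 2) * of_real ((Z n om)\<^sup>2)"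
    by (simp add: numeral_2_eq_2 power_mult_distrib power2_eq_square mult.assoc)
   also have "\<bar>t * Z n om\<bar> ^ Suc 2 / fact (Suc 2) = \<bar>t\<bar> ^ 3 / 6 * \<bar>Z n om\<bar> ^ 3"
   proof -
    have e: "Suc 2 = 3" by simp
    show ?thesis unfolding e abs_mult power_mult_distrib by (simp add: fact_numeral)
   qed
   finally show "norm (?e om - (1 + \<i> * t * of_real (Z n om) - of_real (t\<^sup>2 / 2) * of_real ((Z n om)\<^sup>2))) <= \<bar>t\<bar> ^ 3 / 6 * \<bar>Z n om\<bar> ^ 3" .
  qed
  also have "... = \<bar>t\<bar> ^ 3 / 6 * (LINT om|Om. \<bar>Z n om\<bar> ^ 3)" by simp
  also have "... <= \<bar>t\<bar> ^ 3 / 6 * Cm A" by (intro mult_left_mono moment_le[OF ns _ A]) auto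
  finally have "norm ((LINT om|Om. ?e om) - of_real (1 - t\<^sup>2 * V / 2)) <= \<bar>t\<bar> ^ 3 * Cm A / 6" using e1 by simp
  moreover have "norm (cor (1 - t\<^sup>2 * V / 2)) = 1 - t\<^sup>2 * V / 2"
  proof -
   have Cm1: "1 <= Cm A" using V VC by (smt (verit) zero_le_power2)
   have t1: "\<bar>t\<bar> <= 1" using t Cm1 mult_left_mono[of 1 "Cm A" "\<bar>t\<bar>"] by simp
   have "t\<^sup>2 * V <= t\<^sup>2 * Cm A" using VC by (intro mult_left_mono) (auto simp: V_def)
   also have "... = \<bar>t\<bar> * (\<bar>t\<bar> * Cm A)" by (simp add: power2_eq_square)
   also have "... <= 1 * 1" using t t1 Cm1 by (intro mult_mono) auto
   finally have "0 <= 1 - t\<^sup>2 * V / 2" by simp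
   then show ?thesis by (simp only: norm_of_real abs_of_nonneg)
  qed
  ultimately show ?thesis
   using norm_triangle_sub[of "\<integral>om. ?e om \<partial>Om" "of_real (1 - t\<^sup>2 * V / 2)"] by (simp add: V_def)
 qed
 have r: "norm (LINT om|Om. ?e om * q0 (X n om)) <= \<bar>t\<bar> * (C1 * a) + (t ^ 4 * Cm A / 2 + B / 8)"
 proof -
  have i: "integrable Om (\<lambda>om. ?e om * q0 (X n om))" "integrable Om (\<lambda>om. q0 (X n om))" "integrable Om (\<lambda>om. of_real (Z n om) * q0 (X n om))"
   by (rule bfun_Om_integrable[OF bfun_mult[OF eb q0X]], rule bfun_Om_integrable[OF q0X],
     rule bfun_Om_integrable[OF bfun_mult[OF bfun_of_real[OF Z_bfunOm] q0X]])
  have i4: "integrable Om (\<lambda>om. t ^ 4 / 2 * \<bar>Z n om\<bar> ^ 4 + (norm (q0 (X n om)))\<^sup>2 / 8)"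
   by (rule bfun_Om_integrable[OF bfun_add[OF bfun_mult[OF bfun_const bfun_power[OF bfun_abs[OF Z_bfunOm]]] bfun_divide_const[OF nB(2)]]])
  have "(LINT om|Om. ?e om * q0 (X n om)) = (LINT om|Om. ?e om * q0 (X n om) - q0 (X n om) - \<i> * t * (of_real (Z n om) * q0 (X n om)))
    + \<i> * t * (LINT om|Om. of_real (Z n om) * q0 (X n om))"
   using i mean0 by simp
  then have r1: "norm (LINT om|Om. ?e om * q0 (X n om)) <= norm (LINT om|Om. ?e om * q0 (X n om) - q0 (X n om) - \<i> * t * (of_real (Z n om) * q0 (X n om)))
    + norm (\<i> * t * (LINT om|Om. of_real (Z n om) * q0 (X n om)))" by (simp only: norm_triangle_ineq)
  have r2: "norm (\<i> * t * (LINT om|Om. of_real (Z n om) * q0 (X n om))) <= \<bar>t\<bar> * (C1 * a)"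
   unfolding norm_iI using correlation_le[OF n q0 mean0] unfolding a_def by (rule mult_left_mono) simp
  have "norm (LINT om|Om. ?e om * q0 (X n om) - q0 (X n om) - \<i> * t * (of_real (Z n om) * q0 (X n om)))
    <= (LINT om|Om. norm (?e om * q0 (X n om) - q0 (X n om) - \<i> * t * (of_real (Z n om) * q0 (X n om))))"
   by (rule integral_norm_bound)
  also have "... <= (LINT om|Om. t ^ 4 / 2 * \<bar>Z n om\<bar> ^ 4 + (norm (q0 (X n om)))\<^sup>2 / 8)"
  proof (rule integral_mono[OF _ i4])
   show "integrable Om (\<lambda>om. norm (?e om * q0 (X n om) - q0 (X n om) - \<i> * t * (of_real (Z n om) * q0 (X n om))))"
    using i by simp
   fix om
   let ?u = "t * Z n om" and ?q = "norm (q0 (X n om))"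
   have "?e om * q0 (X n om) - q0 (X n om) - \<i> * t * (of_real (Z n om) * q0 (X n om)) = (iexp ?u - (\<Sum>k\<le>1. (\<i> * of_real ?u) ^ k / fact k)) * q0 (X n om)"
    by (simp add: algebra_simps)
   also have "norm ... <= (\<bar>?u\<bar> ^ Suc 1 / fact (Suc 1)) * ?q"
    unfolding norm_mult by (intro mult_right_mono iexp_approx1) auto
   also have "... = ?u\<^sup>2 / 2 * ?q" by (simp add: power2_eq_square abs_mult_self_eq)
   \<comment> \<open>The weights are chosen so that only \<open>B / 8\<close> is charged to the
     variance of \<open>q\<close>: the cross term uses another eighth, and \<open>B / 4\<close> is
     all that the mean can pay.\<close>
   also have "... <= ?u ^ 4 / 2 + ?q\<^sup>2 / 8"
   proof -
    have "0 <= (2 * ?u\<^sup>2 - ?q)\<^sup>2" by simp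
    also have "... = 4 * ?u ^ 4 - 4 * (?u\<^sup>2 * ?q) + ?q\<^sup>2"
     by (simp add: power4_eq_xxxx power2_eq_square algebra_simps)
    finally show ?thesis by simp
   qed
   finally show "norm (?e om * q0 (X n om) - q0 (X n om) - \<i> * t * (of_real (Z n om) * q0 (X n om))) <= t ^ 4 / 2 * \<bar>Z n om\<bar> ^ 4 + ?q\<^sup>2 / 8"
    by (simp add: power_mult_distrib)
  qed
  also have "... = t ^ 4 / 2 * (LINT om|Om. \<bar>Z n om\<bar> ^ 4) + B / 8"
   using bfun_Om_integrable[OF bfun_power[OF bfun_abs[OF Z_bfunOm]], of n 4] bfun_Om_integrable[OF nB(2)] by (simp add: B_def)
  also have "... <= t ^ 4 / 2 * Cm A + B / 8"
   by (intro add_right_mono mult_left_mono moment_le[OF ns _ A]) auto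
  finally show ?thesis using r1 r2 by simp
 qed
 have "(LINT om|Om. ?e om * q (X n om)) = (LINT om|Om. qm * ?e om + ?e om * q0 (X n om))"
  by (simp add: q0_def algebra_simps)
 also have "... = qm * (LINT om|Om. ?e om) + (LINT om|Om. ?e om * q0 (X n om))"
  using bfun_Om_integrable[OF eb] bfun_Om_integrable[OF bfun_mult[OF eb q0X]] by simp
 also have "norm ... <= norm qm * norm (LINT om|Om. ?e om) + norm (LINT om|Om. ?e om * q0 (X n om))"
  by (rule order_trans[OF norm_triangle_ineq]) (simp only: norm_mult order_refl)
 also have "... <= 1 - t\<^sup>2"
 proof (rule block_contraction_aux[OF B0 B1 aB a0 _ V VC t _ qm1 \<phi> _ r])
  show "0 <= C1" using L_ge_1 beta_nonneg by (simp add: C1_def)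
 qed auto
 finally show ?thesis .
qed

end

section \<open>Decay of products at two frequencies\<close>

text \<open>For \<open>norm u <= 1\<close> one has \<open>norm (1 - u)^2 <= 2 * (1 - Re u)\<close>,
  which turns the cross term of \<open>1 - z * w\<close> into the individual losses.\<close>

lemma Re_mult_loss:
 fixes z w :: complex
 assumes "norm z <= 1" "norm w <= 1"
 shows "1 - Re (z * w) <= 2 * (1 - Re z) + 2 * (1 - Re w)"
proof -
 define a b where "a = 1 - z" and "b = 1 - w"
 have sq: "(norm (1 - u))\<^sup>2 <= 2 * (1 - Re u)" if "norm u <= 1" for u :: complex
 proof -
  have "(norm (1 - u))\<^sup>2 = 1 - 2 * Re u + (norm u)\<^sup>2"
   using cmod_sq_sub_mean[of 1 u] by (simp add: norm_minus_commute)
  moreover have "(norm u)\<^sup>2 <= 1" using that by (simp add: power_le_one)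
  ultimately show ?thesis by simp
 qed
 have "1 - Re (z * w) = Re a + Re b - Re (a * b)" by (simp add: a_def b_def algebra_simps)
 also have "... <= Re a + Re b + norm a * norm b"
  using complex_Re_le_cmod[of "- (a * b)"] by (simp add: norm_mult)
 also have "norm a * norm b <= ((norm a)\<^sup>2 + (norm b)\<^sup>2) / 2"
  using sum_squares_bound[of "norm a" "norm b"] by simp
 finally have main: "1 - Re (z * w) <= Re a + Re b + ((norm a)\<^sup>2 + (norm b)\<^sup>2) / 2" by simp
 have arith: "1 - r <= 2 * (1 - x) + 2 * (1 - y)"
  if "1 - r <= p + q + (na + nb) / 2" "p = 1 - x" "q = 1 - y" "na <= 2 * (1 - x)" "nb <= 2 * (1 - y)"
  for r x y p q na nb :: real
  using that by argo
 show ?thesis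
  by (rule arith[OF main _ _ sq[OF assms(1), folded a_def] sq[OF assms(2), folded b_def]]) (simp_all add: a_def b_def)
qed

context elliptic_chain
begin

text \<open>Weights that differ by constants and a multiplicative coboundary have the same products
  up to boundary factors. This removes correctors and changes centerings.\<close>

lemma T_gauge:
 fixes W W' :: "nat => 'a \<times> 'a => complex"
 assumes "!!n x y. x \<in> St n ==> y \<in> St (Suc n) ==> W' n (x, y) * g (Suc n) y = c n * g n x * W n (x, y)"
  and "x \<in> St n"
 shows "T W' n k (\<lambda>z. g (n + k) z * h z) x = (\<Prod>j<k. c (n + j)) * g n x * T W n k h x"
 using assms(2)
proof (induction k arbitrary: n x)
 case (Suc k)
 have "T W' n (Suc k) (\<lambda>z. g (n + Suc k) z * h z) x = T1 W' n (\<lambda>y. (\<Prod>j<k. c (Suc n + j)) * g (Suc n) y * T W (Suc n) k h y) x"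
  using Suc.IH[of _ "Suc n"] Suc.prems by (auto intro!: T1_cong)
 also have "... = (LINT y|kern n x. ((\<Prod>j<k. c (Suc n + j)) * c n * g n x) * (W n (x, y) * T W (Suc n) k h y))"
  unfolding T1_def
 proof (rule Bochner_Integration.integral_cong[OF refl])
  fix y assume "y \<in> space (kern n x)"
  then have "W' n (x, y) * g (Suc n) y = c n * g n x * W n (x, y)" using assms(1) Suc.prems by simp
  show "W' n (x, y) * ((\<Prod>j<k. c (Suc n + j)) * g (Suc n) y * T W (Suc n) k h y)
   = ((\<Prod>j<k. c (Suc n + j)) * c n * g n x) * (W n (x, y) * T W (Suc n) k h y)"
   using \<open>W' n (x, y) * g (Suc n) y = c n * g n x * W n (x, y)\<close> by algebra
 qed
 also have "... = (\<Prod>j<Suc k. c (n + j)) * g n x * T W n (Suc k) h x"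
  by (simp add: T1_def prod.lessThan_Suc_shift mult.commute del: prod.lessThan_Suc)
 finally show ?case .
qed simp

lemma T_eq_process:
 fixes h :: "'a => complex" and Om :: "'w measure"
 assumes pr: "chain_process S M p ep \<beta> Om F X n" and init: "distr Om (M n) (X n) = return (M n) x"
  and W: "bwt W" and h: "bfun (M (n + k)) h" and x: "x \<in> St n"
 shows "(LINT om|Om. (\<Prod>j<k. W (n + j) (X (n + j) om, X (Suc (n + j)) om)) * h (X (n + k) om)) = T W n k h x"
proof -
 interpret chain_process S M p ep \<beta> Om F X n by (rule pr)
 note b = T_bfun[OF W h]
 have "(LINT om|Om. (\<Prod>j<k. W (n + j) (X (n + j) om, X (Suc (n + j)) om)) * h (X (n + k) om)) = (LINT om|Om. T W n k h (X n om))"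
  using markov_T[OF order_refl bfun_const[of _ 1] W h] by simp
 also have "... = (LINT z|distr Om (M n) (X n). T W n k h z)"
  using X_meas[of n] b by (intro integral_distr[symmetric]) (auto simp: bfun_def)
 also have "... = T W n k h x"
  unfolding init using b x by (intro integral_return) (auto simp: bfun_def)
 finally show ?thesis .
qed

lemma bwt_iexp: "(!!n. bfun (MM n) (f n)) ==> bwt (\<lambda>n xy. exp (c * cor (f n xy)))"
 unfolding bwt_def by (intro allI bfun_exp bfun_mult[OF bfun_const] bfun_of_real)

end

context centered_functional
begin

lemma T_iexp_D_le:
 fixes q :: "'a => complex"
 assumes k: "k >= 2" and x: "x \<in> St n"
  and q: "bfun (M (n + k)) q" "!!z. z \<in> St (n + k) ==> norm (q z) <= 1"
  and big: "16 * C1\<^sup>2 + 16 <= ep * (\<Sum>j=n+2..<n+k. sv j)" and A: "(\<Sum>j=n..<n+k. sv j) <= A"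
  and t: "\<bar>t\<bar> * Cm A <= 1"
 shows "norm (T (\<lambda>n xy. exp (\<i> * t * cor (D n xy))) n k q x) <= 1 - t\<^sup>2"
proof -
 obtain Om :: "(nat => 'a) measure" and F X where
  pr: "chain_process S M p ep \<beta> Om F X n" and init: "distr Om (M n) (X n) = return (M n) x"
  using chain_proc_exists[OF x] by blast
 interpret chain_process S M p ep \<beta> Om F X n by (rule pr)
 interpret martingale_process S M p ep \<beta> D L Om F X n by unfold_locales
 have W: "bwt (\<lambda>n xy. exp (\<i> * t * cor (D n xy)))" by (rule bwt_iexp[OF D_bfun])
 have "(\<Prod>j<k. exp (\<i> * t * cor (D (n + j) (X (n + j) om, X (Suc (n + j)) om)))) = exp (\<i> * of_real (t * Z (n + k) om))" for om
 proof -
  have "Z (n + k) om = (\<Sum>j<k. D (n + j) (X (n + j) om, X (Suc (n + j)) om))"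
   unfolding Z_def by (rule sum.reindex_bij_witness[where i = "\<lambda>j. n + j" and j = "\<lambda>j. j - n"]) auto
  then show ?thesis by (simp add: exp_sum[symmetric] sum_distrib_left mult.assoc)
 qed
 then have "T (\<lambda>n xy. exp (\<i> * t * cor (D n xy))) n k q x = (LINT om|Om. exp (\<i> * of_real (t * Z (n + k) om)) * q (X (n + k) om))"
  using T_eq_process[OF pr init W q(1) x] by simp
 then show ?thesis using block_contraction[OF _ q big A t] k by simp
qed

end

sublocale bounded_functional \<subseteq> MC: centered_functional S M p ep \<beta> mart "KD + 1"
proof
 fix n x y assume "x \<in> space (M n)" "y \<in> space (M (Suc n))"
 then show "\<bar>mart n (x, y)\<bar> <= KD + 1" using mart_bound[of x n y] by simp
qed (use mart_bfun mart_centered KD_nonneg in auto)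

context bounded_functional
begin

abbreviation Wf :: "complex => nat => 'a \<times> 'a => complex" where
 "Wf w \<equiv> \<lambda>n xy. exp (w * cor (f n xy))"

lemma Wf_bwt: "bwt (Wf w)" by (rule bwt_iexp[OF f_bfun])

text \<open>The corrector enters through the unimodular gauge \<open>g\<close>; its value at the end
  of the block is absorbed into the arbitrary terminal function.\<close>

lemma T_iexp_f_le:
 fixes q :: "'a => complex"
 assumes k: "k >= 2" and x: "x \<in> St n"
  and q: "bfun (M (n + k)) q" "!!z. z \<in> St (n + k) ==> norm (q z) <= 1"
  and big: "16 * MC.C1\<^sup>2 + 16 <= ep * (\<Sum>j=n+2..<n+k. MC.sv j)" and A: "(\<Sum>j=n..<n+k. MC.sv j) <= A"
  and t: "\<bar>t\<bar> * MC.Cm A <= 1"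
 shows "norm (T (Wf (\<i> * t)) n k q x) <= 1 - t\<^sup>2"
proof -
 define g where "g n x = exp (\<i> * t * cor (corr n x))" for n x
 define c where "c n = exp (\<i> * t * cor (cen n))" for n
 have ng: "norm (g n x) = 1" for n x by (simp add: g_def)
 have nc: "norm (c n) = 1" for n by (simp add: c_def)
 define q' where "q' z = cnj (g (n + k) z) * q z" for z
 have gg: "g n z * cnj (g n z) = 1" for n z
  using complex_norm_square[of "g n z"] ng[of n z] by simp
 have q': "bfun (M (n + k)) q'"
  unfolding q'_def[abs_def] g_def[abs_def] by (intro bfun_mult bfun_cnj bfun_exp bfun_mult[OF bfun_const] bfun_of_real corr_bfun q(1))
 have "T (Wf (\<i> * t)) n k q x = T (Wf (\<i> * t)) n k (\<lambda>z. g (n + k) z * q' z) x"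
  by (simp add: q'_def gg flip: mult.assoc)
 also have "... = (\<Prod>j<k. c (n + j)) * g n x * T (\<lambda>n xy. exp (\<i> * t * cor (mart n xy))) n k q' x"
 proof (rule T_gauge[OF _ x])
  fix n x y
  show "Wf (\<i> * t) n (x, y) * g (Suc n) y = c n * g n x * exp (\<i> * t * cor (mart n (x, y)))"
   by (simp add: f_eq_mart g_def c_def flip: exp_add) (simp add: algebra_simps)
 qed
 also have "norm ... = norm (T (\<lambda>n xy. exp (\<i> * t * cor (mart n xy))) n k q' x)"
  by (simp add: norm_mult ng nc prod_norm[symmetric])
 also have "... <= 1 - t\<^sup>2"
  using q(2) by (intro MC.T_iexp_D_le[OF k x q' _ big A t]) (simp add: q'_def norm_mult ng)
 finally show ?thesis .
qed

text \<open>The integrand at \<open>ta\<close> times the conjugate of the one at \<open>ta'\<close>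
  is the integrand at the difference, whose loss is known from \<open>T_iexp_f_le\<close>. By
  \<open>Re_mult_loss\<close> the two factors must bear at least half of that loss between
  them.\<close>

lemma pair_loss:
 fixes v v' :: "'a => complex"
 assumes k: "k >= 2" and x: "x \<in> St n"
  and v: "bfun (M (n + k)) v" "!!z. z \<in> St (n + k) ==> norm (v z) <= 1"
  and v': "bfun (M (n + k)) v'" "!!z. z \<in> St (n + k) ==> norm (v' z) <= 1"
  and big: "16 * MC.C1\<^sup>2 + 16 <= ep * (\<Sum>j=n+2..<n+k. MC.sv j)" and A: "(\<Sum>j=n..<n+k. MC.sv j) <= A"
  and t: "\<bar>ta - ta'\<bar> * MC.Cm A <= 1"
 shows "(ta - ta')\<^sup>2 / 2 <= (1 - norm (T (Wf (\<i> * ta)) n k v x)) + (1 - norm (T (Wf (\<i> * ta')) n k v' x))"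
proof -
 obtain Om :: "(nat => 'a) measure" and F X where
  pr: "chain_process S M p ep \<beta> Om F X n" and init: "distr Om (M n) (X n) = return (M n) x"
  using chain_proc_exists[OF x] by blast
 interpret chain_process S M p ep \<beta> Om F X n by (rule pr)
 define t where "t = ta - ta'"
 define z where "z = T (Wf (\<i> * ta)) n k v x"
 define z' where "z' = T (Wf (\<i> * ta')) n k v' x"
 define E where "E ta om = (\<Prod>j<k. Wf (\<i> * of_real ta) (n + j) (X (n + j) om, X (Suc (n + j)) om))" for ta om
 have nE: "norm (E ta om) = 1" for ta om by (simp add: E_def prod_norm[symmetric])
 have EE: "E ta om * cnj (E ta' om) = E t om" for om
  unfolding E_def t_def cnj_prod prod.distrib[symmetric]
  by (intro prod.cong refl) (simp add: exp_cnj algebra_simps flip: exp_add)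
 have bE: "bfun Om (E ta)" for ta
  unfolding E_def[abs_def] by (intro bfun_prod bfun_XXOm bwtD[OF Wf_bwt]) simp
 have bv: "bfun Om (\<lambda>om. v (X (n + k) om))" and bv': "bfun Om (\<lambda>om. v' (X (n + k) om))"
  by (rule bfun_XOm[OF _ v(1)], simp, rule bfun_XOm[OF _ v'(1)], simp)
 define A where "A om = E ta om * v (X (n + k) om)" for om
 define B where "B om = E ta' om * v' (X (n + k) om)" for om
 have bA: "bfun Om A" and bB: "bfun Om B" unfolding A_def[abs_def] B_def[abs_def] by (intro bfun_mult bE bv bv')+
 have zA: "(LINT om|Om. A om) = z" and zB: "(LINT om|Om. B om) = z'"
  using T_eq_process[OF pr init Wf_bwt v(1) x] T_eq_process[OF pr init Wf_bwt v'(1) x]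
  by (simp_all add: A_def B_def E_def z_def z'_def)
 have zAB: "(LINT om|Om. A om * cnj (B om)) = T (Wf (\<i> * t)) n k (\<lambda>y. v y * cnj (v' y)) x"
 proof -
  have "A om * cnj (B om) = E t om * (v (X (n + k) om) * cnj (v' (X (n + k) om)))" for om
   unfolding EE[symmetric] by (simp add: A_def B_def)
  then show ?thesis
   using T_eq_process[OF pr init Wf_bwt bfun_mult[OF v(1) bfun_cnj[OF v'(1)]] x, of "\<i> * t"] by (simp add: E_def)
 qed
 have nAB: "norm (LINT om|Om. A om * cnj (B om)) <= 1 - t\<^sup>2"
  unfolding zAB using v v'
  by (intro T_iexp_f_le[OF k x _ _ big A]) (auto simp: t_def t norm_mult mult_le_one intro!: bfun_mult bfun_cnj)
 have X': "om \<in> space Om ==> X (n + k) om \<in> St (n + k)" for om by (rule X_space) simp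
 have nA: "norm (A om) <= 1" "norm (B om) <= 1" if "om \<in> space Om" for om
  using v(2)[OF X'[OF that]] v'(2)[OF X'[OF that]] by (simp_all add: A_def B_def norm_mult nE)
 have phase: "\<exists>u :: complex. norm u = 1 \<and> u * z = norm z" for z :: complex
 proof (cases "z = 0")
  case False
  then show ?thesis
   by (intro exI[of _ "cnj z / norm z"])
    (simp add: norm_divide complex_norm_square[symmetric] power2_eq_square mult.commute)
 qed (auto intro: exI[of _ 1])
 \<comment> \<open>The rotations make both integrals real and nonnegative, so that
   \<open>1 - Re\<close> measures the loss of norm.\<close>
 obtain u where u: "norm u = 1" "u * z = norm z" using phase by blast
 obtain u' where u': "norm u' = 1" "u' * z' = norm z'" using phase by blast
 have i: "integrable Om (\<lambda>om. (u * A om) * cnj (u' * B om))" "integrable Om (\<lambda>om. u * A om)" "integrable Om (\<lambda>om. u' * B om)"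
  "integrable Om A" "integrable Om B" "integrable Om (\<lambda>om. A om * cnj (B om))"
  by (rule bfun_Om_integrable; intro bfun_mult bfun_const bfun_cnj bA bB)+
 have "(LINT om|Om. 1 - Re ((u * A om) * cnj (u' * B om))) <= (LINT om|Om. 2 * (1 - Re (u * A om)) + 2 * (1 - Re (u' * B om)))"
 proof (rule integral_mono)
  show "integrable Om (\<lambda>om. 1 - Re ((u * A om) * cnj (u' * B om)))"
   by (rule Bochner_Integration.integrable_diff[OF Om.integrable_const integrable_Re[OF i(1)]])
  show "integrable Om (\<lambda>om. 2 * (1 - Re (u * A om)) + 2 * (1 - Re (u' * B om)))"
   by (intro Bochner_Integration.integrable_add integrable_mult_right Bochner_Integration.integrable_diff Om.integrable_const integrable_Re i)
  fix om assume "om \<in> space Om"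
  then show "1 - Re ((u * A om) * cnj (u' * B om)) <= 2 * (1 - Re (u * A om)) + 2 * (1 - Re (u' * B om))"
   using Re_mult_loss[of "u * A om" "cnj (u' * B om)"] nA u u' by (simp add: norm_mult del: times_complex.sel complex_cnj_mult)
 qed
 also have "... = 2 * (1 - Re (LINT om|Om. u * A om)) + 2 * (1 - Re (LINT om|Om. u' * B om))"
 proof -
  have "(LINT om|Om. 2 * (1 - Re (u * A om)) + 2 * (1 - Re (u' * B om))) = (LINT om|Om. 4 - 2 * Re (u * A om) - 2 * Re (u' * B om))"
   by (simp add: algebra_simps del: times_complex.sel)
  also have "... = 4 - 2 * Re (LINT om|Om. u * A om) - 2 * Re (LINT om|Om. u' * B om)"
   using integrable_Re[OF i(2)] integrable_Re[OF i(3)] i Om.prob_space by (simp del: times_complex.sel)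
  finally show ?thesis by simp
 qed
 also have "... = 2 * (1 - norm z) + 2 * (1 - norm z')"
  using u u' by (simp add: zA zB del: times_complex.sel)
 finally have "(LINT om|Om. 1 - Re ((u * A om) * cnj (u' * B om))) <= 2 * (1 - norm z) + 2 * (1 - norm z')" .
 moreover have "(LINT om|Om. 1 - Re ((u * A om) * cnj (u' * B om))) = 1 - Re ((u * cnj u') * (LINT om|Om. A om * cnj (B om)))"
 proof -
  have "(LINT om|Om. 1 - Re ((u * A om) * cnj (u' * B om))) = 1 - Re (LINT om|Om. (u * A om) * cnj (u' * B om))"
   using integrable_Re[OF i(1)] i(1) Om.prob_space by (simp del: times_complex.sel complex_cnj_mult)
  also have "(LINT om|Om. (u * A om) * cnj (u' * B om)) = (LINT om|Om. (u * cnj u') * (A om * cnj (B om)))"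
   by (rule arg_cong[where f = "integral\<^sup>L Om"]) (simp add: fun_eq_iff)
  also have "... = (u * cnj u') * (LINT om|Om. A om * cnj (B om))" by simp
  finally show ?thesis .
 qed
 moreover have "Re ((u * cnj u') * (LINT om|Om. A om * cnj (B om))) <= 1 - t\<^sup>2"
  using complex_Re_le_cmod[of "(u * cnj u') * (LINT om|Om. A om * cnj (B om))"] nAB u u' by (simp add: norm_mult del: times_complex.sel)
 ultimately show ?thesis unfolding z_def z'_def t_def by simp
qed

text \<open>The minorisation converts an average loss under \<open>M (n + 2)\<close> into a loss
  from every single point.\<close>

lemma two_step_loss:
 fixes W :: "nat => 'a \<times> 'a => complex"
 assumes W: "bwt W" "!!n x y. x \<in> St n ==> y \<in> St (Suc n) ==> norm (W n (x, y)) <= 1"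
  and g: "bfun (M (n + 2)) g" "!!y. y \<in> St (n + 2) ==> norm (g y) <= 1" and x: "x \<in> St n"
 shows "norm (T W n 2 g x) <= 1 - ep * (\<integral>y. 1 - norm (g y) \<partial>M (n + 2))"
proof -
 have b: "bfun (M (n + 2)) (\<lambda>y. norm (g y))" by (rule bfun_norm[OF g(1)])
 have "norm (T W n 2 g x) <= PT n 2 (\<lambda>y. norm (g y)) x"
  using T_norm_le[OF W(1) bwt_1 W(2) g(1) b order_refl x] by simp
 moreover have b1: "bfun (M (n + 2)) (\<lambda>y. 1 - norm (g y))" by (rule bfun_diff[OF bfun_const b])
 have nn: "0 <= 1 - norm (g y)" if "y \<in> St (n + 2)" for y using g(2)[OF that] by simp
 have "ep * (\<integral>y. 1 - norm (g y) \<partial>M (n + 2)) <= PT n 2 (\<lambda>y. 1 - norm (g y)) x"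
  by (rule PT_ge[OF order_refl b1 nn x])
 moreover have "PT n 2 (\<lambda>y. 1 - norm (g y)) x = 1 - PT n 2 (\<lambda>y. norm (g y)) x"
  using T_diff[of "\<lambda>_ _. 1 :: real" n 2 "\<lambda>_. 1" "\<lambda>y. norm (g y)" x, OF bwt_1 bfun_const b x] T_one_const[OF x, of 2 "1::real"] by simp
 ultimately show ?thesis by linarith
qed

lemma Wf_norm_le_1: "norm (T (Wf (\<i> * cor ta)) n k v x) <= c"
 if "x \<in> St n" "bfun (M (n + k)) v" "!!z. z \<in> St (n + k) ==> norm (v z) <= c"
 using that by (intro T_norm_le_1 Wf_bwt) auto

text \<open>\<open>pair_loss\<close> concerns a common starting point. Averaging it over
  \<open>M (n + 2)\<close> and stepping back twice decouples the starting points of the two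
  frequencies.\<close>

lemma pair_step:
 fixes v v' :: "'a => complex"
 assumes k: "k >= 2" and x: "x \<in> St n" "x' \<in> St n"
  and v: "bfun (M (n + 2 + k)) v" "!!z. z \<in> St (n + 2 + k) ==> norm (v z) <= 1"
  and v': "bfun (M (n + 2 + k)) v'" "!!z. z \<in> St (n + 2 + k) ==> norm (v' z) <= 1"
  and big: "16 * MC.C1\<^sup>2 + 16 <= ep * (\<Sum>j=n+2+2..<n+2+k. MC.sv j)" and A: "(\<Sum>j=n+2..<n+2+k. MC.sv j) <= A"
  and t: "\<bar>ta - ta'\<bar> * MC.Cm A <= 1"
 shows "norm (T (Wf (\<i> * ta)) n (2 + k) v x) * norm (T (Wf (\<i> * ta')) n (2 + k) v' x') <= exp (- ep * (ta - ta')\<^sup>2 / 2)"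
proof -
 define g where "g = T (Wf (\<i> * ta)) (n + 2) k v"
 define g' where "g' = T (Wf (\<i> * ta')) (n + 2) k v'"
 have g: "bfun (M (n + 2)) g" and g': "bfun (M (n + 2)) g'"
  unfolding g_def g'_def by (intro T_bfun Wf_bwt v v')+
 have ng: "norm (g y) <= 1" "norm (g' y) <= 1" if "y \<in> St (n + 2)" for y
  unfolding g_def g'_def using v v' that by (intro Wf_norm_le_1; auto)+
 define \<eta> where "\<eta> = (\<integral>y. 1 - norm (g y) \<partial>M (n + 2))"
 define \<eta>' where "\<eta>' = (\<integral>y. 1 - norm (g' y) \<partial>M (n + 2))"
 interpret N: prob_space "M (n + 2)" by (rule prob_M)
 have i: "integrable (M (n + 2)) (\<lambda>y. 1 - norm (g y))" "integrable (M (n + 2)) (\<lambda>y. 1 - norm (g' y))"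
  by (rule N.bfun_integrable, intro bfun_diff bfun_const bfun_norm g g')+
 have "(\<integral>y. (ta - ta')\<^sup>2 / 2 \<partial>M (n + 2)) <= (\<integral>y. (1 - norm (g y)) + (1 - norm (g' y)) \<partial>M (n + 2))"
  using pair_loss[OF k _ v v' big A t] unfolding g_def[symmetric] g'_def[symmetric]
  by (intro integral_mono Bochner_Integration.integrable_add i N.integrable_const) auto
 also have "... = \<eta> + \<eta>'" unfolding \<eta>_def \<eta>'_def by (rule Bochner_Integration.integral_add[OF i])
 finally have \<eta>\<eta>: "(ta - ta')\<^sup>2 / 2 <= \<eta> + \<eta>'" using N.prob_space by simp
 have "norm (T (Wf (\<i> * ta)) n (2 + k) v x) <= 1 - ep * \<eta>"
  unfolding T_add_steps g_def[symmetric] \<eta>_def by (intro two_step_loss Wf_bwt g ng x) auto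
 also have "... <= exp (- (ep * \<eta>))" using exp_ge_add_one_self[of "- (ep * \<eta>)"] by simp
 finally have 1: "norm (T (Wf (\<i> * ta)) n (2 + k) v x) <= exp (- (ep * \<eta>))" .
 have "norm (T (Wf (\<i> * ta')) n (2 + k) v' x') <= 1 - ep * \<eta>'"
  unfolding T_add_steps g'_def[symmetric] \<eta>'_def by (intro two_step_loss Wf_bwt g' ng x) auto
 also have "... <= exp (- (ep * \<eta>'))" using exp_ge_add_one_self[of "- (ep * \<eta>')"] by simp
 finally have 2: "norm (T (Wf (\<i> * ta')) n (2 + k) v' x') <= exp (- (ep * \<eta>'))" .
 have "norm (T (Wf (\<i> * ta)) n (2 + k) v x) * norm (T (Wf (\<i> * ta')) n (2 + k) v' x') <= exp (- (ep * \<eta>)) * exp (- (ep * \<eta>'))"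
  using 1 2 by (intro mult_mono) auto
 also have "... = exp (- ep * (\<eta> + \<eta>'))" by (simp add: exp_add[symmetric] algebra_simps)
 also have "... <= exp (- ep * (ta - ta')\<^sup>2 / 2)"
 proof -
  have "ep * ((ta - ta')\<^sup>2 / 2) <= ep * (\<eta> + \<eta>')" using \<eta>\<eta> eps_pos by (intro mult_left_mono) auto
  then show ?thesis by simp
 qed
 finally show ?thesis .
qed

text \<open>The mass that the contraction needs, plus at most \<open>(KD + 1)^2\<close> for each of
  five steps: two for decoupling, two that \<open>Z_var_ge\<close> gives up, one by which a minimal
  block overshoots.\<close>

definition blk :: real where "blk = (16 * MC.C1\<^sup>2 + 16) / ep + 5 * (KD + 1)\<^sup>2"

lemma blk_pos: "0 < blk"
 unfolding blk_def using eps_pos by (intro add_pos_nonneg divide_pos_pos add_nonneg_pos) auto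

text \<open>In the induction only the product of the two norms is under control. As \<open>z\<close>
  and \<open>z'\<close> vary independently, the product of the suprema is at most \<open>e\<close>,
  and dividing by the suprema reduces to \<open>pair_step\<close>.\<close>

lemma pair_step_scaled:
 fixes v v' :: "'a => complex"
 assumes k: "k >= 2" and x: "x \<in> St n" "x' \<in> St n"
  and v: "bfun (M (n + 2 + k)) v" and v': "bfun (M (n + 2 + k)) v'"
  and vv: "!!z z'. z \<in> St (n + 2 + k) ==> z' \<in> St (n + 2 + k) ==> norm (v z) * norm (v' z') <= e"
  and big: "16 * MC.C1\<^sup>2 + 16 <= ep * (\<Sum>j=n+2+2..<n+2+k. MC.sv j)" and A: "(\<Sum>j=n+2..<n+2+k. MC.sv j) <= A"
  and t: "\<bar>ta - ta'\<bar> * MC.Cm A <= 1"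
 shows "norm (T (Wf (\<i> * ta)) n (2 + k) v x) * norm (T (Wf (\<i> * ta')) n (2 + k) v' x') <= exp (- ep * (ta - ta')\<^sup>2 / 2) * e"
proof -
 let ?N = "M (n + 2 + k)"
 define a where "a = (SUP z\<in>space ?N. norm (v z))"
 define b where "b = (SUP z\<in>space ?N. norm (v' z))"
 have bdd: "bdd_above ((\<lambda>z. norm (v z)) ` space ?N)" "bdd_above ((\<lambda>z. norm (v' z)) ` space ?N)"
 proof -
  obtain B where "!!z. z \<in> space ?N ==> norm (v z) <= B" using v by (elim bfunE) blast
  then show "bdd_above ((\<lambda>z. norm (v z)) ` space ?N)" by (rule bdd_aboveI2)
  obtain B' where "!!z. z \<in> space ?N ==> norm (v' z) <= B'" using v' by (elim bfunE) blast
  then show "bdd_above ((\<lambda>z. norm (v' z)) ` space ?N)" by (rule bdd_aboveI2)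
 qed
 have va: "norm (v z) <= a" and vb: "norm (v' z) <= b" if "z \<in> space ?N" for z
  unfolding a_def b_def by (rule cSUP_upper[OF that bdd(1)], rule cSUP_upper[OF that bdd(2)])
 obtain z0 where z0: "z0 \<in> space ?N" using space_nonempty by blast
 have a0: "0 <= a" "0 <= b" by (rule order_trans[OF norm_ge_zero va[OF z0]], rule order_trans[OF norm_ge_zero vb[OF z0]])
 have e0: "0 <= e" by (rule order_trans[OF mult_nonneg_nonneg[OF norm_ge_zero norm_ge_zero] vv[OF z0 z0]])
 have ab: "a * b <= e"
 proof -
  have 1: "a * norm (v' z') <= e" if z': "z' \<in> space ?N" for z'
  proof (cases "norm (v' z') = 0")
   case False
   then have p: "norm (v' z') > 0" by simp
   have "a <= e / norm (v' z')"
    unfolding a_def using vv[OF _ z'] z0 p by (intro cSUP_least) (auto simp: field_simps)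
   then show ?thesis using p by (simp add: field_simps)
  qed (use e0 in simp)
  show ?thesis
  proof (cases "a = 0")
   case False
   then have p: "a > 0" using a0 by simp
   have "b <= e / a"
    unfolding b_def using 1 z0 p by (intro cSUP_least) (auto simp: field_simps)
   then show ?thesis using p by (simp add: field_simps)
  qed (use e0 in simp)
 qed
 show ?thesis
 proof (cases "a = 0 \<or> b = 0")
  case True
  have "norm (T (Wf (\<i> * ta)) n (2 + k) v x) <= a"
   using va v x by (intro Wf_norm_le_1) (auto simp: add.assoc)
  moreover have "norm (T (Wf (\<i> * ta')) n (2 + k) v' x') <= b"
   using vb v' x by (intro Wf_norm_le_1) (auto simp: add.assoc)
  ultimately have "norm (T (Wf (\<i> * ta)) n (2 + k) v x) * norm (T (Wf (\<i> * ta')) n (2 + k) v' x') <= a * b"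
   using a0 by (intro mult_mono) auto
  also have "... = 0" using True by auto
  also have "... <= exp (- ep * (ta - ta')\<^sup>2 / 2) * e" using e0 by simp
  finally show ?thesis .
 next
  case False
  then have p: "a > 0" "b > 0" using a0 by auto
  define u where "u z = of_real (inverse a) * v z" for z
  define u' where "u' z = of_real (inverse b) * v' z" for z
  have u: "bfun ?N u" "bfun ?N u'" unfolding u_def[abs_def] u'_def[abs_def] by (intro bfun_mult bfun_const v v')+
  have nu: "norm (u z) <= 1" "norm (u' z) <= 1" if "z \<in> space ?N" for z
  proof -
   have "norm (u z) = norm (v z) / a" "norm (u' z) = norm (v' z) / b"
    using p by (simp_all add: u_def u'_def norm_mult norm_inverse divide_inverse mult.commute)
   then show "norm (u z) <= 1" "norm (u' z) <= 1" using va[OF that] vb[OF that] p by simp_all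
  qed
  have v1: "bfun (M (n + (2 + k))) v" "bfun (M (n + (2 + k))) v'" using v v' by (simp_all add: add.assoc)
  have "norm (T (Wf (\<i> * ta)) n (2 + k) u x) * norm (T (Wf (\<i> * ta')) n (2 + k) u' x') <= exp (- ep * (ta - ta')\<^sup>2 / 2)"
   by (rule pair_step[OF k x u(1) nu(1) u(2) nu(2) big A t])
  moreover have "norm (T (Wf (\<i> * ta)) n (2 + k) u x) = inverse a * norm (T (Wf (\<i> * ta)) n (2 + k) v x)"
   unfolding u_def[abs_def] T_cmult[OF Wf_bwt v1(1) x(1)] norm_mult norm_of_real using p by (simp del: T.simps)
  moreover have "norm (T (Wf (\<i> * ta')) n (2 + k) u' x') = inverse b * norm (T (Wf (\<i> * ta')) n (2 + k) v' x')"
   unfolding u'_def[abs_def] T_cmult[OF Wf_bwt v1(2) x(2)] norm_mult norm_of_real using p by (simp del: T.simps)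
  ultimately have "(inverse a * norm (T (Wf (\<i> * ta)) n (2 + k) v x)) * (inverse b * norm (T (Wf (\<i> * ta')) n (2 + k) v' x')) <= exp (- ep * (ta - ta')\<^sup>2 / 2)"
   by (simp only:)
  then have "norm (T (Wf (\<i> * ta)) n (2 + k) v x) * norm (T (Wf (\<i> * ta')) n (2 + k) v' x') <= exp (- ep * (ta - ta')\<^sup>2 / 2) * (a * b)"
   using p by (simp add: field_simps del: T.simps)
  also have "... <= exp (- ep * (ta - ta')\<^sup>2 / 2) * e" using ab by (intro mult_left_mono) auto
  finally show ?thesis .
 qed
qed

text \<open>Greedy cutting from the left: each contracting block uses up mass at most
  \<open>blk\<close>. The \<open>- 1\<close> accounts for the last stretch, too short to
  contract.\<close>

theorem pair_decay:
 fixes v v' :: "'a => complex"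
 assumes t: "\<bar>ta - ta'\<bar> * MC.Cm blk <= 1"
  and x: "x \<in> St n" "x' \<in> St n"
  and v: "bfun (M (n + d)) v" "!!z. z \<in> St (n + d) ==> norm (v z) <= 1"
  and v': "bfun (M (n + d)) v'" "!!z. z \<in> St (n + d) ==> norm (v' z) <= 1"
 shows "norm (T (Wf (\<i> * ta)) n d v x) * norm (T (Wf (\<i> * ta')) n d v' x')
  <= exp (- (ep * (ta - ta')\<^sup>2 / 2) * ((\<Sum>j=n..<n+d. MC.sv j) / blk - 1))"
 using x v v'
proof (induction d arbitrary: n x x' v v' rule: less_induct)
 case (less d)
 let ?c = "ep * (ta - ta')\<^sup>2 / 2" and ?L2 = "(KD + 1)\<^sup>2"
 let ?A0 = "(16 * MC.C1\<^sup>2 + 16) / ep"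
 have c0: "0 <= ?c" using eps_pos by simp
 have A0: "0 < ?A0" using eps_pos by (intro divide_pos_pos add_nonneg_pos) auto
 have L2: "0 <= ?L2" by simp
 have sub: "(\<Sum>j=a..<a+b. MC.sv j) <= b * ?L2" for a b
 proof -
  have "(\<Sum>j=a..<a+b. MC.sv j) <= (\<Sum>j=a..<a+b. ?L2)" by (intro sum_mono MC.sv_le)
  then show ?thesis by simp
 qed
 let ?big = "\<lambda>k. ?A0 <= (\<Sum>j=n+2+2..<n+2+k. MC.sv j)"
 show ?case
 proof (cases "d >= 2 \<and> ?big (d - 2)")
  case False
  have "(\<Sum>j=n..<n+d. MC.sv j) <= blk"
  proof (cases "d <= 4")
   case True
   have "(\<Sum>j=n..<n+d. MC.sv j) <= d * ?L2" by (rule sub)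
   also have "... <= 5 * ?L2" using True by (intro mult_right_mono) auto
   finally show ?thesis using A0 unfolding blk_def by linarith
  next
   case F: False
   then have "n + 2 + (d - 2) = n + d" by simp
   then have "(\<Sum>j=n+4..<n+d. MC.sv j) < ?A0" using False F by (simp add: eval_nat_numeral)
   moreover have "(\<Sum>j=n..<n+d. MC.sv j) = (\<Sum>j=n..<n+4. MC.sv j) + (\<Sum>j=n+4..<n+d. MC.sv j)"
    using F by (intro sum.atLeastLessThan_concat[symmetric]) auto
   moreover have "(\<Sum>j=n..<n+4. MC.sv j) <= 4 * ?L2" using sub[of n 4] by simp
   ultimately show ?thesis using L2 unfolding blk_def by linarith
  qed
  then have "(\<Sum>j=n..<n+d. MC.sv j) / blk - 1 <= 0" using blk_pos by simp
  then have "0 <= - ?c * ((\<Sum>j=n..<n+d. MC.sv j) / blk - 1)" using c0 by (simp add: mult_nonneg_nonpos)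
  then have a1: "1 <= exp (- ?c * ((\<Sum>j=n..<n+d. MC.sv j) / blk - 1))" by simp
  have "norm (T (Wf (\<i> * ta)) n d v x) * norm (T (Wf (\<i> * ta')) n d v' x') <= 1 * 1"
   using less.prems by (intro mult_mono Wf_norm_le_1) auto
  then show ?thesis using a1 unfolding mult_1 by (rule order_trans)
 next
  case True
  \<comment> \<open>Minimality bounds the mass of the block from above, as the moment constant
    \<open>Cm blk\<close> requires.\<close>
  define k where "k = (LEAST k. ?big k)"
  have bd: "?big (d - 2)" using True by (rule conjunct2)
  have bigk: "?big k" unfolding k_def by (rule LeastI[of ?big, OF bd])
  have kd: "k <= d - 2" unfolding k_def by (rule Least_le[of ?big, OF bd])
  have k2: "k > 2"
  proof (rule ccontr)
   assume "\<not> k > 2"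
   then have "{n+2+2..<n+2+k} = {}" by auto
   then have "(\<Sum>j=n+2+2..<n+2+k. MC.sv j) = 0" by (simp only: sum.empty)
   then show False using bigk A0 by linarith
  qed
  then obtain k' where k': "k = Suc k'" "k' >= 2" by (cases k) auto
  have "\<not> ?big k'" by (rule not_less_Least[of k' ?big, folded k_def]) (simp add: k')
  then have up: "(\<Sum>j=n+2+2..<n+2+k'. MC.sv j) < ?A0" by (simp only: not_le)
  have e1: "(\<Sum>j=n+2..<n+2+k. MC.sv j) = (\<Sum>j=n+2..<n+2+2. MC.sv j) + ((\<Sum>j=n+2+2..<n+2+k'. MC.sv j) + MC.sv (n+2+k'))"
  proof -
   have "(\<Sum>j=n+2..<n+2+k. MC.sv j) = (\<Sum>j=n+2..<n+2+2. MC.sv j) + (\<Sum>j=n+2+2..<n+2+k. MC.sv j)"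
    using k' by (intro sum.atLeastLessThan_concat[symmetric]) auto
   moreover have "(\<Sum>j=n+2+2..<n+2+k. MC.sv j) = (\<Sum>j=n+2+2..<n+2+k'. MC.sv j) + MC.sv (n+2+k')"
    using k' by simp
   ultimately show ?thesis by simp
  qed
  have A3: "(\<Sum>j=n+2..<n+2+k. MC.sv j) <= ?A0 + 3 * ?L2"
  proof -
   have "(\<Sum>j=n+2..<n+2+2. MC.sv j) <= 2 * ?L2" using sub[of "n+2" 2] by simp
   then show ?thesis unfolding e1 using up MC.sv_le[of "n+2+k'"] by linarith
  qed
  have A: "(\<Sum>j=n+2..<n+2+k. MC.sv j) <= blk" using A3 L2 unfolding blk_def by linarith
  have big': "16 * MC.C1\<^sup>2 + 16 <= ep * (\<Sum>j=n+2+2..<n+2+k. MC.sv j)"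
   using bigk eps_pos by (simp add: field_simps)
  define m where "m = n + 2 + k"
  define d' where "d' = d - (2 + k)"
  have d: "d = (2 + k) + d'" "d' < d" using kd True by (auto simp: d'_def)
  have md: "m + d' = n + d" using d by (simp add: m_def)
  have nm: "n + (2 + k) = m" by (simp add: m_def)
  let ?e = "exp (- ?c * ((\<Sum>j=m..<m+d'. MC.sv j) / blk - 1))"
  have bv: "bfun (M (m + d')) v" "bfun (M (m + d')) v'" using less.prems md by simp_all
  have IH: "norm (T (Wf (\<i> * ta)) m d' v z) * norm (T (Wf (\<i> * ta')) m d' v' z') <= ?e"
   if "z \<in> St m" "z' \<in> St m" for z z'
   using less.prems md by (intro less.IH[OF d(2) that bv(1) _ bv(2)]) auto
  have "norm (T (Wf (\<i> * ta)) n d v x) * norm (T (Wf (\<i> * ta')) n d v' x')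
   = norm (T (Wf (\<i> * ta)) n (2 + k) (T (Wf (\<i> * ta)) m d' v) x) * norm (T (Wf (\<i> * ta')) n (2 + k) (T (Wf (\<i> * ta')) m d' v') x')"
   unfolding d(1) T_add_steps nm ..
  also have "... <= exp (- ep * (ta - ta')\<^sup>2 / 2) * ?e"
  proof (rule pair_step_scaled[OF _ less.prems(1,2) _ _ _ big' A t])
   show "2 <= k" using k2 by simp
   show "bfun (M (n + 2 + k)) (T (Wf (\<i> * ta)) m d' v)" "bfun (M (n + 2 + k)) (T (Wf (\<i> * ta')) m d' v')"
    unfolding m_def[symmetric] by (rule T_bfun[OF Wf_bwt bv(1)], rule T_bfun[OF Wf_bwt bv(2)])
   show "norm (T (Wf (\<i> * ta)) m d' v z) * norm (T (Wf (\<i> * ta')) m d' v' z') <= ?e"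
    if "z \<in> St (n + 2 + k)" "z' \<in> St (n + 2 + k)" for z z'
    using that unfolding m_def[symmetric] by (rule IH)
  qed
  also have "... = exp (- ?c * ((\<Sum>j=m..<m+d'. MC.sv j) / blk - 1) - ?c)"
   by (simp add: exp_add[symmetric] algebra_simps)
  also have "... <= exp (- ?c * ((\<Sum>j=n..<n+d. MC.sv j) / blk - 1))"
  proof -
   have s1: "(\<Sum>j=n..<n+d. MC.sv j) = (\<Sum>j=n..<n+2. MC.sv j) + ((\<Sum>j=n+2..<m. MC.sv j) + (\<Sum>j=m..<m+d'. MC.sv j))"
    unfolding md[symmetric]
    using sum.atLeastLessThan_concat[of n "n + 2" "m + d'" MC.sv] sum.atLeastLessThan_concat[of "n + 2" m "m + d'" MC.sv]
    by (simp add: m_def)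
   have sd: "(\<Sum>j=n..<n+d. MC.sv j) <= blk + (\<Sum>j=m..<m+d'. MC.sv j)"
   proof -
    have "(\<Sum>j=n..<n+2. MC.sv j) <= 2 * ?L2" using sub[of n 2] by simp
    moreover have "(\<Sum>j=n+2..<m. MC.sv j) <= ?A0 + 3 * ?L2" using A3 by (simp add: m_def)
    ultimately show ?thesis using s1 unfolding blk_def by linarith
   qed
   have "(\<Sum>j=n..<n+d. MC.sv j) / blk - 1 <= ((\<Sum>j=m..<m+d'. MC.sv j) / blk - 1) + 1"
   proof -
    from sd have "(\<Sum>j=n..<n+d. MC.sv j) / blk <= (blk + (\<Sum>j=m..<m+d'. MC.sv j)) / blk"
     using blk_pos by (intro divide_right_mono) auto
    also have "... = 1 + (\<Sum>j=m..<m+d'. MC.sv j) / blk" using blk_pos by (simp add: add_divide_distrib)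
    finally show ?thesis by simp
   qed
   then have "?c * ((\<Sum>j=n..<n+d. MC.sv j) / blk - 1) <= ?c * (((\<Sum>j=m..<m+d'. MC.sv j) / blk - 1) + 1)"
    using c0 by (rule mult_left_mono)
   also have "... = ?c * ((\<Sum>j=m..<m+d'. MC.sv j) / blk - 1) + ?c" by (simp only: distrib_left mult_1_right)
   finally have le: "?c * ((\<Sum>j=n..<n+d. MC.sv j) / blk - 1) <= ?c * ((\<Sum>j=m..<m+d'. MC.sv j) / blk - 1) + ?c" .
   have "- c * a - c <= - c * b" if "c * b <= c * a + c" for a b c :: real using that by simp
   from this[OF le] show ?thesis by (simp only: exp_le_cancel_iff)
  qed
  finally show ?thesis .
 qed
qed

end

section \<open>The logarithm of the moment generating function\<close>

lemma exp_minus_1_minus_le: "norm (exp z - 1 - z) <= exp (norm z) * (norm z)\<^sup>2" for z :: complex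
proof -
 have "norm (exp z - (\<Sum>k\<le>1. z ^ k / fact k)) <= exp \<bar>Re z\<bar> * norm z ^ Suc 1 / fact 1"
  by (rule Taylor_exp)
 also have "... <= exp (norm z) * (norm z)\<^sup>2"
  using abs_Re_le_cmod[of z] by (simp add: power2_eq_square mult_right_mono)
 finally show ?thesis by (simp add: diff_diff_eq)
qed

lemma exp_minus_1_le: "norm (exp z - 1) <= exp (norm z) * norm z" for z :: complex
proof -
 have "norm (exp z - (\<Sum>k\<le>0. z ^ k / fact k)) <= exp \<bar>Re z\<bar> * norm z ^ Suc 0 / fact 0"
  by (rule Taylor_exp)
 also have "... <= exp (norm z) * norm z"
  using abs_Re_le_cmod[of z] by (simp add: mult_right_mono)
 finally show ?thesis by simp
qed

text \<open>Since \<open>Y\<close> is bounded, the quadratic remainder of the exponential is uniform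
  in \<open>om\<close> and the difference quotient converges directly. The factor \<open>G\<close>
  makes the lemma iterable for higher moments.\<close>

lemma (in prob_space) mgf_derivative:
 fixes G :: "'a => complex" and Y :: "'a => real"
 assumes G: "bfun M G" and Y: "bfun M Y"
 shows "((\<lambda>w. \<integral>om. G om * exp (w * of_real (Y om)) \<partial>M) has_field_derivative (LINT om|M. G om * of_real (Y om) * exp (w * of_real (Y om)))) (at w)"
proof -
 obtain B where B: "B >= 0" "!!x. x \<in> space M ==> norm (G x) <= B" using G by (elim bfunE) blast
 obtain C where C: "C >= 0" "!!x. x \<in> space M ==> norm (Y x) <= C" using Y by (elim bfunE) blast
 have bY: "bfun M (\<lambda>om. cor (Y om))" by (rule bfun_of_real[OF Y])
 have bE: "bfun M (\<lambda>om. exp (w * of_real (Y om)))" for w :: complex by (rule bfun_exp[OF bfun_mult[OF bfun_const bY]])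
 have i: "integrable M (\<lambda>om. G om * exp (w * of_real (Y om)))" "integrable M (\<lambda>om. G om * of_real (Y om) * exp (w * of_real (Y om)))" for w
  by (rule bfun_integrable[OF bfun_mult[OF G bE]], rule bfun_integrable[OF bfun_mult[OF bfun_mult[OF G bY] bE]])
 define f where "f w = (LINT om|M. G om * exp (w * of_real (Y om)))" for w
 define f' where "f' = (LINT om|M. G om * of_real (Y om) * exp (w * of_real (Y om)))"
 define c where "c = B * exp (norm w * C) * (exp C * C\<^sup>2)"
 have bound: "norm ((f (w + h) - f w) / h - f') <= c * norm h" if h: "h \<noteq> 0" "norm h <= 1" for h
 proof -
  have "(f (w + h) - f w) / h - f' = (f (w + h) - f w - h * f') / h" using h by (simp add: field_simps)
  also have "f (w + h) - f w - h * f' = (LINT om|M. G om * exp (w * of_real (Y om)) * (exp (h * of_real (Y om)) - 1 - h * of_real (Y om)))"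
  proof -
   have "f (w + h) - f w - h * f' = (LINT om|M. G om * exp ((w + h) * of_real (Y om)) - G om * exp (w * of_real (Y om)) - h * (G om * of_real (Y om) * exp (w * of_real (Y om))))"
    unfolding f_def f'_def using i by simp
   also have "... = (LINT om|M. G om * exp (w * of_real (Y om)) * (exp (h * of_real (Y om)) - 1 - h * of_real (Y om)))"
    by (rule Bochner_Integration.integral_cong[OF refl]) (simp add: distrib_right exp_add right_diff_distrib ac_simps)
   finally show ?thesis .
  qed
  also have "norm (... / h) <= c * norm h"
  proof -
   have "norm (LINT om|M. G om * exp (w * of_real (Y om)) * (exp (h * of_real (Y om)) - 1 - h * of_real (Y om))) <= c * (norm h)\<^sup>2"
   proof (rule norm_integral_le_const)
    fix om assume om: "om \<in> space M"
    let ?z = "h * cor (Y om)"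
    have Yc: "\<bar>Y om\<bar> <= C" using C(2)[OF om] by simp
    have 1: "norm (exp (w * of_real (Y om))) <= exp (norm w * C)"
    proof -
     have "norm (exp (w * of_real (Y om))) <= exp (norm (w * cor (Y om)))" by (rule norm_exp)
     also have "... <= exp (norm w * C)" using Yc by (simp add: norm_mult mult_left_mono)
     finally show ?thesis .
    qed
    have zn: "norm ?z <= norm h * C" using Yc by (simp add: norm_mult mult_left_mono)
    have zC: "norm ?z <= C" using zn mult_right_mono[OF h(2) C(1)] by simp
    have "norm (exp ?z - 1 - ?z) <= exp (norm ?z) * (norm ?z)\<^sup>2" by (rule exp_minus_1_minus_le)
    also have "... <= exp C * (norm h * C)\<^sup>2" using zn zC by (intro mult_mono power_mono) auto
    finally have 2: "norm (exp ?z - 1 - ?z) <= exp C * (norm h * C)\<^sup>2" .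
    have "norm (G om * exp (w * of_real (Y om)) * (exp ?z - 1 - ?z)) <= B * exp (norm w * C) * (exp C * (norm h * C)\<^sup>2)"
     unfolding norm_mult using B C 1 2 om by (intro mult_mono) auto
    then show "norm (G om * exp (w * of_real (Y om)) * (exp ?z - 1 - ?z)) <= c * (norm h)\<^sup>2"
     by (simp add: c_def power_mult_distrib ac_simps)
   qed (use B C in \<open>simp add: c_def\<close>)
   then show ?thesis using h by (simp add: norm_divide divide_le_eq power2_eq_square mult.assoc)
  qed
  finally show ?thesis .
 qed
 have "((\<lambda>h. (f (w + h) - f w) / h - f') \<longlongrightarrow> 0) (at 0)"
 proof (rule Lim_null_comparison)
  show "\<forall>\<^sub>F h in at 0. norm ((f (w + h) - f w) / h - f') <= c * norm h"
   using eventually_at_ball'[of 1 "0 :: complex" UNIV] by (rule eventually_mono) (use bound in \<open>auto simp: dist_norm\<close>)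
  show "((\<lambda>h. c * norm h) \<longlongrightarrow> 0) (at (0 :: complex))"
   by (rule tendsto_mult_right_zero) (rule tendsto_norm_zero, rule tendsto_ident_at)
 qed
 then have "((\<lambda>h. (f (w + h) - f w) / h) \<longlongrightarrow> f') (at 0)" by (rule Lim_null[THEN iffD2])
 then show ?thesis unfolding f_def f'_def by (simp add: DERIV_def)
qed

lemma norm_three: "norm (a + b - c) <= norm a + norm b + norm (c :: complex)"
 using norm_triangle_ineq4[of "a + b" c] norm_triangle_ineq[of a b] by linarith

lemma norm_Ln_near_1: "norm (z - 1) < 1/2 ==> norm (Ln z) <= 2 * norm (z - 1)" for z :: complex
 using norm_Ln_le[of "z - 1"] by simp

context bounded_functional
begin

abbreviation "LL \<equiv> KD + 1"

text \<open>Centred weights: the logarithm of the uncentred transform contains \<open>w\<close>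
  times the sum of the \<open>cen j\<close>, which \<open>SV\<close> does not control.\<close>

definition Wc :: "complex => nat => 'a \<times> 'a => complex" where
 "Wc w n xy = exp (w * cor (f n xy - cen n))"

lemma fc_bfun: "bfun (MM n) (\<lambda>xy. f n xy - cen n)"
 by (rule bfun_diff[OF f_bfun bfun_const])

lemma Wc_bwt: "bwt (Wc w)"
 unfolding Wc_def[abs_def] by (rule bwt_iexp[OF fc_bfun])

text \<open>Perturbation constant of one block; \<open>1 + 2 * LL^2\<close> is the largest mass that
  a block can have in \<open>log_mgf_local\<close>.\<close>

definition Cp :: real where "Cp = 8 * LL * exp 1 * exp (3 * \<beta> * (1 + 2 * LL\<^sup>2))"

lemma Cp_pos: "0 < Cp" using KD_nonneg by (simp add: Cp_def)

lemma T_Wc_eq_mgf: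
 fixes h :: "'a => complex" and Om :: "'w measure"
 assumes pr: "chain_process S M p ep \<beta> Om F X n" and init: "distr Om (M n) (X n) = return (M n) x"
  and h: "bfun (M (n + k)) h" and x: "x \<in> St n"
 shows "T (Wc w) n k h x = (LINT om|Om. h (X (n + k) om) * exp (w * of_real (\<Sum>j<k. f (n + j) (X (n + j) om, X (Suc (n + j)) om) - cen (n + j))))"
proof -
 have *: "(\<Prod>j<k. Wc w (n + j) (X (n + j) om, X (Suc (n + j)) om)) * h (X (n + k) om)
   = h (X (n + k) om) * exp (w * of_real (\<Sum>j<k. f (n + j) (X (n + j) om, X (Suc (n + j)) om) - cen (n + j)))" for om
  by (simp add: Wc_def exp_sum sum_distrib_left)
 show ?thesis unfolding T_eq_process[OF pr init Wc_bwt h x, of w, symmetric] by (simp only: *)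
qed

lemma T_Wc_holomorphic:
 assumes x: "x \<in> St n"
 shows "(\<lambda>w. T (Wc w) n k (\<lambda>_. 1) x) holomorphic_on UNIV"
proof -
 obtain Om :: "(nat => 'a) measure" and F X where
  pr: "chain_process S M p ep \<beta> Om F X n" and init: "distr Om (M n) (X n) = return (M n) x"
  using chain_proc_exists[OF x] by blast
 interpret chain_process S M p ep \<beta> Om F X n by (rule pr)
 let ?Y = "\<lambda>om. \<Sum>j<k. f (n + j) (X (n + j) om, X (Suc (n + j)) om) - cen (n + j)"
 have Y: "bfun Om ?Y" by (rule bfun_sum, rule bfun_XXOm[OF _ fc_bfun]) simp
 have "T (Wc w) n k (\<lambda>_. 1) x = (LINT om|Om. 1 * exp (w * of_real (?Y om)))" for w
  by (rule T_Wc_eq_mgf[OF pr init bfun_const x])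
 moreover have "(\<lambda>w. \<integral>om. 1 * exp (w * of_real (?Y om)) \<partial>Om) holomorphic_on UNIV"
  unfolding holomorphic_on_def field_differentiable_def
  using Om.mgf_derivative[OF bfun_const Y] has_field_derivative_at_within by blast
 ultimately show ?thesis by simp
qed

text \<open>Exponential moments of \<open>Z\<close> are bounded on a stretch of bounded mass,
  whatever its number of steps. Hence the weights move the product by O(norm w) uniformly in
  \<open>k\<close>.\<close>

lemma T_perturb:
 fixes h :: "'a => complex"
 assumes x: "x \<in> St n" and h: "bfun (M (n + k)) h" "!!z. z \<in> St (n + k) ==> norm (h z) <= H"
  and w: "norm w * (2 * LL) <= 1" and A: "(\<Sum>j=n..<n+k. MC.sv j) <= 1 + 2 * LL\<^sup>2"
 shows "norm (T (Wc w) n k h x - PT n k h x) <= norm w * Cp * H"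
proof -
 obtain Om :: "(nat => 'a) measure" and F X where
  pr: "chain_process S M p ep \<beta> Om F X n" and init: "distr Om (M n) (X n) = return (M n) x"
  using chain_proc_exists[OF x] by blast
 interpret chain_process S M p ep \<beta> Om F X n by (rule pr)
 interpret martingale_process S M p ep \<beta> mart LL Om F X n by unfold_locales
 let ?Y = "\<lambda>om. \<Sum>j<k. f (n + j) (X (n + j) om, X (Suc (n + j)) om) - cen (n + j)"
 have Y: "bfun Om ?Y" by (rule bfun_sum, rule bfun_XXOm[OF _ fc_bfun]) simp
 have hX: "bfun Om (\<lambda>om. h (X (n + k) om))" by (rule bfun_XOm[OF _ h(1)]) simp
 have YZ: "?Y om = Z (n + k) om + corr n (X n om) - corr (n + k) (X (n + k) om)" for om
 proof (induction k)
  case (Suc k)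
  then show ?case using Z_Suc[of "n + k" om] by (simp add: f_eq_mart)
 qed simp
 have LLp: "LL > 0" using KD_nonneg by simp
 have H0: "0 <= H" by (rule order_trans[OF norm_ge_zero h(2)[OF base_in]])
 have pw: "norm (exp (w * of_real (?Y om)) - 1) <= norm w * (2 * LL * exp 1 * exp (\<bar>Z (n + k) om\<bar> / LL))"
  if om: "om \<in> space Om" for om
 proof -
  define y where "y = ?Y om"
  have yle: "\<bar>y\<bar> <= \<bar>Z (n + k) om\<bar> + LL"
   unfolding y_def YZ using corr_bound[OF X_space[OF order_refl om]] corr_bound[OF X_space[of "n + k" om]] om KA_nonneg K_nonneg
   by (auto simp: KD_def)
  have nw: "norm (w * cor y) <= \<bar>y\<bar> / (2 * LL)"
  proof -
   have "norm w <= 1 / (2 * LL)" using w LLp by (simp add: field_simps)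
   from mult_right_mono[OF this, of "\<bar>y\<bar>"] show ?thesis by (simp add: norm_mult)
  qed
  \<comment> \<open>Half of the available exponential moment absorbs the linear factor, the other
    half the exponential.\<close>
  have y2: "\<bar>y\<bar> <= 2 * LL * exp (\<bar>y\<bar> / (2 * LL))"
  proof -
   have "\<bar>y\<bar> / (2 * LL) <= exp (\<bar>y\<bar> / (2 * LL))" using exp_ge_add_one_self[of "\<bar>y\<bar> / (2 * LL)"] by linarith
   then show ?thesis using LLp by (simp add: divide_le_eq mult.commute)
  qed
  have "norm (exp (w * of_real y) - 1) <= exp (norm (w * cor y)) * norm (w * cor y)"
   by (rule exp_minus_1_le)
  also have "... <= exp (\<bar>y\<bar> / (2 * LL)) * (norm w * \<bar>y\<bar>)"
   using nw by (intro mult_mono) (auto simp: norm_mult)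
  also have "... <= exp (\<bar>y\<bar> / (2 * LL)) * (norm w * (2 * LL * exp (\<bar>y\<bar> / (2 * LL))))"
   using y2 by (intro mult_left_mono) auto
  also have "... = norm w * (2 * LL * (exp (\<bar>y\<bar> / (2 * LL)) * exp (\<bar>y\<bar> / (2 * LL))))" by (simp only: ac_simps)
  also have "exp (\<bar>y\<bar> / (2 * LL)) * exp (\<bar>y\<bar> / (2 * LL)) = exp (\<bar>y\<bar> / LL)"
  proof -
   have "a / (2 * b) + a / (2 * b) = a / b" if "b > 0" for a b :: real using that by (simp add: field_simps)
   from this[OF LLp] show ?thesis by (simp only: exp_add[symmetric])
  qed
  finally have 1: "norm (exp (w * of_real y) - 1) <= norm w * (2 * LL * exp (\<bar>y\<bar> / LL))" .
  have "\<bar>y\<bar> / LL <= (\<bar>Z (n + k) om\<bar> + LL) / LL" using yle LLp by (intro divide_right_mono) auto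
  also have "... = 1 + \<bar>Z (n + k) om\<bar> / LL" using LLp by (simp add: add_divide_distrib)
  finally have "exp (\<bar>y\<bar> / LL) <= exp 1 * exp (\<bar>Z (n + k) om\<bar> / LL)" by (simp add: exp_add[symmetric])
  then have "norm w * (2 * LL * exp (\<bar>y\<bar> / LL)) <= norm w * (2 * LL * (exp 1 * exp (\<bar>Z (n + k) om\<bar> / LL)))"
   using LLp by (intro mult_left_mono) auto
  with 1 show ?thesis unfolding y_def by (simp add: mult.assoc)
 qed
 have bwt1: "bwt (\<lambda>n xy. 1 :: complex)" by simp
 have eb: "bfun Om (\<lambda>om. exp (w * of_real (?Y om)))" by (rule bfun_exp[OF bfun_mult[OF bfun_const bfun_of_real[OF Y]]])
 have i: "integrable Om (\<lambda>om. h (X (n + k) om) * exp (w * of_real (?Y om)))" "integrable Om (\<lambda>om. h (X (n + k) om))"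
  by (rule bfun_Om_integrable[OF bfun_mult[OF hX eb]], rule bfun_Om_integrable[OF hX])
 have "T (Wc w) n k h x - PT n k h x = (LINT om|Om. h (X (n + k) om) * exp (w * of_real (?Y om))) - (LINT om|Om. h (X (n + k) om))"
  using T_Wc_eq_mgf[OF pr init h(1) x, of w] T_eq_process[OF pr init bwt1 h(1) x] by simp
 also have "... = (LINT om|Om. h (X (n + k) om) * (exp (w * of_real (?Y om)) - 1))"
  unfolding right_diff_distrib mult_1_right by (rule Bochner_Integration.integral_diff[OF i, symmetric])
 finally have e: "T (Wc w) n k h x - PT n k h x = (LINT om|Om. h (X (n + k) om) * (exp (w * of_real (?Y om)) - 1))" .
 have "norm (T (Wc w) n k h x - PT n k h x) <= (LINT om|Om. norm (h (X (n + k) om) * (exp (w * of_real (?Y om)) - 1)))"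
  unfolding e by (rule integral_norm_bound)
 also have "... <= (LINT om|Om. H * (norm w * (2 * LL * exp 1)) * exp (\<bar>Z (n + k) om\<bar> / LL))"
 proof (rule integral_mono)
  show "integrable Om (\<lambda>om. norm (h (X (n + k) om) * (exp (w * of_real (?Y om)) - 1)))"
   by (rule bfun_Om_integrable[OF bfun_norm[OF bfun_mult[OF hX bfun_diff[OF eb bfun_const]]]])
  show "integrable Om (\<lambda>om. H * (norm w * (2 * LL * exp 1)) * exp (\<bar>Z (n + k) om\<bar> / LL))"
   by (rule bfun_Om_integrable[OF bfun_mult[OF bfun_const bfun_exp[OF bfun_divide_const[OF bfun_abs[OF Z_bfunOm]]]]])
  fix om assume om: "om \<in> space Om"
  have "norm (h (X (n + k) om) * (exp (w * of_real (?Y om)) - 1)) <= H * (norm w * (2 * LL * exp 1 * exp (\<bar>Z (n + k) om\<bar> / LL)))"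
   unfolding norm_mult using h(2)[OF X_space[of "n + k" om]] pw[OF om] om H0 by (intro mult_mono) auto
  then show "norm (h (X (n + k) om) * (exp (w * of_real (?Y om)) - 1)) <= H * (norm w * (2 * LL * exp 1)) * exp (\<bar>Z (n + k) om\<bar> / LL)"
   by (simp only: mult.assoc)
 qed
 also have "... = H * (norm w * (2 * LL * exp 1)) * (LINT om|Om. exp (\<bar>Z (n + k) om\<bar> / LL))" by simp
 also have "... <= H * (norm w * (2 * LL * exp 1)) * (4 * exp (3 * \<beta> * (1 + 2 * LL\<^sup>2)))"
 proof (rule mult_left_mono)
  have "(LINT om|Om. exp (\<bar>Z (n + k) om\<bar> / LL)) <= 4 * exp (3 * \<beta> * (\<Sum>j=n..<n+k. MC.sv j))" by (rule exp_abs_Z_le) simp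
  also have "... <= 4 * exp (3 * \<beta> * (1 + 2 * LL\<^sup>2))" using A beta_nonneg by (simp add: mult_left_mono)
  finally show "(LINT om|Om. exp (\<bar>Z (n + k) om\<bar> / LL)) <= 4 * exp (3 * \<beta> * (1 + 2 * LL\<^sup>2))" .
 qed (use H0 LLp in simp)
 also have "... = norm w * Cp * H" by (simp add: Cp_def)
 finally show ?thesis .
qed

text \<open>Solves \<open>(1 - ep) * kap + 4 * Cp = (1 - ep / 2) * kap\<close>, so that a relative
  oscillation \<open>kap * norm w\<close> reproduces itself over a block. The radius
  \<open>rad\<close> is small enough for the base value to lose at most the fraction
  \<open>ep / 2\<close> meanwhile.\<close>

definition kap :: real where "kap = 8 * Cp / ep"
definition rad :: real where "rad = min (1 / (2 * LL)) (ep / (2 * (kap + 2 * Cp)))"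

lemma kap_pos: "0 < kap" using Cp_pos eps_pos by (simp add: kap_def)

lemma rad_pos: "0 < rad"
 using Cp_pos kap_pos eps_pos KD_nonneg by (auto simp: rad_def intro!: divide_pos_pos)

lemma rad_bounds:
 assumes "norm w < rad"
 shows "norm w * (2 * LL) <= 1" "norm w * (kap + 2 * Cp) <= ep / 2" "norm w * kap <= 1 / 2" "norm w * Cp <= 1 / 4"
proof -
 have "norm w <= 1 / (2 * LL)" using assms by (simp add: rad_def)
 then show "norm w * (2 * LL) <= 1" using KD_nonneg by (simp add: le_divide_eq)
 have "norm w <= ep / (2 * (kap + 2 * Cp))" using assms by (simp add: rad_def)
 moreover have "u * s <= e / 2" if "u <= e / (2 * s)" "s > 0" for u s e :: real
  using that by (simp add: le_divide_eq)
 ultimately show *: "norm w * (kap + 2 * Cp) <= ep / 2" using kap_pos Cp_pos add_pos_pos[of kap "2 * Cp"] by simp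
 have "norm w * kap <= norm w * (kap + 2 * Cp)" "norm w * (2 * Cp) <= norm w * (kap + 2 * Cp)"
  using kap_pos Cp_pos by (auto intro!: mult_left_mono)
 then show "norm w * kap <= 1 / 2" "norm w * Cp <= 1 / 4" using * eps_less_1 by auto
qed

text \<open>An invariant cone: mixing contracts the oscillation relative to the base value by
  \<open>1 - ep\<close>, the perturbation adds \<open>4 * Cp * norm w\<close>, and the base value
  itself stays within \<open>ep / 2\<close> of its former size.\<close>

lemma block_step:
 fixes h :: "'a => complex"
 assumes k: "k >= 2" and A: "(\<Sum>j=n..<n+k. MC.sv j) <= 1 + 2 * LL\<^sup>2" and w: "norm w < rad"
  and h: "bfun (M (n + k)) h" and a0: "h (base (n + k)) \<noteq> 0"
  and osc: "!!x y. x \<in> St (n + k) ==> y \<in> St (n + k) ==> norm (h x - h y) <= kap * norm w * norm (h (base (n + k)))"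
 shows "norm (T (Wc w) n k h (base n) / h (base (n + k)) - 1) < 1 / 2"
  and "!!x y. x \<in> St n ==> y \<in> St n ==> norm (T (Wc w) n k h x - T (Wc w) n k h y) <= kap * norm w * norm (T (Wc w) n k h (base n))"
proof -
 define a where "a = h (base (n + k))"
 have a: "a \<noteq> 0" using a0 by (simp add: a_def)
 define g where "g z = h z / a" for z
 note r = rad_bounds[OF w]
 have g: "bfun (M (n + k)) g" unfolding g_def[abs_def] by (rule bfun_divide_const[OF h])
 have gosc: "norm (g x - g y) <= norm w * kap" if "x \<in> St (n + k)" "y \<in> St (n + k)" for x y
 proof -
  have "norm (g x - g y) = norm (h x - h y) / norm a" by (simp add: g_def norm_divide flip: diff_divide_distrib)
  also have "... <= (kap * norm w * norm a) / norm a" using osc[OF that] by (intro divide_right_mono) (auto simp: a_def)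
  also have "... = norm w * kap" using a by simp
  finally show ?thesis .
 qed
 have gb: "g (base (n + k)) = 1" using a by (simp add: g_def a_def)
 have g1: "norm (g x - 1) <= norm w * kap" if "x \<in> St (n + k)" for x
  using gosc[OF that base_in] gb by simp
 have g2: "norm (g x) <= 2" if "x \<in> St (n + k)" for x
  using g1[OF that] r(3) norm_triangle_sub[of "g x" 1] by simp
 have Pg1: "norm (PT n k g x - 1) <= norm w * kap" if x: "x \<in> St n" for x
 proof -
  have "norm (PT n k (\<lambda>z. g z - 1) x) <= norm w * kap"
   using g1 g x by (intro T_norm_le_1) auto
  moreover have "PT n k (\<lambda>z. g z - 1) x = PT n k g x - 1"
   using T_diff[OF bwt_1 g bfun_const[of _ 1] x] T_one_const[OF x, of k "1::complex"] by simp
  ultimately show ?thesis by simp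
 qed
 have Posc: "norm (PT n k g x - PT n k g y) <= (1 - ep) * (norm w * kap)" if "x \<in> St n" "y \<in> St n" for x y
 proof -
  have "norm (PT n k g x - PT n k g y) <= (1 - ep) ^ (k div 2) * (norm w * kap)"
   by (rule PT_osc_le[OF g gosc that])
  also have "... <= (1 - ep) ^ 1 * (norm w * kap)"
   using k eps_pos eps_less_1 kap_pos by (intro mult_right_mono power_decreasing) auto
  finally show ?thesis by simp
 qed
 have pert: "norm (T (Wc w) n k g x - PT n k g x) <= norm w * (2 * Cp)" if "x \<in> St n" for x
  using T_perturb[OF that g g2 r(1) A] by (simp add: mult.commute mult.left_commute)
 have Tg: "T (Wc w) n k h x = a * T (Wc w) n k g x" if "x \<in> St n" for x
 proof -
  have "T (Wc w) n k h x = T (Wc w) n k (\<lambda>z. a * g z) x" using a by (simp add: g_def)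
  also have "... = a * T (Wc w) n k g x" by (rule T_cmult[OF Wc_bwt g that])
  finally show ?thesis .
 qed
 have b1: "norm (T (Wc w) n k g (base n) - 1) <= ep / 2"
 proof -
  have "norm (T (Wc w) n k g (base n) - 1) <= norm (T (Wc w) n k g (base n) - PT n k g (base n)) + norm (PT n k g (base n) - 1)"
   by (rule norm_diff_triangle_ineq[of _ _ _ _, THEN order_trans[rotated]]) simp
  also have "... <= norm w * (2 * Cp) + norm w * kap" by (intro add_mono pert Pg1 base_in)
  also have "... = norm w * (kap + 2 * Cp)" by (simp add: algebra_simps)
  finally show ?thesis using r(2) by simp
 qed
 have "T (Wc w) n k h (base n) / h (base (n + k)) = T (Wc w) n k g (base n)"
  using Tg[OF base_in] a by (simp add: a_def)
 then show "norm (T (Wc w) n k h (base n) / h (base (n + k)) - 1) < 1 / 2"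
  using b1 eps_less_1 by simp
 fix x y assume xy: "x \<in> St n" "y \<in> St n"
 have "norm (T (Wc w) n k g x - T (Wc w) n k g y) <= norm (T (Wc w) n k g x - PT n k g x) + norm (PT n k g x - PT n k g y) + norm (T (Wc w) n k g y - PT n k g y)"
 proof -
  have "T (Wc w) n k g x - T (Wc w) n k g y = (T (Wc w) n k g x - PT n k g x) + (PT n k g x - PT n k g y) - (T (Wc w) n k g y - PT n k g y)" by simp
  then show ?thesis by (simp only: norm_three)
 qed
 also have "... <= norm w * (2 * Cp) + (1 - ep) * (norm w * kap) + norm w * (2 * Cp)"
  by (intro add_mono pert Posc xy)
 also have "... = norm w * kap * (1 - ep / 2)"
  using eps_pos by (simp add: kap_def field_simps)
 also have "... <= norm w * kap * norm (T (Wc w) n k g (base n))"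
 proof (rule mult_left_mono)
  show "1 - ep / 2 <= norm (T (Wc w) n k g (base n))"
   using b1 norm_triangle_sub[of 1 "T (Wc w) n k g (base n)"] by (simp add: norm_minus_commute)
 qed (use kap_pos in simp)
 finally have "norm (T (Wc w) n k g x - T (Wc w) n k g y) <= norm w * kap * norm (T (Wc w) n k g (base n))" .
 then have "norm a * norm (T (Wc w) n k g x - T (Wc w) n k g y) <= norm a * (norm w * kap * norm (T (Wc w) n k g (base n)))"
  by (rule mult_left_mono) simp
 then show "norm (T (Wc w) n k h x - T (Wc w) n k h y) <= kap * norm w * norm (T (Wc w) n k h (base n))"
  unfolding Tg[OF xy(1)] Tg[OF xy(2)] Tg[OF base_in] right_diff_distrib[symmetric] norm_mult by (simp only: ac_simps)
qed

definition vv :: "nat => nat => complex => 'a => complex" where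
 "vv n d w = T (Wc w) n d (\<lambda>_. 1)"

lemma vv_bfun: "bfun (M n) (vv n d w)" unfolding vv_def by (rule T_bfun_1[OF Wc_bwt])

lemma vv_holomorphic: "x \<in> St n ==> (\<lambda>w. vv n d w x) holomorphic_on A"
 unfolding vv_def by (rule holomorphic_on_subset[OF T_Wc_holomorphic subset_UNIV])

lemma vv_0: "x \<in> St n ==> vv n d 0 x = 1"
 unfolding vv_def Wc_def by (simp add: T_one_const)

lemma Ln_near_1_holomorphic:
 assumes "g holomorphic_on A" "!!w. w \<in> A ==> norm (g w - 1) < 1 / 2"
 shows "(\<lambda>w. Ln (g w)) holomorphic_on A"
proof (rule holomorphic_on_Ln'[OF _ assms(1)])
 fix w assume "w \<in> A"
 then have "Re (g w) > 0" using assms(2)[of w] abs_Re_le_cmod[of "g w - 1"] by simp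
 then show "g w \<notin> \<real>\<^sub>\<le>\<^sub>0" by (auto simp: complex_nonpos_Reals_iff)
qed

text \<open>The logarithm is a sum of principal logarithms of ratios over consecutive blocks, each
  ratio within \<open>1 / 2\<close> of 1. A full block has mass at least 1 and contributes at most
  1, whence the bound by the total mass; the summand 1 is for the incomplete last block.\<close>

theorem log_mgf_local:
 "\<exists>La. La holomorphic_on ball 0 rad \<and> La 0 = 0 \<and>
  (\<forall>w\<in>ball 0 rad. vv n d w (base n) = exp (La w) \<and> norm (La w) <= 1 + (\<Sum>j=n..<n+d. MC.sv j) \<and>
   (\<forall>x\<in>St n. \<forall>y\<in>St n. norm (vv n d w x - vv n d w y) <= kap * norm w * norm (vv n d w (base n))))"
proof (induction d arbitrary: n rule: less_induct)
 case (less d)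
 have sub: "(\<Sum>j=a..<a+b. MC.sv j) <= b * LL\<^sup>2" for a b
 proof -
  have "(\<Sum>j=a..<a+b. MC.sv j) <= (\<Sum>j=a..<a+b. LL\<^sup>2)" by (intro sum_mono MC.sv_le)
  then show ?thesis by simp
 qed
 have sv0: "0 <= (\<Sum>j=a..<b. MC.sv j)" for a b by (intro sum_nonneg MC.sv_nonneg)
 define big where "big k \<longleftrightarrow> k >= 2 \<and> 1 <= (\<Sum>j=n..<n+k. MC.sv j)" for k
 show ?case
 proof (cases "big d")
  case False
  have A: "(\<Sum>j=n..<n+d. MC.sv j) <= 1 + 2 * LL\<^sup>2"
  proof (cases "d >= 2")
   case True
   then have "(\<Sum>j=n..<n+d. MC.sv j) < 1" using False by (auto simp: big_def not_le)
   then show ?thesis using zero_le_power2[of LL] by linarith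
  next
   case d: False
   have "real d * LL\<^sup>2 <= 1 * LL\<^sup>2" using d by (intro mult_right_mono) auto
   then show ?thesis using sub[of n d] zero_le_power2[of LL] by linarith
  qed
  have near: "norm (vv n d w x - 1) <= norm w * Cp" if "norm w < rad" "x \<in> St n" for w x
   using T_perturb[OF that(2) bfun_const[of _ 1] _ rad_bounds(1)[OF that(1)] A, of 1] T_one_const[OF that(2), of d "1::complex"]
   by (simp add: vv_def)
  have near2: "norm (vv n d w (base n) - 1) <= 1 / 4" if "norm w < rad" for w
   using near[OF that base_in] rad_bounds(4)[OF that] by simp
  define La where "La w = Ln (vv n d w (base n))" for w
  have "La holomorphic_on ball 0 rad"
   unfolding La_def using near2 by (intro Ln_near_1_holomorphic vv_holomorphic base_in) force
  moreover have "La 0 = 0" by (simp add: La_def vv_0 base_in)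
  moreover have "vv n d w (base n) = exp (La w) \<and> norm (La w) <= 1 + (\<Sum>j=n..<n+d. MC.sv j) \<and>
   (\<forall>x\<in>St n. \<forall>y\<in>St n. norm (vv n d w x - vv n d w y) <= kap * norm w * norm (vv n d w (base n)))"
   if w: "w \<in> ball 0 rad" for w
  proof (intro conjI ballI)
   have w': "norm w < rad" using w by simp
   have nz: "vv n d w (base n) \<noteq> 0" using near2[OF w'] by auto
   then show "vv n d w (base n) = exp (La w)" by (simp add: La_def)
   show "norm (La w) <= 1 + (\<Sum>j=n..<n+d. MC.sv j)"
    using norm_Ln_near_1[of "vv n d w (base n)"] near2[OF w'] sv0[of n "n+d"] by (simp add: La_def)
   fix x y assume xy: "x \<in> St n" "y \<in> St n"
   have "norm (vv n d w x - vv n d w y) <= norm (vv n d w x - 1) + norm (vv n d w y - 1)"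
    using norm_triangle_ineq4[of "vv n d w x - 1" "vv n d w y - 1"] by simp
   also have "... <= norm w * Cp + norm w * Cp" by (intro add_mono near w' xy)
   also have "... <= kap * norm w * (1 / 2)"
   proof -
    have "ep * Cp <= 1 * Cp" using eps_less_1 Cp_pos by (intro mult_right_mono) auto
    then have "4 * Cp <= kap" using eps_pos Cp_pos by (simp add: kap_def le_divide_eq mult.commute)
    from mult_left_mono[OF this norm_ge_zero[of w]] show ?thesis by (simp add: algebra_simps)
   qed
   also have "... <= kap * norm w * norm (vv n d w (base n))"
    using near2[OF w'] norm_triangle_sub[of 1 "vv n d w (base n)"] kap_pos
    by (intro mult_left_mono) (auto simp: norm_minus_commute)
   finally show "norm (vv n d w x - vv n d w y) <= kap * norm w * norm (vv n d w (base n))" .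
  qed
  ultimately show ?thesis by blast
 next
  case True
  define k where "k = (LEAST k. big k)"
  have bk: "big k" unfolding k_def by (rule LeastI[of big, OF True])
  have kd: "k <= d" unfolding k_def by (rule Least_le[of big, OF True])
  have k2: "k >= 2" and s1: "1 <= (\<Sum>j=n..<n+k. MC.sv j)" using bk by (auto simp: big_def)
  have A: "(\<Sum>j=n..<n+k. MC.sv j) <= 1 + 2 * LL\<^sup>2"
  proof (cases "k = 2")
   case True
   then show ?thesis using sub[of n 2] by simp
  next
   case False
   then obtain k' where k': "k = Suc k'" "k' >= 2" using k2 by (cases k) auto
   have "\<not> big k'" by (rule not_less_Least[of k' big, folded k_def]) (simp add: k')
   then have "(\<Sum>j=n..<n+k'. MC.sv j) < 1" using k' by (auto simp: big_def not_le)
   moreover have "(\<Sum>j=n..<n+k. MC.sv j) = (\<Sum>j=n..<n+k'. MC.sv j) + MC.sv (n + k')" using k' by simp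
   ultimately show ?thesis using MC.sv_le[of "n + k'"] zero_le_power2[of LL] by linarith
  qed
  define d' where "d' = d - k"
  have d: "d = k + d'" "d' < d" using kd k2 by (auto simp: d'_def)
  define m where "m = n + k"
  obtain La' where La': "La' holomorphic_on ball 0 rad" "La' 0 = 0"
   and IH: "!!w. w \<in> ball 0 rad ==> vv m d' w (base m) = exp (La' w)"
    "!!w. w \<in> ball 0 rad ==> norm (La' w) <= 1 + (\<Sum>j=m..<m+d'. MC.sv j)"
    "!!w x y. w \<in> ball 0 rad ==> x \<in> St m ==> y \<in> St m ==>
     norm (vv m d' w x - vv m d' w y) <= kap * norm w * norm (vv m d' w (base m))"
   using less.IH[OF d(2), of m] by blast
  have vT: "vv n d w = T (Wc w) n k (vv m d' w)" for w
   unfolding vv_def d(1) T_add_steps m_def ..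
  have nz: "vv m d' w (base m) \<noteq> 0" if "w \<in> ball 0 rad" for w using IH(1)[OF that] by simp
  have bs: "norm (vv n d w (base n) / vv m d' w (base m) - 1) < 1 / 2"
   "!!x y. x \<in> St n ==> y \<in> St n ==> norm (vv n d w x - vv n d w y) <= kap * norm w * norm (vv n d w (base n))"
   if w: "w \<in> ball 0 rad" for w
   unfolding vT
   using block_step[OF k2 A _ vv_bfun[of "n + k" d' w], of w] w nz[OF w] IH(3)[OF w] unfolding m_def by auto
  define La where "La w = La' w + Ln (vv n d w (base n) / vv m d' w (base m))" for w
  have "La holomorphic_on ball 0 rad"
   unfolding La_def using bs(1) nz
   by (intro holomorphic_on_add La' Ln_near_1_holomorphic holomorphic_on_divide vv_holomorphic base_in)
  moreover have "La 0 = 0" using La'(2) by (simp add: La_def vv_0 base_in)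
  moreover have "vv n d w (base n) = exp (La w)" if w: "w \<in> ball 0 rad" for w
  proof -
   have "vv n d w (base n) / vv m d' w (base m) \<noteq> 0" using bs(1)[OF w] by auto
   then have "exp (La w) = vv m d' w (base m) * (vv n d w (base n) / vv m d' w (base m))"
    by (simp add: La_def exp_add IH(1)[OF w])
   then show ?thesis using nz[OF w] by simp
  qed
  moreover have "norm (La w) <= 1 + (\<Sum>j=n..<n+d. MC.sv j)" if w: "w \<in> ball 0 rad" for w
  proof -
   have "norm (La w) <= norm (La' w) + norm (Ln (vv n d w (base n) / vv m d' w (base m)))"
    unfolding La_def by (rule norm_triangle_ineq)
   also have "... <= (1 + (\<Sum>j=m..<m+d'. MC.sv j)) + 1"
    using IH(2)[OF w] norm_Ln_near_1[OF bs(1)[OF w]] bs(1)[OF w] by (intro add_mono) auto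
   also have "... <= 1 + ((\<Sum>j=n..<m. MC.sv j) + (\<Sum>j=m..<m+d'. MC.sv j))"
    using s1 by (simp add: m_def)
   also have "(\<Sum>j=n..<m. MC.sv j) + (\<Sum>j=m..<m+d'. MC.sv j) = (\<Sum>j=n..<n+d. MC.sv j)"
    unfolding d(1) m_def using sum.atLeastLessThan_concat[of n "n + k" "n + k + d'" MC.sv] by (simp add: add.assoc)
   finally show ?thesis .
  qed
  ultimately show ?thesis using bs(2) by blast
 qed
qed

end

lemma power2_diff_le: "(a - b)\<^sup>2 <= 2 * a\<^sup>2 + 2 * b\<^sup>2" for a b :: real
 using zero_le_power2[of "a + b"] by (simp add: power2_sum power2_diff)

context elliptic_chain
begin

lemma T_cong_W:
 assumes "!!j x y. n <= j ==> j < n + k ==> x \<in> St j ==> y \<in> St (Suc j) ==> W j (x, y) = W' j (x, y)"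
  and "x \<in> St n"
 shows "T W n k h x = T W' n k h x"
 using assms
proof (induction k arbitrary: n x)
 case (Suc k)
 have "T W (Suc n) k h y = T W' (Suc n) k h y" if "y \<in> St (Suc n)" for y
  using that by (intro Suc.IH Suc.prems(1)) auto
 then show ?case
  using Suc.prems by (auto simp: T1_def intro!: Bochner_Integration.integral_cong)
qed simp

end

section \<open>Doob's transform by a real tilt\<close>

locale doob_transform = elliptic_chain +
 fixes Wt :: "nat => 'a \<times> 'a => real" and h :: "nat => 'a => real"
 assumes Wt: "bwt Wt" "!!n x y. x \<in> space (M n) ==> y \<in> space (M (Suc n)) ==> 1 / 2 <= Wt n (x, y)"
   "!!n x y. x \<in> space (M n) ==> y \<in> space (M (Suc n)) ==> Wt n (x, y) <= 2"
  and h: "!!n. bfun (M n) (h n)" "!!n x. x \<in> space (M n) ==> 0 < h n x"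
   "!!n x y. x \<in> space (M n) ==> y \<in> space (M n) ==> h n x <= 3 * h n y"
   "!!n x. x \<in> space (M n) ==> h n x = T1 Wt n (h (Suc n)) x"
begin

definition ph :: "nat => 'a \<times> 'a => real" where
 "ph n xy = p n xy * (Wt n xy * h (Suc n) (snd xy)) / h n (fst xy)"

text \<open>A Harnack inequality across one step: a factor 2 from the weight and 3 from the
  oscillation of \<open>h\<close>.\<close>

lemma h_step_ge: assumes x: "x \<in> St n" and z: "z \<in> St (Suc n)" shows "h (Suc n) z <= 6 * h n x"
proof -
 interpret k: prob_space "kern n x" using x by (rule prob_kern)
 have "h (Suc n) z / 6 = (LINT y|kern n x. h (Suc n) z / 6)" using k.prob_space by simp
 also have "... <= (LINT y|kern n x. Wt n (x, y) * h (Suc n) y)"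
 proof (intro integral_mono integrable_kern[OF x] bfun_const bfun_T1_integrand[OF Wt(1) h(1) x])
  fix y assume "y \<in> space (kern n x)"
  then have y: "y \<in> St (Suc n)" by simp
  have "1 / 2 * (h (Suc n) z / 3) <= Wt n (x, y) * h (Suc n) y"
   using Wt(2)[OF x y] h(3)[OF z y] h(2)[OF z] by (intro mult_mono) auto
  then show "h (Suc n) z / 6 <= Wt n (x, y) * h (Suc n) y" by simp
 qed
 also have "... = h n x" using h(4)[OF x] by (simp add: T1_def)
 finally show ?thesis by simp
qed

lemma h_step_le: assumes x: "x \<in> St n" and z: "z \<in> St (Suc n)" shows "h n x <= 6 * h (Suc n) z"
proof -
 interpret k: prob_space "kern n x" using x by (rule prob_kern)
 have "h n x = (LINT y|kern n x. Wt n (x, y) * h (Suc n) y)" using h(4)[OF x] by (simp add: T1_def)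
 also have "... <= (LINT y|kern n x. 6 * h (Suc n) z)"
 proof (intro integral_mono integrable_kern[OF x] bfun_const bfun_T1_integrand[OF Wt(1) h(1) x])
  fix y assume "y \<in> space (kern n x)"
  then have y: "y \<in> St (Suc n)" by simp
  have "Wt n (x, y) * h (Suc n) y <= 2 * (3 * h (Suc n) z)"
   using Wt(3)[OF x y] h(3)[OF y z] h(2)[OF y] by (intro mult_mono) auto
  then show "Wt n (x, y) * h (Suc n) y <= 6 * h (Suc n) z" by simp
 qed
 also have "... = 6 * h (Suc n) z" using k.prob_space by simp
 finally show ?thesis .
qed

lemma ph_nonneg: "x \<in> St n ==> y \<in> St (Suc n) ==> 0 <= ph n (x, y)"
 using p_nonneg[of x n y] Wt(2)[of x n y] h(2)[of x n] h(2)[of y "Suc n"] by (simp add: ph_def)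

lemma ph_le:
 assumes xy: "x \<in> St n" "y \<in> St (Suc n)"
 shows "ph n (x, y) <= 12 * \<beta>"
proof -
 have hx: "0 < h n x" "0 < h (Suc n) y" using h(2) xy by auto
 have "p n (x, y) * (Wt n (x, y) * h (Suc n) y) <= \<beta> * (2 * (6 * h n x))"
  using p_le[OF xy] p_nonneg[OF xy] Wt(3)[OF xy] Wt(2)[OF xy] h_step_ge[OF xy] hx beta_nonneg
  by (intro mult_mono) auto
 then show ?thesis using hx by (simp add: ph_def divide_le_eq mult.assoc)
qed

lemma ph_meas: "ph n \<in> borel_measurable (MM n)"
proof -
 have [measurable]: "Wt n \<in> borel_measurable (MM n)" "h (Suc n) \<in> borel_measurable (M (Suc n))" "h n \<in> borel_measurable (M n)"
  using bfun_measurable[OF bwtD[OF Wt(1)]] bfun_measurable[OF h(1)] by auto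
 show ?thesis unfolding ph_def[abs_def] by measurable
qed

text \<open>\<open>12 = 2 * 6\<close>: one weight and one Harnack factor.
  \<open>144 = 4 * 36\<close>: two weights and two Harnack factors. The two bounds deteriorate
  differently, which is why \<open>ep\<close> and \<beta> are separate parameters of the
  chain.\<close>

lemma elliptic_chain_ph: "elliptic_chain S M ph (ep / 144) (12 * \<beta>)"
proof (rule elliptic_chain.intro)
 show "mcomplete_of (S n)" "separable_space (mtopology_of (S n))" "sets (M n) = sets (metric_borel (S n))" "prob_space (M n)" for n
  by (rule complete_S separable_S sets_M prob_M)+
 show "ph n \<in> borel_measurable (MM n)" for n by (rule ph_meas)
 show "0 <= ph n (x, y)" if "x \<in> St n" "y \<in> St (Suc n)" for x y n using that by (rule ph_nonneg)
 show "ph n (x, y) <= 12 * \<beta>" if "x \<in> St n" "y \<in> St (Suc n)" for x y n using that by (rule ph_le)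
 show "(LINT y|M (Suc n). ph n (x, y)) = 1" if x: "x \<in> St n" for x n
 proof -
  have "(LINT y|M (Suc n). ph n (x, y)) = (LINT y|M (Suc n). p n (x, y) * (Wt n (x, y) * h (Suc n) y)) / h n x"
   by (simp add: ph_def)
  also have "(LINT y|M (Suc n). p n (x, y) * (Wt n (x, y) * h (Suc n) y)) = T1 Wt n (h (Suc n)) x"
   unfolding T1_def
   using integral_kern[OF x bfun_measurable[OF bfun_T1_integrand[OF Wt(1) h(1) x]]] by simp
  finally show ?thesis using h(4)[OF x] h(2)[OF x] by simp
 qed
 show "ep / 144 <= (LINT y|M (Suc n). ph n (x, y) * ph (Suc n) (y, z))"
  if x: "x \<in> St n" and z: "z \<in> St (Suc (Suc n))" for x z n
 proof -
  interpret N: prob_space "M (Suc n)" by (rule prob_M)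
  have [measurable]: "p (Suc n) \<in> borel_measurable (MM (Suc n))"
   "ph n \<in> borel_measurable (MM n)" "ph (Suc n) \<in> borel_measurable (MM (Suc n))"
   by (rule p_meas, rule ph_meas, rule ph_meas)
  have le: "p n (x, y) * p (Suc n) (y, z) / 144 <= ph n (x, y) * ph (Suc n) (y, z)" if y: "y \<in> St (Suc n)" for y
  proof -
   have pos: "0 < h n x" "0 < h (Suc n) y" "0 < h (Suc (Suc n)) z" using h(2) x y z by auto
   have r: "1 / 36 <= h (Suc (Suc n)) z / h n x"
    using h_step_le[OF x y] h_step_le[OF y z] pos by (simp add: le_divide_eq)
   have "ph n (x, y) * ph (Suc n) (y, z) = (p n (x, y) * p (Suc n) (y, z)) * ((Wt n (x, y) * Wt (Suc n) (y, z)) * (h (Suc (Suc n)) z / h n x))"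
    using pos by (simp add: ph_def)
   also have "... >= (p n (x, y) * p (Suc n) (y, z)) * ((1 / 2 * (1 / 2)) * (1 / 36))"
    using p_nonneg[OF x y] p_nonneg[OF y z] Wt(2)[OF x y] Wt(2)[OF y z] r
    by (intro mult_left_mono mult_mono) (auto intro: mult_nonneg_nonneg order_trans[rotated])
   finally show ?thesis by simp
  qed
  have int1: "integrable (M (Suc n)) (\<lambda>y. p n (x, y) * p (Suc n) (y, z) / 144)"
  proof (rule N.integrable_const_bound[where B = "\<beta> * \<beta> / 144"])
   show "AE y in M (Suc n). norm (p n (x, y) * p (Suc n) (y, z) / 144) <= \<beta> * \<beta> / 144"
   proof (rule AE_I2)
    fix y assume y: "y \<in> St (Suc n)"
    have "\<bar>p n (x, y)\<bar> * \<bar>p (Suc n) (y, z)\<bar> <= \<beta> * \<beta>"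
     using p_bound[OF x y] p_bound[OF y z] beta_nonneg by (intro mult_mono) auto
    then show "norm (p n (x, y) * p (Suc n) (y, z) / 144) <= \<beta> * \<beta> / 144" by (simp add: abs_mult)
   qed
  qed (use x z in measurable)
  have phb: "\<bar>ph n (x, y)\<bar> <= 12 * \<beta>" if xy: "x \<in> St n" "y \<in> St (Suc n)" for x y n
   using ph_le[OF xy] ph_nonneg[OF xy] by simp
  have int2: "integrable (M (Suc n)) (\<lambda>y. ph n (x, y) * ph (Suc n) (y, z))"
  proof (rule N.integrable_const_bound[where B = "(12 * \<beta>) * (12 * \<beta>)"])
   show "AE y in M (Suc n). norm (ph n (x, y) * ph (Suc n) (y, z)) <= (12 * \<beta>) * (12 * \<beta>)"
   proof (rule AE_I2)
    fix y assume y: "y \<in> St (Suc n)"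
    have "\<bar>ph n (x, y)\<bar> * \<bar>ph (Suc n) (y, z)\<bar> <= (12 * \<beta>) * (12 * \<beta>)"
     by (rule mult_mono[OF phb[OF x y] phb[OF y z]]) (use beta_nonneg in auto)
    then show "norm (ph n (x, y) * ph (Suc n) (y, z)) <= (12 * \<beta>) * (12 * \<beta>)" by (simp only: real_norm_def abs_mult)
   qed
  qed (use x z in measurable)
  have "ep / 144 <= (LINT y|M (Suc n). p n (x, y) * p (Suc n) (y, z)) / 144" using p_two[OF x z] by simp
  also have "... = (LINT y|M (Suc n). p n (x, y) * p (Suc n) (y, z) / 144)" by simp
  also have "... <= (LINT y|M (Suc n). ph n (x, y) * ph (Suc n) (y, z))" by (intro integral_mono int1 int2 le)
  finally show ?thesis .
 qed
 show "0 < ep / 144" "ep / 144 < 1" using eps_pos eps_less_1 by auto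
qed

sublocale tilted: elliptic_chain S M ph "ep / 144" "12 * \<beta>" by (rule elliptic_chain_ph)

lemma integral_tilted_kern:
 fixes g :: "'a => complex"
 assumes x: "x \<in> St n" and g: "bfun (M (Suc n)) g"
 shows "(LINT y|tilted.kern n x. g y) = (LINT y|kern n x. of_real (Wt n (x, y) * h (Suc n) y) * g y) / of_real (h n x)"
proof -
 have b: "bfun (M (Suc n)) (\<lambda>y. cor (Wt n (x, y) * h (Suc n) y) * g y)"
  by (intro bfun_mult[OF bfun_of_real[OF bfun_T1_integrand[OF Wt(1) h(1) x]] g])
 have "(LINT y|tilted.kern n x. g y) = (LINT y|M (Suc n). ph n (x, y) *\<^sub>R g y)"
  by (rule tilted.integral_kern[OF x bfun_measurable[OF g]])
 also have "... = (LINT y|M (Suc n). (p n (x, y) *\<^sub>R (of_real (Wt n (x, y) * h (Suc n) y) * g y)) / of_real (h n x))"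
  by (rule Bochner_Integration.integral_cong[OF refl]) (simp add: ph_def scaleR_conv_of_real)
 also have "... = (LINT y|M (Suc n). p n (x, y) *\<^sub>R (of_real (Wt n (x, y) * h (Suc n) y) * g y)) / of_real (h n x)"
  by simp
 also have "(LINT y|M (Suc n). p n (x, y) *\<^sub>R (of_real (Wt n (x, y) * h (Suc n) y) * g y)) = (LINT y|kern n x. of_real (Wt n (x, y) * h (Suc n) y) * g y)"
  by (rule integral_kern[OF x bfun_measurable[OF b], symmetric])
 finally show ?thesis .
qed

text \<open>The factors \<open>h\<close> of consecutive steps cancel, and only the two ends
  survive.\<close>

lemma tilted_T:
 fixes v :: "'a => complex"
 assumes W: "bwt W" and v: "bfun (M (n + k)) v" and x: "x \<in> St n"
 shows "tilted.T W n k v x = T (\<lambda>n xy. W n xy * of_real (Wt n xy)) n k (\<lambda>z. of_real (h (n + k) z) * v z) x / of_real (h n x)"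
 using v x
proof (induction k arbitrary: n x)
 case 0
 then show ?case using h(2)[of x n] by simp
next
 case (Suc k)
 let ?W = "\<lambda>n xy. W n xy * cor (Wt n xy)"
 let ?v = "\<lambda>z. of_real (h (Suc n + k) z) * v z"
 have W': "tilted.bwt W" using W by (simp add: bwt_def tilted.bwt_def)
 have WW: "bwt ?W" unfolding bwt_def by (intro allI bfun_mult bwtD[OF W] bfun_of_real bwtD[OF Wt(1)])
 have v': "bfun (M (Suc n + k)) v" using Suc.prems by simp
 have vb: "bfun (M (Suc n + k)) ?v" by (intro bfun_mult bfun_of_real h(1) v')
 have b: "bfun (M (Suc n)) (tilted.T W (Suc n) k v)" by (rule tilted.T_bfun[OF W' v'])
 have bb: "bfun (M (Suc n)) (\<lambda>y. W n (x, y) * tilted.T W (Suc n) k v y)"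
  by (rule bfun_T1_integrand[OF W b Suc.prems(2)])
 have "tilted.T W n (Suc k) v x = (LINT y|tilted.kern n x. W n (x, y) * tilted.T W (Suc n) k v y)"
  by (simp add: tilted.T1_def)
 also have "... = (LINT y|kern n x. of_real (Wt n (x, y) * h (Suc n) y) * (W n (x, y) * tilted.T W (Suc n) k v y)) / of_real (h n x)"
  by (rule integral_tilted_kern[OF Suc.prems(2) bb])
 also have "(LINT y|kern n x. of_real (Wt n (x, y) * h (Suc n) y) * (W n (x, y) * tilted.T W (Suc n) k v y))
  = (LINT y|kern n x. ?W n (x, y) * T ?W (Suc n) k ?v y)"
 proof (rule Bochner_Integration.integral_cong[OF refl])
  fix y assume "y \<in> space (kern n x)"
  then have y: "y \<in> St (Suc n)" by simp
  show "of_real (Wt n (x, y) * h (Suc n) y) * (W n (x, y) * tilted.T W (Suc n) k v y) = ?W n (x, y) * T ?W (Suc n) k ?v y"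
   using Suc.IH[OF v' y] h(2)[OF y] by simp
 qed
 also have "... = T ?W n (Suc k) ?v x" by (simp add: T1_def)
 finally show ?case by simp
qed

end

context bounded_functional
begin

abbreviation "SV N \<equiv> (\<Sum>j<N. MC.sv j)"

lemma vv_osc:
 assumes w: "norm w < rad" and x: "x \<in> St n" and y: "y \<in> St n"
 shows "norm (vv n d w x - vv n d w y) <= kap * norm w * norm (vv n d w (base n))"
proof -
 obtain La where H: "\<forall>w\<in>ball 0 rad. vv n d w (base n) = exp (La w) \<and> norm (La w) <= 1 + (\<Sum>j=n..<n+d. MC.sv j) \<and>
   (\<forall>x\<in>St n. \<forall>y\<in>St n. norm (vv n d w x - vv n d w y) <= kap * norm w * norm (vv n d w (base n)))"
  using log_mgf_local[of n d] by blast
 have "w \<in> ball 0 rad" using w by simp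
 from bspec[OF bspec[OF bspec[OF H this, THEN conjunct2, THEN conjunct2] x] y] show ?thesis .
qed

end

section \<open>Variance and logarithmic transform under a general initial law\<close>

locale functional_process = bounded_functional S M p ep \<beta> f K + chain_process S M p ep \<beta> Om F X 0
 for S :: "nat => 'a metric" and M p ep \<beta> f K and Om :: "'w measure" and F X
begin

sublocale MP: martingale_process S M p ep \<beta> mart "KD + 1" Om F X 0 ..

definition Sc :: "nat => 'w => real" where "Sc N om = (\<Sum>j<N. f j (XX j om) - cen j)"

lemma Sc_bfun: "bfun Om (Sc N)"
 unfolding Sc_def[abs_def] by (rule bfun_sum, rule bfun_XXOm[OF _ fc_bfun]) simp

lemma Sc_eq: "Sc N om = MP.Z N om + (corr 0 (X 0 om) - corr N (X N om))"
proof (induction N)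
 case (Suc N)
 then show ?case using MP.Z_Suc[of N om] by (simp add: Sc_def f_eq_mart)
qed (simp add: Sc_def)

definition U :: "nat => 'w => real" where "U N om = corr 0 (X 0 om) - corr N (X N om)"

lemma U_bfun: "bfun Om (U N)"
 unfolding U_def[abs_def] by (intro bfun_diff bfun_XOm corr_bfun) auto

lemma U_le: "om \<in> space Om ==> (U N om)\<^sup>2 <= LL\<^sup>2"
proof -
 assume om: "om \<in> space Om"
 have "\<bar>U N om\<bar> <= LL"
  using corr_bound[OF X_space[of 0 om]] corr_bound[OF X_space[of N om]] om K_nonneg by (auto simp: U_def KD_def)
 then show "(U N om)\<^sup>2 <= LL\<^sup>2" by (rule power_mono[of "\<bar>U N om\<bar>" _ 2, simplified])
qed

lemma Sc_second_moment_le: "(LINT om|Om. (Sc N om)\<^sup>2) <= 4 * LL\<^sup>2 + 2 * \<beta> * SV N"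
proof -
 have i: "integrable Om (\<lambda>om. (Sc N om)\<^sup>2)" "integrable Om (\<lambda>om. 2 * (MP.Z N om)\<^sup>2 + 2 * LL\<^sup>2)" "integrable Om (\<lambda>om. (MP.Z N om)\<^sup>2)"
  by (rule bfun_Om_integrable[OF bfun_power[OF Sc_bfun]],
    rule bfun_Om_integrable[OF bfun_add[OF bfun_mult[OF bfun_const bfun_power[OF MP.Z_bfunOm]] bfun_const]],
    rule bfun_Om_integrable[OF bfun_power[OF MP.Z_bfunOm]])
 have "(LINT om|Om. (Sc N om)\<^sup>2) <= (LINT om|Om. 2 * (MP.Z N om)\<^sup>2 + 2 * LL\<^sup>2)"
 proof (rule integral_mono[OF i(1,2)])
  fix om assume om: "om \<in> space Om"
  have "(MP.Z N om + U N om)\<^sup>2 <= 2 * (MP.Z N om)\<^sup>2 + 2 * (U N om)\<^sup>2"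
   using sum_squares_bound[of "MP.Z N om" "U N om"] by (simp add: power2_sum)
  then show "(Sc N om)\<^sup>2 <= 2 * (MP.Z N om)\<^sup>2 + 2 * LL\<^sup>2"
   using U_le[OF om, of N] by (simp add: Sc_eq U_def)
 qed
 also have "... = 2 * (LINT om|Om. (MP.Z N om)\<^sup>2) + 2 * LL\<^sup>2" using i(3) Om.prob_space by simp
 also have "... <= 2 * (LL\<^sup>2 + \<beta> * SV N) + 2 * LL\<^sup>2"
  using MP.Z_var_le[of N] by (simp add: atLeast0LessThan)
 finally show ?thesis by simp
qed

text \<open>After centering, \<open>Z\<close> is the difference of \<open>Sc N\<close> and the
  bounded boundary term \<open>U N\<close>; hence the variance of \<open>Z\<close> is at most twice
  that of \<open>Sc N\<close> plus a constant.\<close>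

lemma Sc_var_ge: "ep / 2 * SV N - 2 * LL\<^sup>2 <= (LINT om|Om. (Sc N om)\<^sup>2) - (LINT om|Om. Sc N om)\<^sup>2"
proof -
 define m where "m = (LINT om|Om. Sc N om)"
 define u where "u = (LINT om|Om. U N om)"
 have i: "integrable Om (Sc N)" "integrable Om (U N)" "integrable Om (\<lambda>om. (Sc N om)\<^sup>2)" "integrable Om (\<lambda>om. (U N om)\<^sup>2)" "integrable Om (\<lambda>om. (MP.Z N om)\<^sup>2)"
  "integrable Om (MP.Z N)"
  by (rule bfun_Om_integrable, rule Sc_bfun U_bfun bfun_power[OF Sc_bfun] bfun_power[OF U_bfun] bfun_power[OF MP.Z_bfunOm] MP.Z_bfunOm)+
 have mu: "m = u"
 proof -
  have "m = (LINT om|Om. MP.Z N om + U N om)" by (simp add: m_def Sc_eq U_def)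
  then show ?thesis using i MP.Z_mean[of N] by (simp add: u_def)
 qed
 have "(LINT om|Om. (MP.Z N om)\<^sup>2) <= (LINT om|Om. 2 * ((Sc N om)\<^sup>2 - 2 * m * Sc N om + m\<^sup>2) + 2 * ((U N om)\<^sup>2 - 2 * u * U N om + u\<^sup>2))"
 proof (rule integral_mono[OF i(5)])
  show "integrable Om (\<lambda>om. 2 * ((Sc N om)\<^sup>2 - 2 * m * Sc N om + m\<^sup>2) + 2 * ((U N om)\<^sup>2 - 2 * u * U N om + u\<^sup>2))"
   using i by simp
  fix om
  have "MP.Z N om = (Sc N om - m) - (U N om - u)" by (simp add: Sc_eq U_def mu)
  then have "(MP.Z N om)\<^sup>2 <= 2 * (Sc N om - m)\<^sup>2 + 2 * (U N om - u)\<^sup>2"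
   by (simp only: power2_diff_le)
  also have "... = 2 * ((Sc N om)\<^sup>2 - 2 * m * Sc N om + m\<^sup>2) + 2 * ((U N om)\<^sup>2 - 2 * u * U N om + u\<^sup>2)"
   by (simp add: power2_diff algebra_simps)
  finally show "(MP.Z N om)\<^sup>2 <= 2 * ((Sc N om)\<^sup>2 - 2 * m * Sc N om + m\<^sup>2) + 2 * ((U N om)\<^sup>2 - 2 * u * U N om + u\<^sup>2)" .
 qed
 also have "... = 2 * ((LINT om|Om. (Sc N om)\<^sup>2) - m\<^sup>2) + 2 * ((LINT om|Om. (U N om)\<^sup>2) - u\<^sup>2)"
  using i Om.prob_space by (simp add: m_def[symmetric] u_def[symmetric] power2_eq_square)
 also have "... <= 2 * ((LINT om|Om. (Sc N om)\<^sup>2) - m\<^sup>2) + 2 * LL\<^sup>2"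
 proof -
  have "norm (LINT om|Om. (U N om)\<^sup>2) <= LL\<^sup>2" using U_le by (intro Om.norm_integral_le_const) auto
  then have "(LINT om|Om. (U N om)\<^sup>2) - u\<^sup>2 <= LL\<^sup>2" using zero_le_power2[of u] unfolding real_norm_def by argo
  then show ?thesis by simp
 qed
 finally have Z: "(LINT om|Om. (MP.Z N om)\<^sup>2) <= 2 * ((LINT om|Om. (Sc N om)\<^sup>2) - m\<^sup>2) + 2 * LL\<^sup>2" .
 have s: "SV N - 2 * LL\<^sup>2 <= (\<Sum>j=2..<N. MC.sv j)"
 proof -
  have "SV N <= (\<Sum>j\<in>{0, 1} \<union> {2..<N}. MC.sv j)" by (intro sum_mono2) (auto intro: MC.sv_nonneg)
  also have "... = (\<Sum>j\<in>{0, 1}. MC.sv j) + (\<Sum>j=2..<N. MC.sv j)" by (intro sum.union_disjoint) auto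
  finally show ?thesis using MC.sv_le[of 0] MC.sv_le[of 1] by simp
 qed
 have "ep * (SV N - 2 * LL\<^sup>2) <= ep * (\<Sum>j=2..<N. MC.sv j)" using s eps_pos by (intro mult_left_mono) auto
 also have "... <= (LINT om|Om. (MP.Z N om)\<^sup>2)" using MP.Z_var_ge[of N] by (simp add: numeral_2_eq_2)
 finally have "ep * (SV N - 2 * LL\<^sup>2) <= 2 * ((LINT om|Om. (Sc N om)\<^sup>2) - m\<^sup>2) + 2 * LL\<^sup>2" using Z by simp
 moreover have "ep * (2 * LL\<^sup>2) <= 1 * (2 * LL\<^sup>2)" using eps_less_1 by (intro mult_right_mono) auto
 ultimately show ?thesis unfolding m_def by (simp add: algebra_simps)
qed

lemma mgf_eq_vv: "(LINT om|Om. exp (w * of_real (Sc N om))) = (LINT om|Om. vv 0 N w (X 0 om))"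
proof -
 have "exp (w * of_real (Sc N om)) = (\<Prod>j<N. Wc w (0 + j) (XX (0 + j) om)) * 1" for om
  by (simp add: Sc_def Wc_def exp_sum[symmetric] sum_distrib_left)
 then show ?thesis
  using markov_T[OF order_refl bfun_const[of _ 1] Wc_bwt bfun_const[of _ 1], of w N] by (simp add: vv_def)
qed

definition Gm :: "nat => complex => complex" where "Gm N w = (LINT om|Om. exp (w * of_real (Sc N om)))"

lemma Gm_deriv: "(Gm N has_field_derivative (LINT om|Om. of_real (Sc N om) * exp (w * of_real (Sc N om)))) (at w)"
 unfolding Gm_def[abs_def] using Om.mgf_derivative[OF bfun_const[of _ 1] Sc_bfun] by simp

lemma Gm_deriv2: "((\<lambda>w. \<integral>om. of_real (Sc N om) * exp (w * of_real (Sc N om)) \<partial>Om) has_field_derivative (LINT om|Om. of_real ((Sc N om)\<^sup>2) * exp (w * of_real (Sc N om)))) (at (w :: complex))"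
 using Om.mgf_derivative[OF bfun_of_real[OF Sc_bfun] Sc_bfun] by (simp add: power2_eq_square)

lemma Gm_near:
 assumes w: "norm w < rad"
 shows "norm (Gm N w - vv 0 N w (base 0)) <= kap * norm w * norm (vv 0 N w (base 0))"
proof -
 have osc: "norm (vv 0 N w x - vv 0 N w y) <= kap * norm w * norm (vv 0 N w (base 0))" if "x \<in> St 0" "y \<in> St 0" for x y
  by (rule vv_osc[OF w that])
 have b: "bfun Om (\<lambda>om. vv 0 N w (X 0 om))" by (rule bfun_XOm[OF _ vv_bfun]) simp
 have "Gm N w - vv 0 N w (base 0) = (LINT om|Om. vv 0 N w (X 0 om) - vv 0 N w (base 0))"
  unfolding Gm_def mgf_eq_vv using bfun_Om_integrable[OF b] Om.prob_space by simp
 also have "norm ... <= kap * norm w * norm (vv 0 N w (base 0))"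
  using osc[OF X_space base_in] kap_pos by (intro Om.norm_integral_le_const) auto
 finally show ?thesis .
qed

text \<open>The initial law enters only through the ratio \<open>q\<close> to the transform from the
  base point, which stays within \<open>1 / 2\<close> of 1 and so has a principal logarithm.\<close>

theorem Gm_log:
 "\<exists>La. La holomorphic_on ball 0 rad \<and> La 0 = 0 \<and>
  (\<forall>w\<in>ball 0 rad. Gm N w = exp (La w) \<and> norm (La w) <= 2 + SV N)"
proof -
 obtain La' where La': "La' holomorphic_on ball 0 rad" "La' 0 = 0"
  "!!w. w \<in> ball 0 rad ==> vv 0 N w (base 0) = exp (La' w)"
  "!!w. w \<in> ball 0 rad ==> norm (La' w) <= 1 + SV N"
  using log_mgf_local[of 0 N] by (auto simp: atLeast0LessThan)
 define q where "q w = Gm N w / vv 0 N w (base 0)" for w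
 have nz: "vv 0 N w (base 0) \<noteq> 0" if "w \<in> ball 0 rad" for w using La'(3)[OF that] by simp
 have Gh: "Gm N holomorphic_on A" for A
  unfolding holomorphic_on_def field_differentiable_def using Gm_deriv has_field_derivative_at_within by blast
 have q: "norm (q w - 1) < 1 / 2" if w: "w \<in> ball 0 rad" for w
 proof (cases "w = 0")
  case True
  then show ?thesis using Om.prob_space by (simp add: q_def Gm_def vv_0 base_in)
 next
  case False
  have w': "norm w < rad" using w by simp
  have "norm (q w - 1) = norm (Gm N w - vv 0 N w (base 0)) / norm (vv 0 N w (base 0))"
   using nz[OF w] by (simp add: q_def field_simps flip: norm_divide)
  also have "... <= (kap * norm w * norm (vv 0 N w (base 0))) / norm (vv 0 N w (base 0))"
   by (intro divide_right_mono Gm_near w') simp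
  also have "... = kap * norm w" using nz[OF w] by simp
  also have "... < 1 / 2"
  proof -
   have "0 < norm w * (2 * Cp)" using False Cp_pos by simp
   then have "norm w * kap < norm w * (kap + 2 * Cp)" by (simp add: distrib_left)
   then show ?thesis using rad_bounds(2)[OF w'] eps_less_1 by (simp add: mult.commute)
  qed
  finally show ?thesis .
 qed
 define La where "La w = La' w + Ln (q w)" for w
 have "La holomorphic_on ball 0 rad"
  unfolding La_def using q nz
  by (intro holomorphic_on_add La' Ln_near_1_holomorphic) (auto simp: q_def[abs_def] intro!: holomorphic_on_divide Gh vv_holomorphic base_in)
 moreover have "La 0 = 0" using La'(2) Om.prob_space by (simp add: La_def q_def Gm_def vv_0 base_in)
 moreover have "Gm N w = exp (La w)" if w: "w \<in> ball 0 rad" for w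
 proof -
  have "q w \<noteq> 0" using q[OF w] by auto
  then have "exp (La w) = vv 0 N w (base 0) * q w" by (simp add: La_def exp_add La'(3)[OF w])
  then show ?thesis using nz[OF w] by (simp add: q_def)
 qed
 moreover have "norm (La w) <= 2 + SV N" if w: "w \<in> ball 0 rad" for w
 proof -
  have "norm (La w) <= norm (La' w) + norm (Ln (q w))" unfolding La_def by (rule norm_triangle_ineq)
  also have "... <= (1 + SV N) + 1" using La'(4)[OF w] norm_Ln_near_1[OF q[OF w]] q[OF w] by (intro add_mono) auto
  finally show ?thesis by simp
 qed
 ultimately show ?thesis by blast
qed

text \<open>Obtained by differentiating \<open>exp (La w)\<close> twice; the integrals do not depend
  on which logarithm is taken.\<close>

lemma Gm_log_derivs:
 assumes r: "0 < r" and La: "La holomorphic_on ball 0 r" "!!w. w \<in> ball 0 r ==> Gm N w = exp (La w)" and w: "w \<in> ball 0 r"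
 shows "(LINT om|Om. of_real (Sc N om) * exp (w * of_real (Sc N om))) = Gm N w * deriv La w"
  and "(LINT om|Om. of_real ((Sc N om)\<^sup>2) * exp (w * of_real (Sc N om))) = Gm N w * ((deriv La w)\<^sup>2 + deriv (deriv La) w)"
proof -
 have La': "(La has_field_derivative deriv La w) (at w)" if "w \<in> ball 0 r" for w
  by (rule holomorphic_derivI[OF La(1) open_ball that])
 have La'': "(deriv La has_field_derivative deriv (deriv La) w) (at w)"
  by (rule holomorphic_derivI[OF holomorphic_deriv[OF La(1) open_ball] open_ball w])
 have 1: "(LINT om|Om. of_real (Sc N om) * exp (w * of_real (Sc N om))) = Gm N w * deriv La w" if w: "w \<in> ball 0 r" for w
 proof (rule DERIV_unique[OF Gm_deriv])
  have "((\<lambda>w. exp (La w)) has_field_derivative exp (La w) * deriv La w) (at w)"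
   by (rule DERIV_fun_exp[OF La'[OF w]])
  then have "(Gm N has_field_derivative exp (La w) * deriv La w) (at w)"
   by (rule has_field_derivative_transform_within_open[OF _ open_ball w]) (simp add: La(2))
  then show "(Gm N has_field_derivative Gm N w * deriv La w) (at w)" by (simp add: La(2)[OF w])
 qed
 show "(LINT om|Om. of_real (Sc N om) * exp (w * of_real (Sc N om))) = Gm N w * deriv La w" by (rule 1[OF w])
 show "(LINT om|Om. of_real ((Sc N om)\<^sup>2) * exp (w * of_real (Sc N om))) = Gm N w * ((deriv La w)\<^sup>2 + deriv (deriv La) w)"
 proof (rule DERIV_unique[OF Gm_deriv2])
  have "((\<lambda>w. Gm N w * deriv La w) has_field_derivative (Gm N w * deriv (deriv La) w + (Gm N w * deriv La w) * deriv La w)) (at w)"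
   using DERIV_mult'[OF Gm_deriv[of N w] La''] unfolding 1[OF w] .
  then have "((\<lambda>w. \<integral>om. of_real (Sc N om) * exp (w * of_real (Sc N om)) \<partial>Om) has_field_derivative (Gm N w * deriv (deriv La) w + (Gm N w * deriv La w) * deriv La w)) (at w)"
   by (rule has_field_derivative_transform_within_open[OF _ open_ball w]) (simp add: 1)
  then show "((\<lambda>w. \<integral>om. of_real (Sc N om) * exp (w * of_real (Sc N om)) \<partial>Om) has_field_derivative Gm N w * ((deriv La w)\<^sup>2 + deriv (deriv La) w)) (at w)"
   by (simp add: algebra_simps power2_eq_square)
 qed
qed

lemma Gm_0: "Gm N 0 = 1" using Om.prob_space by (simp add: Gm_def)

lemma log_second_deriv_0:
 assumes r: "0 < r" and La: "La holomorphic_on ball 0 r" "!!w. w \<in> ball 0 r ==> Gm N w = exp (La w)"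
 shows "deriv La 0 = of_real (LINT om|Om. Sc N om)"
  and "deriv (deriv La) 0 = of_real ((LINT om|Om. (Sc N om)\<^sup>2) - (LINT om|Om. Sc N om)\<^sup>2)"
proof -
 have 0: "0 \<in> ball 0 r" using r by simp
 show 1: "deriv La 0 = of_real (LINT om|Om. Sc N om)"
  using Gm_log_derivs(1)[OF r La 0] Gm_0[of N] by simp
 have "(LINT om|Om. cor ((Sc N om)\<^sup>2)) = (deriv La 0)\<^sup>2 + deriv (deriv La) 0"
  using Gm_log_derivs(2)[OF r La 0] Gm_0[of N] by simp
 then show "deriv (deriv La) 0 = of_real ((LINT om|Om. (Sc N om)\<^sup>2) - (LINT om|Om. Sc N om)\<^sup>2)"
  unfolding integral_complex_of_real 1 by (simp add: algebra_simps)
qed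

end

lemma Cauchy_derivative_bound:
 assumes La: "La holomorphic_on ball 0 r" and r: "0 < r" and B: "!!w. w \<in> ball 0 r ==> norm (La w) <= B"
  and w: "norm w <= r / 2"
 shows "norm ((deriv ^^ n) La w) <= fact n * B / (r / 4) ^ n"
proof -
 have sub: "cball w (r / 4) \<subseteq> ball 0 r"
 proof
  fix z assume "z \<in> cball w (r / 4)"
  then have "norm (z - w) <= r / 4" by (simp add: dist_norm norm_minus_commute)
  then show "z \<in> ball 0 r" using w r norm_triangle_sub[of z w] by simp
 qed
 show ?thesis
 proof (rule Cauchy_inequality)
  show "La holomorphic_on ball w (r / 4)" using sub by (intro holomorphic_on_subset[OF La]) auto
  show "continuous_on (cball w (r / 4)) La"
   by (rule holomorphic_on_imp_continuous_on[OF holomorphic_on_subset[OF La sub]])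
  show "norm (La z) <= B" if "norm (w - z) = r / 4" for z
   using that sub by (intro B) (auto simp: dist_norm)
 qed (use r in simp)
qed

section \<open>Tilting\<close>

lemma second_deriv_lipschitz:
 assumes La: "La holomorphic_on ball 0 r" and r: "0 < r" and B: "!!w. w \<in> ball 0 r ==> norm (La w) <= B"
  and w: "norm w <= r / 2" "norm w' <= r / 2"
 shows "norm (deriv (deriv La) w - deriv (deriv La) w') <= 6 * B / (r / 4) ^ 3 * norm (w - w')"
proof (rule field_differentiable_bound[where S = "cball 0 (r / 2)" and f' = "deriv (deriv (deriv La))"])
 have h: "deriv (deriv La) holomorphic_on ball 0 r" by (intro holomorphic_deriv La open_ball)
 fix z :: complex assume z: "z \<in> cball 0 (r / 2)"
 then have "z \<in> ball 0 r" using r by simp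
 then show "(deriv (deriv La) has_field_derivative deriv (deriv (deriv La)) z) (at z within cball 0 (r / 2))"
  by (rule has_field_derivative_at_within[OF holomorphic_derivI[OF h open_ball]])
 show "norm (deriv (deriv (deriv La)) z) <= 6 * B / (r / 4) ^ 3"
  using Cauchy_derivative_bound[OF La r B, of z 3] z by (simp add: numeral_3_eq_3 fact_numeral)
qed (use w in auto)

context bounded_functional
begin

lemma fc_le: "x \<in> St n ==> y \<in> St (Suc n) ==> \<bar>f n (x, y) - cen n\<bar> <= LL"
 using f_bound[of x n y] cen_bound[of n] KA_nonneg by (simp add: KD_def)

text \<open>The link from operators to the probability in question: under a point mass the transform
  is the operator product at that point.\<close>

lemma point_process_vv:
 fixes Om :: "'w measure"
 assumes x: "x \<in> St 0" and pr: "chain_process S M p ep \<beta> Om F X 0"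
  and init: "distr Om (M 0) (X 0) = return (M 0) x"
 shows "functional_process.Gm M p f Om X N w = vv 0 N w x"
proof -
 interpret FP: functional_process S M p ep \<beta> f K Om F X
  by (rule functional_process.intro[OF bounded_functional_axioms pr])
 have "FP.Gm N w = (LINT y|distr Om (M 0) (X 0). vv 0 N w y)"
  unfolding FP.Gm_def FP.mgf_eq_vv
  by (rule integral_distr[symmetric, OF FP.X_meas[OF order_refl] bfun_measurable[OF vv_bfun]])
 also have "... = vv 0 N w x"
  unfolding init by (rule integral_return[OF x bfun_measurable[OF vv_bfun]])
 finally show ?thesis .
qed

text \<open>In the second part \<open>s\<close> is the variance for the chain from \<open>x\<close>.
  It is identified for every logarithm on every disc, because for the tilted chain the logarithm
  will be a translate of the original one.\<close>

lemma point_log_mgf: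
 assumes x: "x \<in> St 0"
 shows "\<exists>La. La holomorphic_on ball 0 rad \<and> La 0 = 0 \<and>
   (\<forall>w\<in>ball 0 rad. vv 0 N w x = exp (La w) \<and> norm (La w) <= 2 + SV N)"
  and "\<exists>s. ep / 2 * SV N - 2 * LL\<^sup>2 <= s \<and> s <= 4 * LL\<^sup>2 + 2 * \<beta> * SV N \<and>
   (\<forall>r La. 0 < r --> La holomorphic_on ball 0 r --> (\<forall>w\<in>ball 0 r. vv 0 N w x = exp (La w))
    --> deriv (deriv La) 0 = of_real s)"
proof -
 obtain Om :: "(nat => 'a) measure" and F X where pr: "chain_process S M p ep \<beta> Om F X 0"
  and init: "distr Om (M 0) (X 0) = return (M 0) x"
  using chain_proc_exists[OF x] by blast
 interpret FP: functional_process S M p ep \<beta> f K Om F X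
  by (rule functional_process.intro[OF bounded_functional_axioms pr])
 have G: "FP.Gm N w = vv 0 N w x" for w by (rule point_process_vv[OF x pr init])
 show "\<exists>La. La holomorphic_on ball 0 rad \<and> La 0 = 0 \<and>
   (\<forall>w\<in>ball 0 rad. vv 0 N w x = exp (La w) \<and> norm (La w) <= 2 + SV N)"
  using FP.Gm_log[of N] unfolding G .
 define s where "s = (LINT om|Om. (FP.Sc N om)\<^sup>2) - (LINT om|Om. FP.Sc N om)\<^sup>2"
 have "ep / 2 * SV N - 2 * LL\<^sup>2 <= s" using FP.Sc_var_ge[of N] unfolding s_def .
 moreover have "s <= 4 * LL\<^sup>2 + 2 * \<beta> * SV N"
  using FP.Sc_second_moment_le[of N] zero_le_power2[of "\<integral>om. FP.Sc N om \<partial>Om"] unfolding s_def by argo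
 moreover have "deriv (deriv La) 0 = of_real s"
  if "0 < r" "La holomorphic_on ball 0 r" "\<forall>w\<in>ball 0 r. vv 0 N w x = exp (La w)" for r La
  unfolding s_def by (rule FP.log_second_deriv_0(2)[OF that(1,2)]) (use that(3) in \<open>simp add: G\<close>)
 ultimately show "\<exists>s. ep / 2 * SV N - 2 * LL\<^sup>2 <= s \<and> s <= 4 * LL\<^sup>2 + 2 * \<beta> * SV N \<and>
   (\<forall>r La. 0 < r --> La holomorphic_on ball 0 r --> (\<forall>w\<in>ball 0 r. vv 0 N w x = exp (La w))
    --> deriv (deriv La) 0 = of_real s)" by blast
qed

lemma exp_tilt_bounds:
 assumes \<xi>: "\<bar>\<xi>\<bar> < rad" and xy: "x \<in> St n" "y \<in> St (Suc n)"
 shows "1 / 2 <= exp (\<xi> * (f n (x, y) - cen n))" "exp (\<xi> * (f n (x, y) - cen n)) <= 2"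
proof -
 have "\<bar>\<xi>\<bar> * \<bar>f n (x, y) - cen n\<bar> <= \<bar>\<xi>\<bar> * LL" by (intro mult_left_mono fc_le xy) simp
 also have "... <= 1 / 2" using rad_bounds(1)[of "cor \<xi>"] \<xi> by (simp add: algebra_simps)
 finally have a: "\<bar>\<xi> * (f n (x, y) - cen n)\<bar> <= 1 / 2" by (simp add: abs_mult)
 have e: "1 / 2 <= exp t" if "\<bar>t\<bar> <= 1 / 2" for t :: real using exp_ge_add_one_self[of t] that by argo
 show "1 / 2 <= exp (\<xi> * (f n (x, y) - cen n))" by (rule e[OF a])
 define t where "t = \<xi> * (f n (x, y) - cen n)"
 have "1 / 2 <= exp (- t)" using a unfolding t_def by (intro e) simp
 then have "exp t <= 2" by (simp add: exp_minus field_simps)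
 then show "exp (\<xi> * (f n (x, y) - cen n)) <= 2" by (simp only: t_def)
qed

text \<open>The tilt stops at time \<open>N\<close>, so that \<open>th N\<close> equals 1 from then
  on and is exactly harmonic at all times.\<close>

definition tw :: "nat => real => nat => 'a \<times> 'a => real" where
 "tw N \<xi> n xy = (if n < N then exp (\<xi> * (f n xy - cen n)) else 1)"

definition th :: "nat => real => nat => 'a => real" where
 "th N \<xi> n = T (tw N \<xi>) n (N - n) (\<lambda>_. 1)"

lemma tw_bwt: "bwt (tw N \<xi>)"
 unfolding bwt_def
proof
 fix n
 show "bfun (MM n) (tw N \<xi> n)"
 proof (cases "n < N")
  case True
  then show ?thesis
   unfolding tw_def[abs_def] using bfun_exp[OF bfun_mult[OF bfun_const[of _ \<xi>] fc_bfun]] by simp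
 qed (simp add: tw_def[abs_def] bfun_const)
qed

lemma th_eq_vv:
 assumes x: "x \<in> St n"
 shows "of_real (th N \<xi> n x) = vv n (N - n) (of_real \<xi>) x"
proof -
 have "of_real (th N \<xi> n x) = T (\<lambda>n xy. cor (tw N \<xi> n xy)) n (N - n) (\<lambda>_. of_real 1) x"
  unfolding th_def by (rule T_of_real[OF x, symmetric])
 also have "... = T (Wc (of_real \<xi>)) n (N - n) (\<lambda>_. of_real 1) x"
  by (rule T_cong_W[OF _ x]) (auto simp: tw_def Wc_def exp_of_real[symmetric])
 finally show ?thesis by (simp add: vv_def)
qed

lemma T_real_nonneg:
 fixes W :: "nat => 'a \<times> 'a => real"
 assumes "!!n xy. 0 <= W n xy" "x \<in> St n"
 shows "0 <= T W n k (\<lambda>_. 1) x"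
 using assms(2)
proof (induction k arbitrary: n x)
 case (Suc k)
 show ?case
  unfolding T.simps T1_def using Suc.IH assms(1) by (intro integral_nonneg_AE AE_I2 mult_nonneg_nonneg) auto
qed simp

lemma tilt_doob:
 assumes \<xi>: "\<bar>\<xi>\<bar> < rad"
 shows "doob_transform S M p ep \<beta> (tw N \<xi>) (th N \<xi>)"
proof (rule doob_transform.intro[OF elliptic_chain_axioms], rule doob_transform_axioms.intro)
 show "bwt (tw N \<xi>)" by (rule tw_bwt)
 show "1 / 2 <= tw N \<xi> n (x, y)" "tw N \<xi> n (x, y) <= 2" if "x \<in> St n" "y \<in> St (Suc n)" for n x y
  using exp_tilt_bounds[OF \<xi> that] by (auto simp: tw_def)
 show "bfun (M n) (th N \<xi> n)" for n unfolding th_def by (rule T_bfun_1[OF tw_bwt])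
 have nn: "0 <= th N \<xi> n x" if "x \<in> St n" for n x
  unfolding th_def using that by (intro T_real_nonneg) (auto simp: tw_def)
 have osc: "\<bar>th N \<xi> n x - th N \<xi> n (base n)\<bar> <= 1 / 2 * th N \<xi> n (base n)" if x: "x \<in> St n" for n x
 proof -
  have "\<bar>th N \<xi> n x - th N \<xi> n (base n)\<bar> = norm (vv n (N - n) (of_real \<xi>) x - vv n (N - n) (of_real \<xi>) (base n))"
   unfolding th_eq_vv[OF x, symmetric] th_eq_vv[OF base_in, symmetric] by (simp flip: of_real_diff)
  also have "... <= kap * norm (cor \<xi>) * norm (vv n (N - n) (of_real \<xi>) (base n))"
   using \<xi> by (intro vv_osc x base_in) simp
  also have "... <= 1 / 2 * norm (vv n (N - n) (of_real \<xi>) (base n))"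
   using rad_bounds(3)[of "cor \<xi>"] \<xi> by (intro mult_right_mono) (auto simp: mult.commute)
  also have "... = 1 / 2 * th N \<xi> n (base n)"
   unfolding th_eq_vv[OF base_in, symmetric] norm_of_real using nn[OF base_in[of n]] by simp
  finally show ?thesis .
 qed
 have pos: "0 < th N \<xi> n (base n)" for n
 proof -
  obtain La where "\<forall>w\<in>ball 0 rad. vv n (N - n) w (base n) = exp (La w)"
   using log_mgf_local[of n "N - n"] by blast
  then have "vv n (N - n) (of_real \<xi>) (base n) \<noteq> 0" using \<xi> by simp
  then show ?thesis using nn[OF base_in[of n]] unfolding th_eq_vv[OF base_in, symmetric] by simp
 qed
 show "0 < th N \<xi> n x" if "x \<in> St n" for n x using osc[OF that] pos[of n] by argo
 \<comment> \<open>All values lie between one half and three halves of the value at the base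
   point.\<close>
 show "th N \<xi> n x <= 3 * th N \<xi> n y" if "x \<in> St n" "y \<in> St n" for n x y
  using osc[OF that(1)] osc[OF that(2)] pos[of n] by argo
 show "th N \<xi> n x = T1 (tw N \<xi>) n (th N \<xi> (Suc n)) x" if x: "x \<in> St n" for n x
 proof (cases "n < N")
  case True
  then have "N - n = Suc (N - Suc n)" by simp
  then show ?thesis by (simp add: th_def)
 next
  case False
  interpret k: prob_space "kern n x" using x by (rule prob_kern)
  show ?thesis using False k.prob_space by (simp add: th_def T1_def tw_def)
 qed
qed

text \<open>The transform under the tilted chain is a quotient of original transforms. The centering
  \<open>d\<close> is left free: the tilted chain's own one produces its \<open>vv\<close>, and 0
  produces its \<open>Wf\<close>.\<close>

lemma tilted_vv:
 assumes \<xi>: "\<bar>\<xi>\<bar> < rad" and x: "x \<in> St 0"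
 shows "elliptic_chain.T M (doob_transform.ph p (tw N \<xi>) (th N \<xi>)) (\<lambda>n xy. exp (a * cor (f n xy - d n))) 0 N (\<lambda>_. 1) x
  = (\<Prod>j<N. exp (a * of_real (cen j - d j))) * vv 0 N (of_real \<xi> + a) x / vv 0 N (of_real \<xi>) x"
proof -
 interpret D: doob_transform S M p ep \<beta> "tw N \<xi>" "th N \<xi>" by (rule tilt_doob[OF \<xi>])
 let ?W = "\<lambda>n xy. exp (a * cor (f n xy - d n))"
 have W: "bwt ?W" by (rule bwt_iexp[OF bfun_diff[OF f_bfun bfun_const]])
 have "D.tilted.T ?W 0 N (\<lambda>_. 1) x
  = T (\<lambda>n xy. ?W n xy * cor (tw N \<xi> n xy)) 0 N (\<lambda>z. cor (th N \<xi> (0 + N) z) * 1) x / of_real (th N \<xi> 0 x)"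
  by (rule D.tilted_T[OF W bfun_const x])
 also have "T (\<lambda>n xy. ?W n xy * cor (tw N \<xi> n xy)) 0 N (\<lambda>z. cor (th N \<xi> (0 + N) z) * 1) x
  = T (\<lambda>n xy. exp (a * of_real (cen n - d n)) * Wc (of_real \<xi> + a) n xy) 0 N (\<lambda>z. 1 * 1) x"
 proof -
  have "?W j (x, y) * cor (tw N \<xi> j (x, y)) = exp (a * of_real (cen j - d j)) * Wc (of_real \<xi> + a) j (x, y)"
   if "j < 0 + N" for j x y
   using that by (simp add: tw_def Wc_def exp_of_real[symmetric] exp_add[symmetric] algebra_simps)
  then have "T (\<lambda>n xy. ?W n xy * cor (tw N \<xi> n xy)) 0 N h x
   = T (\<lambda>n xy. exp (a * of_real (cen n - d n)) * Wc (of_real \<xi> + a) n xy) 0 N h x" for h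
   by (intro T_cong_W[OF _ x]) simp
  then show ?thesis by (simp add: th_def)
 qed
 also have "... = (\<Prod>j<N. exp (a * of_real (cen (0 + j) - d (0 + j)))) * 1 * T (Wc (of_real \<xi> + a)) 0 N (\<lambda>_. 1) x"
  by (rule T_gauge[where g = "\<lambda>_ _. 1" and h = "\<lambda>_. 1" and W = "Wc (of_real \<xi> + a)" and n = 0 and k = N and x = x
    and c = "\<lambda>n. exp (a * of_real (cen n - d n))" and W' = "\<lambda>n xy. exp (a * of_real (cen n - d n)) * Wc (of_real \<xi> + a) n xy"])
   (use x in simp_all)
 finally show ?thesis unfolding th_eq_vv[OF x, of N \<xi>] by (simp add: vv_def)
qed


text \<open>\<open>pair_decay\<close> for the tilted chain yields decay in terms of its own mass.
  That mass is bounded below by the tilted variance, i.e. the second derivative of the logarithm at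
  \<xi>, which for small \<xi> differs little from the one at 0, i.e. the original variance.\<close>

theorem tilted_pair_decay:
 "\<exists>r \<delta> c C. 0 < r \<and> r <= rad / 2 \<and> 0 < \<delta> \<and> 0 < c \<and> 0 < C \<and>
  (\<forall>N \<xi> ta ta' x. \<bar>\<xi>\<bar> <= r --> \<bar>ta - ta'\<bar> <= \<delta> --> x \<in> St 0 -->
   norm (vv 0 N (of_real \<xi> + \<i> * of_real ta) x) * norm (vv 0 N (of_real \<xi> + \<i> * of_real ta') x)
   <= C * exp (- c * (ta - ta')\<^sup>2 * SV N) * (norm (vv 0 N (of_real \<xi>) x))\<^sup>2)"
proof -
 define e' where "e' = ep / 144"
 define b' where "b' = 12 * \<beta>"
 \<comment> \<open>The constants for the tilted chain are formed before \<xi> and \<open>N\<close>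
   are fixed: they depend only on \<open>ep / 144\<close>, \<open>12 * \<beta>\<close> and
   \<open>K\<close>.\<close>
 define B where "B = bounded_functional.blk e' b' K"
 define L' where "L' = bounded_functional.KD e' K + 1"
 define Cm' where "Cm' = centered_functional.Cm b' L' B"
 \<comment> \<open>With the Lipschitz bound for the second derivative, this radius moves it by at
   most \<open>ep / 4 * (2 + SV N)\<close>, about half of its lower bound.\<close>
 define r where "r = min (rad / 2) (ep / 24 * (rad / 4) ^ 3)"
 define \<delta> where "\<delta> = min 1 (1 / (\<bar>Cm'\<bar> + 1))"
 define D where "D = 2 * LL\<^sup>2 + ep / 2 + 4 * L'\<^sup>2"
 define q where "q = 2 * b' + 1"
 define c where "c = e' / 2 * (ep / 4 / q / B)"
 define C where "C = exp (e' / 2 * (D / q / B + 1))"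
 have e': "0 < e'" using eps_pos by (simp add: e'_def)
 have b': "0 <= b'" using beta_nonneg by (simp add: b'_def)
 have q: "0 < q" using b' by (simp add: q_def)
 have r: "0 < r" "r <= rad / 2" using rad_pos eps_pos by (auto simp: r_def)
 have \<delta>: "0 < \<delta>" by (simp add: \<delta>_def)
 have main: "0 < B \<and> norm (vv 0 N (of_real \<xi> + \<i> * of_real ta) x) * norm (vv 0 N (of_real \<xi> + \<i> * of_real ta') x)
   <= C * exp (- c * (ta - ta')\<^sup>2 * SV N) * (norm (vv 0 N (of_real \<xi>) x))\<^sup>2"
  if \<xi>: "\<bar>\<xi>\<bar> <= r" and ta: "\<bar>ta - ta'\<bar> <= \<delta>" and x: "x \<in> St 0" for N \<xi> ta ta' x
 proof -
  have \<xi>r: "\<bar>\<xi>\<bar> < rad" "\<bar>\<xi>\<bar> <= rad / 2" using \<xi> r rad_pos by auto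
  interpret D: doob_transform S M p ep \<beta> "tw N \<xi>" "th N \<xi>" by (rule tilt_doob[OF \<xi>r(1)])
  interpret H: bounded_functional S M D.ph e' b' f K
   unfolding e'_def b'_def
   by (rule bounded_functional.intro[OF D.elliptic_chain_ph], rule bounded_functional_axioms.intro)
    (rule f_meas, rule f_bound)
  have B: "0 < B" unfolding B_def by (rule H.blk_pos)
  note tv = tilted_vv[OF \<xi>r(1) x, of N]
  obtain La where La: "La holomorphic_on ball 0 rad" "!!w. w \<in> ball 0 rad ==> vv 0 N w x = exp (La w)"
   "!!w. w \<in> ball 0 rad ==> norm (La w) <= 2 + SV N"
   using point_log_mgf(1)[OF x, of N] by blast
  obtain s where s: "ep / 2 * SV N - 2 * LL\<^sup>2 <= s" "deriv (deriv La) 0 = of_real s"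
   using point_log_mgf(2)[OF x, of N] La rad_pos by blast
  obtain s' where s': "s' <= 4 * L'\<^sup>2 + 2 * b' * H.SV N"
   "!!r La. 0 < r ==> La holomorphic_on ball 0 r ==> (\<forall>w\<in>ball 0 r. H.vv 0 N w x = exp (La w)) ==> deriv (deriv La) 0 = of_real s'"
   using H.point_log_mgf(2)[OF x, of N] unfolding L'_def by blast
  define A where "A = (\<Sum>j<N. cen j - H.cen j)"
  define La' where "La' w = w * of_real A + La (of_real \<xi> + w) - La (of_real \<xi>)" for w
  have inball: "of_real \<xi> + w \<in> ball 0 rad" if "w \<in> ball 0 (rad / 2)" for w :: complex
  proof -
   have "norm (of_real \<xi> + w) <= norm (cor \<xi>) + norm w" by (rule norm_triangle_ineq)
   then show ?thesis using that \<xi>r by simp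
  qed
  have \<xi>b: "cor \<xi> \<in> ball 0 rad" using \<xi>r by simp
  \<comment> \<open>The logarithm for the tilted chain is the original one translated by \<xi>, up
    to a linear term from the different centering; second derivatives do not see that term.\<close>
  have "deriv (deriv La') 0 = of_real s'"
  proof (rule s'(2))
   show "0 < rad / 2" using rad_pos by simp
   have "(\<lambda>w. cor \<xi> + w) ` ball 0 (rad / 2) \<subseteq> ball 0 rad" using inball by blast
   then have "(\<lambda>w. La (of_real \<xi> + w)) holomorphic_on ball 0 (rad / 2)"
    by (rule holomorphic_on_compose_gen[unfolded o_def, OF _ La(1), rotated]) (intro holomorphic_intros)
   then show "La' holomorphic_on ball 0 (rad / 2)"
    unfolding La'_def[abs_def] by (intro holomorphic_intros)
   show "\<forall>w\<in>ball 0 (rad / 2). H.vv 0 N w x = exp (La' w)"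
   proof
    fix w :: complex assume w: "w \<in> ball 0 (rad / 2)"
    have "H.vv 0 N w x = (\<Prod>j<N. exp (w * of_real (cen j - H.cen j))) * vv 0 N (of_real \<xi> + w) x / vv 0 N (of_real \<xi>) x"
     using tv[of w H.cen] unfolding H.vv_def H.Wc_def[abs_def] .
    also have "... = exp (w * of_real A) * exp (La (of_real \<xi> + w)) / exp (La (of_real \<xi>))"
     unfolding La(2)[OF inball[OF w]] La(2)[OF \<xi>b]
     by (simp add: exp_sum[symmetric] A_def sum_distrib_left[symmetric] of_real_sum del: of_real_diff)
    also have "... = exp (La' w)" by (simp add: La'_def exp_add exp_diff)
    finally show "H.vv 0 N w x = exp (La' w)" .
   qed
  qed
  moreover have "deriv (deriv La') 0 = deriv (deriv La) (of_real \<xi>)"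
  proof -
   have d: "(La' has_field_derivative of_real A + deriv La (of_real \<xi> + w)) (at w)" if "w \<in> ball 0 (rad / 2)" for w
   proof -
    have "((\<lambda>w. La (of_real \<xi> + w)) has_field_derivative deriv La (of_real \<xi> + w) * 1) (at w)"
     by (rule DERIV_chain2[where f = La and g = "\<lambda>w. of_real \<xi> + w", OF holomorphic_derivI[OF La(1) open_ball inball[OF that]]])
      (auto intro!: derivative_eq_intros)
    then show ?thesis
     unfolding La'_def[abs_def] by (auto intro!: derivative_eq_intros)
   qed
   have 0: "(0::complex) \<in> ball 0 (rad / 2)" using rad_pos by simp
   have "(deriv La has_field_derivative deriv (deriv La) (of_real \<xi> + 0)) (at (of_real \<xi> + 0))"
    by (rule holomorphic_derivI[OF holomorphic_deriv[OF La(1) open_ball] open_ball inball[OF 0]])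
   then have "((\<lambda>w. deriv La (of_real \<xi> + w)) has_field_derivative deriv (deriv La) (of_real \<xi> + 0) * 1) (at 0)"
    by (rule DERIV_chain2[where f = "deriv La" and g = "\<lambda>w. of_real \<xi> + w"]) (auto intro!: derivative_eq_intros)
   then have "((\<lambda>w. of_real A + deriv La (of_real \<xi> + w)) has_field_derivative deriv (deriv La) (of_real \<xi> + 0)) (at 0)"
    by (auto intro!: derivative_eq_intros)
   then have "(deriv La' has_field_derivative deriv (deriv La) (of_real \<xi> + 0)) (at 0)"
    by (rule has_field_derivative_transform_within_open[OF _ open_ball 0]) (simp add: DERIV_imp_deriv[OF d])
   then show ?thesis by (simp add: DERIV_imp_deriv)
  qed
  ultimately have ss: "deriv (deriv La) (of_real \<xi>) = of_real s'" by simp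
  have SV0: "0 <= SV N" "0 <= H.SV N" by (auto intro!: sum_nonneg MC.sv_nonneg H.MC.sv_nonneg)
  have "\<bar>s' - s\<bar> = norm (deriv (deriv La) (of_real \<xi>) - deriv (deriv La) 0)"
   unfolding ss s(2) by (simp flip: of_real_diff)
  also have "... <= 6 * (2 + SV N) / (rad / 4) ^ 3 * norm (cor \<xi> - 0)"
   by (rule second_deriv_lipschitz[OF La(1) rad_pos La(3)]) (use \<xi>r rad_pos in auto)
  also have "... <= 6 * (2 + SV N) / (rad / 4) ^ 3 * (ep / 24 * (rad / 4) ^ 3)"
   using \<xi> SV0 rad_pos by (intro mult_left_mono) (auto simp: r_def)
  also have "... = ep / 4 * (2 + SV N)" using rad_pos by simp
  finally have "ep / 4 * SV N - D <= s' - 4 * L'\<^sup>2" using s(1) by (simp add: D_def algebra_simps abs_le_iff)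
  also have "... <= q * H.SV N" using s'(1) SV0 by (simp add: q_def algebra_simps)
  finally have "(ep / 4 * SV N - D) / q <= H.SV N" using q by (simp add: divide_le_eq mult.commute)
  then have "(ep / 4 * SV N - D) / q / B <= H.SV N / B" using B by (intro divide_right_mono) auto
  then have HS: "ep / 4 / q / B * SV N - D / q / B <= H.SV N / B" by (simp add: diff_divide_distrib)
  define u where "u = (ta - ta')\<^sup>2"
  have "\<bar>ta - ta'\<bar> <= 1" by (rule order_trans[OF ta]) (simp only: \<delta>_def min.cobounded1)
  from power_le_one[OF _ this, of 2] have u: "0 <= u" "u <= 1" by (auto simp: u_def)
  have Cm'0: "\<bar>ta - ta'\<bar> * Cm' <= 1"
  proof -
   have "\<bar>ta - ta'\<bar> * Cm' <= \<bar>ta - ta'\<bar> * \<bar>Cm'\<bar>" by (intro mult_left_mono) auto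
   also have "... <= 1 / (\<bar>Cm'\<bar> + 1) * \<bar>Cm'\<bar>" using ta by (intro mult_right_mono) (auto simp: \<delta>_def)
   also have "... <= 1" by (simp add: divide_le_eq)
   finally show ?thesis .
  qed
  have nT: "norm (D.tilted.T (H.Wf (\<i> * of_real t)) 0 N (\<lambda>_. 1) x) = norm (vv 0 N (of_real \<xi> + \<i> * of_real t) x) / norm (vv 0 N (of_real \<xi>) x)" for t
   using tv[of "\<i> * of_real t" "\<lambda>_. 0"] by (simp add: norm_mult norm_divide prod_norm[symmetric] norm_iI)
  have "norm (D.tilted.T (H.Wf (\<i> * of_real ta)) 0 N (\<lambda>_. 1) x) * norm (D.tilted.T (H.Wf (\<i> * of_real ta')) 0 N (\<lambda>_. 1) x)
   <= exp (- (e' * (ta - ta')\<^sup>2 / 2) * ((\<Sum>j=0..<0+N. H.MC.sv j) / B - 1))"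
   unfolding B_def
   by (rule H.pair_decay) (use Cm'0 x in \<open>auto simp: Cm'_def L'_def B_def intro: bfun_const\<close>)
  also have "... <= exp (- c * u * SV N + e' / 2 * (D / q / B + 1))"
  proof -
   have "e' / 2 * u * (ep / 4 / q / B * SV N - D / q / B) <= e' / 2 * u * (H.SV N / B)"
    using HS e' u by (intro mult_left_mono) auto
   moreover have "u * (e' / 2 * (D / q / B + 1)) <= 1 * (e' / 2 * (D / q / B + 1))"
    using u e' q B eps_pos by (intro mult_right_mono) (auto simp: D_def)
   ultimately show ?thesis by (simp add: c_def u_def[symmetric] atLeast0LessThan algebra_simps)
  qed
  also have "... = C * exp (- c * (ta - ta')\<^sup>2 * SV N)" by (simp only: exp_add C_def u_def mult.commute)
  finally have "norm (vv 0 N (of_real \<xi> + \<i> * of_real ta) x) / norm (vv 0 N (of_real \<xi>) x)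
   * (norm (vv 0 N (of_real \<xi> + \<i> * of_real ta') x) / norm (vv 0 N (of_real \<xi>) x)) <= C * exp (- c * (ta - ta')\<^sup>2 * SV N)"
   unfolding nT .
  moreover have "0 < norm (vv 0 N (of_real \<xi>) x)" using La(2)[OF \<xi>b] by simp
  ultimately show ?thesis using B by (simp add: field_simps power2_eq_square)
 qed
 have "0 < B" using main[of 0 0 0 "base 0" 0] r \<delta> base_in by simp
 then have "0 < c" using e' q eps_pos by (simp add: c_def)
 moreover have "0 < C" by (simp add: C_def)
 ultimately show ?thesis using r \<delta> main by blast
qed

end

section \<open>Harmonic families and reduction of the range\<close>

context elliptic_chain
begin

definition msq :: "nat => ('a => complex) => real" where "msq n g = (LINT y|M n. (norm (g y))\<^sup>2)"

lemma msq_nonneg: "0 <= msq n g" by (simp add: msq_def)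

lemma msq_le_1:
 assumes "bfun (M n) g" "!!y. y \<in> St n ==> norm (g y) <= 1"
 shows "msq n g <= 1"
proof -
 interpret prob_space "M n" by (rule prob_M)
 have "norm (LINT y|M n. (norm (g y))\<^sup>2) <= 1"
  using assms(2) by (intro norm_integral_le_const) (auto intro!: power_le_one)
 then show ?thesis by (simp add: msq_def)
qed

lemma msq_parallelogram:
 assumes g: "bfun (M n) g" and h: "bfun (M n) h"
 shows "msq n (\<lambda>y. (g y - h y) / 2) = (msq n g + msq n h) / 2 - msq n (\<lambda>y. (g y + h y) / 2)"
proof -
 interpret prob_space "M n" by (rule prob_M)
 have i: "integrable (M n) (\<lambda>y. (norm (g y))\<^sup>2)" "integrable (M n) (\<lambda>y. (norm (h y))\<^sup>2)"
  "integrable (M n) (\<lambda>y. (norm ((g y + h y) / 2))\<^sup>2)"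
  by (intro bfun_integrable bfun_power bfun_norm bfun_divide_const bfun_add g h)+
 have "(norm ((a - b) / 2))\<^sup>2 = ((norm a)\<^sup>2 + (norm b)\<^sup>2) / 2 - (norm ((a + b) / 2))\<^sup>2" for a b :: complex
  unfolding norm_divide power_divide cmod_power2 by (simp add: power2_eq_square field_simps)
 then have "msq n (\<lambda>y. (g y - h y) / 2) = (LINT y|M n. ((norm (g y))\<^sup>2 + (norm (h y))\<^sup>2) / 2 - (norm ((g y + h y) / 2))\<^sup>2)"
  unfolding msq_def by simp
 also have "... = (msq n g + msq n h) / 2 - msq n (\<lambda>y. (g y + h y) / 2)"
  unfolding msq_def using i by simp
 finally show ?thesis .
qed

text \<open>As the kernels have bounded densities, closeness in mean square at time
  \<open>Suc n\<close> gives uniform closeness at time \<open>n\<close>. This is how norm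
  convergence becomes pointwise convergence.\<close>

lemma T1_diff_le:
 assumes W: "bwt W" "!!n x y. x \<in> St n ==> y \<in> St (Suc n) ==> norm (W n (x, y)) <= 1"
  and g: "bfun (M (Suc n)) g" and h: "bfun (M (Suc n)) h" and x: "x \<in> St n"
 shows "norm (T1 W n g x - T1 W n h x) <= \<beta> * (2 * sqrt (msq (Suc n) (\<lambda>y. (g y - h y) / 2)))"
proof -
 interpret N: prob_space "M (Suc n)" by (rule prob_M)
 interpret k: prob_space "kern n x" using x by (rule prob_kern)
 define d where "d y = norm ((g y - h y) / 2)" for y
 have d: "bfun (M (Suc n)) d" unfolding d_def[abs_def] by (intro bfun_norm bfun_divide_const bfun_diff g h)
 have gh: "bfun (M (Suc n)) (\<lambda>y. W n (x, y) * (g y - h y))" by (intro bfun_T1_integrand W bfun_diff g h x)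
 have "T1 W n g x - T1 W n h x = T1 W n (\<lambda>y. 1 * g y + (- 1) * h y) x" unfolding T1_lin[OF W(1) g h x] by simp
 also have "... = (LINT y|kern n x. W n (x, y) * (g y - h y))" by (simp add: T1_def)
 finally have "norm (T1 W n g x - T1 W n h x) <= (LINT y|kern n x. norm (W n (x, y) * (g y - h y)))"
  by (simp only: integral_norm_bound)
 also have "... <= (LINT y|kern n x. 2 * d y)"
 proof (intro integral_mono integrable_kern[OF x] bfun_norm gh bfun_mult bfun_const d)
  fix y assume "y \<in> space (kern n x)"
  then have "norm (W n (x, y)) <= 1" using W(2)[OF x] by simp
  then have "norm (W n (x, y)) * norm (g y - h y) <= 1 * norm (g y - h y)" by (intro mult_right_mono) auto
  then show "norm (W n (x, y) * (g y - h y)) <= 2 * d y" by (simp add: norm_mult d_def norm_divide)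
 qed
 also have "... = 2 * (LINT y|kern n x. d y)" by simp
 also have "... <= 2 * (\<beta> * (LINT y|M (Suc n). d y))"
  by (intro mult_left_mono kern_le[OF x d]) (auto simp: d_def)
 also have "... <= 2 * (\<beta> * sqrt (msq (Suc n) (\<lambda>y. (g y - h y) / 2)))"
 proof -
  have "(LINT y|M (Suc n). d y) <= sqrt (msq (Suc n) (\<lambda>y. (g y - h y) / 2))"
   unfolding msq_def d_def[symmetric]
   by (intro real_le_rsqrt N.integral_sq_le N.bfun_integrable bfun_power d)
  then show ?thesis using beta_nonneg by (intro mult_left_mono) auto
 qed
 finally show ?thesis by (simp add: mult.left_commute)
qed

text \<open>A family of (almost) minimal norm inside the decreasing convex sets of families that are harmonic
 up to time \<open>N\<close> is Cauchy, by the parallelogram law.\<close>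

theorem harmonic_family:
 assumes W: "bwt W" "!!n x y. x \<in> St n ==> y \<in> St (Suc n) ==> norm (W n (x, y)) <= (1::real)"
  and x: "x \<in> St 0" and c: "0 < c"
  and v: "!!N. \<exists>v. bfun (M N) v \<and> (\<forall>y\<in>St N. norm (v y) <= 1) \<and> c <= norm (T W 0 N v x :: complex)"
 shows "\<exists>u. (\<forall>n. bfun (M n) (u n)) \<and> (\<forall>n. \<forall>y\<in>St n. norm (u n y) <= 1)
  \<and> (\<forall>n. \<forall>y\<in>St n. u n y = T1 W n (u (Suc n)) y) \<and> c <= Re (u 0 x)"
proof -
 define KK where "KK N = {u. (\<forall>n. bfun (M n) (u n)) \<and> (\<forall>n. \<forall>y\<in>St n. norm (u n y) <= 1)
  \<and> (\<forall>n<N. \<forall>y\<in>St n. u n y = T1 W n (u (Suc n)) y) \<and> c <= Re (u 0 x)}" for N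
 \<comment> \<open>The geometric weights keep the squared norm of a whole family at most 2, and the
   truncation at \<open>N\<close> matches the constraint set \<open>KK N\<close>.\<close>
 define Ph where "Ph N u = (\<Sum>n\<le>N. (1 / 2) ^ n * msq n (u n))" for N :: nat and u
 have KKD: "bfun (M n) (u n)" "y \<in> St n ==> norm (u n y) <= 1" "c <= Re (u 0 x)"
  "n < N ==> y \<in> St n ==> u n y = T1 W n (u (Suc n)) y" if "u \<in> KK N" for u N n y
  using that by (auto simp: KK_def)
 have KK_mono: "KK N' \<subseteq> KK N" if "N <= N'" for N N' using that by (auto simp: KK_def)
 have KK_ne: "KK N \<noteq> {}" for N
 proof -
  obtain v where v: "bfun (M N) v" "\<forall>y\<in>St N. norm (v y) <= 1" "c <= norm (T W 0 N v x)"
   using assms(5)[of N] by blast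
  \<comment> \<open>A lower bound on the norm at \<open>x\<close> would not be a convex constraint;
    after this rotation it is one on the real part.\<close>
  define s where "s = cnj (sgn (T W 0 N v x))"
  have "T W 0 N v x \<noteq> 0" using v(3) c by auto
  then have s: "norm s = 1" by (simp add: s_def norm_sgn)
  define u where "u n = (if n <= N then T W n (N - n) (\<lambda>y. s * v y) else (\<lambda>_. 0))" for n
  have sv: "bfun (M N) (\<lambda>y. s * v y)" using v by (intro bfun_mult bfun_const)
  have "bfun (M n) (u n)" for n
   using T_bfun[OF W(1), of n "N - n" "\<lambda>y. s * v y"] sv by (auto simp: u_def)
  moreover have "norm (u n y) <= 1" if "y \<in> St n" for n y
   using T_norm_le_1[OF W, of n "N - n" "\<lambda>y. s * v y" 1 y] sv v s that by (auto simp: u_def norm_mult)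
  moreover have "u n y = T1 W n (u (Suc n)) y" if "n < N" "y \<in> St n" for n y
  proof -
   have "N - n = Suc (N - Suc n)" using that by simp
   then show ?thesis using that by (simp add: u_def)
  qed
  moreover have "c <= Re (u 0 x)"
  proof -
   have "u 0 x = s * T W 0 N v x"
    using T_cmult[OF W(1), of 0 N v x s] v x by (simp add: u_def)
   also have "... = of_real (norm (T W 0 N v x))"
    using \<open>T W 0 N v x \<noteq> 0\<close> complex_norm_square[of "T W 0 N v x"]
    by (simp add: s_def sgn_div_norm scaleR_conv_of_real field_simps power2_eq_square)
   finally show ?thesis using v(3) by simp
  qed
  ultimately have "u \<in> KK N" by (auto simp: KK_def)
  then show ?thesis by blast
 qed
 have Ph0: "0 <= Ph N u" for N u unfolding Ph_def by (intro sum_nonneg mult_nonneg_nonneg msq_nonneg) auto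
 have Ph2: "Ph N u <= 2" if "u \<in> KK N'" for N N' u
 proof -
  have "Ph N u <= (\<Sum>n\<le>N. (1 / 2) ^ n * 1)"
   unfolding Ph_def using KKD[OF that] by (intro sum_mono mult_left_mono msq_le_1) auto
  also have "(\<Sum>n\<le>N. (1 / 2) ^ n * 1) = 2 - (1 / 2 :: real) ^ N" by (induction N) auto
  also have "... <= 2" by simp
  finally show ?thesis .
 qed
 have Ph_mono: "Ph N u <= Ph N' u" if "N <= N'" for N N' u
  unfolding Ph_def using that by (intro sum_mono2) (auto intro: mult_nonneg_nonneg msq_nonneg)
 define I where "I N = (INF u\<in>KK N. Ph N u)" for N
 have bdd: "bdd_below (Ph N ` A)" for N A using Ph0 by (intro bdd_belowI[of _ 0]) auto
 have I_le: "I N <= Ph N u" if "u \<in> KK N" for N u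
  unfolding I_def by (rule cINF_lower[OF bdd that])
 have I_mono: "I N <= I N'" if "N <= N'" for N N'
  unfolding I_def[of N']
 proof (rule cINF_greatest[OF KK_ne])
  fix u assume "u \<in> KK N'"
  then have "u \<in> KK N" using KK_mono[OF that] by blast
  from I_le[OF this] Ph_mono[OF that, of u] show "I N <= Ph N' u" by simp
 qed
 have I2: "I N <= 2" for N
 proof -
  obtain u where u: "u \<in> KK N" using KK_ne by blast
  show ?thesis using I_le[OF u] Ph2[OF u, of N] by simp
 qed
 have "\<exists>u\<in>KK N. Ph N u < I N + (1 / 2) ^ N" for N
 proof -
  have "\<exists>a\<in>Ph N ` KK N. a < I N + (1 / 2) ^ N"
   by (rule cInf_lessD) (use KK_ne in \<open>auto simp: I_def\<close>)
  then show ?thesis by blast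
 qed
 then obtain U where U: "!!N. U N \<in> KK N" "!!N. Ph N (U N) < I N + (1 / 2) ^ N" by metis
 define L where "L = (SUP N. I N)"
 have I_L: "I N <= L" for N unfolding L_def using I2 by (intro cSUP_upper bdd_aboveI[of _ 2]) auto
 have I_tends: "I \<longlonglongrightarrow> L"
  unfolding L_def using I2 I_mono by (intro LIMSEQ_incseq_SUP bdd_aboveI[of _ 2]) (auto simp: incseq_def)
 define \<eta> where "\<eta> N = (L - I N) + 2 * (1 / 2) ^ N" for N :: nat
 have \<eta>_tends: "\<eta> \<longlonglongrightarrow> 0"
  unfolding \<eta>_def using I_tends LIMSEQ_power_zero[of "1 / 2 :: real"] by (auto intro!: tendsto_eq_intros)
 \<comment> \<open>The midpoint of two members lies in the convex set \<open>KK N\<close>, so its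
   norm is at least the infimum \<open>I N\<close>; the parallelogram law then bounds the difference
   by the excess over \<open>I N\<close>.\<close>
 have diff: "(1 / 2) ^ n * msq n (\<lambda>y. (U N n y - U N' n y) / 2) <= \<eta> N" if "n <= N" "N <= N'" for n N N'
 proof -
  have UN': "U N' \<in> KK N" using U(1)[of N'] KK_mono[OF that(2)] by blast
  note D = KKD[OF U(1)[of N]] and D' = KKD[OF UN']
  have mid: "(\<lambda>n y. (U N n y + U N' n y) / 2) \<in> KK N"
  proof -
   have "T1 W n (\<lambda>y. (U N (Suc n) y + U N' (Suc n) y) / 2) y = (U N n y + U N' n y) / 2"
    if "n < N" "y \<in> St n" for n y
    using T1_lin[OF W(1) D(1)[of "Suc n"] D'(1)[of "Suc n"] that(2), of "1 / 2" "1 / 2"] D(4)[OF that] D'(4)[OF that]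
    by (simp add: add_divide_distrib)
   moreover have "norm ((U N n y + U N' n y) / 2) <= 1" if "y \<in> St n" for n y
    using norm_triangle_ineq[of "U N n y" "U N' n y"] D(2)[OF that] D'(2)[OF that] by (simp add: norm_divide)
   moreover have "bfun (M n) (\<lambda>y. (U N n y + U N' n y) / 2)" for n by (intro bfun_divide_const bfun_add D D')
   moreover have "c <= Re ((U N 0 x + U N' 0 x) / 2)" using D(3) D'(3) by simp
   ultimately show ?thesis by (simp add: KK_def)
  qed
  have "(1 / 2) ^ n * msq n (\<lambda>y. (U N n y - U N' n y) / 2) <= Ph N (\<lambda>n y. (U N n y - U N' n y) / 2)"
   unfolding Ph_def by (rule member_le_sum[where f = "\<lambda>n. (1 / 2) ^ n * msq n (\<lambda>y. (U N n y - U N' n y) / 2)"])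
    (use that in \<open>auto intro: mult_nonneg_nonneg msq_nonneg\<close>)
  also have "... = (\<Sum>n\<le>N. (1 / 2) ^ n * ((msq n (U N n) + msq n (U N' n)) / 2 - msq n (\<lambda>y. (U N n y + U N' n y) / 2)))"
   unfolding Ph_def using msq_parallelogram[OF D(1) D'(1)] by simp
  also have "... = (Ph N (U N) + Ph N (U N')) / 2 - Ph N (\<lambda>n y. (U N n y + U N' n y) / 2)"
   by (simp add: Ph_def algebra_simps sum.distrib sum_subtractf sum_divide_distrib add_divide_distrib)
  also have "... <= ((I N + (1 / 2) ^ N) + (L + (1 / 2) ^ N)) / 2 - I N"
  proof -
   have "(1 / 2 :: real) ^ N' <= (1 / 2) ^ N" by (rule power_decreasing[OF that(2)]) auto
   then show ?thesis
    using U(2)[of N] U(2)[of N'] Ph_mono[OF that(2), of "U N'"] I_L[of N'] I_le[OF mid] by argo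
  qed
  also have "... <= \<eta> N" using I_L[of N] zero_le_power[of "1 / 2 :: real" N] unfolding \<eta>_def by argo
  finally show ?thesis .
 qed
 have near: "norm (U N n y - U N' n y) <= \<beta> * (2 * sqrt (2 ^ Suc n * \<eta> N))"
  if n: "n < N" "N <= N'" and y: "y \<in> St n" for n N N' y
 proof -
  have nN': "n < N'" using n by simp
  have "norm (U N n y - U N' n y) <= \<beta> * (2 * sqrt (msq (Suc n) (\<lambda>y. (U N (Suc n) y - U N' (Suc n) y) / 2)))"
   unfolding KKD(4)[OF U(1) n(1) y] KKD(4)[OF U(1) nN' y]
   by (rule T1_diff_le[OF W KKD(1)[OF U(1)] KKD(1)[OF U(1)] y])
  also have "... <= \<beta> * (2 * sqrt (2 ^ Suc n * \<eta> N))"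
  proof (intro mult_left_mono real_sqrt_le_mono)
   have "2 ^ Suc n * ((1 / 2) ^ Suc n * msq (Suc n) (\<lambda>y. (U N (Suc n) y - U N' (Suc n) y) / 2)) <= 2 ^ Suc n * \<eta> N"
    using diff[of "Suc n" N N'] n by (intro mult_left_mono) auto
   then show "msq (Suc n) (\<lambda>y. (U N (Suc n) y - U N' (Suc n) y) / 2) <= 2 ^ Suc n * \<eta> N"
    by (simp only: mult.assoc[symmetric] power_mult_distrib[symmetric]) simp
  qed (use beta_nonneg in auto)
  finally show ?thesis .
 qed
 have conv: "convergent (\<lambda>N. U N n y)" if y: "y \<in> St n" for n y
 proof -
  have "(\<lambda>N. \<beta> * (2 * sqrt (2 ^ Suc n * \<eta> N))) \<longlonglongrightarrow> 0"
   using \<eta>_tends by (auto intro!: tendsto_eq_intros)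
  have "Cauchy (\<lambda>N. U N n y)"
  proof (rule metric_CauchyI)
   fix e :: real assume e: "0 < e"
   from order_tendstoD(2)[OF \<open>(\<lambda>N. \<beta> * (2 * sqrt (2 ^ Suc n * \<eta> N))) \<longlonglongrightarrow> 0\<close>, of "e / 2"] e
   obtain N0 where N0: "!!N. N >= N0 ==> \<beta> * (2 * sqrt (2 ^ Suc n * \<eta> N)) < e / 2"
    by (auto simp: eventually_sequentially)
   define N1 where "N1 = max N0 (Suc n)"
   have N1: "dist (U N1 n y) (U N n y) < e / 2" if "N >= N1" for N
   proof -
    have "n < N1" "N0 <= N1" by (auto simp: N1_def)
    then show ?thesis using near[OF _ that y] N0[of N1] unfolding dist_norm by simp
   qed
   have "dist (U N n y) (U N' n y) < e" if "N >= N1" "N' >= N1" for N N'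
    using N1[OF that(1)] N1[OF that(2)] dist_triangle_half_r by blast
   then show "\<exists>N1. \<forall>N\<ge>N1. \<forall>N'\<ge>N1. dist (U N n y) (U N' n y) < e" by blast
  qed
  then show ?thesis by (rule Cauchy_convergent)
 qed
 define u where "u n y = lim (\<lambda>N. U N n y)" for n y
 have lim: "(\<lambda>N. U N n y) \<longlonglongrightarrow> u n y" if "y \<in> St n" for n y
  unfolding u_def using conv[OF that] by (simp add: convergent_LIMSEQ_iff)
 have u1: "norm (u n y) <= 1" if y: "y \<in> St n" for n y
  by (rule LIMSEQ_le_const2[OF tendsto_norm[OF lim[OF y]]]) (use KKD(2)[OF U(1) y] in auto)
 have ub: "bfun (M n) (u n)" for n
 proof (rule bfunI[OF _ u1])
  have m: "U N n \<in> borel_measurable (M n)" for N by (rule bfun_measurable[OF KKD(1)[OF U(1)]])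
  show "u n \<in> borel_measurable (M n)" unfolding u_def[abs_def] by (rule borel_measurable_lim_metric[OF m])
 qed
 have "u n y = T1 W n (u (Suc n)) y" if y: "y \<in> St n" for n y
 proof -
  interpret k: prob_space "kern n y" using y by (rule prob_kern)
  have "(\<lambda>N. T1 W n (U N (Suc n)) y) \<longlonglongrightarrow> T1 W n (u (Suc n)) y"
   unfolding T1_def
  proof (rule integral_dominated_convergence[where w = "\<lambda>_. 1"])
   show "(\<lambda>z. W n (y, z) * u (Suc n) z) \<in> borel_measurable (kern n y)"
    using integrable_kern[OF y bfun_T1_integrand[OF W(1) ub y]] by simp
   show "(\<lambda>z. W n (y, z) * U N (Suc n) z) \<in> borel_measurable (kern n y)" for N
    using integrable_kern[OF y bfun_T1_integrand[OF W(1) KKD(1)[OF U(1)] y]] by simp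
   show "AE z in kern n y. (\<lambda>N. W n (y, z) * U N (Suc n) z) \<longlonglongrightarrow> W n (y, z) * u (Suc n) z"
    by (intro AE_I2 tendsto_mult tendsto_const lim) simp
   show "AE z in kern n y. norm (W n (y, z) * U N (Suc n) z) <= 1" for N
    using W(2)[OF y] KKD(2)[OF U(1)] by (intro AE_I2) (auto simp: norm_mult intro: mult_le_one)
  qed simp
  moreover have "\<forall>\<^sub>F N in sequentially. T1 W n (U N (Suc n)) y = U N n y"
   using eventually_gt_at_top[of n] by eventually_elim (simp add: KKD(4)[OF U(1) _ y])
  ultimately have "(\<lambda>N. U N n y) \<longlonglongrightarrow> T1 W n (u (Suc n)) y" by (rule Lim_transform_eventually)
  then show ?thesis using lim[OF y] by (rule LIMSEQ_unique[rotated])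
 qed
 moreover have "c <= Re (u 0 x)"
  by (rule LIMSEQ_le_const[OF tendsto_Re[OF lim[OF x]]]) (use KKD(3)[OF U(1)] in auto)
 ultimately show ?thesis using u1 ub by blast
qed

end

text \<open>The principal argument, in a form whose measurability is immediate.\<close>

definition ang :: "complex => real" where
 "ang z = (if z \<in> \<real>\<^sub>\<le>\<^sub>0 then pi else Im (Ln z))"

lemma ang_measurable [measurable]: "ang \<in> borel_measurable borel"
 unfolding ang_def[abs_def]
 by (rule borel_measurable_continuous_on_if) (auto intro!: borel_closed continuous_intros)

lemma ang_le: "\<bar>ang z\<bar> <= pi"
 using mpi_less_Im_Ln[of z] Im_Ln_le_pi[of z] by (cases "z = 0") (auto simp: ang_def)

lemma ang_polar: "z = of_real (norm z) * exp (\<i> * of_real (ang z))"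
proof (cases "z \<in> \<real>\<^sub>\<le>\<^sub>0")
 case True
 then obtain r where "z = of_real r" "r <= 0" by (auto elim: nonpos_Reals_cases)
 then show ?thesis using True by (simp add: ang_def exp_pi_i')
next
 case False
 then have z: "z \<noteq> 0" by auto
 have "of_real (ln (norm z)) + \<i> * of_real (ang z) = Ln z"
  using False z by (simp add: complex_eq_iff ang_def Re_Ln)
 then have "exp (of_real (ln (norm z)) + \<i> * of_real (ang z)) = z" using z by simp
 then show ?thesis using z by (simp add: exp_add exp_of_real)
qed

text \<open>Near 1 the logarithm is Lipschitz; otherwise the right-hand side is at least
  \<open>pi\<close>.\<close>

lemma abs_le_norm_iexp_minus_1:
 assumes b: "\<bar>b\<bar> <= pi"
 shows "\<bar>b\<bar> <= 2 * pi * norm (exp (\<i> * cor b) - 1)"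
proof (cases "norm (exp (\<i> * cor b) - 1) < 1 / 2")
 case True
 have "b \<noteq> - pi"
 proof
  assume "b = - pi"
  then have "exp (\<i> * cor b) = - 1" by (simp add: exp_minus exp_pi_i')
  then show False using True by simp
 qed
 then have "Ln (exp (\<i> * cor b)) = \<i> * cor b"
  using b by (intro Ln_exp) auto
 then have "\<bar>b\<bar> = norm (Ln (exp (\<i> * cor b)))" by (simp add: norm_mult)
 also have "... <= 2 * norm (exp (\<i> * cor b) - 1)" by (rule norm_Ln_near_1[OF True])
 also have "... <= 2 * pi * norm (exp (\<i> * cor b) - 1)"
  using pi_ge_two by (intro mult_right_mono) auto
 finally show ?thesis .
next
 case False
 have "\<bar>b\<bar> <= 2 * pi * (1 / 2)" using b by simp
 also have "... <= 2 * pi * norm (exp (\<i> * cor b) - 1)"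
  using False by (intro mult_left_mono) auto
 finally show ?thesis .
qed

lemma (in prob_space) integral_sq_diff_const:
 fixes w :: "'a => real"
 assumes "integrable M w" "integrable M (\<lambda>z. (w z)\<^sup>2)"
 shows "(LINT z|M. (w z - a)\<^sup>2) = (LINT z|M. (w z)\<^sup>2) - 2 * a * (LINT z|M. w z) + a\<^sup>2"
proof -
 have "(LINT z|M. (w z - a)\<^sup>2) = (LINT z|M. (w z)\<^sup>2 - 2 * a * w z + a\<^sup>2)"
  by (simp add: power2_diff algebra_simps)
 then show ?thesis using assms prob_space by simp
qed

section \<open>Asymptotic rigidity of moduli and phases\<close>

context chain_process
begin

lemma markov_PT_real:
 fixes A :: "'w => real" and h :: "'a => real"
 assumes n: "n >= s" and A: "bfun (F n) A" and h: "bfun (M (n + k)) h"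
 shows "(LINT om|Om. A om * h (X (n + k) om)) = (LINT om|Om. A om * PT n k h (X n om))"
proof -
 have "cor (LINT om|Om. A om * h (X (n + k) om))
  = (LINT om|Om. of_real (A om) * ((\<Prod>j<k. (\<lambda>n xy. 1) (n + j) (XX (n + j) om)) * of_real (h (X (n + k) om))))"
  by (simp flip: of_real_mult)
 also have "... = (LINT om|Om. of_real (A om) * T (\<lambda>n xy. 1) n k (\<lambda>y. of_real (h y)) (X n om))"
  by (rule markov_T[OF n bfun_of_real[OF A] bwt_1 bfun_of_real[OF h]])
 also have "... = (LINT om|Om. cor (A om * PT n k h (X n om)))"
  using T_of_real[of _ n "\<lambda>_ _. 1" k h] X_space[OF n]
  by (intro Bochner_Integration.integral_cong) auto
 finally show ?thesis by (simp only: integral_complex_of_real of_real_eq_iff)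
qed

text \<open>Given \<open>X n\<close>, the law two steps later dominates \<open>ep\<close> times the
  reference measure. If \<open>w'\<close> there is close to the value \<open>w (X n om)\<close>,
  then \<open>w'\<close> is nearly constant. Jensen's inequality replaces the random value by its
  mean.\<close>

lemma two_step_square_ge:
 fixes w w' :: "'a => real"
 assumes n: "n >= s" and w: "bfun (M n) w" and w': "bfun (M (n + 2)) w'"
 shows "ep * (\<integral>z. (w' z - (LINT om|Om. w (X n om)))\<^sup>2 \<partial>M (n + 2)) <= (LINT om|Om. (w' (X (n + 2) om) - w (X n om))\<^sup>2)"
proof -
 interpret N: prob_space "M (n + 2)" by (rule prob_M)
 define m where "m = (LINT om|Om. w (X n om))"
 define A1 where "A1 = (\<integral>z. w' z \<partial>M (n + 2))"
 define A2 where "A2 = (\<integral>z. (w' z)\<^sup>2 \<partial>M (n + 2))"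
 have sq: "bfun (M (n + 2)) (\<lambda>z. (w' z)\<^sup>2)" by (rule bfun_power[OF w'])
 have expand: "(\<integral>z. (w' z - a)\<^sup>2 \<partial>M (n + 2)) = A2 - 2 * a * A1 + a\<^sup>2" for a
  unfolding A1_def A2_def by (rule N.integral_sq_diff_const) (intro N.bfun_integrable w' sq)+
 have nk: "n + 2 >= s" using n by simp
 have wF: "bfun (F n) (\<lambda>om. w (X n om))" by (rule bfun_X[OF n order_refl w])
 have b: "bfun Om (\<lambda>om. w (X n om))" "bfun Om (\<lambda>om. w' (X (n + 2) om))" by (rule bfun_XOm[OF n w], rule bfun_XOm[OF nk w'])
 have bP: "bfun Om (\<lambda>om. PT n 2 w' (X n om))" "bfun Om (\<lambda>om. PT n 2 (\<lambda>z. (w' z)\<^sup>2) (X n om))"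
  by (rule bfun_XOm[OF n T_bfun[OF bwt_1 w']], rule bfun_XOm[OF n T_bfun[OF bwt_1 sq]])
 note i = bfun_Om_integrable[OF b(1)] bfun_Om_integrable[OF bfun_power[OF b(1), of 2]] bfun_Om_integrable[OF bfun_power[OF b(2), of 2]]
  bfun_Om_integrable[OF bfun_mult[OF b(1) b(2)]] bfun_Om_integrable[OF bfun_mult[OF b(1) bP(1)]] bfun_Om_integrable[OF bP(2)]
 have "m\<^sup>2 <= (LINT om|Om. (w (X n om))\<^sup>2)" unfolding m_def by (rule Om.integral_sq_le[OF i(2,1)])
 then have "ep * (\<integral>z. (w' z - m)\<^sup>2 \<partial>M (n + 2)) <= ep * (A2 - 2 * m * A1 + (LINT om|Om. (w (X n om))\<^sup>2))"
  unfolding expand using eps_pos by (intro mult_left_mono) auto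
 also have "... = (LINT om|Om. ep * (A2 - 2 * A1 * w (X n om) + (w (X n om))\<^sup>2))"
  using i Om.prob_space by (simp add: m_def)
 also have "... <= (LINT om|Om. PT n 2 (\<lambda>z. (w' z)\<^sup>2) (X n om) - 2 * (w (X n om) * PT n 2 w' (X n om)) + (w (X n om))\<^sup>2)"
 proof (rule integral_mono)
  fix om assume "om \<in> space Om"
  then have x: "X n om \<in> St n" by (rule X_space[OF n])
  define a where "a = w (X n om)"
  have ge: "ep * (\<integral>z. (w' z - a)\<^sup>2 \<partial>M (n + 2)) <= PT n 2 (\<lambda>z. (w' z - a)\<^sup>2) (X n om)"
   by (rule PT_ge[OF order_refl _ _ x]) (intro bfun_power bfun_diff w' bfun_const, simp)
  have "(\<lambda>z. (w' z - a)\<^sup>2) = (\<lambda>z. 1 * (w' z)\<^sup>2 + 1 * ((- 2 * a) * w' z + a\<^sup>2 * 1))"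
   by (simp add: power2_diff fun_eq_iff)
  then have "PT n 2 (\<lambda>z. (w' z - a)\<^sup>2) (X n om) = PT n 2 (\<lambda>z. 1 * (w' z)\<^sup>2 + 1 * ((- 2 * a) * w' z + a\<^sup>2 * 1)) (X n om)" by (simp only:)
  also have "... = 1 * PT n 2 (\<lambda>z. (w' z)\<^sup>2) (X n om) + 1 * PT n 2 (\<lambda>z. (- 2 * a) * w' z + a\<^sup>2 * 1) (X n om)"
   by (rule T_lin[OF bwt_1 sq _ x]) (intro bfun_add bfun_mult bfun_const w')
  also have "PT n 2 (\<lambda>z. (- 2 * a) * w' z + a\<^sup>2 * 1) (X n om) = (- 2 * a) * PT n 2 w' (X n om) + a\<^sup>2 * PT n 2 (\<lambda>_. 1) (X n om)"
   by (rule T_lin[OF bwt_1 w' bfun_const x])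
  also have "PT n 2 (\<lambda>_. 1) (X n om) = (1::real)" by (rule T_one_const[OF x])
  finally have e: "PT n 2 (\<lambda>z. (w' z - a)\<^sup>2) (X n om) = PT n 2 (\<lambda>z. (w' z)\<^sup>2) (X n om) - 2 * (a * PT n 2 w' (X n om)) + a\<^sup>2"
   by argo
  have "A2 - 2 * A1 * a + a\<^sup>2 = A2 - 2 * a * A1 + a\<^sup>2" by simp
  then show "ep * (A2 - 2 * A1 * w (X n om) + (w (X n om))\<^sup>2)
   <= PT n 2 (\<lambda>z. (w' z)\<^sup>2) (X n om) - 2 * (w (X n om) * PT n 2 w' (X n om)) + (w (X n om))\<^sup>2"
   using ge unfolding expand e a_def[symmetric] by (simp only:)
 qed (use i in simp_all)
 also have "... = (LINT om|Om. PT n 2 (\<lambda>z. (w' z)\<^sup>2) (X n om)) - 2 * (LINT om|Om. w (X n om) * PT n 2 w' (X n om)) + (LINT om|Om. (w (X n om))\<^sup>2)"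
  using i by simp
 also have "... = (LINT om|Om. (w' (X (n + 2) om))\<^sup>2) - 2 * (LINT om|Om. w (X n om) * w' (X (n + 2) om)) + (LINT om|Om. (w (X n om))\<^sup>2)"
  using markov_PT_real[OF n wF w'] markov_PT_real[OF n bfun_const[of _ 1] sq] by simp
 also have "... = (LINT om|Om. (w' (X (n + 2) om))\<^sup>2 - 2 * (w (X n om) * w' (X (n + 2) om)) + (w (X n om))\<^sup>2)"
  using i by simp
 also have "... = (LINT om|Om. (w' (X (n + 2) om) - w (X n om))\<^sup>2)"
  by (simp add: power2_diff algebra_simps)
 finally show ?thesis unfolding m_def .
qed

end

text \<open>\<open>d\<close> is the phase mismatch modulo \<open>2 * pi\<close>. The modulus is
  replaced by a deterministic \<open>r\<close>, because the modulus itself may be small at some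
  points and would then say nothing about phases.\<close>

lemma polar_diff_le:
 fixes A B :: complex
 assumes A: "A = exp (\<i> * of_real t) * (of_real wa * exp (\<i> * of_real a))" and B: "B = of_real wb * exp (\<i> * of_real b)"
  and w: "wa = norm A" "wb = norm B" and r: "0 <= r"
  and k: "t + a - b = 2 * pi * of_int k + d"
 shows "(r * norm (exp (\<i> * cor d) - 1))\<^sup>2 <= 8 * ((norm (A - B))\<^sup>2 + (wb - r)\<^sup>2)"
proof -
 have "\<i> * cor (t + a - b) = 2 * of_int k * of_real pi * \<i> + \<i> * of_real d" unfolding k by (simp add: algebra_simps)
 then have "exp (\<i> * cor (t + a - b)) = exp (2 * of_int k * of_real pi * \<i>) * exp (\<i> * of_real d)" by (simp only: exp_add)
 also have "exp (2 * of_int k * of_real pi * \<i>) = (1::complex)" using exp_integer_2pi[of "of_int k"] by simp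
 finally have ed: "exp (\<i> * cor d) = exp (\<i> * cor (t + a - b))" by simp
 have e: "exp (\<i> * cor (t + a - b)) * exp (\<i> * of_real b) = exp (\<i> * of_real t) * exp (\<i> * of_real a)"
  by (simp add: exp_add[symmetric] algebra_simps)
 have n1: "norm (exp (\<i> * cor x)) = 1" for x by simp
 have "r * norm (exp (\<i> * cor d) - 1) = norm (of_real r * (exp (\<i> * cor d) - 1) * exp (\<i> * of_real b))"
  using r by (simp add: norm_mult)
 also have "of_real r * (exp (\<i> * cor d) - 1) * exp (\<i> * of_real b)
  = of_real (r - wa) * (exp (\<i> * of_real t) * exp (\<i> * of_real a)) + ((A - B) + of_real (wb - r) * exp (\<i> * of_real b))"
 proof -
  have "of_real r * (Ed - 1) * Eb = of_real (r - wa) * (Et * Ea) + ((Et * (of_real wa * Ea) - of_real wb * Eb) + of_real (wb - r) * Eb)"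
   if "Ed * Eb = Et * Ea" for Ed Eb Et Ea :: complex
  proof -
   have "of_real r * (Ed - 1) * Eb = of_real r * (Ed * Eb) - of_real r * Eb" by (simp add: algebra_simps)
   then show ?thesis unfolding that by (simp add: algebra_simps)
  qed
  from this[OF e] show ?thesis unfolding ed A B .
 qed
 also have "norm ... <= norm (of_real (r - wa) * (exp (\<i> * of_real t) * exp (\<i> * of_real a))) + (norm (A - B) + norm (of_real (wb - r) * exp (\<i> * cor b)))"
  by (intro norm_triangle_le add_left_mono norm_triangle_ineq order_refl)
 also have "... = \<bar>r - wa\<bar> + (norm (A - B) + \<bar>wb - r\<bar>)" by (simp only: norm_mult n1 norm_of_real mult_1_right)
 also have "... <= 2 * (norm (A - B) + \<bar>wb - r\<bar>)"
  using norm_triangle_ineq3[of A B] unfolding w by argo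
 finally have "(r * norm (exp (\<i> * cor d) - 1))\<^sup>2 <= (2 * (norm (A - B) + \<bar>wb - r\<bar>))\<^sup>2"
  using r by (intro power_mono) auto
 also have "... <= 8 * ((norm (A - B))\<^sup>2 + \<bar>wb - r\<bar>\<^sup>2)"
 proof -
  have "(2 * (x + y))\<^sup>2 <= 8 * (x\<^sup>2 + y\<^sup>2)" for x y :: real
   using zero_le_power2[of "x - y"] by (simp add: power_mult_distrib power2_sum power2_diff)
  then show ?thesis .
 qed
 finally show ?thesis by simp
qed

context elliptic_chain
begin

text \<open>A mean square with respect to the reference measure: bounds derived along the chain from
  \<open>x\<close> thereby carry over to the given initial law.\<close>

definition sqk :: "nat => ('a \<times> 'a => real) => real" where
 "sqk n b = (\<integral>x. \<integral>y. (b (x, y))\<^sup>2 \<partial>kern n x \<partial>M n)"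

lemma sqk_nonneg: "0 <= sqk n b" unfolding sqk_def by (intro integral_nonneg_AE AE_I2) auto

end

context functional_process
begin

lemma E_sq_le_sqk:
 assumes b: "bfun (MM n) b" and n: "n >= 1"
 shows "(LINT om|Om. (b (XX n om))\<^sup>2) <= \<beta> * sqk n b"
proof -
 obtain m where m: "n = Suc m" using n by (cases n) auto
 have b2: "bfun (MM n) (\<lambda>z. (b z)\<^sup>2)" by (rule bfun_power[OF b])
 have "(LINT om|Om. (b (XX n om))\<^sup>2) = (LINT om|Om. 1 * (LINT y|kern n (X n om). (b (X n om, y))\<^sup>2))"
  using markov_1[OF _ b2] by simp
 also have "... <= \<beta> * sqk n b * (LINT om|Om. 1)"
  unfolding sqk_def m by (rule MP.law_le) (use kern_bfun[OF b2] in \<open>auto simp: m\<close>)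
 finally show ?thesis using Om.prob_space by simp
qed

lemma sqk_le_E_sq:
 assumes b: "bfun (MM n) b" and n: "n >= 2"
 shows "ep * sqk n b <= (LINT om|Om. (b (XX n om))\<^sup>2)"
proof -
 have b2: "bfun (MM n) (\<lambda>z. (b z)\<^sup>2)" by (rule bfun_power[OF b])
 have "ep * sqk n b <= (LINT om|Om. (LINT y|kern n (X n om). (b (X n om, y))\<^sup>2))"
  unfolding sqk_def by (rule MP.law_ge) (use kern_bfun[OF b2] n in auto)
 also have "... = (LINT om|Om. (b (XX n om))\<^sup>2)" using markov_1[OF _ b2] by simp
 finally show ?thesis .
qed

text \<open>\<open>u n (X n om)\<close> is the conditional mean of the rotated next value
  \<open>A n\<close>, so \<open>a n\<close> increases by exactly the mean square deviation
  \<open>dd n\<close>. As \<open>a n <= 1\<close>, the deviations are summable: moduli become nearly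
  constant and the phases satisfy a cocycle equation with square-summable error
  \<open>b\<close>.\<close>

theorem phase_decomposition:
 assumes u': "\<forall>n. bfun (M n) (u n)" "\<forall>n. \<forall>y\<in>St n. norm (u n y) <= 1"
  "\<forall>n. \<forall>y\<in>St n. u n y = T1 (Wf (\<i> * of_real ta)) n (u (Suc n)) y"
  and c: "0 < c" "c\<^sup>2 <= (LINT om|Om. (norm (u 0 (X 0 om)))\<^sup>2)"
 shows "\<exists>\<alpha> k b n0 B. (\<forall>n. \<alpha> n \<in> borel_measurable (M n) \<and> (\<forall>y. \<bar>\<alpha> n y\<bar> <= pi)) \<and>
  (\<forall>n. (\<lambda>xy. real_of_int (k n xy)) \<in> borel_measurable (MM n)) \<and>
  (\<forall>n. bfun (MM n) (b n)) \<and>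
  (\<forall>n y z. ta * f n (y, z) = \<alpha> n y - \<alpha> (Suc n) z + 2 * pi * of_int (k n (y, z)) + b n (y, z)) \<and>
  (\<forall>N. (\<Sum>n=n0..<N. sqk n (b n)) <= (B::real))"
proof -
 note u = u'[rule_format]
 define w where "w n y = norm (u n y)" for n y
 define e where "e n om = exp (\<i> * of_real ta * cor (f n (XX n om)))" for n om
 define A where "A n om = e n om * u (Suc n) (X (Suc n) om)" for n om
 define dd where "dd n = (LINT om|Om. (norm (A n om - u n (X n om)))\<^sup>2)" for n
 define a where "a n = (LINT om|Om. (w n (X n om))\<^sup>2)" for n
 have e1: "norm (e n om) = 1" for n om by (simp add: e_def)
 have uX: "bfun Om (\<lambda>om. u n (X n om))" for n by (rule bfun_XOm[OF _ u(1)]) simp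
 have wb: "bfun (M n) (w n)" for n unfolding w_def[abs_def] by (rule bfun_norm[OF u(1)])
 have wX: "bfun Om (\<lambda>om. w n (X n om))" for n by (rule bfun_XOm[OF _ wb]) simp
 have eb: "bfun Om (e n)" for n unfolding e_def[abs_def] using bfun_XXOm[OF _ bwtD[OF Wf_bwt]] by simp
 have Ab: "bfun Om (A n)" for n unfolding A_def[abs_def] by (rule bfun_mult[OF eb uX])
 have nA: "norm (A n om) = w (Suc n) (X (Suc n) om)" for n om by (simp add: A_def norm_mult e1 w_def)
 \<comment> \<open>Orthogonality of a conditional mean and the deviation from it.\<close>
 have dd_eq: "dd n = a (Suc n) - a n" for n
 proof -
  have hb: "bfun (MM n) (\<lambda>(y, z). Wf (\<i> * of_real ta) n (y, z) * u (Suc n) z)"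
   by (rule T1_bfun_pair[OF Wf_bwt u(1)])
  have "(LINT om|Om. cnj (u n (X n om)) * A n om) = (LINT om|Om. cnj (u n (X n om)) * u n (X n om))"
  proof -
   have "(LINT om|Om. cnj (u n (X n om)) * A n om) = (LINT om|Om. cnj (u n (X n om)) * T1 (Wf (\<i> * of_real ta)) n (u (Suc n)) (X n om))"
    using markov_mult[OF _ bfun_cnj[OF bfun_X[OF _ order_refl u(1)]] hb] by (simp add: A_def e_def T1_def)
   also have "... = (LINT om|Om. cnj (u n (X n om)) * u n (X n om))"
    using u(3)[OF X_space[of n]] by (intro Bochner_Integration.integral_cong) auto
   finally show ?thesis .
  qed
  also have "... = of_real (a n)"
   unfolding a_def w_def by (simp only: complex_norm_square mult.commute[of "cnj _"] integral_complex_of_real[symmetric])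
  finally have c1: "(LINT om|Om. cnj (u n (X n om)) * A n om) = of_real (a n)" .
  define R where "R om = Re (cnj (u n (X n om)) * A n om)" for om
  have cross: "(LINT om|Om. R om) = a n"
   unfolding R_def using c1
   using integral_Re[OF bfun_Om_integrable[OF bfun_mult[OF bfun_cnj[OF uX[of n]] Ab[of n]]]] by simp
  have i: "integrable Om (\<lambda>om. (w (Suc n) (X (Suc n) om))\<^sup>2)" "integrable Om (\<lambda>om. (w n (X n om))\<^sup>2)"
   "integrable Om R"
   unfolding R_def[abs_def] by (intro bfun_Om_integrable bfun_power wX bfun_Re bfun_mult bfun_cnj uX Ab)+
  have "dd n = (LINT om|Om. (w (Suc n) (X (Suc n) om))\<^sup>2 - 2 * R om + (w n (X n om))\<^sup>2)"
   unfolding dd_def cmod_sq_sub_mean nA w_def[symmetric] R_def ..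
  also have "... = a (Suc n) - 2 * a n + a n" using i cross by (simp add: a_def)
  finally show ?thesis by simp
 qed
 have dd0: "0 <= dd n" for n unfolding dd_def by simp
 have a_ge: "c\<^sup>2 <= a n" for n
 proof (induction n)
  case 0 then show ?case using c by (simp add: a_def w_def)
 next
  case (Suc n) then show ?case using dd0[of n] dd_eq[of n] by simp
 qed
 have a_le: "a n <= 1" for n
 proof -
  have "norm (LINT om|Om. (w n (X n om))\<^sup>2) <= 1"
   using u(2)[OF X_space[of n]] by (intro Om.norm_integral_le_const) (auto simp: w_def intro!: power_le_one)
  then show ?thesis by (simp add: a_def)
 qed
 have dd_sum: "(\<Sum>n<N. dd n) <= 1" for N
 proof -
  have "(\<Sum>n<N. dd n) = a N - a 0" by (simp add: dd_eq sum_lessThan_telescope)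
  also have "0 <= a 0" by (simp add: a_def)
  ultimately show ?thesis using a_le[of N] \<open>0 <= a 0\<close> by simp
 qed
 have step: "(LINT om|Om. (w (Suc n) (X (Suc n) om) - w n (X n om))\<^sup>2) <= dd n" for n
  unfolding dd_def
 proof (rule integral_mono)
  show "integrable Om (\<lambda>om. (w (Suc n) (X (Suc n) om) - w n (X n om))\<^sup>2)"
   by (intro bfun_Om_integrable bfun_power bfun_diff wX)
  show "integrable Om (\<lambda>om. (norm (A n om - u n (X n om)))\<^sup>2)"
   by (intro bfun_Om_integrable bfun_power bfun_norm bfun_diff Ab uX)
  fix om
  have "\<bar>w (Suc n) (X (Suc n) om) - w n (X n om)\<bar> <= norm (A n om - u n (X n om))"
   using norm_triangle_ineq3[of "A n om" "u n (X n om)"] unfolding nA w_def[symmetric] .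
  then show "(w (Suc n) (X (Suc n) om) - w n (X n om))\<^sup>2 <= (norm (A n om - u n (X n om)))\<^sup>2"
   by (intro abs_le_square_iff[THEN iffD1]) simp
 qed
 define r where "r n = (LINT om|Om. w n (X n om))" for n
 define C1 where "C1 = 2 * \<beta> / ep"
 have C10: "0 <= C1" using beta_nonneg eps_pos by (simp add: C1_def)
 have r0: "0 <= r n" for n by (simp add: r_def w_def)
 \<comment> \<open>The modulus at time \<open>n + 2\<close> is close to the deterministic number
   \<open>r n\<close>: this follows from \<open>two_step_square_ge\<close>, with the law compared
   from above afterwards.\<close>
 have two: "(LINT om|Om. (w (n + 2) (X (n + 2) om) - r n)\<^sup>2) <= C1 * (dd n + dd (Suc n))" for n
 proof -
  have i: "integrable Om (\<lambda>om. (w (Suc n) (X (Suc n) om) - w n (X n om))\<^sup>2)"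
   "integrable Om (\<lambda>om. (w (n + 2) (X (n + 2) om) - w (Suc n) (X (Suc n) om))\<^sup>2)"
   "integrable Om (\<lambda>om. (w (n + 2) (X (n + 2) om) - w n (X n om))\<^sup>2)"
   by (intro bfun_Om_integrable bfun_power bfun_diff wX)+
  have "(LINT om|Om. (w (n + 2) (X (n + 2) om) - r n)\<^sup>2) = (LINT om|Om. 1 * (w (Suc (Suc n)) (X (Suc (Suc n)) om) - r n)\<^sup>2)" by simp
  also have "... <= \<beta> * (LINT z|M (Suc (Suc n)). (w (Suc (Suc n)) z - r n)\<^sup>2) * (LINT om|Om. 1)"
   by (rule MP.law_le) (auto intro!: bfun_power bfun_diff wb)
  also have "... = \<beta> / ep * (ep * (\<integral>z. (w (n + 2) z - r n)\<^sup>2 \<partial>M (n + 2)))" using Om.prob_space eps_pos by simp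
  also have "... <= \<beta> / ep * (LINT om|Om. (w (n + 2) (X (n + 2) om) - w n (X n om))\<^sup>2)"
   unfolding r_def using beta_nonneg eps_pos by (intro mult_left_mono two_step_square_ge wb) auto
  also have "... <= \<beta> / ep * (LINT om|Om. 2 * (w (n + 2) (X (n + 2) om) - w (Suc n) (X (Suc n) om))\<^sup>2 + 2 * (w (Suc n) (X (Suc n) om) - w n (X n om))\<^sup>2)"
  proof (intro mult_left_mono integral_mono)
   fix om
   show "(w (n + 2) (X (n + 2) om) - w n (X n om))\<^sup>2 <= 2 * (w (n + 2) (X (n + 2) om) - w (Suc n) (X (Suc n) om))\<^sup>2 + 2 * (w (Suc n) (X (Suc n) om) - w n (X n om))\<^sup>2"
    using power2_diff_le[of "w (n + 2) (X (n + 2) om) - w (Suc n) (X (Suc n) om)" "w n (X n om) - w (Suc n) (X (Suc n) om)"]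
    by (simp add: power2_commute[of "w n (X n om)"])
  qed (use i beta_nonneg eps_pos in auto)
  also have "... = \<beta> / ep * (2 * (LINT om|Om. (w (Suc (Suc n)) (X (Suc (Suc n)) om) - w (Suc n) (X (Suc n) om))\<^sup>2) + 2 * (LINT om|Om. (w (Suc n) (X (Suc n) om) - w n (X n om))\<^sup>2))"
   using i by simp
  also have "... <= \<beta> / ep * (2 * dd (Suc n) + 2 * dd n)"
   using step[of n] step[of "Suc n"] beta_nonneg eps_pos by (intro mult_left_mono add_mono) auto
  also have "... = C1 * (dd n + dd (Suc n))" by (simp add: C1_def algebra_simps add_divide_distrib)
  finally show ?thesis .
 qed
 have "summable dd" by (rule summableI_nonneg_bounded[OF dd0 dd_sum])
 then have dd_tends: "dd \<longlonglongrightarrow> 0" by (rule summable_LIMSEQ_zero)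
 have "(\<lambda>n. C1 * (dd n + dd (Suc n))) \<longlonglongrightarrow> 0"
  using dd_tends LIMSEQ_Suc[OF dd_tends] by (auto intro!: tendsto_eq_intros)
 from order_tendstoD(2)[OF this, of "c\<^sup>2 / 4"] c(1)
 obtain n1 where n1: "!!n. n >= n1 ==> C1 * (dd n + dd (Suc n)) < c\<^sup>2 / 4" by (auto simp: eventually_sequentially)
 \<comment> \<open>Late enough the deviations are too small to explain a mean square of
   \<open>c^2\<close>, so the deterministic modulus is bounded away from 0.\<close>
 have r_ge: "c\<^sup>2 / 4 <= (r n)\<^sup>2" if "n >= n1" for n
 proof -
  have i: "integrable Om (\<lambda>om. (w (n + 2) (X (n + 2) om) - r n)\<^sup>2)" "integrable Om (\<lambda>om. (w (n + 2) (X (n + 2) om))\<^sup>2)"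
   by (intro bfun_Om_integrable bfun_power bfun_diff wX bfun_const)+
  have "a (n + 2) <= (LINT om|Om. 2 * (w (n + 2) (X (n + 2) om) - r n)\<^sup>2 + 2 * (r n)\<^sup>2)"
   unfolding a_def
  proof (rule integral_mono[OF i(2)])
   fix om
   show "(w (n + 2) (X (n + 2) om))\<^sup>2 <= 2 * (w (n + 2) (X (n + 2) om) - r n)\<^sup>2 + 2 * (r n)\<^sup>2"
    using power2_diff_le[of "w (n + 2) (X (n + 2) om) - r n" "- r n"] by simp
  qed (use i in simp)
  also have "... = 2 * (LINT om|Om. (w (n + 2) (X (n + 2) om) - r n)\<^sup>2) + 2 * (r n)\<^sup>2" using i Om.prob_space by simp
  finally show ?thesis using two[of n] n1[OF that] a_ge[of "n + 2"] by argo
 qed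
 define \<alpha> where "\<alpha> n y = ang (u n y)" for n y
 define \<psi> where "\<psi> n yz = ta * f n yz + \<alpha> (Suc n) (snd yz) - \<alpha> n (fst yz)" for n yz
 \<comment> \<open>Rounding to the nearest multiple leaves an error in \<open>[- pi, pi]\<close>,
   where it is controlled by its complex exponential.\<close>
 define k where "k n yz = round (\<psi> n yz / (2 * pi))" for n yz
 define b where "b n yz = \<psi> n yz - 2 * pi * of_int (k n yz)" for n yz
 have \<alpha>m [measurable]: "\<alpha> n \<in> borel_measurable (M n)" for n
  using bfun_measurable[OF u(1)[of n]] unfolding \<alpha>_def[abs_def] by measurable
 have \<alpha>le: "\<bar>\<alpha> n y\<bar> <= pi" for n y unfolding \<alpha>_def by (rule ang_le)
 have [measurable]: "f n \<in> borel_measurable (MM n)" for n by (rule f_meas)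
 have \<psi>m [measurable]: "\<psi> n \<in> borel_measurable (MM n)" for n unfolding \<psi>_def[abs_def] by measurable
 have km [measurable]: "(\<lambda>xy. real_of_int (k n xy)) \<in> borel_measurable (MM n)" for n
  unfolding k_def[abs_def] round_def by measurable
 have ble: "\<bar>b n yz\<bar> <= pi" for n yz
 proof -
  have "b n yz = 2 * pi * (\<psi> n yz / (2 * pi) - of_int (k n yz))" by (simp add: b_def field_simps)
  then have "\<bar>b n yz\<bar> = 2 * pi * \<bar>of_int (k n yz) - \<psi> n yz / (2 * pi)\<bar>" by (simp add: abs_mult abs_minus_commute)
  also have "... <= 2 * pi * (1 / 2)" unfolding k_def by (intro mult_left_mono of_int_round_abs_le) auto
  finally show ?thesis by simp
 qed
 have bb: "bfun (MM n) (b n)" for n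
 proof (rule bfunI)
  show "b n \<in> borel_measurable (MM n)" unfolding b_def[abs_def] by measurable
  show "norm (b n z) <= pi" for z using ble[of n z] by simp
 qed
 \<comment> \<open>\<open>128 = 4 * 8 * 4\<close>: from \<open>abs_le_norm_iexp_minus_1\<close>
   squared, from \<open>polar_diff_le\<close>, and from the lower bound \<open>c^2 / 4\<close> of
   \<open>r_ge\<close>.\<close>
 define C2 where "C2 = 128 * pi\<^sup>2 / c\<^sup>2"
 have Eb: "(LINT om|Om. (b m (XX m om))\<^sup>2) <= C2 * (dd m + C1 * (dd n + dd (Suc n)))" if n: "n >= n1" and m: "m = n + 2" for n m
 proof -
  have i: "integrable Om (\<lambda>om. (norm (A m om - u m (X m om)))\<^sup>2)" "integrable Om (\<lambda>om. (w m (X m om) - r n)\<^sup>2)"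
   "integrable Om (\<lambda>om. (b m (XX m om))\<^sup>2)"
   by (intro bfun_Om_integrable bfun_power bfun_norm bfun_diff Ab uX wX bfun_const bfun_XXOm[OF _ bb] le0)+
  have "(LINT om|Om. (b m (XX m om))\<^sup>2) <= (LINT om|Om. C2 * ((norm (A m om - u m (X m om)))\<^sup>2 + (w m (X m om) - r n)\<^sup>2))"
  proof (rule integral_mono[OF i(3)])
   fix om
   let ?d = "b m (XX m om)"
   have 1: "(r n * norm (exp (\<i> * cor ?d) - 1))\<^sup>2 <= 8 * ((norm (A m om - u m (X m om)))\<^sup>2 + (w m (X m om) - r n)\<^sup>2)"
   proof (rule polar_diff_le[where t = "ta * f m (XX m om)" and a = "\<alpha> (Suc m) (X (Suc m) om)" and b = "\<alpha> m (X m om)"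
      and k = "k m (XX m om)" and wa = "w (Suc m) (X (Suc m) om)"])
    show "A m om = exp (\<i> * of_real (ta * f m (XX m om))) * (of_real (w (Suc m) (X (Suc m) om)) * exp (\<i> * of_real (\<alpha> (Suc m) (X (Suc m) om))))"
     unfolding A_def e_def w_def \<alpha>_def ang_polar[symmetric] by (simp add: mult.assoc)
    show "u m (X m om) = of_real (w m (X m om)) * exp (\<i> * of_real (\<alpha> m (X m om)))"
     unfolding w_def \<alpha>_def by (rule ang_polar)
    show "ta * f m (XX m om) + \<alpha> (Suc m) (X (Suc m) om) - \<alpha> m (X m om) = 2 * pi * of_int (k m (XX m om)) + ?d"
     by (simp add: b_def \<psi>_def)
   qed (simp_all add: nA w_def r0)
   have "(?d)\<^sup>2 <= (2 * pi * norm (exp (\<i> * cor ?d) - 1))\<^sup>2"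
    using power_mono[OF abs_le_norm_iexp_minus_1[OF ble[of m "(XX m om)"]], of 2] by simp
   then have "c\<^sup>2 / 4 * (?d)\<^sup>2 <= (r n)\<^sup>2 * (2 * pi * norm (exp (\<i> * cor ?d) - 1))\<^sup>2"
    using r_ge[OF n] by (intro mult_mono) auto
   also have "... = 4 * pi\<^sup>2 * (r n * norm (exp (\<i> * cor ?d) - 1))\<^sup>2" by (simp add: power_mult_distrib)
   also have "... <= 4 * pi\<^sup>2 * (8 * ((norm (A m om - u m (X m om)))\<^sup>2 + (w m (X m om) - r n)\<^sup>2))"
    by (rule mult_left_mono[OF 1]) simp
   finally show "(?d)\<^sup>2 <= C2 * ((norm (A m om - u m (X m om)))\<^sup>2 + (w m (X m om) - r n)\<^sup>2)"
    using c(1) by (simp add: C2_def field_simps)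
  qed (use i in simp)
  also have "... = C2 * (dd m + (LINT om|Om. (w m (X m om) - r n)\<^sup>2))" using i by (simp add: dd_def)
  also have "... <= C2 * (dd m + C1 * (dd n + dd (Suc n)))" unfolding m by (intro mult_left_mono add_left_mono two) (simp add: C2_def)
  finally show ?thesis .
 qed
 have C20: "0 <= C2" by (simp add: C2_def)
 have "(\<Sum>m=n1+2..<N. sqk m (b m)) <= 1 / ep * (C2 * (1 + C1 * 2))" for N
 proof -
  have "sqk m (b m) <= 1 / ep * (C2 * (dd m + C1 * (dd (m - 2) + dd (m - 1))))" if "m \<in> {n1+2..<N}" for m
  proof -
   have m: "m - 2 >= n1" "m = (m - 2) + 2" "m >= 2" "Suc (m - 2) = m - 1" using that by auto
   have "ep * sqk m (b m) <= C2 * (dd m + C1 * (dd (m - 2) + dd (m - 1)))"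
    using order_trans[OF sqk_le_E_sq[OF bb m(3)] Eb[OF m(1,2)]] unfolding m(4) .
   then show ?thesis using eps_pos by (simp add: field_simps)
  qed
  then have "(\<Sum>m=n1+2..<N. sqk m (b m)) <= (\<Sum>m=n1+2..<N. 1 / ep * (C2 * (dd m + C1 * (dd (m - 2) + dd (m - 1)))))"
   by (rule sum_mono)
  also have "... = 1 / ep * (C2 * ((\<Sum>m=n1+2..<N. dd m) + C1 * ((\<Sum>m=n1+2..<N. dd (m - 2)) + (\<Sum>m=n1+2..<N. dd (m - 1)))))"
   by (simp only: sum_distrib_left[symmetric] sum.distrib)
  also have "... <= 1 / ep * (C2 * (1 + C1 * (1 + 1)))"
  proof -
   have le: "(\<Sum>m=n1+2..<N. dd (m - i)) <= 1" if "i <= 2" for i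
   proof -
    have "(\<Sum>m=n1+2..<N. dd (m - i)) = (\<Sum>m\<in>(\<lambda>m. m - i) ` {n1+2..<N}. dd m)"
     using that by (subst sum.reindex) (auto simp: inj_on_def)
    also have "... <= (\<Sum>m<N. dd m)" by (rule sum_mono2) (auto simp: dd0)
    also have "... <= 1" by (rule dd_sum)
    finally show ?thesis .
   qed
   show ?thesis
    using le[of 0] le[of 1] le[of 2] C10 C20 eps_pos by (intro mult_left_mono add_mono) auto
  qed
  finally show ?thesis by simp
 qed
 moreover have "ta * f n (y, z) = \<alpha> n y - \<alpha> (Suc n) z + 2 * pi * of_int (k n (y, z)) + b n (y, z)" for n y z
  by (simp add: b_def \<psi>_def)
 ultimately show ?thesis using \<alpha>m \<alpha>le km bb by blast
qed

end

section \<open>Covariances, and reduction to a lattice-valued functional\<close>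

context functional_process
begin

text \<open>One step leads from time \<open>n\<close> to the state at time \<open>Suc n\<close>,
  another one turns an integral bound into a pointwise one; the rest contracts. For small
  \<open>j\<close> truncated subtraction gives the trivial rate 1.\<close>

definition mixr :: "nat => real" where "mixr j = (1 - ep) ^ ((j - 2) div 2)"

lemma mixr_nonneg: "0 <= mixr j" using eps_less_1 by (simp add: mixr_def)

lemma sum_mixr_le: "(\<Sum>j<N. mixr j) <= 2 + 2 / ep"
proof -
 have e: "(\<Sum>j<N+2. mixr j) = 2 + (\<Sum>j<N. (1 - ep) ^ (j div 2))"
 proof (induction N)
  case 0
  then show ?case by (simp add: mixr_def numeral_2_eq_2)
 next
  case (Suc N)
  then show ?case by (simp add: mixr_def)
 qed
 have "(\<Sum>j<N. mixr j) <= (\<Sum>j<N+2. mixr j)" by (intro sum_mono2 mixr_nonneg) auto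
 also have "... <= 2 + 2 / ep"
  unfolding e using suminf_power_div2(3)[of "1 - ep" N] eps_pos eps_less_1 by simp
 finally show ?thesis .
qed

text \<open>For close times the inequality of means suffices. Otherwise the conditional mean of the
  later term given time \<open>Suc n\<close> has small oscillation and is nearly constant. The bound
  is by a sum of squares, the form needed for summing rows.\<close>

lemma covariance_le:
 assumes b: "bfun (MM n) b" and b': "bfun (MM m) b'" and n: "1 <= n" "n <= m"
 shows "\<bar>(LINT om|Om. b (XX n om) * b' (XX m om))
   - (LINT om|Om. b (XX n om)) * (LINT om|Om. b' (XX m om))\<bar>
  <= \<beta> * (1 + \<beta>) * mixr (m - n) * (sqk n b + sqk m b')"
proof -
 define B where "B om = b (XX n om)" for om
 define B' where "B' om = b' (XX m om)" for om
 have Bb: "bfun Om B" and Bb': "bfun Om B'"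
  unfolding B_def[abs_def] B'_def[abs_def] by (rule bfun_XXOm[OF _ b], simp, rule bfun_XXOm[OF _ b'], simp)
 note i = bfun_Om_integrable[OF Bb] bfun_Om_integrable[OF Bb'] bfun_Om_integrable[OF bfun_power[OF Bb, of 2]]
  bfun_Om_integrable[OF bfun_power[OF Bb', of 2]] bfun_Om_integrable[OF bfun_mult[OF Bb Bb']] bfun_Om_integrable[OF bfun_abs[OF Bb]]
 have E: "(LINT om|Om. (B om)\<^sup>2) <= \<beta> * sqk n b" "(LINT om|Om. (B' om)\<^sup>2) <= \<beta> * sqk m b'"
  unfolding B_def B'_def by (rule E_sq_le_sqk[OF b n(1)], rule E_sq_le_sqk[OF b']) (use n in simp)
 have s0: "0 <= sqk n b" "0 <= sqk m b'" by (rule sqk_nonneg)+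
 have "\<bar>(LINT om|Om. B om * B' om) - (LINT om|Om. B om) * (LINT om|Om. B' om)\<bar> <= \<beta> * (1 + \<beta>) * mixr (m - n) * (sqk n b + sqk m b')"
 proof (cases "m <= Suc n")
  case True
  have prod_le: "\<bar>x * y\<bar> <= (x\<^sup>2 + y\<^sup>2) / 2" for x y :: real
   using zero_le_power2[of "\<bar>x\<bar> - \<bar>y\<bar>"] by (simp add: power2_diff abs_mult)
  have "\<bar>\<integral>om. B om * B' om \<partial>Om\<bar> <= (LINT om|Om. ((B om)\<^sup>2 + (B' om)\<^sup>2) / 2)"
   using i prod_le by (intro order_trans[OF integral_abs_bound] integral_mono) auto
  also have "... = ((LINT om|Om. (B om)\<^sup>2) + (LINT om|Om. (B' om)\<^sup>2)) / 2" using i by simp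
  finally have 1: "\<bar>\<integral>om. B om * B' om \<partial>Om\<bar> <= ((LINT om|Om. (B om)\<^sup>2) + (LINT om|Om. (B' om)\<^sup>2)) / 2" .
  have "\<bar>(LINT om|Om. B om) * (LINT om|Om. B' om)\<bar> <= ((LINT om|Om. B om)\<^sup>2 + (LINT om|Om. B' om)\<^sup>2) / 2" by (rule prod_le)
  also have "... <= ((LINT om|Om. (B om)\<^sup>2) + (LINT om|Om. (B' om)\<^sup>2)) / 2"
   using Om.integral_sq_le[OF i(3,1)] Om.integral_sq_le[OF i(4,2)] by simp
  finally have "\<bar>(LINT om|Om. B om * B' om) - (LINT om|Om. B om) * (LINT om|Om. B' om)\<bar> <= \<beta> * (sqk n b + sqk m b')"
   using 1 E unfolding distrib_left by argo
  also have "... <= \<beta> * (1 + \<beta>) * mixr (m - n) * (sqk n b + sqk m b')"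
  proof -
   have "(m - n - 2) div 2 = 0" using True by simp
   then have "mixr (m - n) = 1" by (simp add: mixr_def)
   moreover have "\<beta> * 1 <= \<beta> * (1 + \<beta>)" using beta_nonneg by (intro mult_left_mono) auto
   ultimately show ?thesis using s0 by (intro mult_right_mono) auto
  qed
  finally show ?thesis .
 next
  case False
  define k where "k = m - n - 2"
  have m: "m = Suc n + k + 1" using False by (simp add: k_def)
  define bb where "bb x = (LINT y|kern m x. b' (x, y))" for x
  have bbb: "bfun (M m) bb" unfolding bb_def[abs_def] by (rule kern_bfun[OF b'])
  interpret N: prob_space "M m" by (rule prob_M)
  define J where "J = (LINT x|M m. \<bar>bb x\<bar>)"
  have J: "J\<^sup>2 <= sqk m b'"
  proof -
   have "J\<^sup>2 <= (LINT x|M m. \<bar>bb x\<bar>\<^sup>2)"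
    unfolding J_def by (rule N.integral_sq_le; intro N.bfun_integrable bfun_power bfun_abs bbb)
   also have "... <= sqk m b'"
    unfolding sqk_def
   proof (rule integral_mono)
    have bk: "bfun (MM m) (\<lambda>z. (b' z)\<^sup>2)" by (rule bfun_power[OF b'])
    show "integrable (M m) (\<lambda>x. \<bar>bb x\<bar>\<^sup>2)" by (intro N.bfun_integrable bfun_power bfun_abs bbb)
    show "integrable (M m) (\<lambda>x. \<integral>y. (b' (x, y))\<^sup>2 \<partial>kern m x)" by (rule N.bfun_integrable[OF kern_bfun[OF bk]])
    fix x assume x: "x \<in> St m"
    interpret k: prob_space "kern m x" using x by (rule prob_kern)
    show "\<bar>bb x\<bar>\<^sup>2 <= (LINT y|kern m x. (b' (x, y))\<^sup>2)"
     unfolding bb_def power2_abs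
     by (rule k.integral_sq_le; intro integrable_kern[OF x] bfun_power bfun_pair1[OF b' x])
   qed
   finally show ?thesis .
  qed
  have J0: "0 <= J" by (simp add: J_def)
  \<comment> \<open>The step that converts the integral \<open>J\<close> into a bound at every
    point; the \<open>k\<close> steps before it contract.\<close>
  define h where "h = PT (Suc n + k) 1 bb"
  have bbm: "bfun (M (Suc n + k + 1)) bb" using bbb m by simp
  have hb: "bfun (M (Suc n + k)) h" unfolding h_def by (rule T_bfun[OF bwt_1 bbm])
  have hle: "\<bar>h y\<bar> <= \<beta> * J" if y: "y \<in> St (Suc n + k)" for y
  proof -
   have "norm (h y) <= PT (Suc n + k) 1 (\<lambda>x. \<bar>bb x\<bar>) y"
    unfolding h_def by (rule T_norm_le[OF bwt_1 bwt_1 _ bbm bfun_abs[OF bbm] _ y]) auto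
   also have "... <= \<beta> * (\<integral>x. \<bar>bb x\<bar> \<partial>M (Suc n + k + 1))"
    by (rule PT_le[OF order_refl bfun_abs[OF bbm] _ y]) simp
   finally show ?thesis using m by (simp add: J_def)
  qed
  define G where "G = PT (Suc n) k h"
  have Gb: "bfun (M (Suc n)) G" unfolding G_def by (rule T_bfun[OF bwt_1 hb])
  define os where "os = (1 - ep) ^ (k div 2) * (2 * (\<beta> * J))"
  have os0: "0 <= os" using eps_less_1 beta_nonneg J0 by (simp add: os_def)
  have osc: "\<bar>G y - G z\<bar> <= os" if "y \<in> St (Suc n)" "z \<in> St (Suc n)" for y z
   unfolding G_def os_def
  proof (rule PT_osc_le_real[OF hb _ that])
   fix u v assume "u \<in> St (Suc n + k)" "v \<in> St (Suc n + k)"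
   from hle[OF this(1)] hle[OF this(2)] show "\<bar>h u - h v\<bar> <= 2 * (\<beta> * J)" by linarith
  qed
  have GT: "PT (Suc n) (k + 1) bb = G" unfolding G_def h_def by (rule T_add_steps)
  have BF: "bfun (F (Suc n)) B" unfolding B_def[abs_def] by (rule bfun_XX[OF _ _ b]) auto
  have BFm: "bfun (F m) B" by (rule bfun_mono[OF BF]) (use m in auto)
  have mv: "(LINT om|Om. A om * B' om) = (LINT om|Om. A om * G (X (Suc n) om))"
   if A: "bfun (F (Suc n)) A" "bfun (F m) A" for A
  proof -
   have "(LINT om|Om. A om * B' om) = (LINT om|Om. A om * bb (X m om))"
    unfolding B'_def bb_def by (rule markov_real[OF _ A(2) b']) simp
   also have "... = (LINT om|Om. A om * bb (X (Suc n + (k + 1)) om))" using m by simp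
   also have "... = (LINT om|Om. A om * G (X (Suc n) om))"
    unfolding GT[symmetric] by (rule markov_PT_real[OF _ A(1)]) (use bbm in \<open>auto simp: add.assoc\<close>)
   finally show ?thesis .
  qed
  have GX: "bfun Om (\<lambda>om. G (X (Suc n) om))" by (rule bfun_XOm[OF _ Gb]) simp
  define g0 where "g0 = (LINT om|Om. G (X (Suc n) om))"
  have g0: "(LINT om|Om. B' om) = g0" using mv[of "\<lambda>_. 1"] by (simp add: g0_def)
  have Gd: "\<bar>G (X (Suc n) om) - g0\<bar> <= os" if om: "om \<in> space Om" for om
  proof -
   have "G (X (Suc n) om) - g0 = (LINT om'|Om. G (X (Suc n) om) - G (X (Suc n) om'))"
    using bfun_Om_integrable[OF GX] Om.prob_space by (simp add: g0_def)
   also have "norm ... <= os"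
    using osc[OF X_space X_space] om os0 by (intro Om.norm_integral_le_const) auto
   finally show ?thesis by simp
  qed
  have "(LINT om|Om. B om * B' om) - (LINT om|Om. B om) * (LINT om|Om. B' om) = (LINT om|Om. B om * (G (X (Suc n) om) - g0))"
   unfolding g0 mv[OF BF BFm] using i(1) bfun_Om_integrable[OF bfun_mult[OF Bb GX]] by (simp add: right_diff_distrib)
  also have "\<bar>...\<bar> <= (LINT om|Om. \<bar>B om\<bar> * os)"
  proof (intro order_trans[OF integral_abs_bound] integral_mono)
   show "integrable Om (\<lambda>om. \<bar>B om * (G (X (Suc n) om) - g0)\<bar>)"
    by (intro bfun_Om_integrable bfun_abs bfun_mult bfun_diff Bb GX bfun_const)
   show "\<bar>B om * (G (X (Suc n) om) - g0)\<bar> <= \<bar>B om\<bar> * os" if "om \<in> space Om" for om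
    unfolding abs_mult by (rule mult_left_mono[OF Gd[OF that]]) simp
  qed (use i in simp)
  also have "... = (1 - ep) ^ (k div 2) * \<beta> * (2 * ((LINT om|Om. \<bar>B om\<bar>) * J))" by (simp add: os_def)
  also have "... <= (1 - ep) ^ (k div 2) * \<beta> * ((1 + \<beta>) * (sqk n b + sqk m b'))"
  proof (intro mult_left_mono)
   have "(LINT om|Om. \<bar>B om\<bar>)\<^sup>2 <= (LINT om|Om. \<bar>B om\<bar>\<^sup>2)" by (rule Om.integral_sq_le) (use i in simp_all)
   then have "(LINT om|Om. \<bar>B om\<bar>)\<^sup>2 <= \<beta> * sqk n b" using E(1) by simp
   moreover have "2 * ((LINT om|Om. \<bar>B om\<bar>) * J) <= (LINT om|Om. \<bar>B om\<bar>)\<^sup>2 + J\<^sup>2"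
    using sum_squares_bound[of "\<integral>om. \<bar>B om\<bar> \<partial>Om" J] by (simp add: mult.assoc)
   moreover have "\<beta> * sqk n b + sqk m b' <= (1 + \<beta>) * (sqk n b + sqk m b')"
    using s0 beta_nonneg by (simp add: algebra_simps)
   ultimately show "2 * ((LINT om|Om. \<bar>B om\<bar>) * J) <= (1 + \<beta>) * (sqk n b + sqk m b')" using J by argo
  qed (use eps_less_1 beta_nonneg in auto)
  also have "... = \<beta> * (1 + \<beta>) * mixr (m - n) * (sqk n b + sqk m b')" by (simp add: mixr_def k_def)
  finally show ?thesis .
 qed
 then show ?thesis unfolding B_def B'_def .
qed

text \<open>Schur's test: by symmetry of the rates each row contributes its square times a row sum,
  and the row sums are bounded. The variance is thus linear in the total of the squares, not in the
  number of terms.\<close>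

lemma sum_variance_le:
 assumes b: "!!n. bfun (MM n) (b n)" and n0: "1 <= n0"
 defines "Bs N om \<equiv> (\<Sum>n=n0..<N. b n (XX n om))"
 shows "(LINT om|Om. (Bs N om - (LINT om|Om. Bs N om))\<^sup>2) <= 4 * (\<beta> * (1 + \<beta>)) * (2 + 2 / ep) * (\<Sum>n=n0..<N. sqk n (b n))"
proof -
 define B where "B n om = b n (XX n om)" for n om
 define m where "m n = (LINT om|Om. B n om)" for n
 define I where "I = {n0..<N}"
 define C where "C = \<beta> * (1 + \<beta>)"
 define R where "R = 2 + 2 / ep"
 define s where "s n = sqk n (b n)" for n
 define d where "d n m = (if n <= m then m - n else n - m)" for n m :: nat
 have s0: "0 <= s n" for n unfolding s_def by (rule sqk_nonneg)
 have C0: "0 <= C" using beta_nonneg by (simp add: C_def)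
 have Bb: "bfun Om (B n)" for n unfolding B_def[abs_def] by (rule bfun_XXOm[OF _ b]) simp
 note i = bfun_Om_integrable[OF Bb] bfun_Om_integrable[OF bfun_mult[OF Bb Bb]]
 have cov: "(LINT om|Om. (B n om - m n) * (B k om - m k)) <= C * mixr (d n k) * (s n + s k)" if "n \<in> I" "k \<in> I" for n k
 proof -
  have e: "(LINT om|Om. (B n om - m n) * (B k om - m k)) = (LINT om|Om. B n om * B k om) - m n * m k"
  proof -
   have "(LINT om|Om. (B n om - m n) * (B k om - m k)) = (LINT om|Om. B n om * B k om - m k * B n om - m n * B k om + m n * m k)"
    by (simp add: algebra_simps)
   then show ?thesis using i Om.prob_space by (simp add: m_def)
  qed
  show ?thesis
  proof (cases "n <= k")
   case True
   then show ?thesis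
    using order_trans[OF abs_ge_self covariance_le[OF b b, of n k]] that n0 unfolding e unfolding m_def B_def C_def s_def d_def I_def by simp
  next
   case False
   then show ?thesis
    using order_trans[OF abs_ge_self covariance_le[OF b b, of k n]] that n0 unfolding e unfolding m_def B_def C_def s_def d_def I_def
    by (simp add: mult.commute add.commute)
  qed
 qed
 have row: "(\<Sum>k\<in>I. mixr (d n k)) <= 2 * R" if "n \<in> I" for n
 proof -
  have "(\<Sum>k\<in>I. mixr (d n k)) = (\<Sum>k\<in>{n0..<n}. mixr (n - k)) + (\<Sum>k\<in>{n..<N}. mixr (k - n))"
  proof -
   have "I = {n0..<n} \<union> {n..<N}" using that by (auto simp: I_def)
   then have "(\<Sum>k\<in>I. mixr (d n k)) = (\<Sum>k\<in>{n0..<n}. mixr (d n k)) + (\<Sum>k\<in>{n..<N}. mixr (d n k))"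
    by (simp add: sum.union_disjoint)
   then show ?thesis by (simp add: d_def)
  qed
  also have "(\<Sum>k\<in>{n0..<n}. mixr (n - k)) = (\<Sum>j\<in>(\<lambda>k. n - k) ` {n0..<n}. mixr j)"
   by (subst sum.reindex) (auto simp: inj_on_def)
  also have "(\<Sum>k\<in>{n..<N}. mixr (k - n)) = (\<Sum>j\<in>(\<lambda>k. k - n) ` {n..<N}. mixr j)"
   by (subst sum.reindex) (auto simp: inj_on_def)
  also have "(\<Sum>j\<in>(\<lambda>k. n - k) ` {n0..<n}. mixr j) + (\<Sum>j\<in>(\<lambda>k. k - n) ` {n..<N}. mixr j) <= (\<Sum>j<Suc n. mixr j) + (\<Sum>j<N. mixr j)"
   by (intro add_mono sum_mono2) (auto simp: mixr_nonneg)
  also have "... <= 2 * R" using sum_mixr_le[of "Suc n"] sum_mixr_le[of N] unfolding R_def by argo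
  finally show ?thesis .
 qed
 have mean: "(LINT om|Om. Bs N om) = (\<Sum>n\<in>I. m n)"
  unfolding Bs_def m_def I_def B_def[symmetric] using i by simp
 have "(LINT om|Om. (Bs N om - (LINT om|Om. Bs N om))\<^sup>2) = (LINT om|Om. (\<Sum>n\<in>I. B n om - m n)\<^sup>2)"
  unfolding mean unfolding Bs_def I_def B_def[symmetric] by (simp add: sum_subtractf)
 also have "... = (LINT om|Om. (\<Sum>n\<in>I. \<Sum>k\<in>I. (B n om - m n) * (B k om - m k)))"
  by (simp only: power2_eq_square sum_product)
 also have "... = (\<Sum>n\<in>I. \<Sum>k\<in>I. \<integral>om. (B n om - m n) * (B k om - m k) \<partial>Om)"
 proof -
  have "integrable Om (\<lambda>om. (B n om - m n) * (B k om - m k))" for n k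
   by (intro bfun_Om_integrable bfun_mult bfun_diff Bb bfun_const)
  then show ?thesis by simp
 qed
 also have "... <= (\<Sum>n\<in>I. \<Sum>k\<in>I. C * mixr (d n k) * (s n + s k))" by (intro sum_mono cov)
 also have "... = (\<Sum>n\<in>I. \<Sum>k\<in>I. C * mixr (d n k) * s n) + (\<Sum>n\<in>I. \<Sum>k\<in>I. C * mixr (d n k) * s k)"
  by (simp add: distrib_left sum.distrib)
 also have "(\<Sum>n\<in>I. \<Sum>k\<in>I. C * mixr (d n k) * s k) = (\<Sum>n\<in>I. \<Sum>k\<in>I. C * mixr (d n k) * s n)"
 proof -
  have "d n k = d k n" for n k by (auto simp: d_def)
  then show ?thesis by (subst sum.swap) simp
 qed
 also have "(\<Sum>n\<in>I. \<Sum>k\<in>I. C * mixr (d n k) * s n) + (\<Sum>n\<in>I. \<Sum>k\<in>I. C * mixr (d n k) * s n)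
  = 2 * (\<Sum>n\<in>I. C * s n * (\<Sum>k\<in>I. mixr (d n k)))"
  by (simp add: sum_distrib_left mult_ac)
 also have "... <= 2 * (\<Sum>n\<in>I. C * s n * (2 * R))"
  by (intro mult_left_mono sum_mono row) (auto intro!: mult_nonneg_nonneg C0 s0)
 also have "... = 4 * C * R * (\<Sum>n\<in>I. s n)" by (simp add: sum_distrib_left sum_distrib_right mult_ac)
 finally show ?thesis unfolding C_def R_def s_def I_def .
qed

text \<open>Dividing the phase equation by \<open>ta\<close> splits \<open>f\<close> into a bounded
  coboundary, a multiple of \<open>2 * pi / ta\<close>, and an error whose sums have bounded
  variance. Only the lattice part is kept in \<open>g\<close>.\<close>

theorem arithmetic_reduction:
 assumes ta: "ta \<noteq> 0" and x: "x \<in> St 0" and c: "0 < c"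
  and v: "!!N. \<exists>v. bfun (M N) v \<and> (\<forall>y\<in>St N. norm (v y) <= 1) \<and> c <= norm (T (Wf (\<i> * of_real ta)) 0 N v x)"
 shows "\<exists>g m D. (\<forall>n. g n \<in> borel_measurable (MM n)) \<and> (\<forall>n xy. \<exists>k::int. g n xy = 2 * pi / ta * of_int k) \<and>
  (\<forall>N. integrable Om (\<lambda>om. ((\<Sum>j<N. f j (XX j om) - g j (XX j om)) - m N)\<^sup>2) \<and>
   (LINT om|Om. ((\<Sum>j<N. f j (XX j om) - g j (XX j om)) - m N)\<^sup>2) <= (D::real))"
proof -
 have W1: "norm (Wf (\<i> * of_real ta) n (y, z)) <= 1" for n y z by simp
 obtain u where u: "\<forall>n. bfun (M n) (u n)" "\<forall>n. \<forall>y\<in>St n. norm (u n y) <= 1"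
  "\<forall>n. \<forall>y\<in>St n. u n y = T1 (Wf (\<i> * of_real ta)) n (u (Suc n)) y" "c <= Re (u 0 x)"
  using harmonic_family[OF Wf_bwt W1 x c v] by blast
 \<comment> \<open>The harmonic family is known to be nonzero only at \<open>x\<close>, so its
   phases are analysed along the chain from \<open>x\<close>.\<close>
 obtain Om' :: "(nat => 'a) measure" and F' X' where pr: "chain_process S M p ep \<beta> Om' F' X' 0"
  and init: "distr Om' (M 0) (X' 0) = return (M 0) x"
  using chain_proc_exists[OF x] by blast
 interpret FQ: functional_process S M p ep \<beta> f K Om' F' X'
  by (rule functional_process.intro[OF bounded_functional_axioms pr])
 have u0m: "(\<lambda>y. (norm (u 0 y))\<^sup>2) \<in> borel_measurable (M 0)"
  by (intro bfun_measurable bfun_power bfun_norm u(1)[rule_format])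
 have "(LINT om|Om'. (norm (u 0 (X' 0 om)))\<^sup>2) = (LINT y|distr Om' (M 0) (X' 0). (norm (u 0 y))\<^sup>2)"
  by (rule integral_distr[symmetric, OF FQ.X_meas[OF order_refl] u0m])
 also have "... = (norm (u 0 x))\<^sup>2" unfolding init by (rule integral_return[OF x u0m])
 finally have "c\<^sup>2 <= (LINT om|Om'. (norm (u 0 (X' 0 om)))\<^sup>2)"
  using power_mono[of c "norm (u 0 x)" 2] c u(4) complex_Re_le_cmod[of "u 0 x"] by simp
 from FQ.phase_decomposition[OF u(1,2,3) c this] obtain \<alpha> k b n0 and B :: real where
  \<alpha>: "!!n. \<alpha> n \<in> borel_measurable (M n)" "!!n y. \<bar>\<alpha> n y\<bar> <= pi"
  and k: "!!n. (\<lambda>xy. real_of_int (k n xy)) \<in> borel_measurable (MM n)"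
  and b: "!!n. bfun (MM n) (b n)"
  and dec: "!!n y z. ta * f n (y, z) = \<alpha> n y - \<alpha> (Suc n) z + 2 * pi * of_int (k n (y, z)) + b n (y, z)"
  and B: "!!N. (\<Sum>n=n0..<N. sqk n (b n)) <= B" by (elim exE conjE) blast
 \<comment> \<open>At time 0 the initial law need not be comparable with the reference measure,
   hence the maximum with 1; before \<open>n2\<close> the functional \<open>g\<close> is set to
   0.\<close>
 define n2 where "n2 = max n0 1"
 define g where "g n xy = (if n < n2 then 0 else 2 * pi / ta * of_int (k n xy))" for n xy
 define Bs where "Bs N om = (\<Sum>n=n2..<N. b n (XX n om))" for N om
 define m where "m N = (LINT om|Om. Bs N om) / ta" for N
 define Sd where "Sd N om = (\<Sum>j<N. f j (XX j om) - g j (XX j om))" for N om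
 \<comment> \<open>The first \<open>n2\<close> steps contribute at most \<open>n2 * K\<close>, the
   two boundary phases at most \<open>2 * pi\<close> before division.\<close>
 define D0 where "D0 = n2 * K + 2 * pi / \<bar>ta\<bar>"
 define V0 where "V0 = 4 * (\<beta> * (1 + \<beta>)) * (2 + 2 / ep) * B"
 have gm: "g n \<in> borel_measurable (MM n)" for n
  unfolding g_def[abs_def] using k[of n] by (cases "n < n2") auto
 have gk: "\<exists>k::int. g n xy = 2 * pi / ta * of_int k" for n xy
  by (cases "n < n2") (auto simp: g_def intro: exI[of _ 0])
 have first: "\<bar>Sd N om\<bar> <= n2 * K" if "N <= n2" "om \<in> space Om" for N om
 proof -
  have "\<bar>Sd N om\<bar> <= (\<Sum>j<N. K)"
   unfolding Sd_def using that f_bound[OF X_space X_space]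
   by (intro order_trans[OF sum_abs] sum_mono) (auto simp: g_def)
  also have "... <= n2 * K" using that K_nonneg by (auto intro!: mult_right_mono)
  finally show ?thesis .
 qed
 have later: "Sd N om = Sd n2 om + (\<alpha> n2 (X n2 om) - \<alpha> N (X N om)) / ta + Bs N om / ta" if "n2 <= N" for N om
  using that
 proof (induction N rule: dec_induct)
  case base
  then show ?case by (simp add: Bs_def)
 next
  case (step N)
  have "f N (XX N om) - g N (XX N om)
   = (\<alpha> N (X N om) - \<alpha> (Suc N) (X (Suc N) om) + b N (XX N om)) / ta"
   using dec[of N "X N om" "X (Suc N) om"] ta step(1) by (simp add: g_def field_simps)
  moreover have "Bs (Suc N) om = Bs N om + b N (XX N om)" using step(1) by (simp add: Bs_def)
  moreover have "Sd (Suc N) om = Sd N om + (f N (XX N om) - g N (XX N om))" by (simp add: Sd_def)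
  ultimately show ?case using step.IH by (simp add: add_divide_distrib diff_divide_distrib)
 qed
 have near: "\<bar>Sd N om - Bs N om / ta\<bar> <= D0" if om: "om \<in> space Om" for N om
 proof (cases "N <= n2")
  case True
  have "0 <= 2 * pi / \<bar>ta\<bar>" by simp
  with first[OF True om] have "\<bar>Sd N om\<bar> <= D0" unfolding D0_def by argo
  then show ?thesis using True by (simp add: Bs_def)
 next
  case False
  define a where "a = (\<alpha> n2 (X n2 om) - \<alpha> N (X N om)) / ta"
  have "\<bar>a\<bar> <= 2 * pi / \<bar>ta\<bar>"
   unfolding a_def
   using \<alpha>(2)[of n2 "X n2 om"] \<alpha>(2)[of N "X N om"] unfolding abs_divide by (intro divide_right_mono) auto
  moreover have "Sd N om = Sd n2 om + a + Bs N om / ta" unfolding a_def by (rule later) (use False in simp)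
  ultimately show ?thesis using first[OF order_refl om] unfolding D0_def by argo
 qed
 have bX: "bfun Om (\<lambda>om. b n (XX n om))" for n by (rule bfun_XXOm[OF _ b]) simp
 have Bsb: "bfun Om (Bs N)" for N unfolding Bs_def[abs_def] by (intro bfun_sum bX)
 have Sdb: "bfun Om (Sd N)" for N
 proof -
  have "Sd N \<in> borel_measurable Om"
  proof -
   have "(\<lambda>om. g j (XX j om)) \<in> borel_measurable Om" for j
    by (rule measurable_compose[OF measurable_Pair[OF X_meas X_meas] gm]) auto
   moreover have "(\<lambda>om. f j (XX j om)) \<in> borel_measurable Om" for j
    by (rule measurable_compose[OF measurable_Pair[OF X_meas X_meas] f_meas]) auto
   ultimately show ?thesis unfolding Sd_def[abs_def] by measurable
  qed
  then have "(\<lambda>om. Sd N om - Bs N om / ta) \<in> borel_measurable Om" using bfun_measurable[OF Bsb] by measurable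
  then have "bfun Om (\<lambda>om. Sd N om - Bs N om / ta)" by (rule bfunI) (use near in auto)
  from bfun_add[OF this bfun_divide_const[OF Bsb[of N], of ta]] show ?thesis by simp
 qed
 have "(LINT om|Om. (Sd N om - m N)\<^sup>2) <= 2 * D0\<^sup>2 + 2 * (V0 / ta\<^sup>2)" for N
 proof -
  have i: "integrable Om (\<lambda>om. (Sd N om - m N)\<^sup>2)" "integrable Om (\<lambda>om. (Bs N om - (LINT om|Om. Bs N om))\<^sup>2)"
   by (intro bfun_Om_integrable bfun_power bfun_diff Sdb Bsb bfun_const)+
  have "(LINT om|Om. (Sd N om - m N)\<^sup>2) <= (LINT om|Om. 2 * D0\<^sup>2 + 2 * ((Bs N om - (LINT om|Om. Bs N om))\<^sup>2 / ta\<^sup>2))"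
  proof (rule integral_mono[OF i(1)])
   fix om assume om: "om \<in> space Om"
   have "(Sd N om - Bs N om / ta)\<^sup>2 <= D0\<^sup>2"
    using power_mono[OF near[OF om, of N], of 2] by simp
   moreover have "(Sd N om - m N)\<^sup>2 <= 2 * (Sd N om - Bs N om / ta)\<^sup>2 + 2 * (m N - Bs N om / ta)\<^sup>2"
    using power2_diff_le[of "Sd N om - Bs N om / ta" "m N - Bs N om / ta"] by simp
   moreover have "(m N - Bs N om / ta)\<^sup>2 = (Bs N om - (LINT om|Om. Bs N om))\<^sup>2 / ta\<^sup>2"
    unfolding m_def diff_divide_distrib[symmetric] power_divide by (simp only: power2_commute)
   ultimately show "(Sd N om - m N)\<^sup>2 <= 2 * D0\<^sup>2 + 2 * ((Bs N om - (LINT om|Om. Bs N om))\<^sup>2 / ta\<^sup>2)" by simp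
  qed (use i in simp)
  also have "... = 2 * D0\<^sup>2 + 2 * ((LINT om|Om. (Bs N om - (LINT om|Om. Bs N om))\<^sup>2) / ta\<^sup>2)" using i Om.prob_space by simp
  also have "... <= 2 * D0\<^sup>2 + 2 * (V0 / ta\<^sup>2)"
  proof (intro add_left_mono mult_left_mono divide_right_mono)
   have "(LINT om|Om. (Bs N om - (LINT om|Om. Bs N om))\<^sup>2) <= 4 * (\<beta> * (1 + \<beta>)) * (2 + 2 / ep) * (\<Sum>n=n2..<N. sqk n (b n))"
    unfolding Bs_def by (rule sum_variance_le[OF b]) (simp add: n2_def)
   also have "... <= V0"
    unfolding V0_def
   proof (rule mult_left_mono)
    have "(\<Sum>n=n2..<N. sqk n (b n)) <= (\<Sum>n=n0..<N. sqk n (b n))"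
     by (intro sum_mono2 sqk_nonneg) (auto simp: n2_def)
    then show "(\<Sum>n=n2..<N. sqk n (b n)) <= B" using B[of N] by simp
   qed (use beta_nonneg eps_pos in auto)
   finally show "(LINT om|Om. (Bs N om - (LINT om|Om. Bs N om))\<^sup>2) <= V0" .
  qed auto
  finally show ?thesis .
 qed
 moreover have "integrable Om (\<lambda>om. (Sd N om - m N)\<^sup>2)" for N
  by (intro bfun_Om_integrable bfun_power bfun_diff Sdb bfun_const)
 ultimately show ?thesis using gm gk unfolding Sd_def by blast
qed

end

section \<open>Uniform smallness near a nonzero frequency\<close>

context elliptic_chain
begin

text \<open>Exponential in \<open>k\<close>, which is harmless: it is applied to a fixed number of
  initial steps only.\<close>

lemma T_weight_diff_le:
 fixes W W' :: "nat => 'a \<times> 'a => complex"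
 assumes W: "bwt W" "bwt W'" and W': "!!n x y. x \<in> St n ==> y \<in> St (Suc n) ==> norm (W' n (x, y)) <= 1"
  and d: "!!n x y. x \<in> St n ==> y \<in> St (Suc n) ==> norm (W n (x, y) - W' n (x, y)) <= \<eta>" and \<eta>: "0 <= \<eta>"
  and h: "bfun (M (n + k)) h" "!!y. y \<in> St (n + k) ==> norm (h y) <= c" and x: "x \<in> St n"
 shows "norm (T W n k h x - T W' n k h x) <= ((1 + \<eta>) ^ k - 1) * c"
 using h x
proof (induction k arbitrary: n x)
 case (Suc k)
 interpret k: prob_space "kern n x" using Suc.prems(3) by (rule prob_kern)
 have h: "bfun (M (Suc n + k)) h" "!!y. y \<in> St (Suc n + k) ==> norm (h y) <= c" using Suc.prems by auto
 let ?t = "T W (Suc n) k h" and ?t' = "T W' (Suc n) k h"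
 note b = bfun_T1_integrand[OF W(1) T_bfun[OF W(1) h(1)] Suc.prems(3)] bfun_T1_integrand[OF W(2) T_bfun[OF W(2) h(1)] Suc.prems(3)]
 have "T W n (Suc k) h x - T W' n (Suc k) h x = (LINT y|kern n x. W n (x, y) * ?t y - W' n (x, y) * ?t' y)"
  using integrable_kern[OF Suc.prems(3) b(1)] integrable_kern[OF Suc.prems(3) b(2)] by (simp add: T1_def)
 also have "norm ... <= ((1 + \<eta>) ^ Suc k - 1) * c"
 proof (rule k.norm_integral_le_const)
  have c0: "0 <= c" using h(2)[of "SOME x. x \<in> St (Suc n + k)"] space_nonempty[of "Suc n + k"]
   by (meson norm_ge_zero order_trans someI_ex)
  have e1: "1 <= (1 + \<eta>) ^ k" using \<eta> by simp
  have e: "(1 + \<eta>) ^ k * \<eta> + ((1 + \<eta>) ^ k - 1) = (1 + \<eta>) ^ Suc k - 1" by (simp add: algebra_simps)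
  have "1 <= (1 + \<eta>) ^ Suc k" using \<eta> by (intro one_le_power) simp
  then show "0 <= ((1 + \<eta>) ^ Suc k - 1) * c" using c0 by simp
  fix y assume "y \<in> space (kern n x)"
  then have y: "y \<in> St (Suc n)" by simp
  have t': "norm (?t' y) <= c" by (rule T_norm_le_1[OF W(2) W' h y])
  have "norm (?t y - ?t' y) <= ((1 + \<eta>) ^ k - 1) * c" by (rule Suc.IH[OF h y])
  then have t: "norm (?t y) <= (1 + \<eta>) ^ k * c"
   using t' norm_triangle_sub[of "?t y" "?t' y"] by (simp add: algebra_simps)
  have "W n (x, y) * ?t y - W' n (x, y) * ?t' y = (W n (x, y) - W' n (x, y)) * ?t y + W' n (x, y) * (?t y - ?t' y)"
   by (simp add: algebra_simps)
  also have "norm ... <= norm ((W n (x, y) - W' n (x, y)) * ?t y) + norm (W' n (x, y) * (?t y - ?t' y))" by (rule norm_triangle_ineq)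
  also have "... <= \<eta> * ((1 + \<eta>) ^ k * c) + 1 * (((1 + \<eta>) ^ k - 1) * c)"
   unfolding norm_mult using d[OF Suc.prems(3) y] W'[OF Suc.prems(3) y] t \<open>norm (?t y - ?t' y) <= _\<close> \<eta>
   by (intro add_mono mult_mono) auto
  also have "... = ((1 + \<eta>) ^ Suc k - 1) * c" unfolding e[symmetric] by (simp add: algebra_simps)
  finally show "norm (W n (x, y) * ?t y - W' n (x, y) * ?t' y) <= ((1 + \<eta>) ^ Suc k - 1) * c" .
 qed
 finally show ?case .
qed simp

end

context bounded_functional
begin

lemma vv_norm_le:
 assumes y: "y \<in> St n"
 shows "norm (vv n d (of_real \<xi> + \<i> * of_real ta) y) <= norm (vv n d (of_real \<xi>) y)"
proof -
 define U where "U n xy = exp (\<xi> * (f n xy - cen n))" for n xy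
 have U: "bwt U" unfolding bwt_def U_def[abs_def] by (intro allI bfun_exp bfun_mult bfun_const fc_bfun)
 have "vv n d (of_real \<xi>) y = T (\<lambda>n xy. cor (U n xy)) n d (\<lambda>_. of_real 1) y"
  unfolding vv_def by (rule T_cong_W[OF _ y, THEN trans]) (auto simp: Wc_def U_def exp_of_real[symmetric])
 also have "... = of_real (T U n d (\<lambda>_. 1) y)" by (rule T_of_real[OF y])
 finally have "norm (vv n d (of_real \<xi>) y) = T U n d (\<lambda>_. 1) y"
  using T_real_nonneg[of U y n d] y by (simp add: U_def)
 moreover have "norm (vv n d (of_real \<xi> + \<i> * of_real ta) y) <= T U n d (\<lambda>_. 1) y"
  unfolding vv_def by (rule T_norm_le[OF Wc_bwt U _ bfun_const bfun_const _ y]) (auto simp: Wc_def U_def)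
 ultimately show ?thesis by simp
qed

text \<open>Only the first \<open>n\<close> steps are perturbed in \<xi> and \<open>ta\<close>; all
  later ones form a terminal function of norm at most \<open>3 / 2 * H\<close>. The numerator is at
  most \<open>3 * e * H\<close> and the denominator at least \<open>H / 4\<close>, whence
  12.\<close>

lemma vv_uniform_small:
 assumes x: "x \<in> St 0" and e: "0 < e"
  and small: "!!v. bfun (M n) v ==> (!!y. y \<in> St n ==> norm (v y) <= 1) ==> norm (T (Wf (\<i> * of_real ta\<^sub>0)) 0 n v x) <= e"
 shows "\<exists>r>0. \<forall>N\<ge>n. \<forall>\<xi> ta. \<bar>\<xi>\<bar> < r --> \<bar>ta - ta\<^sub>0\<bar> < r -->
  norm (vv 0 N (of_real \<xi> + \<i> * of_real ta) x) <= 12 * e * norm (vv 0 N (of_real \<xi>) x)"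
proof -
 define e' where "e' = min e (1 / 6)"
 have e': "0 < e'" "e' <= e" "e' <= 1 / 6" using e by (auto simp: e'_def)
 have LL0: "0 < LL" using KD_nonneg by simp
 have "((\<lambda>r. (1 + exp (2 * r * LL) * (2 * r * LL)) ^ n) \<longlongrightarrow> (1 + exp (2 * 0 * LL) * (2 * 0 * LL)) ^ n) (at_right 0)"
  by (intro tendsto_intros)
 then have "\<forall>\<^sub>F r in at_right 0. (1 + exp (2 * r * LL) * (2 * r * LL)) ^ n < 1 + e'"
  by (rule order_tendstoD(2)) (use e' in simp)
 with eventually_at_right_real[OF rad_pos] have "\<forall>\<^sub>F r in at_right 0. (1 + exp (2 * r * LL) * (2 * r * LL)) ^ n < 1 + e' \<and> r < rad \<and> 0 < r"
  by eventually_elim auto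
 then obtain r where r: "(1 + exp (2 * r * LL) * (2 * r * LL)) ^ n < 1 + e'" "r < rad" "0 < r"
  using eventually_happens trivial_limit_at_right_real by blast
 define \<eta> where "\<eta> = exp (2 * r * LL) * (2 * r * LL)"
 have \<eta>: "0 <= \<eta>" "(1 + \<eta>) ^ n - 1 <= e'" using r LL0 by (auto simp: \<eta>_def)
 have wd: "norm (Wc w j (y, z) - Wc w' j (y, z)) <= \<eta>"
  if w: "norm (w - w') <= 2 * r" "norm (Wc w' j (y, z)) = 1" and y: "y \<in> St j" "z \<in> St (Suc j)" for w w' j y z
 proof -
  let ?a = "cor (f j (y, z) - cen j)"
  have "Wc w j (y, z) - Wc w' j (y, z) = Wc w' j (y, z) * (exp ((w - w') * ?a) - 1)"
   by (simp add: Wc_def exp_diff[symmetric] exp_add[symmetric] algebra_simps)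
  then have "norm (Wc w j (y, z) - Wc w' j (y, z)) = norm (exp ((w - w') * ?a) - 1)" using w by (simp add: norm_mult)
  also have "... <= exp (norm ((w - w') * ?a)) * norm ((w - w') * ?a)" by (rule exp_minus_1_le)
  also have "... <= \<eta>"
  proof -
   have "norm ((w - w') * ?a) <= 2 * r * LL"
    unfolding norm_mult norm_of_real using w(1) fc_le[OF y] r by (intro mult_mono) auto
   then show ?thesis unfolding \<eta>_def by (intro mult_mono) auto
  qed
  finally show ?thesis .
 qed
 have "norm (vv 0 N (of_real \<xi> + \<i> * of_real ta) x) <= 12 * e * norm (vv 0 N (of_real \<xi>) x)"
  if N: "n <= N" and \<xi>: "\<bar>\<xi>\<bar> < r" and ta: "\<bar>ta - ta\<^sub>0\<bar> < r" for N \<xi> ta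
 proof -
  define d where "d = N - n"
  have Nd: "N = n + d" using N by (simp add: d_def)
  define w where "w = cor \<xi> + \<i> * of_real ta"
  define H where "H = norm (vv n d (of_real \<xi>) (base n))"
  define g where "g = vv n d (of_real \<xi>)"
  define g' where "g' = vv n d w"
  have split: "vv 0 N w x = T (Wc w) 0 n (vv n d w) x" for w unfolding vv_def Nd using T_add_steps[of "Wc w" 0 n d] by simp
  have b: "bfun (M (0 + n)) g" "bfun (M (0 + n)) g'" unfolding g_def g'_def by (simp_all add: vv_bfun)
  have \<xi>r: "norm (cor \<xi>) < rad" using \<xi> r(2) by simp
  have osc: "norm (g y - g (base n)) <= 1 / 2 * H" if "y \<in> St n" for y
  proof -
   have "norm (g y - g (base n)) <= kap * norm (cor \<xi>) * H"
    unfolding g_def H_def by (rule vv_osc[OF \<xi>r that base_in])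
   also have "... <= 1 / 2 * H" using rad_bounds(3)[OF \<xi>r] by (intro mult_right_mono) (auto simp: H_def mult.commute)
   finally show ?thesis .
  qed
  have gH: "norm (g y) <= 3 / 2 * H" if "y \<in> St n" for y
   using osc[OF that] norm_triangle_sub[of "g y" "g (base n)"] by (simp add: H_def g_def)
  have g'H: "norm (g' y) <= 3 / 2 * H" if "y \<in> St n" for y
   using vv_norm_le[OF that, of d \<xi> ta] gH[OF that] by (simp add: g_def g'_def w_def)
  have H0: "0 < H"
  proof -
   obtain La where "\<forall>w\<in>ball 0 rad. vv n d w (base n) = exp (La w)" using log_mgf_local[of n d] by blast
   then have "vv n d (of_real \<xi>) (base n) \<noteq> 0" using \<xi>r by simp
   then show ?thesis by (simp add: H_def)
  qed
  have W0: "norm (Wc 0 j yz) = 1" "norm (Wc (\<i> * of_real ta\<^sub>0) j yz) = 1" for j yz by (simp_all add: Wc_def)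
  have "norm (T (Wc (of_real \<xi>)) 0 n g x - T (Wc 0) 0 n g x) <= ((1 + \<eta>) ^ n - 1) * (3 / 2 * H)"
   by (rule T_weight_diff_le[OF Wc_bwt Wc_bwt _ _ \<eta>(1) b(1) _ x]) (use \<xi> r gH in \<open>auto simp: W0 intro!: wd\<close>)
  also have "... <= 1 / 6 * (3 / 2 * H)" using \<eta> e' H0 by (intro mult_right_mono) auto
  finally have low1: "norm (T (Wc (of_real \<xi>)) 0 n g x - T (Wc 0) 0 n g x) <= H / 4" by simp
  have "norm (PT 0 n (\<lambda>y. g y - g (base n)) x) <= 1 / 2 * H"
   by (rule T_norm_le_1[OF bwt_1 _ bfun_diff[OF b(1) bfun_const] _ x]) (use osc in auto)
  moreover have "PT 0 n (\<lambda>y. g y - g (base n)) x = T (Wc 0) 0 n g x - g (base n)"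
   using T_diff[OF bwt_1 b(1) bfun_const x, of "g (base n)"] x by (simp add: T_one_const Wc_def[abs_def])
  ultimately have low: "H / 4 <= norm (vv 0 N (of_real \<xi>) x)"
   using low1 norm_triangle_sub[of "g (base n)" "T (Wc 0) 0 n g x"] norm_triangle_sub[of "T (Wc 0) 0 n g x" "T (Wc (of_real \<xi>)) 0 n g x"]
   unfolding split g_def[symmetric] H_def by (simp add: norm_minus_commute g_def)
  have wn: "norm (w - \<i> * of_real ta\<^sub>0) <= 2 * r"
  proof -
   have "w - \<i> * of_real ta\<^sub>0 = of_real \<xi> + \<i> * of_real (ta - ta\<^sub>0)" by (simp add: w_def algebra_simps)
   also have "norm ... <= \<bar>\<xi>\<bar> + \<bar>ta - ta\<^sub>0\<bar>" by (rule norm_triangle_ineq[THEN order_trans]) (simp add: norm_mult flip: of_real_diff)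
   finally show ?thesis using \<xi> ta by simp
  qed
  have "norm (T (Wc w) 0 n g' x - T (Wc (\<i> * of_real ta\<^sub>0)) 0 n g' x) <= ((1 + \<eta>) ^ n - 1) * (3 / 2 * H)"
   by (rule T_weight_diff_le[OF Wc_bwt Wc_bwt _ _ \<eta>(1) b(2) _ x]) (use wn g'H in \<open>auto simp: W0 intro!: wd\<close>)
  also have "... <= e * (3 / 2 * H)" using \<eta> e' H0 by (intro mult_right_mono) auto
  finally have up1: "norm (T (Wc w) 0 n g' x - T (Wc (\<i> * of_real ta\<^sub>0)) 0 n g' x) <= e * (3 / 2 * H)" .
  define s where "s = 3 / 2 * H"
  have s: "0 < s" using H0 by (simp add: s_def)
  have ns: "norm (inverse (of_real s) * z) = norm z / s" for z :: complex
   using s by (simp add: norm_mult norm_inverse divide_inverse mult.commute)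
  have "norm (T (Wf (\<i> * of_real ta\<^sub>0)) 0 n (\<lambda>y. inverse (of_real s) * g' y) x) <= e"
  proof (rule small)
   show "norm (inverse (of_real s) * g' y) <= 1" if "y \<in> St n" for y
    unfolding ns using g'H[OF that, folded s_def] s by simp
   show "bfun (M n) (\<lambda>y. inverse (of_real s) * g' y)" using bfun_mult[OF bfun_const b(2)] by simp
  qed
  also have "T (Wf (\<i> * of_real ta\<^sub>0)) 0 n (\<lambda>y. inverse (of_real s) * g' y) x = inverse (of_real s) * T (Wf (\<i> * of_real ta\<^sub>0)) 0 n g' x"
   by (rule T_cmult[OF Wf_bwt b(2) x])
  finally have "norm (T (Wf (\<i> * of_real ta\<^sub>0)) 0 n g' x) <= e * s"
   unfolding ns using s by (simp only: pos_divide_le_eq)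
  moreover have "norm (T (Wc (\<i> * of_real ta\<^sub>0)) 0 n g' x) = norm (T (Wf (\<i> * of_real ta\<^sub>0)) 0 n g' x)"
  proof -
   have "T (Wc (\<i> * of_real ta\<^sub>0)) 0 n (\<lambda>z. 1 * g' z) x = (\<Prod>j<n. exp (\<i> * of_real (- (ta\<^sub>0 * cen (0 + j))))) * 1 * T (Wf (\<i> * of_real ta\<^sub>0)) 0 n g' x"
    by (rule T_gauge[where g = "\<lambda>_ _. 1" and h = g' and n = 0 and k = n and x = x and c = "\<lambda>j. exp (\<i> * of_real (- (ta\<^sub>0 * cen j)))"
       and W = "Wf (\<i> * of_real ta\<^sub>0)" and W' = "Wc (\<i> * of_real ta\<^sub>0)"])
     (use x in \<open>simp_all add: Wc_def exp_add[symmetric] algebra_simps\<close>)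
   then show ?thesis by (simp add: norm_mult prod_norm[symmetric] del: of_real_minus of_real_mult)
  qed
  ultimately have "norm (vv 0 N w x) <= 3 * (e * H)"
   using up1 norm_triangle_sub[of "T (Wc w) 0 n g' x" "T (Wc (\<i> * of_real ta\<^sub>0)) 0 n g' x"] unfolding split g'_def[symmetric] s_def by simp
  also have "... <= 12 * e * norm (vv 0 N (of_real \<xi>) x)" using mult_left_mono[OF low, of "12 * e"] e by simp
  finally show ?thesis unfolding w_def .
 qed
 then show ?thesis using r by blast
qed

end

section \<open>Moments of the exponentially tilted sum\<close>

context functional_process
begin

definition mg :: "nat => nat => real => real" where "mg i N \<xi> = (LINT om|Om. Sc N om ^ i * exp (\<xi> * Sc N om))"

lemma mg_eq: "(LINT om|Om. of_real (Sc N om) ^ i * exp (of_real \<xi> * of_real (Sc N om))) = cor (mg i N \<xi>)"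
 unfolding mg_def integral_complex_of_real[symmetric] by (simp add: exp_of_real[symmetric])

lemma mg_deriv: "(mg i N has_real_derivative mg (Suc i) N \<xi>) (at \<xi>)"
proof -
 have "((\<lambda>w. \<integral>om. of_real (Sc N om) ^ i * exp (w * of_real (Sc N om)) \<partial>Om)
   has_field_derivative (LINT om|Om. of_real (Sc N om) ^ Suc i * exp (w * of_real (Sc N om)))) (at (w :: complex))" for w
  using Om.mgf_derivative[OF bfun_power[OF bfun_of_real[OF Sc_bfun[of N]], where n = i] Sc_bfun[of N], of w] by (simp add: mult_ac)
 from has_field_derivative_Re[OF has_vector_derivative_real_field[OF this[of "of_real \<xi>"]]] show ?thesis unfolding mg_eq by simp
qed

lemma mg_0_pos: "0 < mg 0 N \<xi>"
proof -
 have "Gm N (of_real \<xi>) = of_real (mg 0 N \<xi>)" using mg_eq[where i = 0] by (simp add: Gm_def)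
 obtain B where B: "!!om. om \<in> space Om ==> norm (\<xi> * Sc N om) <= B"
  using bfun_mult[OF bfun_const Sc_bfun, of \<xi> N] by (elim bfunE) blast
 have "exp (- B) = (LINT om|Om. exp (- B))" using Om.prob_space by simp
 also have "... <= mg 0 N \<xi>"
  unfolding mg_def
 proof (rule integral_mono)
  show "integrable Om (\<lambda>om. Sc N om ^ 0 * exp (\<xi> * Sc N om))"
   by (intro bfun_Om_integrable bfun_mult bfun_power bfun_exp bfun_const Sc_bfun)
  show "exp (- B) <= Sc N om ^ 0 * exp (\<xi> * Sc N om)" if "om \<in> space Om" for om using B[OF that] by (simp add: abs_le_iff)
 qed simp
 finally show ?thesis using exp_gt_zero[of "- B"] by linarith
qed

lemma ln_mg_deriv: "((\<lambda>\<xi>. ln (mg 0 N \<xi>)) has_real_derivative mg 1 N \<xi> / mg 0 N \<xi>) (at \<xi>)"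
 using DERIV_chain2[OF DERIV_ln_divide[OF mg_0_pos] mg_deriv[of 0 N \<xi>]] by simp

lemma mg_ratio_deriv:
 "((\<lambda>\<xi>. mg 1 N \<xi> / mg 0 N \<xi>) has_real_derivative (mg 2 N \<xi> * mg 0 N \<xi> - (mg 1 N \<xi>)\<^sup>2) / (mg 0 N \<xi>)\<^sup>2) (at \<xi>)"
 using DERIV_divide[OF mg_deriv[of 1 N \<xi>] mg_deriv[of 0 N \<xi>]] mg_0_pos[of N \<xi>] by (simp add: numeral_2_eq_2 mult.commute)

text \<open>The derivative of the tilted mean is the variance under the tilted law.\<close>

lemma mg_ratio_mono: "\<xi> <= \<xi>' ==> mg 1 N \<xi> / mg 0 N \<xi> <= mg 1 N \<xi>' / mg 0 N \<xi>'"
proof (rule DERIV_nonneg_imp_nondecreasing[where f = "\<lambda>\<xi>. mg 1 N \<xi> / mg 0 N \<xi>"])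
 fix \<xi>
 define m where "m = mg 1 N \<xi> / mg 0 N \<xi>"
 have b: "integrable Om (\<lambda>om. Sc N om ^ i * exp (\<xi> * Sc N om))" for i
  by (intro bfun_Om_integrable bfun_mult bfun_power bfun_exp bfun_const Sc_bfun)
 have "0 <= (LINT om|Om. (Sc N om - m)\<^sup>2 * exp (\<xi> * Sc N om))" by simp
 also have "... = (LINT om|Om. Sc N om ^ 2 * exp (\<xi> * Sc N om) - 2 * m * (Sc N om ^ 1 * exp (\<xi> * Sc N om)) + m\<^sup>2 * (Sc N om ^ 0 * exp (\<xi> * Sc N om)))"
  by (simp add: power2_diff algebra_simps)
 also have "... = mg 2 N \<xi> - 2 * m * mg 1 N \<xi> + m\<^sup>2 * mg 0 N \<xi>"
  unfolding mg_def using b[of 2] b[of 1] b[of 0] by simp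
 also have "... = mg 2 N \<xi> - (mg 1 N \<xi>)\<^sup>2 / mg 0 N \<xi>" using mg_0_pos[of N \<xi>] by (simp add: m_def power2_eq_square field_simps)
 finally have "0 <= mg 2 N \<xi> * mg 0 N \<xi> - (mg 1 N \<xi>)\<^sup>2" using mg_0_pos[of N \<xi>] by (simp add: field_simps)
 then show "\<exists>y. ((\<lambda>\<xi>. mg 1 N \<xi> / mg 0 N \<xi>) has_real_derivative y) (at \<xi>) \<and> 0 <= y"
  using mg_ratio_deriv[of N \<xi>] by (intro exI conjI) auto
qed

text \<open>Strict growth at the single point \<xi> together with monotonicity everywhere determines
  the solution. This gives the definite description in \<open>legendre\<close> its value.\<close>

lemma tilt_unique:
 assumes "mg 1 N \<xi> / mg 0 N \<xi> = y" "mg 1 N \<xi>' / mg 0 N \<xi>' = y" "(mg 1 N \<xi>)\<^sup>2 < mg 2 N \<xi> * mg 0 N \<xi>"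
 shows "\<xi>' = \<xi>"
proof -
 let ?D = "\<lambda>\<xi>. mg 1 N \<xi> / mg 0 N \<xi>"
 have p: "0 < (mg 2 N \<xi> * mg 0 N \<xi> - (mg 1 N \<xi>)\<^sup>2) / (mg 0 N \<xi>)\<^sup>2" using assms(3) mg_0_pos[of N \<xi>] by simp
 obtain d1 where d1: "0 < d1" "!!h. 0 < h ==> h < d1 ==> ?D \<xi> < ?D (\<xi> + h)"
  using DERIV_pos_inc_right[OF mg_ratio_deriv p] by blast
 obtain d2 where d2: "0 < d2" "!!h. 0 < h ==> h < d2 ==> ?D (\<xi> - h) < ?D \<xi>"
  using DERIV_pos_inc_left[OF mg_ratio_deriv p] by blast
 have "\<not> \<xi> < \<xi>'"
 proof
  assume l: "\<xi> < \<xi>'"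
  define h where "h = min (d1 / 2) (\<xi>' - \<xi>)"
  have "?D \<xi> < ?D (\<xi> + h)" using d1(1) l by (intro d1(2)) (auto simp: h_def min_def)
  also have "... <= ?D \<xi>'" by (rule mg_ratio_mono) (simp add: h_def min_def)
  finally show False using assms by simp
 qed
 moreover have "\<not> \<xi>' < \<xi>"
 proof
  assume l: "\<xi>' < \<xi>"
  define h where "h = min (d2 / 2) (\<xi> - \<xi>')"
  have "?D \<xi>' <= ?D (\<xi> - h)" by (rule mg_ratio_mono) (simp add: h_def min_def)
  also have "... < ?D \<xi>" using d2(1) l by (intro d2(2)) (auto simp: h_def min_def)
  finally show False using assms by simp
 qed
 ultimately show ?thesis by simp
qed

end

section \<open>The saddle point method\<close>

text \<open>The Lipschitz bound is integrated along the segment once and twice; the factors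
  \<open>1 / 2\<close> and \<open>1 / 6\<close> are given away.\<close>

lemma taylor2_bounds:
 assumes La: "La holomorphic_on ball 0 r" and r: "0 < r" and B: "0 <= B"
  and lip: "!!w w'. norm w <= r / 2 ==> norm w' <= r / 2 ==> norm (deriv (deriv La) w - deriv (deriv La) w') <= B * norm (w - w')"
  and w: "norm w <= r / 2" "norm w' <= r / 2"
 shows "norm (deriv La w' - deriv La w - deriv (deriv La) w * (w' - w)) <= B * norm (w' - w) ^ 2"
  and "norm (La w' - La w - deriv La w * (w' - w) - deriv (deriv La) w * (w' - w)\<^sup>2 / 2) <= B * norm (w' - w) ^ 3"
proof -
 have sub: "norm z <= r / 2" if "z \<in> closed_segment w v" "norm v <= r / 2" for z v
  using closed_segment_subset[OF _ _ convex_cball, of w 0 "r / 2" v] that w by auto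
 have D: "(La has_field_derivative deriv La z) (at z within A)" "(deriv La has_field_derivative deriv (deriv La) z) (at z within A)"
  if "norm z <= r / 2" for z A
  using that r by (auto intro!: has_field_derivative_at_within[OF holomorphic_derivI[OF La open_ball]]
    has_field_derivative_at_within[OF holomorphic_derivI[OF holomorphic_deriv[OF La open_ball] open_ball]])
 have 1: "norm (deriv La v - deriv La w - deriv (deriv La) w * (v - w)) <= B * norm (v - w) ^ 2" if v: "norm v <= r / 2" for v
 proof -
  let ?g = "\<lambda>z. deriv La z - deriv (deriv La) w * z"
  have "norm (?g v - ?g w) <= B * norm (v - w) * norm (v - w)"
  proof (rule field_differentiable_bound[where S = "closed_segment w v" and f' = "\<lambda>z. deriv (deriv La) z - deriv (deriv La) w"])
   fix z assume z: "z \<in> closed_segment w v"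
   show "(?g has_field_derivative deriv (deriv La) z - deriv (deriv La) w) (at z within closed_segment w v)"
    by (rule derivative_eq_intros D(2) sub[OF z v] refl | simp)+
   have "norm (deriv (deriv La) z - deriv (deriv La) w) <= B * norm (z - w)" by (rule lip[OF sub[OF z v] w(1)])
   also have "... <= B * norm (v - w)" using segment_bound(1)[OF z] B by (intro mult_left_mono) auto
   finally show "norm (deriv (deriv La) z - deriv (deriv La) w) <= B * norm (v - w)" .
  qed auto
  then show ?thesis by (simp add: algebra_simps power2_eq_square)
 qed
 from 1[OF w(2)] show "norm (deriv La w' - deriv La w - deriv (deriv La) w * (w' - w)) <= B * norm (w' - w) ^ 2" .
 let ?g = "\<lambda>z. La z - deriv La w * (z - w) - deriv (deriv La) w * (z - w)\<^sup>2 / 2"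
 have "norm (?g w' - ?g w) <= B * norm (w' - w) ^ 2 * norm (w' - w)"
 proof (rule field_differentiable_bound[where S = "closed_segment w w'" and f' = "\<lambda>z. deriv La z - deriv La w - deriv (deriv La) w * (z - w)"])
  fix z assume z: "z \<in> closed_segment w w'"
  show "(?g has_field_derivative deriv La z - deriv La w - deriv (deriv La) w * (z - w)) (at z within closed_segment w w')"
   by (rule derivative_eq_intros D(1) sub[OF z w(2)] refl | simp)+
  have "norm (deriv La z - deriv La w - deriv (deriv La) w * (z - w)) <= B * norm (z - w) ^ 2" by (rule 1[OF sub[OF z w(2)]])
  also have "... <= B * norm (w' - w) ^ 2" using segment_bound(1)[OF z] B by (intro mult_left_mono power_mono) auto
  finally show "norm (deriv La z - deriv La w - deriv (deriv La) w * (z - w)) <= B * norm (w' - w) ^ 2" .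
 qed auto
 then show "norm (La w' - La w - deriv La w * (w' - w) - deriv (deriv La) w * (w' - w)\<^sup>2 / 2) <= B * norm (w' - w) ^ 3"
  by (simp add: power2_eq_square power3_eq_cube mult.assoc algebra_simps)
qed

lemma gauss_integral:
 assumes q: "0 < q"
 shows "integrable lborel (\<lambda>t. exp (- q * (t - \<mu>)\<^sup>2))" "(LINT t|lborel. exp (- q * (t - \<mu>)\<^sup>2)) = sqrt (pi / q)"
proof -
 define \<sigma> where "\<sigma> = sqrt (1 / (2 * q))"
 have \<sigma>: "0 < \<sigma>" "\<sigma>\<^sup>2 = 1 / (2 * q)" using q by (auto simp: \<sigma>_def)
 have e: "(\<lambda>t. exp (- q * (t - \<mu>)\<^sup>2)) = (\<lambda>t. sqrt (pi / q) * normal_density \<mu> \<sigma> t)"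
  using q by (auto simp: normal_density_def \<sigma>(2) real_sqrt_divide fun_eq_iff field_simps)
 show "integrable lborel (\<lambda>t. exp (- q * (t - \<mu>)\<^sup>2))" "(LINT t|lborel. exp (- q * (t - \<mu>)\<^sup>2)) = sqrt (pi / q)"
  unfolding e using \<sigma> integrable_normal_density[OF \<sigma>(1), of \<mu>] integral_normal_density[OF \<sigma>(1), of \<mu>] by simp_all
qed

text \<open>On a short interval, compare with the maximum point: the product bound gives Gaussian decay away from it,
 and interpolating with the sup bound \<open>m\<close> gains the factor \<open>sqrt m\<close>.\<close>

lemma pair_integral_le:
 fixes \<rho> :: "real => real"
 assumes cont: "continuous_on UNIV \<rho>" and nn: "!!t. 0 <= \<rho> t" and q: "0 < q" and A: "0 <= A" and \<delta>: "0 < \<delta>"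
  and pair: "!!s t. \<bar>s - t\<bar> <= \<delta> ==> \<rho> s * \<rho> t <= A * exp (- q * (s - t)\<^sup>2)"
  and m: "!!t. t \<in> {a..b} ==> \<rho> t <= m" "0 <= m" and ab: "a <= b" "b - a <= (1 + real k) * \<delta>"
 shows "(LINT t|lborel. indicator {a..b} t * \<rho> t) <= (1 + real k) * (sqrt m * sqrt (sqrt A) * sqrt (4 * pi / q))"
 using ab m(1)
proof (induction k arbitrary: a)
 have int: "integrable lborel (\<lambda>t. indicator {a..b} t * \<rho> t)" for a b
  using borel_integrable_compact[of "{a..b}" \<rho>] continuous_on_subset[OF cont] by auto
 have q4: "0 < q / 4" using q by simp
 have short: "(LINT t|lborel. indicator {a..b} t * \<rho> t) <= sqrt m * sqrt (sqrt A) * sqrt (4 * pi / q)"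
  if ab: "a <= b" "b - a <= \<delta>" and m1: "!!t. t \<in> {a..b} ==> \<rho> t <= m" for a b
 proof -
  obtain t0 where t0: "t0 \<in> {a..b}" "!!t. t \<in> {a..b} ==> \<rho> t <= \<rho> t0"
   using continuous_attains_sup[of "{a..b}" \<rho>] continuous_on_subset[OF cont] ab by auto
  have "(LINT t|lborel. indicator {a..b} t * \<rho> t) <= (LINT t|lborel. sqrt m * sqrt (sqrt A) * exp (- (q / 4) * (t - t0)\<^sup>2))"
  proof (rule integral_mono[OF int])
   show "integrable lborel (\<lambda>t. sqrt m * sqrt (sqrt A) * exp (- (q / 4) * (t - t0)\<^sup>2))"
    using gauss_integral(1)[OF q4] by simp
   fix t :: real
   show "indicator {a..b} t * \<rho> t <= sqrt m * sqrt (sqrt A) * exp (- (q / 4) * (t - t0)\<^sup>2)"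
   proof (cases "t \<in> {a..b}")
    case True
    define E where "E = exp (- (q / 4) * (t - t0)\<^sup>2)"
    have E: "E ^ 4 = exp (- q * (t - t0)\<^sup>2)" "0 < E" by (simp_all add: E_def exp_of_nat_mult[symmetric])
    have "(\<rho> t)\<^sup>2 <= \<rho> t * \<rho> t0" unfolding power2_eq_square by (rule mult_left_mono[OF t0(2)[OF True] nn])
    also have "... <= A * E ^ 4" unfolding E(1) by (rule pair) (use True t0(1) ab in auto)
    also have "... = (sqrt A * E\<^sup>2)\<^sup>2" using A by (simp add: power_mult_distrib flip: power_mult)
    finally have "\<rho> t <= sqrt A * E\<^sup>2" by (rule power2_le_imp_le) (use A in simp)
    then have "\<rho> t * \<rho> t <= m * (sqrt A * E\<^sup>2)" using m1[OF True] nn m(2) by (intro mult_mono) auto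
    also have "... = (sqrt m * sqrt (sqrt A) * E)\<^sup>2" using A m(2) by (simp add: power_mult_distrib)
    finally have "(\<rho> t)\<^sup>2 <= (sqrt m * sqrt (sqrt A) * E)\<^sup>2" by (simp only: power2_eq_square[of "\<rho> t"])
    then have "\<rho> t <= sqrt m * sqrt (sqrt A) * E" by (rule power2_le_imp_le) (use A m(2) E(2) in simp)
    then show ?thesis using True by (simp add: E_def)
   qed (use A m(2) in auto)
  qed
  also have "... = sqrt m * sqrt (sqrt A) * sqrt (4 * pi / q)"
   using gauss_integral[OF q4, of t0] by (simp add: mult.commute)
  finally show ?thesis .
 qed
 define X where "X = sqrt m * sqrt (sqrt A) * sqrt (4 * pi / q)"
 have X0: "0 <= X" using A m(2) q by (simp add: X_def)
 {
  case 0
  then show ?case using short by simp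
 next
  case (Suc k)
  show ?case
  proof (cases "a + \<delta> <= b")
   case True
   have "(LINT t|lborel. indicator {a..b} t * \<rho> t) <= (LINT t|lborel. indicator {a..a+\<delta>} t * \<rho> t + indicator {a+\<delta>..b} t * \<rho> t)"
    using nn by (intro integral_mono int Bochner_Integration.integrable_add) (auto simp: indicator_def)
   also have "... = (LINT t|lborel. indicator {a..a+\<delta>} t * \<rho> t) + (LINT t|lborel. indicator {a+\<delta>..b} t * \<rho> t)"
    by (intro Bochner_Integration.integral_add int)
   also have "... <= X + (1 + real k) * X"
    unfolding X_def using Suc.prems True \<delta> by (intro add_mono short Suc.IH) (auto simp: algebra_simps)
   finally show ?thesis unfolding X_def[symmetric] by (simp add: algebra_simps)
  next
   case False
   have "(LINT t|lborel. indicator {a..b} t * \<rho> t) <= X"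
    unfolding X_def using Suc.prems False by (intro short) auto
   also have "... <= (1 + real (Suc k)) * X" using X0 by (simp add: algebra_simps)
   finally show ?thesis unfolding X_def .
  qed
 }
qed

text \<open>\<open>GP\<close> is the transform under the initial law, with logarithm
  \<open>La\<close>, mean \<open>a\<close> and variance \<open>V\<close>; \<open>Gx\<close> is the
  transform from the starting point and \<open>y\<close> the target. The saddle point belongs to
  \<open>GP\<close>, which defines the rate function. \<open>Gx\<close> needs no logarithm: it is
  compared with \<open>GP\<close> near 0, and only its norm matters elsewhere.\<close>

locale saddle_point =
 fixes La Gx GP :: "nat => complex => complex" and V y a :: "nat => real" and r C \<kappa> \<delta>0 c :: real
 assumes r_pos: "0 < r" and C1: "1 <= C" and \<kappa>: "0 <= \<kappa>" and \<delta>0: "0 < \<delta>0" and c_pos: "0 < c"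
  and V_top: "filterlim V at_top sequentially"
  and La_holo: "La N holomorphic_on ball 0 r" and GP_exp: "norm w < r ==> GP N w = exp (La N w)" and La_0: "La N 0 = 0"
  and La_bound: "\<forall>\<^sub>F N in sequentially. \<forall>w. norm w < r --> norm (La N w) <= C * V N"
  and d1: "deriv (La N) 0 = of_real (a N)" and d2: "deriv (deriv (La N)) 0 = of_real (V N)"
  and dreal: "\<bar>\<xi>\<bar> < r ==> deriv (La N) (of_real \<xi>) \<in> \<real>"
  and near: "norm w < r ==> norm (Gx N w - GP N w) <= \<kappa> * norm w * norm (GP N w)"
  and Gx_cont: "continuous_on UNIV (Gx N)"
  and pair: "\<bar>\<xi>\<bar> < r ==> \<bar>ta - ta'\<bar> <= \<delta>0 ==>
   norm (Gx N (of_real \<xi> + \<i> * of_real ta)) * norm (Gx N (of_real \<xi> + \<i> * of_real ta'))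
   <= C * exp (- (c * V N) * (ta - ta')\<^sup>2) * (norm (Gx N (of_real \<xi>)))\<^sup>2"
  and small: "ta\<^sub>0 \<noteq> 0 ==> \<bar>ta\<^sub>0\<bar> <= pi ==> 0 < e ==> \<exists>s>0. \<forall>\<^sub>F N in sequentially. \<forall>\<xi> ta. \<bar>\<xi>\<bar> < s --> \<bar>ta - ta\<^sub>0\<bar> < s -->
   norm (Gx N (of_real \<xi> + \<i> * of_real ta)) <= e * norm (Gx N (of_real \<xi>))"
  and y: "(\<lambda>N. (y N - a N) / V N) \<longlonglongrightarrow> 0"
begin

text \<open>\<open>B * V N\<close> is a Lipschitz constant of the second derivative on the half
  disc. The radius \<open>r1\<close> makes cubic terms at most an eighth of quadratic ones; its
  bound 1 keeps it below \<open>pi\<close>.\<close>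

definition "B = 6 * C / (r / 4) ^ 3"
definition "r1 = min (min (r / 8) (1 / (8 * B))) 1"

definition good :: "nat => bool" where
 "good N \<longleftrightarrow> 1 <= V N \<and> (\<forall>w. norm w < r --> norm (La N w) <= C * V N)"

lemma eventually_good: "\<forall>\<^sub>F N in sequentially. good N"
 using La_bound filterlim_at_top[THEN iffD1, OF V_top, rule_format, of 1] unfolding good_def by eventually_elim auto

lemma B_pos: "0 < B" using C1 r_pos by (simp add: B_def)

lemma r1: "0 < r1" "r1 <= r / 8" "B * r1 <= 1 / 8" "r1 <= 1"
proof -
 have "r1 <= 1 / (8 * B)" by (simp add: r1_def)
 then have "B * r1 <= B * (1 / (8 * B))" using B_pos by (intro mult_left_mono) auto
 then show "B * r1 <= 1 / 8" using B_pos by simp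
qed (use r_pos B_pos in \<open>auto simp: r1_def\<close>)

lemma B_small: "\<bar>\<xi>\<bar> <= r1 ==> B * \<bar>\<xi>\<bar> <= 1 / 8"
 by (rule order_trans[OF mult_left_mono r1(3)]) (use B_pos in auto)

lemma lip:
 assumes N: "good N" and w: "norm w <= r / 2" "norm w' <= r / 2"
 shows "norm (deriv (deriv (La N)) w - deriv (deriv (La N)) w') <= B * V N * norm (w - w')"
 using second_deriv_lipschitz[OF La_holo r_pos _ w, of N "C * V N"] N by (simp add: good_def B_def)

lemma taylor:
 assumes N: "good N" and w: "norm w <= r / 2" "norm w' <= r / 2"
 shows "norm (deriv (La N) w' - deriv (La N) w - deriv (deriv (La N)) w * (w' - w)) <= B * V N * norm (w' - w) ^ 2"
  and "norm (La N w' - La N w - deriv (La N) w * (w' - w) - deriv (deriv (La N)) w * (w' - w)\<^sup>2 / 2) <= B * V N * norm (w' - w) ^ 3"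
 using taylor2_bounds[OF La_holo r_pos _ lip[OF N] w] N B_pos by (auto simp: good_def)

lemma taylor_0:
 assumes N: "good N" and \<xi>: "\<bar>\<xi>\<bar> <= r1"
 shows "\<bar>Re (deriv (La N) (of_real \<xi>)) - a N - V N * \<xi>\<bar> <= B * V N * \<bar>\<xi>\<bar> ^ 2"
  and "\<bar>Re (La N (of_real \<xi>)) - a N * \<xi> - V N * \<xi>\<^sup>2 / 2\<bar> <= B * V N * \<bar>\<xi>\<bar> ^ 3"
proof -
 have w: "norm (0::complex) <= r / 2" "norm (cor \<xi>) <= r / 2" using \<xi> r1 r_pos by auto
 show "\<bar>Re (deriv (La N) (of_real \<xi>)) - a N - V N * \<xi>\<bar> <= B * V N * \<bar>\<xi>\<bar> ^ 2"
  using abs_Re_le_cmod[THEN order_trans, OF taylor(1)[OF N w]] by (simp add: d1 d2)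
 show "\<bar>Re (La N (of_real \<xi>)) - a N * \<xi> - V N * \<xi>\<^sup>2 / 2\<bar> <= B * V N * \<bar>\<xi>\<bar> ^ 3"
  using abs_Re_le_cmod[THEN order_trans, OF taylor(2)[OF N w]] by (simp add: d1 d2 La_0 power2_eq_square)
qed

definition tilt :: "nat => real => bool" where
 "tilt N \<xi> \<longleftrightarrow> \<bar>\<xi>\<bar> <= r1 \<and> deriv (La N) (of_real \<xi>) = of_real (y N) \<and> \<bar>\<xi>\<bar> * V N <= 2 * \<bar>y N - a N\<bar>"

text \<open>On \<open>[- r1, r1]\<close> the derivative is \<open>a N + V N * \<xi>\<close> up to an
  eighth of the linear term, so it passes through \<open>y N\<close> by the intermediate value
  theorem. The same expansion bounds the solution.\<close>

lemma tilt_exists: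
 assumes N: "good N" and yN: "\<bar>y N - a N\<bar> <= r1 / 2 * V N"
 shows "\<exists>\<xi>. tilt N \<xi>"
proof -
 define h where "h \<xi> = Re (deriv (La N) (of_real \<xi>))" for \<xi>
 have V1: "1 <= V N" using N by (simp add: good_def)
 have quad: "B * V N * \<bar>\<xi>\<bar> ^ 2 <= V N * \<bar>\<xi>\<bar> / 8" if "\<bar>\<xi>\<bar> <= r1" for \<xi>
 proof -
  have "B * \<bar>\<xi>\<bar> * (V N * \<bar>\<xi>\<bar>) <= 1 / 8 * (V N * \<bar>\<xi>\<bar>)"
   using B_small[OF that] V1 by (intro mult_right_mono) auto
  then show ?thesis by (simp add: power2_eq_square mult_ac)
 qed
 have hb: "\<bar>h \<xi> - a N - V N * \<xi>\<bar> <= V N * \<bar>\<xi>\<bar> / 8" if "\<bar>\<xi>\<bar> <= r1" for \<xi>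
  unfolding h_def by (rule order_trans[OF taylor_0(1)[OF N that] quad[OF that]])
 have "continuous_on {- r1..r1} h"
  unfolding h_def[abs_def]
 proof (intro continuous_on_Re continuous_on_compose2[where f = cor and s = "{-r1..r1}" and t = "ball 0 r" and g = "deriv (La N)"])
  show "continuous_on (ball 0 r) (deriv (La N))"
   by (intro holomorphic_on_imp_continuous_on holomorphic_deriv La_holo open_ball)
 qed (use r1 in \<open>auto intro!: continuous_intros\<close>)
 moreover have "h (- r1) <= y N" "y N <= h r1"
 proof -
  have lin: "h2 <= y' \<and> y' <= h1" if "\<bar>h1 - a' - P\<bar> <= P / 8" "\<bar>h2 - a' + P\<bar> <= P / 8" "\<bar>y' - a'\<bar> <= P / 2" "0 < P" for h1 h2 y' a' P :: real
   using that by linarith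
  have "\<bar>h r1 - a N - V N * r1\<bar> <= V N * r1 / 8" "\<bar>h (- r1) - a N + V N * r1\<bar> <= V N * r1 / 8"
   "\<bar>y N - a N\<bar> <= V N * r1 / 2" "0 < V N * r1"
   using hb[of r1] hb[of "- r1"] yN r1(1) V1 by (simp_all add: mult.commute)
  from lin[OF this] show "h (- r1) <= y N" "y N <= h r1" by simp_all
 qed
 ultimately obtain \<xi> where \<xi>: "- r1 <= \<xi>" "\<xi> <= r1" "h \<xi> = y N" using IVT'[of h "- r1" "y N" r1] r1(1) by auto
 then have x1: "\<bar>\<xi>\<bar> <= r1" by simp
 have "deriv (La N) (of_real \<xi>) = of_real (y N)"
  using dreal[of \<xi> N] x1 r1 r_pos \<xi>(3) by (simp add: h_def complex_is_Real_iff complex_eq_iff)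
 moreover have "\<bar>\<xi>\<bar> * V N <= 2 * \<bar>y N - a N\<bar>"
 proof -
  have lin: "t <= 2 * \<bar>D\<bar>" if "\<bar>D - g\<bar> <= t / 8" "t = \<bar>g\<bar>" for D g t :: real
   using that by linarith
  show ?thesis
   unfolding mult.commute[of _ "V N"] by (rule lin[of _ "V N * \<xi>"]) (use hb[OF x1] \<xi>(3) V1 in \<open>auto simp: abs_mult\<close>)
 qed
 ultimately show ?thesis using x1 unfolding tilt_def by blast
qed

definition xi :: "nat => real" where "xi N = (SOME \<xi>. tilt N \<xi>)"

lemma eventually_tilt: "\<forall>\<^sub>F N in sequentially. good N \<and> tilt N (xi N)"
proof -
 have "\<forall>\<^sub>F N in sequentially. dist ((y N - a N) / V N) 0 < r1 / 2" by (rule tendstoD[OF y]) (use r1 in simp)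
 then show ?thesis
  using eventually_good
 proof eventually_elim
  case (elim N)
  then have "\<bar>y N - a N\<bar> <= r1 / 2 * V N" by (simp add: good_def divide_less_eq abs_divide)
  from someI_ex[OF tilt_exists[OF elim(2) this]] elim(2) show ?case by (simp add: xi_def)
 qed
qed

lemma xi_tends: "xi \<longlonglongrightarrow> 0"
proof (rule Lim_null_comparison)
 show "\<forall>\<^sub>F N in sequentially. norm (xi N) <= 2 * \<bar>(y N - a N) / V N\<bar>"
  using eventually_tilt
 proof eventually_elim
  case (elim N)
  then show ?case by (simp add: good_def tilt_def abs_divide le_divide_eq)
 qed
 show "(\<lambda>N. 2 * \<bar>(y N - a N) / V N\<bar>) \<longlonglongrightarrow> 0" by (rule tendsto_mult_right_zero[OF tendsto_rabs_zero[OF y]])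
qed

text \<open>With \<open>x\<close> the saddle point and \<open>v = V N\<close>, both \<open>R\<close>
  and \<open>Q / 2\<close> equal \<open>v * x^2 / 2\<close> up to errors of relative size
  \<open>B * \<bar>x\<bar>\<close>, which tends to 0.\<close>

lemma quadratic_rate:
 "\<exists>\<delta>. \<delta> \<longlonglongrightarrow> 0 \<and> (\<forall>\<^sub>F N in sequentially. xi N * y N - Re (La N (of_real (xi N))) = (1 + \<delta> N) / 2 * ((y N - a N)\<^sup>2 / V N))"
proof -
 define R where "R N = xi N * y N - Re (La N (of_real (xi N)))" for N
 define Q where "Q N = (y N - a N)\<^sup>2 / V N" for N
 \<comment> \<open>If the target is the mean then \<open>R\<close> and \<open>Q\<close> both vanish,
   and the value 0 is a convention.\<close>
 define \<delta> where "\<delta> N = (if y N = a N then 0 else 2 * R N / Q N - 1)" for N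
 have key: "\<bar>\<delta> N\<bar> <= 14 * B * \<bar>xi N\<bar> \<and> R N = (1 + \<delta> N) / 2 * Q N" if N: "good N" "tilt N (xi N)" for N
 proof -
  define x where "x = xi N"
  define v where "v = V N"
  define D where "D = y N - a N"
  have v1: "1 <= v" using N by (simp add: good_def v_def)
  have x: "\<bar>x\<bar> <= r1" "deriv (La N) (of_real x) = of_real (y N)" "\<bar>x\<bar> * v <= 2 * \<bar>D\<bar>" using N(2) by (auto simp: tilt_def x_def D_def v_def)
  define p where "p = B * \<bar>x\<bar>"
  have p: "0 <= p" "p <= 1 / 8" using B_small[OF x(1)] B_pos by (auto simp: p_def)
  define e1 where "e1 = D - v * x"
  define e2 where "e2 = Re (La N (of_real x)) - a N * x - v * x\<^sup>2 / 2"
  have e1: "\<bar>e1\<bar> <= p * (v * \<bar>x\<bar>)"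
   using taylor_0(1)[OF N(1) x(1)] x(2) by (simp add: e1_def D_def p_def v_def power2_eq_square mult_ac)
  have e2: "\<bar>e2\<bar> <= p * (v * x\<^sup>2)"
   using taylor_0(2)[OF N(1) x(1)] by (simp add: e2_def p_def v_def power3_eq_cube power2_eq_square mult_ac abs_mult[symmetric])
  have D: "D = v * x + e1" by (simp add: e1_def)
  have R: "R N = v * x\<^sup>2 / 2 + x * e1 - e2"
   by (simp add: R_def e1_def e2_def x_def[symmetric] D_def algebra_simps power2_eq_square)
  have xe: "\<bar>x * e1\<bar> <= p * (v * x\<^sup>2)"
   using mult_left_mono[OF e1, of "\<bar>x\<bar>"] by (simp add: abs_mult power2_eq_square mult_ac abs_mult_self_eq)
  show ?thesis
  proof (cases "D = 0")
   case True
   then have "x = 0" using x(3) v1 by (auto simp: mult_le_0_iff)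
   then show ?thesis using True by (simp add: \<delta>_def R_def Q_def D_def x_def[symmetric] La_0)
  next
   case False
   have x0: "x \<noteq> 0" using False D e1 by auto
   have vx: "0 < v * x\<^sup>2" using x0 v1 by simp
   have Q: "Q N = v * x\<^sup>2 + 2 * (x * e1) + e1\<^sup>2 / v"
    using v1 by (simp add: Q_def D_def[symmetric] v_def[symmetric] D power2_eq_square field_simps)
   have e11: "e1\<^sup>2 / v <= p * (v * x\<^sup>2)"
   proof -
    have "e1\<^sup>2 <= (p * (v * \<bar>x\<bar>))\<^sup>2" using power_mono[OF e1, of 2] by simp
    also have "... = p * (p * (v\<^sup>2 * x\<^sup>2))" by (simp add: power_mult_distrib power2_eq_square)
    also have "... <= 1 * (p * (v\<^sup>2 * x\<^sup>2))" using p by (intro mult_right_mono) auto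
    finally show ?thesis using v1 by (simp add: divide_le_eq power2_eq_square mult_ac)
   qed
   have pu: "p * (v * x\<^sup>2) <= 1 / 8 * (v * x\<^sup>2)" using p vx by (intro mult_right_mono) auto
   have F: "0 <= e1\<^sup>2 / v" using v1 by simp
   have lin: "u / 2 <= u + 2 * G + F \<and> \<bar>2 * (u / 2 + G - e) - (u + 2 * G + F)\<bar> <= 7 * P"
    if "\<bar>G\<bar> <= P" "\<bar>e\<bar> <= P" "0 <= F" "F <= P" "P <= 1 / 8 * u" for u G F e P :: real
    using that by (auto simp: abs_le_iff)
   have Qge: "v * x\<^sup>2 / 2 <= Q N" and diff: "\<bar>2 * R N - Q N\<bar> <= 7 * (p * (v * x\<^sup>2))"
    unfolding Q R using lin[OF xe e2 F e11 pu] by blast+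
   have Q0: "0 < Q N" using Qge vx by simp
   have "\<bar>\<delta> N\<bar> = \<bar>2 * R N - Q N\<bar> / Q N" using False Q0 by (simp add: \<delta>_def D_def field_simps abs_divide)
   also have "... <= 14 * p"
   proof -
    have "7 * (p * (v * x\<^sup>2)) <= 14 * p * Q N" using mult_left_mono[OF Qge, of "14 * p"] p by simp
    then show ?thesis using Q0 diff by (simp add: divide_le_eq)
   qed
   finally show ?thesis using False Q0 by (simp add: p_def x_def \<delta>_def D_def)
  qed
 qed
 have "\<forall>\<^sub>F N in sequentially. norm (\<delta> N) <= 14 * B * \<bar>xi N\<bar>" using eventually_tilt by eventually_elim (use key in auto)
 moreover have "(\<lambda>N. 14 * B * \<bar>xi N\<bar>) \<longlonglongrightarrow> 0" using xi_tends by (auto intro!: tendsto_eq_intros)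
 ultimately have "\<delta> \<longlonglongrightarrow> 0" by (rule Lim_null_comparison)
 moreover have "\<forall>\<^sub>F N in sequentially. R N = (1 + \<delta> N) / 2 * Q N" using eventually_tilt by eventually_elim (use key in auto)
 ultimately show ?thesis unfolding R_def Q_def by blast
qed

lemma second_deriv_pos:
 assumes "good N" "tilt N \<xi>" shows "0 < Re (deriv (deriv (La N)) (of_real \<xi>))"
proof -
 have V1: "1 <= V N" and \<xi>: "\<bar>\<xi>\<bar> <= r1" using assms by (auto simp: good_def tilt_def)
 have "\<bar>Re (deriv (deriv (La N)) (of_real \<xi>)) - V N\<bar> <= B * V N * \<bar>\<xi>\<bar>"
  using abs_Re_le_cmod[THEN order_trans, OF lip[OF assms(1), of "of_real \<xi>" 0]] \<xi> r1 r_pos by (simp add: d2)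
 also have "... = V N * (B * \<bar>\<xi>\<bar>)" by simp
 also have "... <= V N * (1 / 8)" using B_small[OF \<xi>] V1 by (intro mult_left_mono) auto
 finally show ?thesis using V1 by linarith
qed

end

section \<open>Laplace asymptotics on the vertical line through the saddle point\<close>

context saddle_point
begin

definition "ok N \<longleftrightarrow> good N \<and> tilt N (xi N) \<and> \<kappa> * \<bar>xi N\<bar> <= 1 / 2"

definition "ray N t = cor (xi N) + \<i> * of_real t"
text \<open>The integrand of the inversion formula, normalised at the saddle point. It factors into
  \<open>qq\<close>, the effect of the starting point, and \<open>exp (EE N t)\<close>, whose linear
  term vanishes by the choice of the saddle point.\<close>

definition "HH N t = Gx N (ray N t) * exp (- (\<i> * of_real t * of_real (y N))) / GP N (of_real (xi N))"
definition "qq N t = Gx N (ray N t) / GP N (ray N t)"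
definition "EE N t = La N (ray N t) - La N (of_real (xi N)) - \<i> * of_real t * of_real (y N)"

lemma eventually_ok: "\<forall>\<^sub>F N in sequentially. ok N"
proof -
 have "(\<lambda>N. \<kappa> * \<bar>xi N\<bar>) \<longlonglongrightarrow> 0" by (rule tendsto_mult_right_zero[OF tendsto_rabs_zero[OF xi_tends]])
 then have "\<forall>\<^sub>F N in sequentially. \<kappa> * \<bar>xi N\<bar> < 1 / 2" by (rule order_tendstoD(2)) simp
 with eventually_tilt show ?thesis by eventually_elim (simp add: ok_def)
qed

lemma okD: assumes "ok N" shows "1 <= V N" "\<bar>xi N\<bar> <= r1" "\<bar>xi N\<bar> < r"
 using assms r1 r_pos by (auto simp: ok_def good_def tilt_def)

lemma ray_norm: "norm (ray N t) <= \<bar>xi N\<bar> + \<bar>t\<bar>"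
 unfolding ray_def by (rule norm_triangle_ineq[THEN order_trans]) (simp add: norm_mult)

lemma HH_eq:
 assumes N: "ok N" and t: "\<bar>t\<bar> <= r1"
 shows "HH N t = qq N t * exp (EE N t)" "norm (qq N t - 1) <= \<kappa> * (\<bar>xi N\<bar> + \<bar>t\<bar>)"
  "norm (EE N t + of_real (V N * t\<^sup>2 / 2)) <= B * V N * \<bar>t\<bar> ^ 3 + B * V N * \<bar>xi N\<bar> * t\<^sup>2 / 2"
proof -
 let ?x = "cor (xi N)"
 have w: "norm (ray N t) < r" "norm (ray N t) <= r / 2" "norm ?x <= r / 2" "norm ?x < r"
  using ray_norm[of N t] okD[OF N] t r1 r_pos by auto
 have nz: "GP N (ray N t) \<noteq> 0" unfolding GP_exp[OF w(1)] by simp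
 show "HH N t = qq N t * exp (EE N t)"
  unfolding HH_def qq_def EE_def GP_exp[OF w(1)] GP_exp[OF w(4)] by (simp add: exp_diff exp_minus exp_add field_simps)
 have "norm (qq N t - 1) = norm (Gx N (ray N t) - GP N (ray N t)) / norm (GP N (ray N t))"
  using nz by (simp add: qq_def field_simps flip: norm_divide)
 also have "... <= \<kappa> * norm (ray N t) * norm (GP N (ray N t)) / norm (GP N (ray N t))"
  by (intro divide_right_mono near[OF w(1)]) simp
 also have "... = \<kappa> * norm (ray N t)" using nz by simp
 also have "... <= \<kappa> * (\<bar>xi N\<bar> + \<bar>t\<bar>)" by (intro mult_left_mono ray_norm \<kappa>)
 finally show "norm (qq N t - 1) <= \<kappa> * (\<bar>xi N\<bar> + \<bar>t\<bar>)" .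
 have g: "good N" and d: "deriv (La N) ?x = of_real (y N)" using N by (auto simp: ok_def tilt_def)
 define T where "T = La N (ray N t) - La N ?x - deriv (La N) ?x * (ray N t - ?x) - deriv (deriv (La N)) ?x * (ray N t - ?x)\<^sup>2 / 2"
 have rx: "ray N t - ?x = \<i> * of_real t" by (simp add: ray_def)
 have "EE N t + of_real (V N * t\<^sup>2 / 2) = T - (deriv (deriv (La N)) ?x - deriv (deriv (La N)) 0) * of_real (t\<^sup>2 / 2)"
  unfolding EE_def T_def rx d d2 by (simp add: power_mult_distrib algebra_simps)
 also have "norm ... <= norm T + norm ((deriv (deriv (La N)) ?x - deriv (deriv (La N)) 0) * of_real (t\<^sup>2 / 2))" by (rule norm_triangle_ineq4)
 also have "... <= B * V N * \<bar>t\<bar> ^ 3 + B * V N * \<bar>xi N\<bar> * t\<^sup>2 / 2"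
 proof (rule add_mono)
  show "norm T <= B * V N * \<bar>t\<bar> ^ 3" using taylor(2)[OF g w(3,2)] unfolding T_def[symmetric] by (simp add: rx norm_mult)
  have "norm (deriv (deriv (La N)) ?x - deriv (deriv (La N)) 0) * (t\<^sup>2 / 2) <= B * V N * norm (?x - 0) * (t\<^sup>2 / 2)"
   using r_pos by (intro mult_right_mono lip[OF g w(3)]) auto
  then show "norm ((deriv (deriv (La N)) ?x - deriv (deriv (La N)) 0) * of_real (t\<^sup>2 / 2)) <= B * V N * \<bar>xi N\<bar> * t\<^sup>2 / 2"
   unfolding norm_mult norm_of_real by simp
 qed
 finally show "norm (EE N t + of_real (V N * t\<^sup>2 / 2)) <= B * V N * \<bar>t\<bar> ^ 3 + B * V N * \<bar>xi N\<bar> * t\<^sup>2 / 2" .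
qed

text \<open>Supplies the integrable majorant for \<open>central\<close>: the two error terms of
  \<open>EE\<close> take at most half of its Gaussian exponent.\<close>

lemma HH_norm_le:
 assumes N: "ok N" and t: "\<bar>t\<bar> <= r1"
 shows "norm (HH N t) <= (1 + \<kappa> * r) * exp (- (1 / 4) * (V N * t\<^sup>2))"
proof -
 define u where "u = V N * t\<^sup>2"
 have u: "0 <= u" using okD(1)[OF N] by (simp add: u_def)
 have "B * V N * \<bar>t\<bar> ^ 3 = B * \<bar>t\<bar> * u" by (simp add: u_def power3_eq_cube power2_eq_square mult_ac)
 also have "... <= 1 / 8 * u" by (intro mult_right_mono B_small t u)
 finally have 1: "B * V N * \<bar>t\<bar> ^ 3 <= u / 8" by simp
 have "B * V N * \<bar>xi N\<bar> * t\<^sup>2 / 2 = B * \<bar>xi N\<bar> * u / 2" by (simp add: u_def mult_ac)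
 also have "... <= 1 / 8 * u / 2" by (intro divide_right_mono mult_right_mono B_small okD[OF N] u) simp
 finally have 2: "B * V N * \<bar>xi N\<bar> * t\<^sup>2 / 2 <= u / 8" using u by simp
 have "\<bar>Re (EE N t) + u / 2\<bar> <= norm (EE N t + of_real (V N * t\<^sup>2 / 2))"
  using abs_Re_le_cmod[of "EE N t + of_real (V N * t\<^sup>2 / 2)"] by (simp add: u_def)
 then have "Re (EE N t) <= - (1 / 4) * u" using HH_eq(3)[OF N t] 1 2 by linarith
 then have e: "norm (exp (EE N t)) <= exp (- (1 / 4) * u)" by simp
 have "norm (qq N t) <= 1 + \<kappa> * (\<bar>xi N\<bar> + \<bar>t\<bar>)"
  using HH_eq(2)[OF N t] norm_triangle_sub[of "qq N t" 1] by simp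
 also have "... <= 1 + \<kappa> * r" using okD(2)[OF N] t r1 r_pos \<kappa> by (intro add_left_mono mult_left_mono) auto
 finally show ?thesis unfolding HH_eq(1)[OF N t] norm_mult u_def[symmetric] using e \<kappa> r_pos by (intro mult_mono) auto
qed

lemma HH_cont: "continuous_on A (HH N)"
 unfolding HH_def[abs_def] ray_def divide_inverse
 by (intro continuous_intros continuous_on_compose2[OF Gx_cont]) auto

lemma HH_tends: "(\<lambda>N. indicator {- r1..r1} (s / sqrt (V N)) *\<^sub>R HH N (s / sqrt (V N))) \<longlonglongrightarrow> of_real (exp (- (1 / 2) * s\<^sup>2))"
proof -
 define t where "t N = s / sqrt (V N)" for N
 have "filterlim (\<lambda>N. sqrt (V N)) at_top sequentially" by (rule filterlim_compose[OF sqrt_at_top V_top])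
 then have t0: "t \<longlonglongrightarrow> 0" unfolding t_def[abs_def] by (intro tendsto_divide_0[OF tendsto_const] filterlim_at_top_imp_at_infinity)
 have tr: "\<forall>\<^sub>F N in sequentially. \<bar>t N\<bar> < r1" using order_tendstoD(2)[OF tendsto_rabs_zero[OF t0] r1(1)] .
 have "(\<lambda>N. qq N (t N) - 1) \<longlonglongrightarrow> 0"
 proof (rule Lim_null_comparison)
  show "\<forall>\<^sub>F N in sequentially. norm (qq N (t N) - 1) <= \<kappa> * (\<bar>xi N\<bar> + \<bar>t N\<bar>)"
   using eventually_ok tr by eventually_elim (use HH_eq(2) in auto)
  show "(\<lambda>N. \<kappa> * (\<bar>xi N\<bar> + \<bar>t N\<bar>)) \<longlonglongrightarrow> 0"
   by (rule tendsto_mult_right_zero) (rule tendsto_add_zero[OF tendsto_rabs_zero[OF xi_tends] tendsto_rabs_zero[OF t0]])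
 qed
 then have q: "(\<lambda>N. qq N (t N)) \<longlonglongrightarrow> 1" by (rule LIM_zero_cancel)
 have "(\<lambda>N. EE N (t N) - of_real (- (1 / 2) * s\<^sup>2)) \<longlonglongrightarrow> 0"
 proof (rule Lim_null_comparison)
  show "\<forall>\<^sub>F N in sequentially. norm (EE N (t N) - of_real (- (1 / 2) * s\<^sup>2)) <= B * s\<^sup>2 * (\<bar>t N\<bar> + \<bar>xi N\<bar> / 2)"
   using eventually_ok tr
  proof eventually_elim
   case (elim N)
   have v: "V N * (t N)\<^sup>2 = s\<^sup>2" using okD(1)[OF elim(1)] by (simp add: t_def power_divide)
   have 1: "B * V N * \<bar>t N\<bar> ^ 3 = B * (V N * (t N)\<^sup>2) * \<bar>t N\<bar>" by (simp add: power3_eq_cube power2_eq_square mult_ac)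
   have 2: "B * V N * \<bar>xi N\<bar> * (t N)\<^sup>2 / 2 = B * (V N * (t N)\<^sup>2) * (\<bar>xi N\<bar> / 2)" by simp
   have "norm (EE N (t N) + of_real (V N * (t N)\<^sup>2 / 2)) <= B * s\<^sup>2 * \<bar>t N\<bar> + B * s\<^sup>2 * (\<bar>xi N\<bar> / 2)"
    using HH_eq(3)[OF elim(1), of "t N"] elim(2) unfolding 1 2 v by simp
   then show ?case unfolding v by (simp add: distrib_left)
  qed
  show "(\<lambda>N. B * s\<^sup>2 * (\<bar>t N\<bar> + \<bar>xi N\<bar> / 2)) \<longlonglongrightarrow> 0"
   by (rule tendsto_mult_right_zero) (intro tendsto_add_zero tendsto_rabs_zero t0 tendsto_divide_zero xi_tends)
 qed
 then have "(\<lambda>N. EE N (t N)) \<longlonglongrightarrow> of_real (- (1 / 2) * s\<^sup>2)" by (rule LIM_zero_cancel)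
 from tendsto_mult[OF q tendsto_exp[OF this]]
 have "(\<lambda>N. qq N (t N) * exp (EE N (t N))) \<longlonglongrightarrow> of_real (exp (- (1 / 2) * s\<^sup>2))" by (simp only: mult_1_left exp_of_real)
 moreover have "\<forall>\<^sub>F N in sequentially. qq N (t N) * exp (EE N (t N)) = indicator {- r1..r1} (t N) *\<^sub>R HH N (t N)"
  using eventually_ok tr
 proof eventually_elim
  case (elim N)
  then have "\<bar>t N\<bar> <= r1" "t N \<in> {- r1..r1}" by auto
  then show ?case by (simp add: HH_eq(1)[OF elim(1)])
 qed
 ultimately show ?thesis unfolding t_def by (rule Lim_transform_eventually)
qed

lemma HH_int: "integrable lborel (\<lambda>t. indicator {l..u} t *\<^sub>R HH N t)" "integrable lborel (\<lambda>t. indicator {l..u} t * norm (HH N t))"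
 using borel_integrable_compact[OF _ HH_cont[of "{l..u}" N]] borel_integrable_compact[OF _ continuous_on_norm[OF HH_cont[of "{l..u}" N]]] by auto

text \<open>Dominated convergence after the substitution \<open>t = s / sqrt (V N)\<close>.\<close>

lemma central: "(\<lambda>N. sqrt (V N) *\<^sub>R (LINT t|lborel. indicator {- r1..r1} t *\<^sub>R HH N t)) \<longlonglongrightarrow> of_real (sqrt (2 * pi))"
proof -
 define f where "f N s = indicator {- r1..r1} (s / sqrt (V N)) *\<^sub>R HH N (s / sqrt (V N))" for N s
 obtain N0 where N0: "!!N. N >= N0 ==> ok N" using eventually_ok by (auto simp: eventually_sequentially)
 have fm: "f N \<in> borel_measurable borel" for N
 proof -
  have "HH N \<in> borel_measurable borel" by (rule borel_measurable_continuous_onI[OF HH_cont])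
  then show ?thesis unfolding f_def[abs_def] by measurable
 qed
 have "(\<lambda>N. \<integral>s. f (N + N0) s \<partial>lborel) \<longlonglongrightarrow> (LINT s|lborel. of_real (exp (- (1 / 2) * (s - 0)\<^sup>2)))"
 proof (rule integral_dominated_convergence[where w = "\<lambda>s. (1 + \<kappa> * r) * exp (- (1 / 4) * (s - 0)\<^sup>2)"])
  show "integrable lborel (\<lambda>s. (1 + \<kappa> * r) * exp (- (1 / 4) * (s - 0)\<^sup>2))"
   by (intro integrable_mult_right gauss_integral) simp
  show "AE s in lborel. (\<lambda>N. f (N + N0) s) \<longlonglongrightarrow> of_real (exp (- (1 / 2) * (s - 0)\<^sup>2))"
   using LIMSEQ_ignore_initial_segment[OF HH_tends] unfolding f_def by simp
  show "AE s in lborel. norm (f (N + N0) s) <= (1 + \<kappa> * r) * exp (- (1 / 4) * (s - 0)\<^sup>2)" for N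
  proof (rule AE_I2)
   fix s :: real
   let ?M = "N + N0"
   have M: "ok ?M" by (rule N0) simp
   show "norm (f ?M s) <= (1 + \<kappa> * r) * exp (- (1 / 4) * (s - 0)\<^sup>2)"
   proof (cases "s / sqrt (V ?M) \<in> {- r1..r1}")
    case True
    then have "\<bar>s / sqrt (V ?M)\<bar> <= r1" by auto
    from HH_norm_le[OF M this] True okD(1)[OF M] show ?thesis by (simp add: f_def power_divide)
   qed (use \<kappa> r_pos in \<open>simp add: f_def\<close>)
  qed
 qed (use fm in auto)
 also have "(LINT s|lborel. cor (exp (- (1 / 2) * (s - 0)\<^sup>2))) = of_real (sqrt (2 * pi))"
  unfolding integral_complex_of_real using gauss_integral(2)[of "1 / 2" 0] by (simp add: mult.commute)
 finally have "(\<lambda>N. \<integral>s. f N s \<partial>lborel) \<longlonglongrightarrow> of_real (sqrt (2 * pi))" by (rule LIMSEQ_offset)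
 moreover have "\<forall>\<^sub>F N in sequentially. (LINT s|lborel. f N s) = sqrt (V N) *\<^sub>R (LINT t|lborel. indicator {- r1..r1} t *\<^sub>R HH N t)"
  using eventually_ok
 proof eventually_elim
  case (elim N)
  have V: "0 < sqrt (V N)" using okD(1)[OF elim] by simp
  then show ?case
   using lborel_integral_real_affine[of "1 / sqrt (V N)" "\<lambda>t. indicator {- r1..r1} t *\<^sub>R HH N t" 0] by (simp add: f_def)
 qed
 ultimately show ?thesis by (rule Lim_transform_eventually)
qed

text \<open>The assumption \<open>small\<close> holds near each single frequency; compactness of the
  range \<open>r1 <= \<bar>ta\<bar> <= pi\<close> makes it uniform.\<close>

lemma small_uniform:
 assumes e: "0 < e"
 shows "\<forall>\<^sub>F N in sequentially. \<forall>ta. r1 <= \<bar>ta\<bar> --> \<bar>ta\<bar> <= pi --> norm (Gx N (ray N ta)) <= e * norm (Gx N (of_real (xi N)))"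
proof -
 define K where "K = {- pi..- r1} \<union> {r1..pi}"
 have "\<forall>ta0\<in>K. \<exists>s>0. \<forall>\<^sub>F N in sequentially. \<forall>\<xi> ta. \<bar>\<xi>\<bar> < s --> \<bar>ta - ta0\<bar> < s -->
   norm (Gx N (of_real \<xi> + \<i> * of_real ta)) <= e * norm (Gx N (of_real \<xi>))"
  using small e r1(1) by (auto simp: K_def)
 from bchoice[OF this] obtain s where s: "!!ta0. ta0 \<in> K ==> 0 < s ta0" "!!ta0. ta0 \<in> K ==> \<forall>\<^sub>F N in sequentially. \<forall>\<xi> ta. \<bar>\<xi>\<bar> < s ta0 --> \<bar>ta - ta0\<bar> < s ta0 -->
   norm (Gx N (of_real \<xi> + \<i> * of_real ta)) <= e * norm (Gx N (of_real \<xi>))"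
  by blast
 have "compact K" unfolding K_def by (intro compact_Un compact_Icc)
 then obtain D where D: "D \<subseteq> K" "finite D" "K \<subseteq> (\<Union>ta0\<in>D. ball ta0 (s ta0))"
  by (rule compactE_image[where C = K and f = "\<lambda>ta0. ball ta0 (s ta0)"]) (use s(1) in auto)
 have "\<forall>\<^sub>F N in sequentially. \<forall>ta0\<in>D. \<forall>ta. \<bar>ta - ta0\<bar> < s ta0 --> norm (Gx N (ray N ta)) <= e * norm (Gx N (of_real (xi N)))"
 proof (rule eventually_ball_finite[OF D(2)], rule ballI)
  fix ta0 assume "ta0 \<in> D"
  then have K: "ta0 \<in> K" using D(1) by blast
  have "\<forall>\<^sub>F N in sequentially. \<bar>xi N\<bar> < s ta0" by (rule order_tendstoD(2)[OF tendsto_rabs_zero[OF xi_tends] s(1)[OF K]])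
  with s(2)[OF K] show "\<forall>\<^sub>F N in sequentially. \<forall>ta. \<bar>ta - ta0\<bar> < s ta0 --> norm (Gx N (ray N ta)) <= e * norm (Gx N (of_real (xi N)))"
   by eventually_elim (simp add: ray_def)
 qed
 then show ?thesis
 proof eventually_elim
  case (elim N)
  show ?case
  proof (intro allI impI)
   fix ta :: real assume "r1 <= \<bar>ta\<bar>" "\<bar>ta\<bar> <= pi"
   then have "ta \<in> K" by (auto simp: K_def)
   then obtain ta0 where "ta0 \<in> D" "\<bar>ta - ta0\<bar> < s ta0" using D(3) by (auto simp: dist_real_def abs_minus_commute)
   then show "norm (Gx N (ray N ta)) <= e * norm (Gx N (of_real (xi N)))" using elim by blast
  qed
 qed
qed

definition "TT N = (LINT t|lborel. indicator {r1..pi} t * norm (HH N t)) + (LINT t|lborel. indicator {- pi..- r1} t * norm (HH N t))"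

text \<open>\<open>pair_integral_le\<close> with decay rate \<open>c * V N\<close> gives an integral
  of order \<open>sqrt (e' / V N)\<close> when the integrand is at most \<open>e'\<close>, and
  \<open>e'\<close> can be taken arbitrarily small.\<close>

lemma tail: "(\<lambda>N. sqrt (V N) * TT N) \<longlonglongrightarrow> 0"
proof (rule tendstoI)
 fix e :: real assume e: "0 < e"
 obtain k where k: "pi / \<delta>0 <= real k" using real_arch_simple by blast
 define X where "X = 4 * (1 + real k) * sqrt (sqrt C) * sqrt (4 * pi / c)"
 have X: "0 < X" using C1 c_pos by (simp add: X_def)
 \<comment> \<open>Squared because the sup bound enters the integral only through its square
   root.\<close>
 define e' where "e' = (e / (2 * X))\<^sup>2"
 have e': "0 < e'" "sqrt e' = e / (2 * X)" using e X by (simp_all add: e'_def)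
 show "\<forall>\<^sub>F N in sequentially. dist (sqrt (V N) * TT N) 0 < e"
  using eventually_ok small_uniform[OF e'(1)]
 proof eventually_elim
  case (elim N)
  note N = elim(1)
  let ?x = "cor (xi N)"
  have V1: "1 <= V N" by (rule okD(1)[OF N])
  have xr: "norm ?x < r" using okD(3)[OF N] by simp
  have GP0: "0 < norm (GP N ?x)" unfolding GP_exp[OF xr] by simp
  have nr: "norm (Gx N ?x - GP N ?x) <= 1 / 2 * norm (GP N ?x)"
   using near[OF xr, of N] mult_right_mono[of "\<kappa> * \<bar>xi N\<bar>" "1 / 2" "norm (GP N ?x)"] N by (simp add: ok_def)
  have Gx0: "0 < norm (Gx N ?x)" using nr GP0 norm_triangle_sub[of "GP N ?x" "Gx N ?x"] norm_minus_commute[of "Gx N ?x" "GP N ?x"] by linarith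
  have Gx2: "norm (Gx N ?x) <= 2 * norm (GP N ?x)" using nr GP0 norm_triangle_sub[of "Gx N ?x" "GP N ?x"] by linarith
  define \<rho> where "\<rho> t = norm (Gx N (ray N t)) / norm (Gx N ?x)" for t
  have \<rho>_cont: "continuous_on UNIV \<rho>"
   unfolding \<rho>_def[abs_def] ray_def using Gx0 by (intro continuous_intros continuous_on_compose2[OF Gx_cont]) auto
  have \<rho>0: "0 <= \<rho> t" for t by (simp add: \<rho>_def)
  have H\<rho>: "norm (HH N t) <= 2 * \<rho> t" for t
  proof -
   have "norm (HH N t) = norm (Gx N (ray N t)) / norm (GP N ?x)"
   proof -
    have "norm (exp (- (\<i> * of_real t * cor (y N)))) = 1" by simp
    then show ?thesis unfolding HH_def norm_divide norm_mult[of "Gx N (ray N t)"] by simp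
   qed
   also have "... = \<rho> t * (norm (Gx N ?x) / norm (GP N ?x))" using Gx0 by (simp add: \<rho>_def)
   also have "... <= \<rho> t * 2" using Gx2 GP0 by (intro mult_left_mono \<rho>0) (simp add: divide_le_eq)
   finally show ?thesis by simp
  qed
  have \<rho>pair: "\<rho> s * \<rho> t <= C * exp (- (c * V N) * (s - t)\<^sup>2)" if "\<bar>s - t\<bar> <= \<delta>0" for s t
   using pair[OF okD(3)[OF N] that, of N] Gx0 unfolding ray_def[symmetric] by (simp add: \<rho>_def divide_le_eq power2_eq_square)
  have piece: "sqrt (V N) * (LINT t|lborel. indicator {a..b} t * norm (HH N t)) <= X / 2 * sqrt e'"
   if ab: "a <= b" "b - a <= pi" "{a..b} \<subseteq> {t. r1 <= \<bar>t\<bar> \<and> \<bar>t\<bar> <= pi}" for a b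
  proof -
   have \<rho>int: "integrable lborel (\<lambda>t. indicator {a..b} t * \<rho> t)"
    using borel_integrable_compact[of "{a..b}" \<rho>] continuous_on_subset[OF \<rho>_cont] by auto
   have "(LINT t|lborel. indicator {a..b} t * norm (HH N t)) <= (LINT t|lborel. 2 * (indicator {a..b} t * \<rho> t))"
    by (intro integral_mono HH_int integrable_mult_right \<rho>int) (use H\<rho> in \<open>auto simp: indicator_def\<close>)
   also have "... = 2 * (LINT t|lborel. indicator {a..b} t * \<rho> t)" by simp
   also have "... <= 2 * ((1 + real k) * (sqrt e' * sqrt (sqrt C) * sqrt (4 * pi / (c * V N))))"
   proof (intro mult_left_mono pair_integral_le[OF \<rho>_cont \<rho>0 _ _ \<delta>0 \<rho>pair])
    show "\<rho> t <= e'" if "t \<in> {a..b}" for t using elim(2) ab(3) that Gx0 by (auto simp: \<rho>_def divide_le_eq)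
    have "pi <= real k * \<delta>0" using k \<delta>0 by (simp add: divide_le_eq)
    then show "b - a <= (1 + real k) * \<delta>0" using ab(2) \<delta>0 by (simp add: distrib_right)
   qed (use c_pos V1 C1 e' ab(1) in auto)
   finally have "sqrt (V N) * (LINT t|lborel. indicator {a..b} t * norm (HH N t))
    <= sqrt (V N) * (2 * ((1 + real k) * (sqrt e' * sqrt (sqrt C) * sqrt (4 * pi / (c * V N)))))"
    using V1 by (intro mult_left_mono) auto
   also have "... = 2 * ((1 + real k) * (sqrt e' * sqrt (sqrt C) * (sqrt (V N) * sqrt (4 * pi / (c * V N)))))" by (simp add: mult_ac)
   also have "sqrt (V N) * sqrt (4 * pi / (c * V N)) = sqrt (4 * pi / c)"
    using V1 by (simp flip: real_sqrt_mult)
   also have "2 * ((1 + real k) * (sqrt e' * sqrt (sqrt C) * sqrt (4 * pi / c))) = X / 2 * sqrt e'" by (simp add: X_def)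
   finally show ?thesis .
  qed
  have "r1 <= pi" using r1(4) pi_gt3 by simp
  then have "sqrt (V N) * TT N <= X / 2 * sqrt e' + X / 2 * sqrt e'"
   unfolding TT_def distrib_left using r1(1) by (intro add_mono piece) auto
  then have "sqrt (V N) * TT N < e" using e X by (simp add: e'(2))
  moreover have "0 <= sqrt (V N) * TT N"
   unfolding TT_def using V1 by (intro mult_nonneg_nonneg add_nonneg_nonneg integral_nonneg_AE) auto
  ultimately show ?case by simp
 qed
qed

theorem saddle_integral:
 "(\<lambda>N. sqrt (V N / (2 * pi)) *\<^sub>R (LINT t|lborel. indicator {- pi..pi} t *\<^sub>R HH N t)) \<longlonglongrightarrow> 1"
proof -
 have r1pi: "r1 <= pi" using r1(4) pi_gt3 by simp
 define D where "D N = (LINT t|lborel. indicator {- pi..pi} t *\<^sub>R HH N t) - (LINT t|lborel. indicator {- r1..r1} t *\<^sub>R HH N t)" for N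
 have D: "norm (D N) <= TT N" for N
 proof -
  have "norm (D N) = norm (LINT t|lborel. indicator {- pi..pi} t *\<^sub>R HH N t - indicator {- r1..r1} t *\<^sub>R HH N t)"
   unfolding D_def by (simp add: HH_int)
  also have "... <= (LINT t|lborel. indicator {r1..pi} t * norm (HH N t) + indicator {- pi..- r1} t * norm (HH N t))"
   by (rule Bochner_Integration.integral_norm_bound_integral[OF Bochner_Integration.integrable_diff[OF HH_int(1) HH_int(1)]
      Bochner_Integration.integrable_add[OF HH_int(2) HH_int(2)]])
    (use r1pi r1(1) in \<open>auto simp: indicator_def\<close>)
  also have "... = TT N" unfolding TT_def by (intro Bochner_Integration.integral_add HH_int)
  finally show ?thesis .
 qed
 have "(\<lambda>N. sqrt (V N) *\<^sub>R D N) \<longlonglongrightarrow> 0"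
 proof (rule Lim_null_comparison[OF _ tail])
  show "\<forall>\<^sub>F N in sequentially. norm (sqrt (V N) *\<^sub>R D N) <= sqrt (V N) * TT N"
   using eventually_ok
  proof eventually_elim
   case (elim N)
   have "0 <= sqrt (V N)" using okD(1)[OF elim] by simp
   then show ?case using mult_left_mono[OF D[of N], of "sqrt (V N)"] by simp
  qed
 qed
 from tendsto_scaleR[OF tendsto_const[of "1 / sqrt (2 * pi)"] tendsto_add[OF central this]]
 have "(\<lambda>N. (1 / sqrt (2 * pi)) *\<^sub>R (sqrt (V N) *\<^sub>R (LINT t|lborel. indicator {- pi..pi} t *\<^sub>R HH N t)))
  \<longlonglongrightarrow> (1 / sqrt (2 * pi)) *\<^sub>R (of_real (sqrt (2 * pi)) + 0)"
  unfolding D_def scaleR_right_distrib[symmetric] by simp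
 moreover have "(1 / sqrt (2 * pi)) *\<^sub>R (of_real (sqrt (2 * pi)) + 0) = (1 :: complex)"
  unfolding scaleR_conv_of_real by (simp del: real_sqrt_mult flip: of_real_mult)
 ultimately show ?thesis unfolding scaleR_scaleR by (simp only: real_sqrt_divide times_divide_eq_left mult_1_left)
qed

end

section \<open>Fourier inversion and the local limit theorem\<close>

lemma integral_iexp_int:
 "has_bochner_integral lborel (\<lambda>ta. indicator {- pi..pi} ta *\<^sub>R exp (\<i> * cor ta * of_int m)) (if m = 0 then of_real (2 * pi) else 0)"
proof (cases "m = 0")
 case True
 have "has_bochner_integral lborel (\<lambda>x. indicator {- pi..pi} x *\<^sub>R 1) (cor pi - cor (- pi))"
  by (rule has_bochner_integral_FTC_Icc) (auto intro!: derivative_eq_intros)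
 then show ?thesis using True by simp
next
 case False
 have "has_bochner_integral lborel (\<lambda>ta. indicator {- pi..pi} ta *\<^sub>R exp (\<i> * cor ta * of_int m))
  (exp (\<i> * of_real pi * of_int m) / (\<i> * of_int m) - exp (\<i> * of_real (- pi) * of_int m) / (\<i> * of_int m))"
 proof (rule has_bochner_integral_FTC_Icc)
  fix ta :: real
  have "((\<lambda>w. exp (\<i> * w * of_int m) / (\<i> * of_int m)) has_field_derivative exp (\<i> * of_real ta * of_int m)) (at (of_real ta))"
   using False by (auto intro!: derivative_eq_intros)
  then show "((\<lambda>ta. exp (\<i> * of_real ta * of_int m) / (\<i> * of_int m)) has_vector_derivative exp (\<i> * of_real ta * of_int m)) (at ta within {- pi..pi})"
   by (rule has_vector_derivative_real_field)
 qed (auto intro!: continuous_intros)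
 moreover have "exp (\<i> * of_real pi * of_int m) = exp (\<i> * of_real (- pi) * complex_of_int m)"
 proof -
  have "\<i> * of_real pi * of_int m = \<i> * of_real (- pi) * of_int m + 2 * of_int m * of_real pi * \<i>" by (simp add: algebra_simps)
  then show ?thesis using exp_integer_2pi[of "of_int m"] by (simp only: exp_add) simp
 qed
 ultimately show ?thesis using False by simp
qed

text \<open>The vertical line may be shifted by any real \<xi>: for a value \<open>m\<close> of
  \<open>Y\<close> the shift contributes \<open>exp (\<xi> * m)\<close>, which multiplies 0 unless
  \<open>m = 0\<close>.\<close>

lemma (in prob_space) lattice_inversion:
 assumes Y: "bfun M Y" and int: "AE om in M. Y om \<in> \<int>"
 shows "cor (prob {om \<in> space M. Y om = 0})
  = (1 / (2 * pi)) *\<^sub>R (LINT ta|lborel. indicator {- pi..pi} ta *\<^sub>R (LINT om|M. exp ((of_real \<xi> + \<i> * of_real ta) * of_real (Y om))))"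
proof -
 define Q where "Q = restrict_space lborel {- pi..pi}"
 have Qi: "(LINT ta|Q. g ta) = (LINT ta|lborel. indicator {- pi..pi} ta *\<^sub>R g ta)" for g :: "real => complex"
  unfolding Q_def by (rule integral_restrict_space) simp
 interpret Q: finite_measure Q
  unfolding Q_def by (rule finite_measureI) (simp add: emeasure_restrict_space space_restrict_space)
 interpret PQ: pair_sigma_finite M Q ..
 interpret PQf: finite_measure "M \<Otimes>\<^sub>M Q" by (intro finite_measure_pair_measure finite_measure_axioms Q.finite_measure_axioms)
 define G where "G om ta = exp ((of_real \<xi> + \<i> * of_real ta) * cor (Y om))" for om ta
 obtain B where B: "Y \<in> borel_measurable M" "!!om. om \<in> space M ==> norm (Y om) <= B" using Y by (elim bfunE) blast
 have "integrable (M \<Otimes>\<^sub>M Q) (\<lambda>(om, ta). G om ta)"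
 proof (rule PQf.integrable_const_bound[where B = "exp (\<bar>\<xi>\<bar> * B)"])
  show "AE z in M \<Otimes>\<^sub>M Q. norm (case z of (om, ta) => G om ta) <= exp (\<bar>\<xi>\<bar> * B)"
  proof (rule AE_I2, clarsimp simp: space_pair_measure)
   fix om ta assume "om \<in> space M"
   then have "\<bar>\<xi> * Y om\<bar> <= \<bar>\<xi>\<bar> * B" unfolding abs_mult using B(2) by (intro mult_left_mono) auto
   then show "norm (G om ta) <= exp (\<bar>\<xi>\<bar> * B)" by (simp add: G_def)
  qed
  have [measurable]: "Y \<in> borel_measurable M" by (rule B(1))
  have [measurable]: "(\<lambda>ta. ta) \<in> borel_measurable Q" unfolding Q_def by (rule measurable_restrict_space1) simp
  have "(\<lambda>(om, ta). (of_real \<xi> + \<i> * of_real ta) * cor (Y om)) \<in> borel_measurable (M \<Otimes>\<^sub>M Q)" by measurable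
  then show "(\<lambda>(om, ta). G om ta) \<in> borel_measurable (M \<Otimes>\<^sub>M Q)"
   unfolding G_def[abs_def] case_prod_beta by (rule borel_measurable_continuous_on[rotated]) (intro continuous_intros)
 qed
 from PQ.Fubini_integral[OF this] have "(LINT ta|Q. (LINT om|M. G om ta)) = (LINT om|M. (LINT ta|Q. G om ta))" by simp
 also have "... = (LINT om|M. cor (2 * pi * indicator {om \<in> space M. Y om = 0} om))"
 proof (rule integral_cong_AE)
  show "AE om in M. (LINT ta|Q. G om ta) = cor (2 * pi * indicator {om \<in> space M. Y om = 0} om)"
   using int AE_space
  proof eventually_elim
   case (elim om)
   then obtain m where m: "Y om = of_int m" by (auto elim: Ints_cases)
   have "G om ta = exp (of_real \<xi> * of_int m) * exp (\<i> * cor ta * of_int m)" for ta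
    by (simp add: G_def m exp_add[symmetric] algebra_simps)
   then have "(LINT ta|Q. G om ta) = exp (of_real \<xi> * of_int m) * (LINT ta|lborel. indicator {- pi..pi} ta *\<^sub>R exp (\<i> * cor ta * of_int m))"
    by (simp add: Qi[symmetric])
   also have "... = cor (2 * pi * indicator {om \<in> space M. Y om = 0} om)"
    unfolding has_bochner_integral_integral_eq[OF integral_iexp_int] using elim(2) by (simp add: m)
   finally show ?case .
  qed
 qed (use B(1) \<open>integrable (M \<Otimes>\<^sub>M Q) _\<close> in \<open>auto dest!: PQ.integrable_fst' intro!: borel_measurable_of_real\<close>)
 also have "... = of_real (2 * pi * prob {om \<in> space M. Y om = 0})"
  unfolding integral_complex_of_real using B(1) by simp
 finally show ?thesis unfolding Qi[symmetric] G_def[symmetric] by (simp add: scaleR_conv_of_real)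
qed

section \<open>The saddle point of the chain\<close>

context functional_process
begin

definition var :: "nat => real" where "var N = (LINT om|Om. (Sc N om)\<^sup>2) - (LINT om|Om. Sc N om)\<^sup>2"

lemma var_le: "var N <= 4 * LL\<^sup>2 + (2 * \<beta> + 1) * SV N"
proof -
 have "0 <= SV N" by (intro sum_nonneg MC.sv_nonneg)
 then show ?thesis
  using Sc_second_moment_le[of N] zero_le_power2[of "\<integral>om. Sc N om \<partial>Om"] unfolding var_def distrib_right by argo
qed

lemma var_tends: "filterlim SV at_top sequentially ==> filterlim var at_top sequentially"
proof -
 assume SV: "filterlim SV at_top sequentially"
 have "filterlim (\<lambda>N. - 2 * LL\<^sup>2 + ep / 2 * SV N) at_top sequentially"
  by (intro filterlim_tendsto_add_at_top[OF tendsto_const] filterlim_tendsto_pos_mult_at_top[OF tendsto_const _ SV]) (use eps_pos in simp)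
 then show ?thesis
  by (rule filterlim_at_top_mono) (use Sc_var_ge in \<open>auto simp: var_def intro!: always_eventually\<close>)
qed

text \<open>\<open>Gm\<close> is the transform under the given initial law,
  \<open>vv 0 N w x\<close> the one from \<open>x\<close>. The decay estimates are in terms of
  \<open>SV\<close>, the saddle point method in terms of the variance; the two are comparable up to
  additive constants.\<close>

theorem saddle_point_chain:
 assumes x: "x \<in> St 0" and SV: "filterlim SV at_top sequentially"
  and small: "!!ta e. ta \<noteq> 0 ==> \<bar>ta\<bar> <= pi ==> 0 < e ==> \<exists>n. \<forall>v. bfun (M n) v --> (\<forall>y\<in>St n. norm (v y) <= 1) -->
   norm (T (Wf (\<i> * of_real ta)) 0 n v x) <= e"
  and y: "(\<lambda>N. (y N - (LINT om|Om. Sc N om)) / var N) \<longlonglongrightarrow> 0"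
 shows "\<exists>\<xi> L \<delta>. L \<longlonglongrightarrow> (1::complex) \<and> \<delta> \<longlonglongrightarrow> 0 \<and> (\<forall>\<^sub>F N in sequentially. 1 <= var N \<and>
  mg 1 N (\<xi> N) / mg 0 N (\<xi> N) = y N \<and> (mg 1 N (\<xi> N))\<^sup>2 < mg 2 N (\<xi> N) * mg 0 N (\<xi> N) \<and>
  (1 / (2 * pi)) *\<^sub>R (LINT ta|lborel. indicator {- pi..pi} ta *\<^sub>R (vv 0 N (of_real (\<xi> N) + \<i> * of_real ta) x * exp (- ((of_real (\<xi> N) + \<i> * of_real ta) * of_real (y N)))))
   = L N * of_real (1 / sqrt (2 * pi * var N) * exp (- (\<xi> N * y N - ln (mg 0 N (\<xi> N))))) \<and>
  \<xi> N * y N - ln (mg 0 N (\<xi> N)) = (1 + \<delta> N) / 2 * ((y N - (LINT om|Om. Sc N om))\<^sup>2 / var N))"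
proof -
 obtain r d c0 C0 where t: "0 < r" "r <= rad / 2" "0 < d" "0 < c0" "0 < C0"
  "!!N \<xi> ta ta' x. \<bar>\<xi>\<bar> <= r ==> \<bar>ta - ta'\<bar> <= d ==> x \<in> St 0 ==>
   norm (vv 0 N (of_real \<xi> + \<i> * of_real ta) x) * norm (vv 0 N (of_real \<xi> + \<i> * of_real ta') x)
   <= C0 * exp (- c0 * (ta - ta')\<^sup>2 * SV N) * (norm (vv 0 N (of_real \<xi>) x))\<^sup>2"
  using tilted_pair_decay by (elim exE conjE) blast
 have rr: "norm w < rad" if "norm w < r" for w :: complex using that t(1,2) by simp
 obtain La where La: "!!N. La N holomorphic_on ball 0 rad" "!!N. La N 0 = 0"
  "!!N w. w \<in> ball 0 rad ==> Gm N w = exp (La N w)" "!!N w. w \<in> ball 0 rad ==> norm (La N w) <= 2 + SV N"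
  using Gm_log by metis
 \<comment> \<open>The slope in \<open>var_le\<close>; the summand 1 makes it positive.\<close>
 define b2 where "b2 = 2 * \<beta> + 1"
 have b2: "0 < b2" using beta_nonneg by (simp add: b2_def)
 \<comment> \<open>The first entry bounds the logarithm by the variance, the second absorbs the
   additive constant when \<open>SV\<close> is replaced by the variance in the pair decay.\<close>
 define C where "C = max (2 + 2 / ep * (1 + 2 * LL\<^sup>2)) (C0 * exp (c0 / b2 * (d\<^sup>2 * (4 * LL\<^sup>2))))"
 have var1: "\<forall>\<^sub>F N in sequentially. 1 <= var N"
  using filterlim_at_top[THEN iffD1, OF var_tends[OF SV], rule_format, of 1] .
 have Gm_mg: "Gm N (of_real \<xi>) = of_real (mg 0 N \<xi>)" for N \<xi> using mg_eq[of N 0 \<xi>] by (simp add: Gm_def)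
 have dL: "deriv (La N) (of_real \<xi>) = of_real (mg 1 N \<xi> / mg 0 N \<xi>)"
  "deriv (deriv (La N)) (of_real \<xi>) = of_real (mg 2 N \<xi> / mg 0 N \<xi> - (mg 1 N \<xi> / mg 0 N \<xi>)\<^sup>2)"
  "Re (La N (of_real \<xi>)) = ln (mg 0 N \<xi>)" if \<xi>: "\<bar>\<xi>\<bar> < r" for N \<xi>
 proof -
  have b: "cor \<xi> \<in> ball 0 rad" using rr[of "of_real \<xi>"] \<xi> by simp
  have m0: "mg 0 N \<xi> \<noteq> 0" using mg_0_pos[of N \<xi>] by simp
  show 1: "deriv (La N) (of_real \<xi>) = of_real (mg 1 N \<xi> / mg 0 N \<xi>)"
   using Gm_log_derivs(1)[OF rad_pos La(1,3) b] mg_eq[of N 1 \<xi>] m0 by (simp add: Gm_mg field_simps)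
  have "of_real (mg 2 N \<xi>) = of_real (mg 0 N \<xi>) * ((deriv (La N) (of_real \<xi>))\<^sup>2 + deriv (deriv (La N)) (of_real \<xi>))"
   using Gm_log_derivs(2)[OF rad_pos La(1,3) b] mg_eq[of N 2 \<xi>] by (simp add: Gm_mg)
  then show "deriv (deriv (La N)) (of_real \<xi>) = of_real (mg 2 N \<xi> / mg 0 N \<xi> - (mg 1 N \<xi> / mg 0 N \<xi>)\<^sup>2)"
   unfolding 1 using m0 by (simp add: field_simps)
  have "mg 0 N \<xi> = norm (Gm N (of_real \<xi>))" using mg_0_pos[of N \<xi>] by (simp add: Gm_mg)
  then show "Re (La N (of_real \<xi>)) = ln (mg 0 N \<xi>)" unfolding La(3)[OF b] by simp
 qed
 \<comment> \<open>Both transforms lie within one oscillation of the value at the base point, and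
   that value is at most twice \<open>norm (Gm N w)\<close>.\<close>
 have near: "norm (vv 0 N w x - Gm N w) <= 4 * kap * norm w * norm (Gm N w)" if w: "norm w < r" for N w
 proof -
  let ?k = "kap * norm w" and ?v = "norm (vv 0 N w (base 0))"
  have k: "0 <= ?k" "?k <= 1 / 2" using rad_bounds(3)[OF rr[OF w]] kap_pos by (auto simp: mult.commute)
  have 1: "norm (Gm N w - vv 0 N w (base 0)) <= ?k * ?v" by (rule Gm_near[OF rr[OF w]])
  have 2: "norm (vv 0 N w x - vv 0 N w (base 0)) <= ?k * ?v" by (rule vv_osc[OF rr[OF w] x base_in])
  have "?k * ?v <= 1 / 2 * ?v" using k by (intro mult_right_mono) auto
  then have "?v <= 2 * norm (Gm N w)"
   using 1 norm_triangle_sub[of "vv 0 N w (base 0)" "Gm N w"] norm_minus_commute[of "vv 0 N w (base 0)" "Gm N w"] by linarith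
  then have 3: "?k * ?v <= ?k * (2 * norm (Gm N w))" using k by (intro mult_left_mono) auto
  have "norm (vv 0 N w x - Gm N w) <= norm (vv 0 N w x - vv 0 N w (base 0)) + norm (Gm N w - vv 0 N w (base 0))"
   using norm_triangle_ineq4[of "vv 0 N w x - vv 0 N w (base 0)" "Gm N w - vv 0 N w (base 0)"] by simp
  also have "... <= 2 * (?k * (2 * norm (Gm N w)))" using 1 2 3 by linarith
  also have "... = 4 * kap * norm w * norm (Gm N w)" by simp
  finally show ?thesis .
 qed
 interpret SP: saddle_point La "\<lambda>N w. vv 0 N w x" Gm var y "\<lambda>N. \<integral>om. Sc N om \<partial>Om" r C "4 * kap" d "c0 / b2"
 proof (unfold_locales)
  show "0 < r" "0 < d" by (fact t)+
  have "2 <= 2 + 2 / ep * (1 + 2 * LL\<^sup>2)" using eps_pos by simp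
  then show "1 <= C" by (simp add: C_def)
  show "0 <= 4 * kap" using kap_pos by simp
  show "0 < c0 / b2" using t b2 by simp
  show "filterlim var at_top sequentially" by (rule var_tends[OF SV])
  show "La N holomorphic_on ball 0 r" for N using La(1) t(2) rad_pos by (rule_tac holomorphic_on_subset) auto
  show "Gm N w = exp (La N w)" if "norm w < r" for N w using La(3) rr[OF that] by simp
  show "La N 0 = 0" for N by (rule La)
  show "\<forall>\<^sub>F N in sequentially. \<forall>w. norm w < r --> norm (La N w) <= C * var N"
   using var1
  proof eventually_elim
   case (elim N)
   have "ep / 2 * SV N <= var N + 2 * LL\<^sup>2 * 1" using Sc_var_ge[of N] unfolding var_def by argo
   also have "... <= (1 + 2 * LL\<^sup>2) * var N"
    using mult_left_mono[OF elim, of "2 * LL\<^sup>2"] by (simp add: distrib_right)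
   finally have "SV N <= 2 / ep * (1 + 2 * LL\<^sup>2) * var N" using eps_pos by (simp add: field_simps)
   then have "2 + SV N <= (2 + 2 / ep * (1 + 2 * LL\<^sup>2)) * var N" unfolding distrib_right[of 2] using elim by linarith
   also have "... <= C * var N" using elim by (intro mult_right_mono) (auto simp: C_def)
   finally have "2 + SV N <= C * var N" .
   moreover have "norm (La N w) <= 2 + SV N" if "norm w < r" for w using La(4)[of w N] rr[OF that] by simp
   ultimately show ?case by (meson order_trans)
  qed
  show "deriv (La N) 0 = of_real (LINT om|Om. Sc N om)" for N by (rule log_second_deriv_0(1)[OF rad_pos La(1,3)])
  show "deriv (deriv (La N)) 0 = of_real (var N)" for N
   unfolding var_def by (rule log_second_deriv_0(2)[OF rad_pos La(1,3)])
  show "deriv (La N) (of_real \<xi>) \<in> \<real>" if "\<bar>\<xi>\<bar> < r" for N \<xi> unfolding dL(1)[OF that] by simp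
  show "norm (vv 0 N w x - Gm N w) <= 4 * kap * norm w * norm (Gm N w)" if "norm w < r" for N w by (rule near[OF that])
  show "continuous_on UNIV (\<lambda>w. vv 0 N w x)" for N
   by (rule holomorphic_on_imp_continuous_on[OF vv_holomorphic[OF x]])
  show "norm (vv 0 N (of_real \<xi> + \<i> * of_real ta) x) * norm (vv 0 N (of_real \<xi> + \<i> * of_real ta') x)
   <= C * exp (- (c0 / b2 * var N) * (ta - ta')\<^sup>2) * (norm (vv 0 N (of_real \<xi>) x))\<^sup>2"
   if \<xi>: "\<bar>\<xi>\<bar> < r" and ta: "\<bar>ta - ta'\<bar> <= d" for N \<xi> ta ta'
  proof -
   define u where "u = (ta - ta')\<^sup>2"
   have u: "0 <= u" "u <= d\<^sup>2" using power_mono[OF ta, of 2] by (auto simp: u_def)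
   have "c0 / b2 * u * (var N - 4 * LL\<^sup>2) <= c0 / b2 * u * (b2 * SV N)"
    using var_le[of N] t(4) b2 u by (intro mult_left_mono) (auto simp: b2_def)
   also have "... = c0 * u * SV N" using b2 by simp
   finally have 1: "c0 / b2 * u * (var N - 4 * LL\<^sup>2) <= c0 * u * SV N" .
   have 2: "c0 / b2 * (u * (4 * LL\<^sup>2)) <= c0 / b2 * (d\<^sup>2 * (4 * LL\<^sup>2))" using u t(4) b2 by (intro mult_left_mono mult_right_mono) auto
   have eq: "c0 / b2 * u * (var N - 4 * LL\<^sup>2) = c0 / b2 * var N * u - c0 / b2 * (u * (4 * LL\<^sup>2))" by (simp only: right_diff_distrib mult_ac)
   have lin: "- s <= D + - v" if "v - q <= s" "q <= D" for s v q D :: real using that by linarith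
   have le: "- c0 * u * SV N <= c0 / b2 * (d\<^sup>2 * (4 * LL\<^sup>2)) + - (c0 / b2 * var N) * u"
    using lin[OF 1[unfolded eq] 2] by simp
   have "C0 * exp (- c0 * u * SV N) <= C0 * (exp (c0 / b2 * (d\<^sup>2 * (4 * LL\<^sup>2))) * exp (- (c0 / b2 * var N) * u))"
    unfolding exp_add[symmetric] using le t(5) by (intro mult_left_mono) (auto simp: exp_le_cancel_iff)
   also have "... = C0 * exp (c0 / b2 * (d\<^sup>2 * (4 * LL\<^sup>2))) * exp (- (c0 / b2 * var N) * u)" by (rule mult.assoc[symmetric])
   also have "... <= C * exp (- (c0 / b2 * var N) * u)" by (rule mult_right_mono) (simp_all only: C_def max.cobounded2 exp_ge_zero)
   finally have "C0 * exp (- c0 * u * SV N) * (norm (vv 0 N (of_real \<xi>) x))\<^sup>2 <= C * exp (- (c0 / b2 * var N) * u) * (norm (vv 0 N (of_real \<xi>) x))\<^sup>2"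
    by (intro mult_right_mono) auto
   then show ?thesis using t(6)[OF less_imp_le[OF \<xi>] ta x, of N] unfolding u_def by linarith
  qed
  show "\<exists>s>0. \<forall>\<^sub>F N in sequentially. \<forall>\<xi> ta. \<bar>\<xi>\<bar> < s --> \<bar>ta - ta\<^sub>0\<bar> < s -->
    norm (vv 0 N (of_real \<xi> + \<i> * of_real ta) x) <= e * norm (vv 0 N (of_real \<xi>) x)"
   if h: "ta\<^sub>0 \<noteq> 0" "\<bar>ta\<^sub>0\<bar> <= pi" "0 < e" for ta\<^sub>0 e
  proof -
   have e: "0 < e / 12" using h by simp
   obtain n where n: "\<forall>v. bfun (M n) v --> (\<forall>y\<in>St n. norm (v y) <= 1) --> norm (T (Wf (\<i> * of_real ta\<^sub>0)) 0 n v x) <= e / 12"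
    using small[OF h(1,2) e] by blast
   have "\<exists>s>0. \<forall>N\<ge>n. \<forall>\<xi> ta. \<bar>\<xi>\<bar> < s --> \<bar>ta - ta\<^sub>0\<bar> < s -->
     norm (vv 0 N (of_real \<xi> + \<i> * of_real ta) x) <= 12 * (e / 12) * norm (vv 0 N (of_real \<xi>) x)"
    by (rule vv_uniform_small[OF x e]) (use n in blast)
   then show ?thesis by (auto simp: eventually_sequentially)
  qed
  show "(\<lambda>N. (y N - (LINT om|Om. Sc N om)) / var N) \<longlonglongrightarrow> 0" by (rule y)
 qed
 define L where "L N = sqrt (var N / (2 * pi)) *\<^sub>R (LINT t|lborel. indicator {- pi..pi} t *\<^sub>R SP.HH N t)" for N
 obtain \<delta> where \<delta>: "\<delta> \<longlonglongrightarrow> 0"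
  "\<forall>\<^sub>F N in sequentially. SP.xi N * y N - Re (La N (of_real (SP.xi N))) = (1 + \<delta> N) / 2 * ((y N - (LINT om|Om. Sc N om))\<^sup>2 / var N)"
  using SP.quadratic_rate by blast
 have "\<forall>\<^sub>F N in sequentially. 1 <= var N \<and>
  mg 1 N (SP.xi N) / mg 0 N (SP.xi N) = y N \<and> (mg 1 N (SP.xi N))\<^sup>2 < mg 2 N (SP.xi N) * mg 0 N (SP.xi N) \<and>
  (1 / (2 * pi)) *\<^sub>R (LINT ta|lborel. indicator {- pi..pi} ta *\<^sub>R (vv 0 N (of_real (SP.xi N) + \<i> * of_real ta) x * exp (- ((of_real (SP.xi N) + \<i> * of_real ta) * of_real (y N)))))
   = L N * of_real (1 / sqrt (2 * pi * var N) * exp (- (SP.xi N * y N - ln (mg 0 N (SP.xi N))))) \<and>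
  SP.xi N * y N - ln (mg 0 N (SP.xi N)) = (1 + \<delta> N) / 2 * ((y N - (LINT om|Om. Sc N om))\<^sup>2 / var N)"
  using SP.eventually_ok \<delta>(2)
 proof eventually_elim
  case (elim N)
  let ?x = "SP.xi N"
  have v1: "1 <= var N" and xr: "\<bar>?x\<bar> < r" using SP.okD[OF elim(1)] by auto
  have m0: "0 < mg 0 N ?x" by (rule mg_0_pos)
  have "deriv (La N) (of_real ?x) = of_real (y N)" using elim(1) by (simp add: SP.ok_def SP.tilt_def)
  then have yN: "mg 1 N ?x / mg 0 N ?x = y N" unfolding dL(1)[OF xr] of_real_eq_iff .
  have "0 < Re (deriv (deriv (La N)) (of_real ?x))" using elim(1) by (intro SP.second_deriv_pos) (auto simp: SP.ok_def)
  then have pos: "(mg 1 N ?x)\<^sup>2 < mg 2 N ?x * mg 0 N ?x" unfolding dL(2)[OF xr] using m0 by (simp add: field_simps power2_eq_square)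
  have HH: "vv 0 N (of_real ?x + \<i> * of_real ta) x * exp (- ((of_real ?x + \<i> * of_real ta) * of_real (y N)))
   = of_real (exp (- (?x * y N)) * mg 0 N ?x) * SP.HH N ta" for ta
  proof -
   have "- ((of_real ?x + \<i> * of_real ta) * of_real (y N)) = of_real (- (?x * y N)) + - (\<i> * of_real ta * cor (y N))"
    by (simp add: algebra_simps)
   then have "exp (- ((of_real ?x + \<i> * of_real ta) * of_real (y N))) = of_real (exp (- (?x * y N))) * exp (- (\<i> * of_real ta * cor (y N)))"
    by (simp only: exp_add exp_of_real)
   then show ?thesis unfolding SP.HH_def SP.ray_def Gm_mg using m0 by simp
  qed
  have e: "exp (- (?x * y N - ln (mg 0 N ?x))) = exp (- (?x * y N)) * mg 0 N ?x" using m0 by (simp add: exp_diff exp_minus field_simps)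
  have s: "sqrt (var N / (2 * pi)) / sqrt (2 * pi * var N) = 1 / (2 * pi)"
  proof -
   have "var N / (2 * pi) / (2 * pi * var N) = (1 / (2 * pi))\<^sup>2" using v1 by (simp add: power2_eq_square)
   then show ?thesis unfolding real_sqrt_divide[symmetric] by (simp only: real_sqrt_abs) simp
  qed
  have "(1 / (2 * pi)) *\<^sub>R (LINT ta|lborel. indicator {- pi..pi} ta *\<^sub>R (vv 0 N (of_real ?x + \<i> * of_real ta) x * exp (- ((of_real ?x + \<i> * of_real ta) * of_real (y N)))))
   = (1 / (2 * pi)) *\<^sub>R (LINT ta|lborel. of_real (exp (- (?x * y N)) * mg 0 N ?x) * (indicator {- pi..pi} ta *\<^sub>R SP.HH N ta))"
   unfolding HH by (simp add: mult_scaleR_right)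
  also have "... = L N * of_real (1 / sqrt (2 * pi * var N) * exp (- (?x * y N - ln (mg 0 N ?x))))"
   unfolding e L_def integral_mult_right_zero s[symmetric] by (simp add: scaleR_conv_of_real)
  finally show ?case using v1 yN pos elim(2) unfolding dL(3)[OF xr] by blast
 qed
 moreover have "L \<longlonglongrightarrow> 1" unfolding L_def[abs_def] by (rule SP.saddle_integral)
 ultimately show ?thesis using \<delta>(1) by blast
qed

end

section \<open>From the given chain to the setting with times starting at 0\<close>

lemma uniformly_elliptic_chain:
 assumes S: "state_spaces S" and \<kappa>: "transition_kernels S \<kappa>" and ell: "uniformly_elliptic S \<kappa>"
 shows "\<exists>M p ep. elliptic_chain (\<lambda>i. S (Suc i)) M p ep (1 / ep) \<and>
  (\<forall>i. \<forall>x\<in>mspace (S (Suc i)). \<kappa> (Suc i) x = elliptic_chain.kern M p i x) \<and>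
  (\<forall>i. sets (M i) = sets (metric_borel (S (Suc i))))"
proof -
 obtain ep \<mu> p where e: "0 < ep" "ep < (1::real)"
  and U: "\<forall>n\<ge>1. \<mu> n \<in> space (prob_algebra (metric_borel (S n)))"
  "\<forall>n\<ge>1. p n \<in> borel_measurable (metric_borel (S n) \<Otimes>\<^sub>M metric_borel (S (Suc n)))"
  "\<forall>n\<ge>1. \<forall>x\<in>mspace (S n). \<kappa> n x = density (\<mu> (Suc n)) (\<lambda>y. ennreal (p n (x, y)))"
  "\<forall>n\<ge>1. \<forall>x\<in>mspace (S n). \<forall>y\<in>mspace (S (Suc n)). 0 <= p n (x, y) \<and> p n (x, y) <= 1 / ep"
  "\<forall>n\<ge>1. \<forall>x\<in>mspace (S n). \<forall>z\<in>mspace (S (Suc (Suc n))). (LINT y|\<mu> (Suc n). p n (x, y) * p (Suc n) (y, z)) > ep"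
  using ell unfolding uniformly_elliptic_def by (elim exE conjE) (rule that)
 note \<mu> = U(1)[rule_format] and p = U(2)[rule_format] and dens = U(3)[rule_format] and pb = U(4)[rule_format] and two = U(5)[rule_format]
 define M where "M i = \<mu> (Suc i)" for i
 define q where "q i = p (Suc i)" for i
 have sM: "sets (M i) = sets (metric_borel (S (Suc i)))" and pM: "prob_space (M i)" for i
  using \<mu>[of "Suc i"] by (auto simp: M_def space_prob_algebra)
 have spM: "space (M i) = mspace (S (Suc i))" for i using sets_eq_imp_space_eq[OF sM[of i]] by simp
 have qm: "q i \<in> borel_measurable (M i \<Otimes>\<^sub>M M (Suc i))" for i
  using p[of "Suc i"] unfolding q_def measurable_cong_sets[OF sets_pair_measure_cong[OF sM sM] refl] by simp
 have ec: "elliptic_chain (\<lambda>i. S (Suc i)) M q ep (1 / ep)"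
 proof (rule elliptic_chain.intro)
  show "mcomplete_of (S (Suc n))" "separable_space (mtopology_of (S (Suc n)))" for n using S by (auto simp: state_spaces_def)
  show "(LINT y|M (Suc n). q n (x, y)) = 1" if x: "x \<in> space (M n)" for n x
  proof -
   have xs: "x \<in> mspace (S (Suc n))" using x spM by simp
   have qx: "(\<lambda>y. q n (x, y)) \<in> borel_measurable (M (Suc n))" using measurable_compose[OF measurable_Pair1'[OF x] qm] .
   have nn: "AE y in M (Suc n). 0 <= q n (x, y)" using pb[of "Suc n" x] xs spM by (intro AE_I2) (auto simp: q_def)
   have "\<kappa> (Suc n) \<in> metric_borel (S (Suc n)) \<rightarrow>\<^sub>M prob_algebra (metric_borel (S (Suc (Suc n))))"
    using \<kappa> by (simp add: transition_kernels_def)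
   from measurable_space[OF this, of x] have "prob_space (\<kappa> (Suc n) x)" using xs by (simp add: space_prob_algebra)
   then have "emeasure (density (M (Suc n)) (\<lambda>y. ennreal (q n (x, y)))) (space (M (Suc n))) = 1"
    using prob_space.emeasure_space_1[of "\<kappa> (Suc n) x"] dens[of "Suc n" x] xs by (simp add: M_def q_def)
   then have "(\<integral>\<^sup>+y. ennreal (q n (x, y)) \<partial>M (Suc n)) = 1"
    using qx by (simp add: emeasure_density cong: nn_integral_cong)
   then show ?thesis using qx nn by (simp add: integral_eq_nn_integral)
  qed
  show "ep <= (LINT y|M (Suc n). q n (x, y) * q (Suc n) (y, z))" if "x \<in> space (M n)" "z \<in> space (M (Suc (Suc n)))" for n x z
   using two[of "Suc n" x z] that spM by (simp add: q_def M_def)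
 qed (use sM pM qm pb spM e in \<open>auto simp: q_def\<close>)
 moreover have "\<kappa> (Suc i) x = elliptic_chain.kern M q i x" if "x \<in> mspace (S (Suc i))" for i x
  unfolding elliptic_chain.kern_def[OF ec] using dens[of "Suc i" x] that by (simp add: M_def q_def)
 ultimately show ?thesis using sM by blast
qed

lemma as_uniformly_boundedD:
 assumes "as_uniformly_bounded P X f"
 shows "\<exists>K. \<forall>n\<ge>1. AE om in P. \<bar>f n (X n om, X (Suc n) om)\<bar> <= real K"
proof -
 let ?e = "\<lambda>n. esssup P (\<lambda>om. ereal \<bar>f n (X n om, X (Suc n) om)\<bar>)"
 obtain K :: nat where K: "(SUP n\<in>{1..}. ?e n) < ereal (real K)"
  using assms less_PInf_Ex_of_nat unfolding as_uniformly_bounded_def by auto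
 have "AE om in P. \<bar>f n (X n om, X (Suc n) om)\<bar> <= real K" if "n >= 1" for n
  using esssup_AE[where M = P and f = "\<lambda>om. ereal \<bar>f n (X n om, X (Suc n) om)\<bar>"]
 proof eventually_elim
  case (elim om)
  have "?e n <= (SUP n\<in>{1..}. ?e n)" using that by (intro SUP_upper) auto
  then have "ereal \<bar>f n (X n om, X (Suc n) om)\<bar> <= ereal (real K)" using elim K by order
  then show ?case by simp
 qed
 then show ?thesis by blast
qed

lemma closed_subgroup_multiples: "closed_subgroup (range (\<lambda>k::int. h * of_int k))"
proof -
 have "closed ((*\<^sub>R) h ` (of_int ` UNIV :: real set))" by (rule closed_scaling[OF closed_of_int_image])
 then have "closed (range (\<lambda>k::int. h * of_int k))" by (simp add: image_image)
 moreover have "0 \<in> range (\<lambda>k::int. h * of_int k)" by (rule range_eqI[of _ _ 0]) simp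
 moreover have "u + v \<in> range (\<lambda>k::int. h * of_int k)" if u: "u \<in> range (\<lambda>k::int. h * of_int k)" and v: "v \<in> range (\<lambda>k::int. h * of_int k)" for u v
 proof -
  obtain i j where "u = h * of_int i" "v = h * of_int j" using u v by blast
  then show ?thesis by (intro range_eqI[of _ _ "i + j"]) (simp add: distrib_left)
 qed
 moreover have "- u \<in> range (\<lambda>k::int. h * of_int k)" if u: "u \<in> range (\<lambda>k::int. h * of_int k)" for u
 proof -
  obtain i where "u = h * of_int i" using u by blast
  then show ?thesis by (intro range_eqI[of _ _ "- i"]) simp
 qed
 ultimately show ?thesis unfolding closed_subgroup_def by blast
qed

text \<open>\<open>g\<close> is a competitor in the definition of the essential range, which is
  therefore contained in the multiples of \<open>h\<close>; by irreducibility it contains 1.\<close>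

lemma irreducible_multiples:
 assumes P: "prob_space P" and irr: "irreducible_functional P S X f" "alg_range P X f = \<int>"
  and g: "additive_functional S g" "center_tight P X (\<lambda>n xy. f n xy - g n xy)" "!!n xy. \<exists>k::int. g n xy = h * of_int k"
 shows "\<exists>k::int. 1 = h * of_int k"
proof -
 interpret prob_space P by (rule P)
 have "alg_range P X g \<subseteq> range (\<lambda>k::int. h * of_int k)"
  unfolding alg_range_def
 proof (rule Inter_lower, rule CollectI, intro conjI exI allI impI)
  show "closed_subgroup (range (\<lambda>k::int. h * of_int k))" by (rule closed_subgroup_multiples)
  fix n :: nat
  have "g n (X n om, X (Suc n) om) - (\<lambda>_. 0) n \<in> range (\<lambda>k::int. h * of_int k)" for om
   using g(3)[of n "(X n om, X (Suc n) om)"] by auto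
  then show "\<P>(om in P. g n (X n om, X (Suc n) om) - (\<lambda>_. 0) n \<in> range (\<lambda>k::int. h * of_int k)) = 1" using prob_space by simp
 qed
 moreover have "ess_range P S X f \<subseteq> alg_range P X g" unfolding ess_range_def using g(1,2) by blast
 moreover have "1 \<in> ess_range P S X f" using irr by (simp add: irreducible_functional_def)
 ultimately have "1 \<in> range (\<lambda>k::int. h * of_int k)" by blast
 then show ?thesis by blast
qed

text \<open>Chebyshev's inequality. The second moment is given for sums \<open>W\<close> that agree
  with the partial sums only almost surely, as with a truncated functional.\<close>

lemma center_tightI:
 fixes W :: "nat => 'w => real"
 assumes P: "prob_space P" and m: "!!N. partial_sum X u N \<in> borel_measurable P" "!!N. W N \<in> borel_measurable P"
  and ae: "!!N. AE om in P. partial_sum X u N om = W N om"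
  and sq: "!!N. integrable P (\<lambda>om. (W N om - c N)\<^sup>2)" "!!N. (LINT om|P. (W N om - c N)\<^sup>2) <= D"
 shows "center_tight P X u"
 unfolding center_tight_def
proof (intro exI allI impI)
 interpret prob_space P by (rule P)
 have D0: "0 <= D" using order_trans[OF _ sq(2)[of 0]] by simp
 fix e :: real and N :: nat assume e: "0 < e"
 \<comment> \<open>The summand 1 makes the final inequality strict, also when
   \<open>D = 0\<close>.\<close>
 define K where "K = sqrt (D / e) + 1"
 have K: "0 < K" "D < e * K\<^sup>2"
 proof -
  have "0 <= sqrt (D / e)" using D0 e by simp
  then show "0 < K" unfolding K_def by linarith
  have "D / e = (sqrt (D / e))\<^sup>2" using D0 e by simp
  also have "... < K\<^sup>2" unfolding K_def using \<open>0 <= sqrt (D / e)\<close> by (intro power_strict_mono) auto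
  finally show "D < e * K\<^sup>2" using e by (simp add: divide_less_eq mult.commute)
 qed
 define A where "A = {om \<in> space P. \<bar>W N om - c N\<bar> > K}"
 have A: "A \<in> sets P" unfolding A_def using m(2)[of N] by measurable
 have eq: "prob {om \<in> space P. \<bar>partial_sum X u N om - c N\<bar> > K} = prob A"
  unfolding A_def using m[of N] ae[of N] by (intro measure_eq_AE) (auto elim: eventually_mono)
 have "prob A * K\<^sup>2 = (LINT om|P. K\<^sup>2 * indicator A om)" using A by simp
 also have "... <= (LINT om|P. (W N om - c N)\<^sup>2)"
 proof (rule integral_mono[OF _ sq(1)])
  show "integrable P (\<lambda>om. K\<^sup>2 * indicator A om)" using A by (simp add: emeasure_eq_measure)
  show "K\<^sup>2 * indicator A om <= (W N om - c N)\<^sup>2" for om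
   using K(1) power_mono[of K "\<bar>W N om - c N\<bar>" 2] by (auto simp: A_def indicator_def)
 qed
 finally have "prob {om \<in> space P. \<bar>partial_sum X u N om - c N\<bar> > K} * K\<^sup>2 < e * K\<^sup>2" unfolding eq using sq(2)[of N] K(2) by linarith
 then show "\<P>(om in P. sqrt (D / e) + 1 < \<bar>partial_sum X u N om - c N\<bar>) < e" using K(1) by (simp add: K_def)
qed

theorem theorem6p4:
  fixes P :: "'w measure"
    and S :: "nat \<Rightarrow> 'a metric"
    and \<nu> :: "'a measure"
    and \<kappa> :: "nat \<Rightarrow> 'a \<Rightarrow> 'a measure"
    and X :: "nat \<Rightarrow> 'w \<Rightarrow> 'a"
    and f :: "nat \<Rightarrow> 'a \<times> 'a \<Rightarrow> real"
    and c z :: "nat \<Rightarrow> real"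
    and x :: 'a
  defines "E \<equiv> mean_sum P X f"
    and "V \<equiv> var_sum P X f"
    and "I \<equiv> rate_function P X f"
    and "Px \<equiv> path_measure_from S \<kappa> x"
  assumes "markov_chain P S \<nu> \<kappa> X"
    and "uniformly_elliptic S \<kappa>"
    and "additive_functional S f"
    and "as_uniformly_bounded P X f"
    and "irreducible_functional P S X f"
    and "alg_range P X f = \<int>"
    and "\<And>N. N \<ge> 1 \<Longrightarrow> AE \<omega> in P. partial_sum X f N \<omega> - c N \<in> \<int>"
    and "\<And>N. N \<ge> 1 \<Longrightarrow> z N - c N \<in> \<int>"
    and "(\<lambda>N. (z N - E N) / V N) \<longlonglongrightarrow> 0"
    and "x \<in> mspace (S 1)"
    and "as_uniformly_bounded Px coord f"
    and "\<And>N. N \<ge> 1 \<Longrightarrow> AE \<omega> in Px. partial_sum coord f N \<omega> - c N \<in> \<int>"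
  shows "(\<exists>\<delta>. \<delta> \<longlonglongrightarrow> 0 \<and> (\<forall>\<^sub>F N in sequentially.
           \<P>(\<omega> in Px. partial_sum coord f N \<omega> = z N)
             = (1 + \<delta> N) / sqrt (2 * pi * V N) * exp (- V N * I N (z N / V N)))) \<and>
         (\<exists>\<delta> \<delta>'. \<delta> \<longlonglongrightarrow> 0 \<and> \<delta>' \<longlonglongrightarrow> 0 \<and> (\<forall>\<^sub>F N in sequentially.
           \<P>(\<omega> in Px. partial_sum coord f N \<omega> = z N)
             = (1 + \<delta> N) / sqrt (2 * pi * V N)
               * exp (- (1 + \<delta>' N) / 2 * ((z N - E N) / sqrt (V N))\<^sup>2)))"
proof -
 note mc = assms(5) and irr = assms(9,10)
 have S: "state_spaces S" and \<kappa>: "transition_kernels S \<kappa>" and P: "prob_space P"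
  using mc by (auto simp: markov_chain_def)
 have ret: "return (metric_borel (S 1)) x \<in> space (prob_algebra (metric_borel (S 1)))"
  using assms(14) by (simp add: space_prob_algebra prob_space_return)
 have mcx: "markov_chain Px S (return (metric_borel (S 1)) x) \<kappa> coord"
  unfolding Px_def path_measure_from_def by (rule markov_chain_path_measure[OF S \<kappa> ret])
 obtain M p ep where ec: "elliptic_chain (\<lambda>i. S (Suc i)) M p ep (1 / ep)"
  and kern: "!!i x. x \<in> mspace (S (Suc i)) ==> \<kappa> (Suc i) x = elliptic_chain.kern M p i x"
  and sM: "!!i. sets (M i) = sets (metric_borel (S (Suc i)))"
  using uniformly_elliptic_chain[OF S \<kappa> assms(6)] by blast
 have spM: "space (M i) = mspace (S (Suc i))" for i using sets_eq_imp_space_eq[OF sM[of i]] by simp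
 obtain K1 K2 :: nat where K1: "!!n. n >= 1 ==> AE om in P. \<bar>f n (X n om, X (Suc n) om)\<bar> <= K1"
  and K2: "!!n. n >= 1 ==> AE om in Px. \<bar>f n (coord n om, coord (Suc n) om)\<bar> <= K2"
  using as_uniformly_boundedD[OF assms(8)] as_uniformly_boundedD[OF assms(15)] by blast
 define K where "K = real (max K1 K2)"
 \<comment> \<open>\<open>f\<close> is bounded only almost surely, while the operators need a bound
   at every point. Truncation changes nothing almost surely under either measure, hence the larger
   of the two bounds.\<close>
 define ft where "ft i xy = max (- K) (min K (f (Suc i) xy))" for i xy
 have fm: "f (Suc i) \<in> borel_measurable (M i \<Otimes>\<^sub>M M (Suc i))" for i
  using assms(7) unfolding additive_functional_def measurable_cong_sets[OF sets_pair_measure_cong[OF sM sM] refl] by simp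
 have bf: "bounded_functional (\<lambda>i. S (Suc i)) M p ep (1 / ep) ft K"
 proof (rule bounded_functional.intro[OF ec], rule bounded_functional_axioms.intro)
  show "ft n \<in> borel_measurable (M n \<Otimes>\<^sub>M M (Suc n))" for n unfolding ft_def[abs_def] using fm[of n] by measurable
  show "\<bar>ft n (x, y)\<bar> <= K" for n x y by (auto simp: ft_def K_def abs_le_iff)
 qed
 define X' where "X' n = X (Suc n - 0)" for n
 define Y' where "Y' n = (coord (Suc n - 0) :: (nat => 'a) => 'a)" for n
 have k': "\<kappa> i x = elliptic_chain.kern M p (0 + i - 1) x" if "i >= 1" "x \<in> space (M (0 + i - 1))" for i x
  using kern[of x "i - 1"] that by (simp add: spM)
 have pr: "chain_process (\<lambda>i. S (Suc i)) M p ep (1 / ep) P (\<lambda>n. past P S X (Suc n - 0)) X' 0"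
  unfolding X'_def[abs_def] by (rule elliptic_chain.chain_procI[OF ec mc _ k']) auto
 have prx: "chain_process (\<lambda>i. S (Suc i)) M p ep (1 / ep) Px (\<lambda>n. past Px S coord (Suc n - 0)) Y' 0"
  unfolding Y'_def[abs_def] by (rule elliptic_chain.chain_procI[OF ec mcx _ k']) auto
 interpret FP: functional_process "\<lambda>i. S (Suc i)" M p ep "1 / ep" ft K P "\<lambda>n. past P S X (Suc n - 0)" X'
  by (rule functional_process.intro[OF bf pr])
 interpret FX: functional_process "\<lambda>i. S (Suc i)" M p ep "1 / ep" ft K Px "\<lambda>n. past Px S coord (Suc n - 0)" Y'
  by (rule functional_process.intro[OF bf prx])
 have x0: "x \<in> space (M 0)" using assms(14) by (simp add: spM)
 have init: "distr Px (M 0) (Y' 0) = return (M 0) x"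
 proof -
  have "distr Px (M 0) (Y' 0) = distr Px (metric_borel (S 1)) (coord 1)"
   by (rule distr_cong) (auto simp: Y'_def sM)
  also have "... = return (metric_borel (S 1)) x" using mcx by (simp add: markov_chain_def)
  also have "... = return (M 0) x" by (rule return_cong) (simp add: sM)
  finally show ?thesis .
 qed
 define cs where "cs N = (\<Sum>j<N. FP.cen j)" for N
 have shift: "partial_sum Z u N om = (\<Sum>j<N. u (Suc j) (Z (Suc j) om, Z (Suc (Suc j)) om))" for Z :: "nat => 'v => 'a" and u :: "nat => 'a \<times> 'a => real" and N om
  unfolding partial_sum_def by (rule sum.reindex_bij_witness[of _ Suc "\<lambda>n. n - 1"]) auto
 have trunc: "\<bar>f (Suc j) xy\<bar> <= K' ==> K' <= K ==> ft j xy = f (Suc j) xy" for j xy K' by (auto simp: ft_def abs_le_iff)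
 have ae: "AE om in Q. \<forall>j\<in>{..<N}. ft j (Z (Suc j) om, Z (Suc (Suc j)) om) = f (Suc j) (Z (Suc j) om, Z (Suc (Suc j)) om)"
  if "!!n. n >= 1 ==> AE om in Q. \<bar>f n (Z n om, Z (Suc n) om)\<bar> <= K'" "K' <= K" for Q :: "'v measure" and Z :: "nat => 'v => 'a" and K' N
 proof (rule AE_finite_all[THEN iffD2], simp, rule ballI)
  fix j
  show "AE om in Q. ft j (Z (Suc j) om, Z (Suc (Suc j)) om) = f (Suc j) (Z (Suc j) om, Z (Suc (Suc j)) om)"
   using that(1)[of "Suc j"] by (rule AE_mp) (use trunc[OF _ that(2)] in auto)
 qed
 have aeP: "AE om in P. \<forall>j\<in>{..<N}. ft j (X' j om, X' (Suc j) om) = f (Suc j) (X (Suc j) om, X (Suc (Suc j)) om)" for N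
  using ae[OF K1, of N] by (simp add: K_def X'_def)
 have aeX: "AE om in Px. \<forall>j\<in>{..<N}. ft j (Y' j om, Y' (Suc j) om) = f (Suc j) (coord (Suc j) om, coord (Suc (Suc j)) om)" for N
  using ae[OF K2, of N] by (simp add: K_def Y'_def)
 have SP: "AE om in P. partial_sum X f N om = FP.Sc N om + cs N" for N
  using aeP[of N] by eventually_elim (simp add: shift FP.Sc_def cs_def sum_subtractf)
 have SX: "AE om in Px. partial_sum coord f N om = FX.Sc N om + cs N" for N
  using aeX[of N] by eventually_elim (simp add: shift FX.Sc_def cs_def sum_subtractf)
 have psm: "partial_sum X u N \<in> borel_measurable P" if "!!j. u (Suc j) \<in> borel_measurable (M j \<Otimes>\<^sub>M M (Suc j))" for u N
  unfolding shift[abs_def]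
  using FP.X_meas by (intro borel_measurable_sum measurable_compose[OF measurable_Pair that]) (auto simp: X'_def)
 have psx: "partial_sum coord f N \<in> borel_measurable Px" for N
  unfolding shift[abs_def]
  using FX.X_meas by (intro borel_measurable_sum measurable_compose[OF measurable_Pair fm]) (auto simp: Y'_def)
 have fSc: "integrable P (FP.Sc N)" "integrable P (\<lambda>om. (FP.Sc N om)\<^sup>2)" for N
  by (rule FP.bfun_Om_integrable[OF FP.Sc_bfun], rule FP.bfun_Om_integrable[OF bfun_power[OF FP.Sc_bfun]])
 define a where "a N = (LINT om|P. FP.Sc N om)" for N
 have E: "E N = a N + cs N" for N
 proof -
  have "E N = (LINT om|P. FP.Sc N om + cs N)"
   unfolding E_def mean_sum_def using psm[OF fm] fSc SP by (intro integral_cong_AE) auto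
  then show ?thesis using fSc FP.Om.prob_space by (simp add: a_def)
 qed
 have V: "V N = FP.var N" for N
 proof -
  have "V N = (LINT om|P. (partial_sum X f N om - E N)\<^sup>2)" by (simp add: V_def var_sum_def E_def mean_sum_def)
  also have "... = (LINT om|P. (FP.Sc N om - a N)\<^sup>2)"
  proof (rule integral_cong_AE)
   show "AE om in P. (partial_sum X f N om - E N)\<^sup>2 = (FP.Sc N om - a N)\<^sup>2"
    using SP[of N] by eventually_elim (simp add: E)
  qed (use psm[OF fm, of N] fSc in measurable)
  also have "... = FP.var N"
   unfolding FP.Om.integral_sq_diff_const[OF fSc] FP.var_def a_def by (simp add: power2_eq_square)
  finally show ?thesis .
 qed
 \<comment> \<open>Used twice: with \<open>h = 0\<close> it excludes bounded variance, with
   \<open>h = 2 * pi / ta\<close> it excludes resonance at the frequency \<open>ta\<close>.\<close>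
 have no_reduction: "\<exists>k::int. 1 = h * of_int k"
  if g: "!!j. g j \<in> borel_measurable (M j \<Otimes>\<^sub>M M (Suc j))" "!!j xy. \<exists>k::int. g j xy = h * of_int k"
   and sq: "!!N. integrable P (\<lambda>om. ((\<Sum>j<N. ft j (X' j om, X' (Suc j) om) - g j (X' j om, X' (Suc j) om)) - m N)\<^sup>2)"
    "!!N. (LINT om|P. ((\<Sum>j<N. ft j (X' j om, X' (Suc j) om) - g j (X' j om, X' (Suc j) om)) - m N)\<^sup>2) <= D"
  for g h m D
 proof (rule irreducible_multiples[OF P irr, where g = "\<lambda>n. g (n - 1)"])
  have gm: "g (n - 1) \<in> borel_measurable (metric_borel (S n) \<Otimes>\<^sub>M metric_borel (S (Suc n)))" if "n >= 1" for n
   using g(1)[of "n - 1"] that unfolding measurable_cong_sets[OF sets_pair_measure_cong[OF sM sM] refl] by simp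
  then show "additive_functional S (\<lambda>n. g (n - 1))" by (simp add: additive_functional_def)
  have d: "(\<lambda>xy. f (Suc j) xy - g j xy) \<in> borel_measurable (M j \<Otimes>\<^sub>M M (Suc j))" for j using fm g(1) by measurable
  have gX: "(\<lambda>om. ft j (X' j om, X' (Suc j) om) - g j (X' j om, X' (Suc j) om)) \<in> borel_measurable P" for j
  proof -
   have "(\<lambda>xy. ft j xy - g j xy) \<in> borel_measurable (M j \<Otimes>\<^sub>M M (Suc j))" using FP.f_meas[of j] g(1) by measurable
   from measurable_compose[OF measurable_Pair[OF FP.X_meas FP.X_meas] this] show ?thesis by simp
  qed
  show "center_tight P X (\<lambda>n xy. f n xy - g (n - 1) xy)"
  proof (rule center_tightI[OF P psm _ _ sq])
   show "AE om in P. partial_sum X (\<lambda>n xy. f n xy - g (n - 1) xy) N om = (\<Sum>j<N. ft j (X' j om, X' (Suc j) om) - g j (X' j om, X' (Suc j) om))" for N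
    using aeP[of N] by eventually_elim (auto simp: shift X'_def intro!: sum.cong)
  qed (use d gX in auto)
 qed (use g(2) in auto)
 \<comment> \<open>If \<open>SV\<close> stayed bounded, \<open>f\<close> itself would be
   center-tight, and the zero functional would be a competitor with \<open>h = 0\<close>.\<close>
 have SV: "filterlim FP.SV at_top sequentially"
 proof (rule ccontr)
  assume "\<not> ?thesis"
  then obtain B where B: "\<not> (\<forall>\<^sub>F N in sequentially. B <= FP.SV N)" by (auto simp: filterlim_at_top)
  have mono: "FP.SV N <= FP.SV N'" if "N <= N'" for N N' using that by (intro sum_mono2) (auto intro: FP.MC.sv_nonneg)
  have SB: "FP.SV N <= B" for N
  proof (rule ccontr)
   assume "\<not> ?thesis"
   then have "\<forall>N'\<ge>N. B <= FP.SV N'" using mono by (meson linear order_trans)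
   then show False using B by (auto simp: eventually_sequentially)
  qed
  have s: "(\<Sum>j<N. ft j (X' j om, X' (Suc j) om) - (\<lambda>_ _. 0) j (X' j om, X' (Suc j) om)) - cs N = FP.Sc N om" for N om
   by (simp add: FP.Sc_def cs_def sum_subtractf)
  have le: "(LINT om|P. (FP.Sc N om)\<^sup>2) <= 4 * (FP.KD + 1)\<^sup>2 + 2 * (1 / ep) * B" for N
    using FP.Sc_second_moment_le[of N] mult_left_mono[OF SB[of N], of "2 * (1 / ep)"] FP.beta_nonneg by linarith
  have "\<exists>k::int. 1 = 0 * real_of_int k"
   by (rule no_reduction[of "\<lambda>_ _. 0" 0 cs, unfolded s, OF _ _ fSc(2) le]) auto
  then show False by simp
 qed
 have small: "\<exists>n. \<forall>v. bfun (M n) v --> (\<forall>y\<in>space (M n). norm (v y) <= 1) --> norm (FP.T (FP.Wf (\<i> * of_real ta)) 0 n v x) <= e"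
  if ta: "ta \<noteq> 0" "\<bar>ta\<bar> <= pi" and e: "0 < e" for ta e
 proof (rule ccontr)
  assume n: "\<not> ?thesis"
  have "\<exists>v. bfun (M N) v \<and> (\<forall>y\<in>space (M N). norm (v y) <= 1) \<and> e <= norm (FP.T (FP.Wf (\<i> * of_real ta)) 0 N v x)" for N
   using n by (meson linear)
  from FP.arithmetic_reduction[OF ta(1) x0 e this] obtain g m D where
   g: "!!n. g n \<in> borel_measurable (M n \<Otimes>\<^sub>M M (Suc n))" "!!n xy. \<exists>k::int. g n xy = 2 * pi / ta * of_int k"
   and D: "!!N. integrable P (\<lambda>om. ((\<Sum>j<N. ft j (X' j om, X' (Suc j) om) - g j (X' j om, X' (Suc j) om)) - m N)\<^sup>2)"
    "!!N. (LINT om|P. ((\<Sum>j<N. ft j (X' j om, X' (Suc j) om) - g j (X' j om, X' (Suc j) om)) - m N)\<^sup>2) <= (D::real)"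
   by (elim exE conjE) blast
  obtain k :: int where "1 = 2 * pi / ta * of_int k" using no_reduction[OF g D] by blast
  then have k: "ta = 2 * pi * of_int k" using ta by (simp add: field_simps)
  then have "k \<noteq> 0" using ta by auto
  then have "1 <= \<bar>real_of_int k\<bar>" by linarith
  then have "2 * pi * 1 <= 2 * pi * \<bar>real_of_int k\<bar>" by (intro mult_left_mono) auto
  then show False using ta(2) pi_gt_zero unfolding k abs_mult by simp
 qed
 define y where "y N = z N - cs N" for N
 have "(\<lambda>N. (y N - (LINT om|P. FP.Sc N om)) / FP.var N) \<longlonglongrightarrow> 0"
  using assms(13) by (simp add: V E y_def a_def algebra_simps)
 from FP.saddle_point_chain[OF x0 SV small this] obtain \<xi> L \<delta> where L: "L \<longlonglongrightarrow> (1::complex)" "\<delta> \<longlonglongrightarrow> 0"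
  and ev: "\<forall>\<^sub>F N in sequentially. 1 <= FP.var N \<and>
   FP.mg 1 N (\<xi> N) / FP.mg 0 N (\<xi> N) = y N \<and> (FP.mg 1 N (\<xi> N))\<^sup>2 < FP.mg 2 N (\<xi> N) * FP.mg 0 N (\<xi> N) \<and>
   (1 / (2 * pi)) *\<^sub>R (LINT ta|lborel. indicator {- pi..pi} ta *\<^sub>R (FP.vv 0 N (of_real (\<xi> N) + \<i> * of_real ta) x * exp (- ((of_real (\<xi> N) + \<i> * of_real ta) * of_real (y N)))))
    = L N * of_real (1 / sqrt (2 * pi * FP.var N) * exp (- (\<xi> N * y N - ln (FP.mg 0 N (\<xi> N))))) \<and>
   \<xi> N * y N - ln (FP.mg 0 N (\<xi> N)) = (1 + \<delta> N) / 2 * ((y N - (LINT om|P. FP.Sc N om))\<^sup>2 / FP.var N)"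
  by blast
 \<comment> \<open>The probability is real, so nothing is lost by passing to the real part of the
   complex factor \<open>L\<close>.\<close>
 define \<delta>1 where "\<delta>1 N = Re (L N) - 1" for N
 have \<delta>1: "\<delta>1 \<longlonglongrightarrow> 0" unfolding \<delta>1_def[abs_def] using tendsto_diff[OF tendsto_Re[OF L(1)] tendsto_const[of 1]] by simp
 have mgf: "(LINT om|P. exp (t * partial_sum X f N om)) = exp (t * cs N) * FP.mg 0 N t" for t N
 proof -
  have "(LINT om|P. exp (t * partial_sum X f N om)) = (LINT om|P. exp (t * cs N) * exp (t * FP.Sc N om))"
  proof (rule integral_cong_AE)
   show "AE om in P. exp (t * partial_sum X f N om) = exp (t * cs N) * exp (t * FP.Sc N om)"
    using SP[of N] by eventually_elim (simp add: exp_add[symmetric] algebra_simps)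
  qed (use psm[OF fm, of N] fSc in measurable)
  then show ?thesis by (simp add: FP.mg_def)
 qed
 have dlog: "(log_mgf P X f N has_real_derivative (cs N + FP.mg 1 N t / FP.mg 0 N t) / V N) (at t)" for N t
 proof -
  have "log_mgf P X f N = (\<lambda>t. (t * cs N + ln (FP.mg 0 N t)) / V N)"
   unfolding log_mgf_def mgf V_def[symmetric] using FP.mg_0_pos by (auto simp: ln_mult_pos fun_eq_iff)
  moreover have "((\<lambda>t. t * cs N + ln (FP.mg 0 N t)) has_real_derivative cs N + FP.mg 1 N t / FP.mg 0 N t) (at t)"
   using DERIV_add[OF DERIV_cmult_right[OF DERIV_ident, of "cs N"] FP.ln_mg_deriv] by simp
  ultimately show ?thesis by (simp only: DERIV_cdivide)
 qed
 \<comment> \<open>The centering adds a linear term \<open>t * cs N\<close> to the logarithm; it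
   shifts the target from \<open>y N\<close> to \<open>z N\<close> and cancels in the Legendre
   transform.\<close>
 have rate: "V N * I N (z N / V N) = \<xi> N * y N - ln (FP.mg 0 N (\<xi> N))"
  if h: "1 <= V N" "FP.mg 1 N (\<xi> N) / FP.mg 0 N (\<xi> N) = y N" "(FP.mg 1 N (\<xi> N))\<^sup>2 < FP.mg 2 N (\<xi> N) * FP.mg 0 N (\<xi> N)" for N
 proof -
  have "(THE t. (log_mgf P X f N has_real_derivative z N / V N) (at t)) = \<xi> N"
  proof (rule the_equality)
   show "(log_mgf P X f N has_real_derivative z N / V N) (at (\<xi> N))" using dlog[of N "\<xi> N"] h(2) by (simp add: y_def)
   fix t assume "(log_mgf P X f N has_real_derivative z N / V N) (at t)"
   from DERIV_unique[OF dlog this] have "FP.mg 1 N t / FP.mg 0 N t = y N" using h(1) by (simp add: y_def field_simps)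
   then show "t = \<xi> N" by (rule FP.tilt_unique[OF h(2) _ h(3)])
  qed
  then show ?thesis
   using h(1) FP.mg_0_pos[of N "\<xi> N"] unfolding I_def rate_function_def legendre_def log_mgf_def mgf V_def[symmetric]
   by (simp add: Let_def ln_mult_pos y_def right_diff_distrib)
 qed
 \<comment> \<open>Valid on every vertical line; below \<open>t\<close> is taken to be the saddle
   point.\<close>
 have prob: "cor (\<P>(om in Px. partial_sum coord f N om = z N))
   = (1 / (2 * pi)) *\<^sub>R (LINT ta|lborel. indicator {- pi..pi} ta *\<^sub>R (FP.vv 0 N (of_real t + \<i> * of_real ta) x * exp (- ((of_real t + \<i> * of_real ta) * of_real (y N)))))"
  if N: "N >= 1" for N t
 proof -
  define Y where "Y om = FX.Sc N om - y N" for om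
  have Yb: "bfun Px Y" unfolding Y_def[abs_def] by (intro bfun_diff FX.Sc_bfun bfun_const)
  have "AE om in Px. Y om \<in> \<int>"
   using SX[of N] assms(16)[OF N]
  proof eventually_elim
   case (elim om)
   have "Y om = (partial_sum coord f N om - c N) - (z N - c N)" unfolding elim(1) by (simp add: Y_def y_def)
   then show ?case using elim(2) assms(12)[OF N] by (simp only: Ints_diff)
  qed
  note inv = FX.Om.lattice_inversion[OF Yb this, of t]
  have ps: "\<P>(om in Px. partial_sum coord f N om = z N) = FX.Om.prob {om \<in> space Px. Y om = 0}"
  proof (rule measure_eq_AE)
   show "AE om in Px. om \<in> {om \<in> space Px. partial_sum coord f N om = z N} \<longleftrightarrow> om \<in> {om \<in> space Px. Y om = 0}"
    using SX[of N] by eventually_elim (auto simp: Y_def y_def)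
  qed (use psx[of N] bfun_measurable[OF Yb] in measurable)
  have vvx: "(LINT om|Px. exp (w * of_real (Y om))) = FP.vv 0 N w x * exp (- (w * of_real (y N)))" for w :: complex
  proof -
   have "exp (w * of_real (Y om)) = exp (w * of_real (FX.Sc N om)) * exp (- (w * of_real (y N)))" for om
    by (simp add: Y_def exp_add[symmetric] algebra_simps)
   then have "(LINT om|Px. exp (w * of_real (Y om))) = FX.Gm N w * exp (- (w * of_real (y N)))" by (simp add: FX.Gm_def)
   then show ?thesis unfolding FP.point_process_vv[OF x0 prx init] .
  qed
  show ?thesis unfolding ps inv vvx ..
 qed
 have main: "\<forall>\<^sub>F N in sequentially. \<P>(om in Px. partial_sum coord f N om = z N) = (1 + \<delta>1 N) / sqrt (2 * pi * V N) * exp (- V N * I N (z N / V N))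
  \<and> V N * I N (z N / V N) = (1 + \<delta> N) / 2 * ((z N - E N) / sqrt (V N))\<^sup>2"
  using ev eventually_ge_at_top[of 1]
 proof eventually_elim
  case (elim N)
  note v = elim(1)[folded V]
  have r: "V N * I N (z N / V N) = \<xi> N * y N - ln (FP.mg 0 N (\<xi> N))" by (rule rate) (use v in blast)+
  have "cor (\<P>(om in Px. partial_sum coord f N om = z N)) = L N * of_real (1 / sqrt (2 * pi * V N) * exp (- (V N * I N (z N / V N))))"
   unfolding r prob[OF elim(2), of "\<xi> N"] using v by blast
  from arg_cong[OF this, of Re]
  have "\<P>(om in Px. partial_sum coord f N om = z N) = (1 + \<delta>1 N) / sqrt (2 * pi * V N) * exp (- V N * I N (z N / V N))"
   by (simp add: \<delta>1_def)
  moreover have "V N * I N (z N / V N) = (1 + \<delta> N) / 2 * ((z N - E N) / sqrt (V N))\<^sup>2"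
   unfolding r using v by (simp add: y_def a_def[symmetric] E power_divide diff_diff_eq add.commute)
  ultimately show ?case ..
 qed
 have "\<forall>\<^sub>F N in sequentially. \<P>(om in Px. partial_sum coord f N om = z N) = (1 + \<delta>1 N) / sqrt (2 * pi * V N) * exp (- V N * I N (z N / V N))"
  using main by eventually_elim blast
 moreover have "\<forall>\<^sub>F N in sequentially. \<P>(om in Px. partial_sum coord f N om = z N)
   = (1 + \<delta>1 N) / sqrt (2 * pi * V N) * exp (- (1 + \<delta> N) / 2 * ((z N - E N) / sqrt (V N))\<^sup>2)"
  using main
 proof eventually_elim
  case (elim N)
  have "- V N * I N (z N / V N) = - (1 + \<delta> N) / 2 * ((z N - E N) / sqrt (V N))\<^sup>2"
   by (simp only: mult_minus_left minus_divide_left[symmetric] conjunct2[OF elim])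
  then show ?case using elim by simp
 qed
 ultimately show ?thesis using \<delta>1 L(2) by blast
qed

end
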